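(* The polynomial 2-functor $\mathbb M\mathrm{at}\colon\mathbf{VDBL}\to\mathbf{VDBL}$, sending each large virtual double category $\mathbb A$ to the virtual double category $\mathbb A\text{-}\mathbb M\mathrm{at}$ of matrices in $\mathbb A$, is familial.
   Context: Size: fix Grothendieck universes $\mathcal U_1\in\mathcal U_2$; small means in $\mathcal U_1$, large means in $\mathcal U_2$. $\mathbf{Set}$ and $\mathbf{Set}_\ast$ are the categories of small sets and small pointed sets; slices are strict slice 2-categories. Virtual double categories. A virtual double category $\mathbb A$ consists of: a category $\mathbb A_{\mathrm{vert}}$, whose objects and morphisms are the objects and vertical morphisms of $\mathbb A$; for each pair of objects a set of horizontal morphisms $\Gamma\colon A\nrightarrow A'$; for each $n\ge0$, each path of horizontal morphisms $\Gamma_i\colon A_{i-1}\nrightarrow A_i$ ($1\le i\le n$), each $\Delta\colon B\nrightarrow B'$ and vertical $u\colon A_0\to B$, $u'\colon A_n\to B'$, a set of multicells, written $\theta\colon(\Gamma_1,\dots,\Gamma_n)\Rightarrow\Delta$ over $(u,u')$ (for $n=0$ the top is a single object $A_0$; a cell is a multicell with $n=1$); identity cells $\mathrm{id}_\Gamma\colon(\Gamma)\Rightarrow\Gamma$ over identities; composites: for $\theta_i\colon(\Gamma_{i,1},\dots,\Gamma_{i,n_i})\Rightarrow\Delta_i$ over $(u_{i-1},u_i)$ ($1\le i\le m$) and $\kappa\colon(\Delta_1,\dots,\Delta_m)\Rightarrow\Lambda$ over $(v,v')$, a multicell $\kappa\circ(\theta_1,\dots,\theta_m)\colon(\Gamma_{1,1},\dots,\Gamma_{m,n_m})\Rightarrow\Lambda$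 over $(vu_0,v'u_m)$; for $m=0$, given $\kappa\colon()\Rightarrow\Lambda$ over $(v,v')$ with top $B$ and vertical $u\colon A\to B$, a composite $\kappa\circ(u)$ over $(vu,v'u)$. Evident unit and associativity axioms hold. A virtual double functor $F\colon\mathbb A\to\mathbb B$ sends objects, vertical and horizontal morphisms and multicells to those of $\mathbb B$, compatibly with boundaries, functorially on vertical morphisms, and preserving identity cells and composites. A vertical transformation $\alpha\colon F\to G$ consists of a natural transformation $F_{\mathrm{vert}}\to G_{\mathrm{vert}}$ with components $\alpha_A\colon FA\to GA$, and cells $\alpha_\Gamma\colon(F\Gamma)\Rightarrow G\Gamma$ over $(\alpha_A,\alpha_{A'})$ for $\Gamma\colon A\nrightarrow A'$, with $\alpha_\Gamma\circ(F\theta)=G\theta\circ(\alpha_{\Gamma_1},\dots,\alpha_{\Gamma_n})$ for each multicell $\theta\colon(\Gamma_1,\dots,\Gamma_n)\Rightarrow\Gamma$ (for $n=0$ the right side is $G\theta\circ(\alpha_{A_0})$). Large virtual double categories, virtual double functors and vertical transformations form the 2-category $\mathbf{VDBL}$. The 2-functor $\mathbb M\mathrm{at}$. For a category $\mathcal C$, let $\mathcal C_{\mathrm{hc}}$ be the virtual double category with vertical category $\mathcal C$, exactly one horizontal morphism between any two objects, and exactly one multicell for each possible boundary. Let $P\colon\mathbf{Set}_\ast\to\mathbf{Set}$ be the forgetful functor. The pullback 2-functor $P_{\mathrm{hc}}^\ast\colon\mathbf{VDBL}/\mathbf{Set}_{\mathrm{hc}}\to\mathbf{VDBL}/(\mathbf{Set}_\ast)_{\mathrm{hc}}$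 has a right 2-adjoint $\prod_{P_{\mathrm{hc}}}$, and $\mathbb M\mathrm{at}$ is the composite of $(\mathbf{Set}_\ast)_{\mathrm{hc}}\times(-)\colon\mathbf{VDBL}\to\mathbf{VDBL}/(\mathbf{Set}_\ast)_{\mathrm{hc}}$, $\prod_{P_{\mathrm{hc}}}$, and the forgetful 2-functor $\mathbf{VDBL}/\mathbf{Set}_{\mathrm{hc}}\to\mathbf{VDBL}$. Explicitly, $\mathbb A\text{-}\mathbb M\mathrm{at}$ has: objects $(I,(A_i)_{i\in I})$ with $I$ a small set and $A_i\in\mathbb A$; vertical morphisms $(I,(A_i))\to(I',(A'_{i'}))$ given by a function $v\colon I\to I'$ and vertical morphisms $f_i\colon A_i\to A'_{v(i)}$; horizontal morphisms $(I,(A_i))\nrightarrow(I',(A'_{i'}))$ given by families $(\Gamma_{i,i'}\colon A_i\nrightarrow A'_{i'})_{i\in I,i'\in I'}$; multicells $((\Gamma_1),\dots,(\Gamma_n))\Rightarrow(\Gamma)$ over $((v,f),(v',f'))$ given by families of multicells $(\Gamma_{1,i_0,i_1},\dots,\Gamma_{n,i_{n-1},i_n})\Rightarrow\Gamma_{v(i_0),v'(i_n)}$ over $(f_{i_0},f'_{i_n})$ in $\mathbb A$, indexed by $(i_0,\dots,i_n)\in I_0\times\cdots\times I_n$; with componentwise composition. Familial 2-functors. Let $\mathscr K$ be a 2-category with a terminal object $1$. A 2-functor $R\colon\mathscr K\to\mathscr L$ is a parametric right 2-adjoint if the 2-functor $R_1\colon\mathscr K\to\mathscr L/R1$, $K\mapsto(R!_K\colon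 RK\to R1)$, has a left 2-adjoint. A split fibration in a 2-category $\mathscr L$ is a morphism $p\colon E\to B$ such that each functor $\mathscr L(X,p)\colon\mathscr L(X,E)\to\mathscr L(X,B)$ is equipped with the structure of a split fibration (chosen functorial cartesian lifts) and, for each $f\colon Y\to X$, the functor $\mathscr L(f,E)$ preserves chosen cartesian lifts. $\mathrm{Spl}(B)$ is the 2-category of split fibrations over $B$, morphisms over $B$ preserving chosen cartesian lifts, and 2-cells as in $\mathscr L/B$; there is a forgetful 2-functor $U_B\colon\mathrm{Spl}(B)\to\mathscr L/B$. The 2-functor $R$ is familial if it is a parametric right 2-adjoint and $R_1$ factorizes as $\mathscr K\to\mathrm{Spl}(R1)\xrightarrow{U_{R1}}\mathscr L/R1$ for some 2-functor $\mathscr K\to\mathrm{Spl}(R1)$. *)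

theory Defs
  imports "HOL-Library.FuncSet"
begin

section \<open>Strict 2-categories\<close>

text \<open>
  Composition is written in the applicative order: \<open>cmp1 K g f\<close> is "g after f", \<open>vcmp\<close> is the
  composition of 2-cells along a 1-cell and \<open>hcmp\<close> the composition along an object.
  The operations are only constrained on composable arguments.
\<close>

record ('o, 'm, 'c) two_cat =
  C0 :: "'o set"
  C1 :: "'m set"
  C2 :: "'c set"
  src1 :: "'m \<Rightarrow> 'o"
  trg1 :: "'m \<Rightarrow> 'o"
  src2 :: "'c \<Rightarrow> 'm"
  trg2 :: "'c \<Rightarrow> 'm"
  id1 :: "'o \<Rightarrow> 'm"
  cmp1 :: "'m \<Rightarrow> 'm \<Rightarrow> 'm"
  id2 :: "'m \<Rightarrow> 'c"
  vcmp :: "'c \<Rightarrow> 'c \<Rightarrow> 'c"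
  hcmp :: "'c \<Rightarrow> 'c \<Rightarrow> 'c"

definition arr1 :: "('o, 'm, 'c) two_cat \<Rightarrow> 'm \<Rightarrow> 'o \<Rightarrow> 'o \<Rightarrow> bool" where
  "arr1 K f a b \<longleftrightarrow> f \<in> C1 K \<and> src1 K f = a \<and> trg1 K f = b"

definition arr2 :: "('o, 'm, 'c) two_cat \<Rightarrow> 'c \<Rightarrow> 'm \<Rightarrow> 'm \<Rightarrow> bool" where
  "arr2 K \<alpha> f g \<longleftrightarrow> \<alpha> \<in> C2 K \<and> src2 K \<alpha> = f \<and> trg2 K \<alpha> = g"

locale two_category =
  fixes K :: "('o, 'm, 'c) two_cat"
  assumes src1_in: "f \<in> C1 K \<Longrightarrow> src1 K f \<in> C0 K"
    and trg1_in: "f \<in> C1 K \<Longrightarrow> trg1 K f \<in> C0 K"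
    and src2_in: "\<alpha> \<in> C2 K \<Longrightarrow> src2 K \<alpha> \<in> C1 K"
    and trg2_in: "\<alpha> \<in> C2 K \<Longrightarrow> trg2 K \<alpha> \<in> C1 K"
    and parallel_src: "\<alpha> \<in> C2 K \<Longrightarrow> src1 K (src2 K \<alpha>) = src1 K (trg2 K \<alpha>)"
    and parallel_trg: "\<alpha> \<in> C2 K \<Longrightarrow> trg1 K (src2 K \<alpha>) = trg1 K (trg2 K \<alpha>)"
    and id1_arr: "a \<in> C0 K \<Longrightarrow> arr1 K (id1 K a) a a"
    and cmp1_arr: "\<lbrakk>arr1 K f a b; arr1 K g b c\<rbrakk> \<Longrightarrow> arr1 K (cmp1 K g f) a c"
    and cmp1_id_left: "arr1 K f a b \<Longrightarrow> cmp1 K (id1 K b) f = f"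
    and cmp1_id_right: "arr1 K f a b \<Longrightarrow> cmp1 K f (id1 K a) = f"
    and cmp1_assoc: "\<lbrakk>arr1 K f a b; arr1 K g b c; arr1 K h c d\<rbrakk>
      \<Longrightarrow> cmp1 K (cmp1 K h g) f = cmp1 K h (cmp1 K g f)"
    and id2_arr: "f \<in> C1 K \<Longrightarrow> arr2 K (id2 K f) f f"
    and vcmp_arr: "\<lbrakk>arr2 K \<alpha> f g; arr2 K \<beta> g h\<rbrakk> \<Longrightarrow> arr2 K (vcmp K \<beta> \<alpha>) f h"
    and vcmp_id_left: "arr2 K \<alpha> f g \<Longrightarrow> vcmp K (id2 K g) \<alpha> = \<alpha>"
    and vcmp_id_right: "arr2 K \<alpha> f g \<Longrightarrow> vcmp K \<alpha> (id2 K f) = \<alpha>"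
    and vcmp_assoc: "\<lbrakk>arr2 K \<alpha> f g; arr2 K \<beta> g h; arr2 K \<gamma> h k\<rbrakk>
      \<Longrightarrow> vcmp K (vcmp K \<gamma> \<beta>) \<alpha> = vcmp K \<gamma> (vcmp K \<beta> \<alpha>)"
    and hcmp_arr: "\<lbrakk>arr2 K \<alpha> f f'; arr2 K \<beta> g g'; trg1 K f = src1 K g\<rbrakk>
      \<Longrightarrow> arr2 K (hcmp K \<beta> \<alpha>) (cmp1 K g f) (cmp1 K g' f')"
    and hcmp_id_left: "\<lbrakk>arr2 K \<alpha> f g; trg1 K f = b\<rbrakk> \<Longrightarrow> hcmp K (id2 K (id1 K b)) \<alpha> = \<alpha>"
    and hcmp_id_right: "\<lbrakk>arr2 K \<alpha> f g; src1 K f = a\<rbrakk> \<Longrightarrow> hcmp K \<alpha> (id2 K (id1 K a)) = \<alpha>"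
    and hcmp_assoc: "\<lbrakk>arr2 K \<alpha> f f'; arr2 K \<beta> g g'; arr2 K \<gamma> h h';
        trg1 K f = src1 K g; trg1 K g = src1 K h\<rbrakk>
      \<Longrightarrow> hcmp K (hcmp K \<gamma> \<beta>) \<alpha> = hcmp K \<gamma> (hcmp K \<beta> \<alpha>)"
    and hcmp_id2: "\<lbrakk>arr1 K f a b; arr1 K g b c\<rbrakk>
      \<Longrightarrow> hcmp K (id2 K g) (id2 K f) = id2 K (cmp1 K g f)"
    and interchange: "\<lbrakk>arr2 K \<alpha> f f'; arr2 K \<alpha>' f' f''; arr2 K \<beta> g g'; arr2 K \<beta>' g' g'';
        trg1 K f = src1 K g\<rbrakk>
      \<Longrightarrow> hcmp K (vcmp K \<beta>' \<beta>) (vcmp K \<alpha>' \<alpha>) = vcmp K (hcmp K \<beta>' \<alpha>') (hcmp K \<beta> \<alpha>)"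

definition whisk_left :: "('o, 'm, 'c) two_cat \<Rightarrow> 'm \<Rightarrow> 'c \<Rightarrow> 'c" where
  "whisk_left K g \<alpha> = hcmp K (id2 K g) \<alpha>"

definition whisk_right :: "('o, 'm, 'c) two_cat \<Rightarrow> 'c \<Rightarrow> 'm \<Rightarrow> 'c" where
  "whisk_right K \<alpha> f = hcmp K \<alpha> (id2 K f)"

record ('o, 'm, 'c, 'p, 'n, 'd) two_fun =
  F0 :: "'o \<Rightarrow> 'p"
  F1 :: "'m \<Rightarrow> 'n"
  F2 :: "'c \<Rightarrow> 'd"

locale two_functor =
  fixes K :: "('o, 'm, 'c) two_cat"
    and L :: "('p, 'n, 'd) two_cat"
    and F :: "('o, 'm, 'c, 'p, 'n, 'd) two_fun"
  assumes F0_in: "a \<in> C0 K \<Longrightarrow> F0 F a \<in> C0 L"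
    and F1_arr: "arr1 K f a b \<Longrightarrow> arr1 L (F1 F f) (F0 F a) (F0 F b)"
    and F2_arr: "arr2 K \<alpha> f g \<Longrightarrow> arr2 L (F2 F \<alpha>) (F1 F f) (F1 F g)"
    and F1_id1: "a \<in> C0 K \<Longrightarrow> F1 F (id1 K a) = id1 L (F0 F a)"
    and F1_cmp1: "\<lbrakk>arr1 K f a b; arr1 K g b c\<rbrakk> \<Longrightarrow> F1 F (cmp1 K g f) = cmp1 L (F1 F g) (F1 F f)"
    and F2_id2: "f \<in> C1 K \<Longrightarrow> F2 F (id2 K f) = id2 L (F1 F f)"
    and F2_vcmp: "\<lbrakk>arr2 K \<alpha> f g; arr2 K \<beta> g h\<rbrakk> \<Longrightarrow> F2 F (vcmp K \<beta> \<alpha>) = vcmp L (F2 F \<beta>) (F2 F \<alpha>)"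
    and F2_hcmp: "\<lbrakk>arr2 K \<alpha> f f'; arr2 K \<beta> g g'; trg1 K f = src1 K g\<rbrakk>
      \<Longrightarrow> F2 F (hcmp K \<beta> \<alpha>) = hcmp L (F2 F \<beta>) (F2 F \<alpha>)"

definition id_two_fun :: "('o, 'm, 'c, 'o, 'm, 'c) two_fun" where
  "id_two_fun = \<lparr>F0 = id, F1 = id, F2 = id\<rparr>"

definition comp_two_fun ::
  "('p, 'n, 'd, 'q, 'l, 'e) two_fun \<Rightarrow> ('o, 'm, 'c, 'p, 'n, 'd) two_fun
    \<Rightarrow> ('o, 'm, 'c, 'q, 'l, 'e) two_fun" where
  "comp_two_fun G F = \<lparr>F0 = F0 G \<circ> F0 F, F1 = F1 G \<circ> F1 F, F2 = F2 G \<circ> F2 F\<rparr>"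

text \<open>Equality of 2-functors out of \<open>K\<close>, disregarding values outside \<open>K\<close>.\<close>

definition two_fun_eq ::
  "('o, 'm, 'c) two_cat \<Rightarrow> ('o, 'm, 'c, 'p, 'n, 'd) two_fun
    \<Rightarrow> ('o, 'm, 'c, 'p, 'n, 'd) two_fun \<Rightarrow> bool" where
  "two_fun_eq K F G \<longleftrightarrow> (\<forall>a\<in>C0 K. F0 F a = F0 G a) \<and> (\<forall>f\<in>C1 K. F1 F f = F1 G f)
    \<and> (\<forall>\<alpha>\<in>C2 K. F2 F \<alpha> = F2 G \<alpha>)"

locale two_natural =
  fixes K :: "('o, 'm, 'c) two_cat"
    and L :: "('p, 'n, 'd) two_cat"
    and F G :: "('o, 'm, 'c, 'p, 'n, 'd) two_fun"
    and \<tau> :: "'o \<Rightarrow> 'n"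
  assumes component: "a \<in> C0 K \<Longrightarrow> arr1 L (\<tau> a) (F0 F a) (F0 G a)"
    and natural1: "arr1 K f a b \<Longrightarrow> cmp1 L (\<tau> b) (F1 F f) = cmp1 L (F1 G f) (\<tau> a)"
    and natural2: "\<lbrakk>arr2 K \<alpha> f g; arr1 K f a b\<rbrakk>
      \<Longrightarrow> whisk_left L (\<tau> b) (F2 F \<alpha>) = whisk_right L (F2 G \<alpha>) (\<tau> a)"

text \<open>\<open>F\<close> is left 2-adjoint to \<open>G\<close>, with unit \<open>\<eta>\<close> and counit \<open>\<epsilon>\<close>.\<close>

locale two_adjunction =
  left: two_functor L K F +
  right: two_functor K L G +
  unit: two_natural L L id_two_fun "comp_two_fun G F" \<eta> +
  counit: two_natural K K "comp_two_fun F G" id_two_fun \<epsilon>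
  for K :: "('o, 'm, 'c) two_cat"
    and L :: "('p, 'n, 'd) two_cat"
    and F :: "('p, 'n, 'd, 'o, 'm, 'c) two_fun"
    and G :: "('o, 'm, 'c, 'p, 'n, 'd) two_fun"
    and \<eta> :: "'p \<Rightarrow> 'n"
    and \<epsilon> :: "'o \<Rightarrow> 'm" +
  assumes triangle_left: "b \<in> C0 L \<Longrightarrow> cmp1 K (\<epsilon> (F0 F b)) (F1 F (\<eta> b)) = id1 K (F0 F b)"
    and triangle_right: "a \<in> C0 K \<Longrightarrow> cmp1 L (F1 G (\<epsilon> a)) (\<eta> (F0 G a)) = id1 L (F0 G a)"

definition has_left_two_adjoint ::
  "('o, 'm, 'c) two_cat \<Rightarrow> ('p, 'n, 'd) two_cat \<Rightarrow> ('o, 'm, 'c, 'p, 'n, 'd) two_fun \<Rightarrow> bool" where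
  "has_left_two_adjoint K L G \<longleftrightarrow> (\<exists>F \<eta> \<epsilon>. two_adjunction K L F G \<eta> \<epsilon>)"

definition terminal :: "('o, 'm, 'c) two_cat \<Rightarrow> 'o \<Rightarrow> bool" where
  "terminal K t \<longleftrightarrow> t \<in> C0 K \<and>
    (\<forall>a\<in>C0 K. (\<exists>!f. arr1 K f a t) \<and> (\<forall>f. arr1 K f a t \<longrightarrow> (\<exists>!\<alpha>. arr2 K \<alpha> f f)))"

definition to_terminal :: "('o, 'm, 'c) two_cat \<Rightarrow> 'o \<Rightarrow> 'o \<Rightarrow> 'm" where
  "to_terminal K t a = (THE f. arr1 K f a t)"

section \<open>Strict slices\<close>

text \<open>
  1-cells and 2-cells of the slice are stored as triples, together with their source and target
  objects.
\<close>

definition slice ::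
  "('o, 'm, 'c) two_cat \<Rightarrow> 'o \<Rightarrow> ('m, 'm \<times> 'm \<times> 'm, 'm \<times> 'c \<times> 'm) two_cat" where
  "slice L B = \<lparr>
    C0 = {p. p \<in> C1 L \<and> trg1 L p = B},
    C1 = {(p, f, q). p \<in> C1 L \<and> trg1 L p = B \<and> q \<in> C1 L \<and> trg1 L q = B
            \<and> arr1 L f (src1 L p) (src1 L q) \<and> cmp1 L q f = p},
    C2 = {(p, \<alpha>, q). p \<in> C1 L \<and> trg1 L p = B \<and> q \<in> C1 L \<and> trg1 L q = B
            \<and> \<alpha> \<in> C2 L \<and> arr1 L (src2 L \<alpha>) (src1 L p) (src1 L q)
            \<and> whisk_left L q \<alpha> = id2 L p},
    src1 = (\<lambda>(p, f, q). p),
    trg1 = (\<lambda>(p, f, q). q),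
    src2 = (\<lambda>(p, \<alpha>, q). (p, src2 L \<alpha>, q)),
    trg2 = (\<lambda>(p, \<alpha>, q). (p, trg2 L \<alpha>, q)),
    id1 = (\<lambda>p. (p, id1 L (src1 L p), p)),
    cmp1 = (\<lambda>(q, g, r) (p, f, q'). (p, cmp1 L g f, r)),
    id2 = (\<lambda>(p, f, q). (p, id2 L f, q)),
    vcmp = (\<lambda>(p, \<beta>, q) (p', \<alpha>, q'). (p, vcmp L \<beta> \<alpha>, q)),
    hcmp = (\<lambda>(q, \<beta>, r) (p, \<alpha>, q'). (p, hcmp L \<beta> \<alpha>, r)) \<rparr>"

definition slice_fun ::
  "('o, 'm, 'c) two_cat \<Rightarrow> ('o, 'm, 'c, 'p, 'n, 'd) two_fun \<Rightarrow> 'o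
    \<Rightarrow> ('o, 'm, 'c, 'n, 'n \<times> 'n \<times> 'n, 'n \<times> 'd \<times> 'n) two_fun" where
  "slice_fun K R t =
    (let p = (\<lambda>a. F1 R (to_terminal K t a)) in
     \<lparr> F0 = p,
       F1 = (\<lambda>f. (p (src1 K f), F1 R f, p (trg1 K f))),
       F2 = (\<lambda>\<alpha>. (p (src1 K (src2 K \<alpha>)), F2 R \<alpha>, p (trg1 K (src2 K \<alpha>)))) \<rparr>)"

section \<open>Split fibrations in a 2-category\<close>

text \<open>
  \<open>cartesian L p \<phi>\<close>: the 2-cell \<open>\<phi>\<close>, a morphism of the category \<open>L(X,E)\<close> where \<open>p : E \<rightarrow> B\<close>,
  is cartesian for the functor \<open>L(X,p) : L(X,E) \<rightarrow> L(X,B)\<close>.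
\<close>

definition cartesian :: "('o, 'm, 'c) two_cat \<Rightarrow> 'm \<Rightarrow> 'c \<Rightarrow> bool" where
  "cartesian L p \<phi> \<longleftrightarrow> \<phi> \<in> C2 L \<and> trg1 L (src2 L \<phi>) = src1 L p \<and>
    (\<forall>\<psi> \<gamma>. \<psi> \<in> C2 L \<and> trg2 L \<psi> = trg2 L \<phi>
       \<and> arr2 L \<gamma> (cmp1 L p (src2 L \<psi>)) (cmp1 L p (src2 L \<phi>))
       \<and> vcmp L (whisk_left L p \<phi>) \<gamma> = whisk_left L p \<psi>
     \<longrightarrow> (\<exists>!\<chi>. arr2 L \<chi> (src2 L \<psi>) (src2 L \<phi>) \<and> vcmp L \<phi> \<chi> = \<psi> \<and> whisk_left L p \<chi> = \<gamma>))"

text \<open>\<open>liftable L p e \<beta>\<close>: for some \<open>X\<close>, \<open>e\<close> is an object of \<open>L(X,E)\<close> and \<open>\<beta>\<close> a morphism of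
  \<open>L(X,B)\<close> with codomain \<open>p e\<close>.\<close>

definition liftable :: "('o, 'm, 'c) two_cat \<Rightarrow> 'm \<Rightarrow> 'm \<Rightarrow> 'c \<Rightarrow> bool" where
  "liftable L p e \<beta> \<longleftrightarrow> e \<in> C1 L \<and> trg1 L e = src1 L p \<and> \<beta> \<in> C2 L \<and> trg2 L \<beta> = cmp1 L p e"

text \<open>
  A split fibration structure on \<open>p\<close>: \<open>c e \<beta>\<close> is the chosen cartesian lift, with codomain \<open>e\<close>, of
  \<open>\<beta>\<close>. The choice is functorial (\<open>lift_id2\<close>, \<open>lift_vcmp\<close>) and preserved by the functors
  \<open>L(f,E)\<close> (\<open>lift_whisk\<close>). Requiring \<open>c\<close> to be undefined elsewhere makes equality of
  \<open>c\<close> the equality of choices.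
\<close>

locale split_fibration =
  fixes L :: "('o, 'm, 'c) two_cat" and p :: 'm and c :: "'m \<Rightarrow> 'c \<Rightarrow> 'c"
  assumes p_in: "p \<in> C1 L"
    and lift_undefined: "\<not> liftable L p e \<beta> \<Longrightarrow> c e \<beta> = undefined"
    and lift_trg2: "liftable L p e \<beta> \<Longrightarrow> trg2 L (c e \<beta>) = e"
    and lift_over: "liftable L p e \<beta> \<Longrightarrow> whisk_left L p (c e \<beta>) = \<beta>"
    and lift_cartesian: "liftable L p e \<beta> \<Longrightarrow> cartesian L p (c e \<beta>)"
    and lift_id2: "\<lbrakk>e \<in> C1 L; trg1 L e = src1 L p\<rbrakk> \<Longrightarrow> c e (id2 L (cmp1 L p e)) = id2 L e"
    and lift_vcmp: "\<lbrakk>liftable L p e \<beta>; \<gamma> \<in> C2 L; trg2 L \<gamma> = src2 L \<beta>\<rbrakk>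
      \<Longrightarrow> c e (vcmp L \<beta> \<gamma>) = vcmp L (c e \<beta>) (c (src2 L (c e \<beta>)) \<gamma>)"
    and lift_whisk: "\<lbrakk>liftable L p e \<beta>; f \<in> C1 L; trg1 L f = src1 L e\<rbrakk>
      \<Longrightarrow> c (cmp1 L e f) (whisk_right L \<beta> f) = whisk_right L (c e \<beta>) f"

definition Spl_mor ::
  "('o, 'm, 'c) two_cat \<Rightarrow> 'm \<times> ('m \<Rightarrow> 'c \<Rightarrow> 'c) \<Rightarrow> 'm \<Rightarrow> 'm \<times> ('m \<Rightarrow> 'c \<Rightarrow> 'c) \<Rightarrow> bool" where
  "Spl_mor L P f Q \<longleftrightarrow> arr1 L f (src1 L (fst P)) (src1 L (fst Q)) \<and> cmp1 L (fst Q) f = fst P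
    \<and> (\<forall>e \<beta>. liftable L (fst P) e \<beta> \<longrightarrow> whisk_left L f (snd P e \<beta>) = snd Q (cmp1 L f e) \<beta>)"

definition Spl :: "('o, 'm, 'c) two_cat \<Rightarrow> 'o \<Rightarrow>
    ('m \<times> ('m \<Rightarrow> 'c \<Rightarrow> 'c),
     ('m \<times> ('m \<Rightarrow> 'c \<Rightarrow> 'c)) \<times> 'm \<times> ('m \<times> ('m \<Rightarrow> 'c \<Rightarrow> 'c)),
     ('m \<times> ('m \<Rightarrow> 'c \<Rightarrow> 'c)) \<times> 'c \<times> ('m \<times> ('m \<Rightarrow> 'c \<Rightarrow> 'c))) two_cat" where
  "Spl L B =
    (let Ob = {(p, c). split_fibration L p c \<and> trg1 L p = B} in
     \<lparr> C0 = Ob,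
       C1 = {(P, f, Q). P \<in> Ob \<and> Q \<in> Ob \<and> Spl_mor L P f Q},
       C2 = {(P, \<alpha>, Q). P \<in> Ob \<and> Q \<in> Ob \<and> \<alpha> \<in> C2 L
               \<and> Spl_mor L P (src2 L \<alpha>) Q \<and> Spl_mor L P (trg2 L \<alpha>) Q
               \<and> whisk_left L (fst Q) \<alpha> = id2 L (fst P)},
       src1 = (\<lambda>(P, f, Q). P),
       trg1 = (\<lambda>(P, f, Q). Q),
       src2 = (\<lambda>(P, \<alpha>, Q). (P, src2 L \<alpha>, Q)),
       trg2 = (\<lambda>(P, \<alpha>, Q). (P, trg2 L \<alpha>, Q)),
       id1 = (\<lambda>P. (P, id1 L (src1 L (fst P)), P)),
       cmp1 = (\<lambda>(Q, g, R) (P, f, Q'). (P, cmp1 L g f, R)),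
       id2 = (\<lambda>(P, f, Q). (P, id2 L f, Q)),
       vcmp = (\<lambda>(P, \<beta>, Q) (P', \<alpha>, Q'). (P, vcmp L \<beta> \<alpha>, Q)),
       hcmp = (\<lambda>(Q, \<beta>, R) (P, \<alpha>, Q'). (P, hcmp L \<beta> \<alpha>, R)) \<rparr>)"

definition Spl_forget ::
    "('m \<times> ('m \<Rightarrow> 'c \<Rightarrow> 'c),
      ('m \<times> ('m \<Rightarrow> 'c \<Rightarrow> 'c)) \<times> 'm \<times> ('m \<times> ('m \<Rightarrow> 'c \<Rightarrow> 'c)),
      ('m \<times> ('m \<Rightarrow> 'c \<Rightarrow> 'c)) \<times> 'c \<times> ('m \<times> ('m \<Rightarrow> 'c \<Rightarrow> 'c)),
      'm, 'm \<times> 'm \<times> 'm, 'm \<times> 'c \<times> 'm) two_fun" where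
  "Spl_forget = \<lparr> F0 = fst, F1 = (\<lambda>(P, f, Q). (fst P, f, fst Q)),
                  F2 = (\<lambda>(P, \<alpha>, Q). (fst P, \<alpha>, fst Q)) \<rparr>"

section \<open>Familial 2-functors\<close>

definition parametric_right_two_adjoint_at ::
  "('o, 'm, 'c) two_cat \<Rightarrow> ('p, 'n, 'd) two_cat \<Rightarrow> ('o, 'm, 'c, 'p, 'n, 'd) two_fun \<Rightarrow> 'o \<Rightarrow> bool"
where
  "parametric_right_two_adjoint_at K L R t \<longleftrightarrow>
    has_left_two_adjoint K (slice L (F0 R t)) (slice_fun K R t)"

definition familial_at ::
  "('o, 'm, 'c) two_cat \<Rightarrow> ('p, 'n, 'd) two_cat \<Rightarrow> ('o, 'm, 'c, 'p, 'n, 'd) two_fun \<Rightarrow> 'o \<Rightarrow> bool"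
where
  "familial_at K L R t \<longleftrightarrow> parametric_right_two_adjoint_at K L R t \<and>
    (\<exists>S. two_functor K (Spl L (F0 R t)) S \<and>
         two_fun_eq K (comp_two_fun Spl_forget S) (slice_fun K R t))"

text \<open>The notion does not depend on the choice of a terminal object; we ask for all of them.\<close>

definition familial ::
  "('o, 'm, 'c) two_cat \<Rightarrow> ('p, 'n, 'd) two_cat \<Rightarrow> ('o, 'm, 'c, 'p, 'n, 'd) two_fun \<Rightarrow> bool"
where
  "familial K L R \<longleftrightarrow> two_category K \<and> two_category L \<and> two_functor K L R \<and>
    (\<exists>t. terminal K t) \<and> (\<forall>t. terminal K t \<longrightarrow> familial_at K L R t)"

section \<open>Virtual double categories\<close>

text \<open>
  \<open>chain Ob Ar s t a xs b\<close>: the list \<open>xs\<close> is a path, from \<open>a\<close> to \<open>b\<close>, of elements of \<open>Ar\<close>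
  with source map \<open>s\<close> and target map \<open>t\<close>; the empty path has a vertex.
\<close>

primrec chain :: "'o set \<Rightarrow> 'x set \<Rightarrow> ('x \<Rightarrow> 'o) \<Rightarrow> ('x \<Rightarrow> 'o) \<Rightarrow> 'o \<Rightarrow> 'x list \<Rightarrow> 'o \<Rightarrow> bool" where
  "chain Ob Ar s t a [] b \<longleftrightarrow> a \<in> Ob \<and> a = b"
| "chain Ob Ar s t a (x # xs) b \<longleftrightarrow> a \<in> Ob \<and> x \<in> Ar \<and> s x = a \<and> chain Ob Ar s t (t x) xs b"

text \<open>
  A multicell \<open>\<theta>\<close> has a top \<open>ctop \<theta>\<close> (a list of horizontal morphisms), a bottom \<open>cbot \<theta>\<close>, and
  vertical sides \<open>clft \<theta>\<close>, \<open>crgt \<theta>\<close>. If the top is empty, the top object is the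
  common domain of the two sides.

  The composite of \<open>\<kappa>\<close> with \<open>\<theta>\<^sub>1, \<dots>, \<theta>\<^sub>m\<close> is \<open>ccomp A \<kappa> u [\<theta>\<^sub>1, \<dots>, \<theta>\<^sub>m]\<close>, where the vertical
  morphism \<open>u\<close> is the leftmost side: it is determined as \<open>clft \<theta>\<^sub>1\<close> if \<open>m > 0\<close>, while for \<open>m = 0\<close>
  it is a genuine argument, so that \<open>ccomp A \<kappa> u []\<close> is the nullary composite of \<open>\<kappa>\<close> with \<open>u\<close>.
\<close>

record ('o, 'v, 'h, 'c) vdc =
  Ob :: "'o set"
  Ver :: "'v set"
  vdom :: "'v \<Rightarrow> 'o"
  vcod :: "'v \<Rightarrow> 'o"
  vid :: "'o \<Rightarrow> 'v"
  vcomp :: "'v \<Rightarrow> 'v \<Rightarrow> 'v"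
  Hor :: "'h set"
  hsrc :: "'h \<Rightarrow> 'o"
  htrg :: "'h \<Rightarrow> 'o"
  Cell :: "'c set"
  ctop :: "'c \<Rightarrow> 'h list"
  cbot :: "'c \<Rightarrow> 'h"
  clft :: "'c \<Rightarrow> 'v"
  crgt :: "'c \<Rightarrow> 'v"
  cid :: "'h \<Rightarrow> 'c"
  ccomp :: "'c \<Rightarrow> 'v \<Rightarrow> 'c list \<Rightarrow> 'c"

definition ver :: "('o, 'v, 'h, 'c) vdc \<Rightarrow> 'v \<Rightarrow> 'o \<Rightarrow> 'o \<Rightarrow> bool" where
  "ver A u a b \<longleftrightarrow> u \<in> Ver A \<and> vdom A u = a \<and> vcod A u = b"

definition hpath :: "('o, 'v, 'h, 'c) vdc \<Rightarrow> 'o \<Rightarrow> 'h list \<Rightarrow> 'o \<Rightarrow> bool" where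
  "hpath A = chain (Ob A) (Hor A) (hsrc A) (htrg A)"

definition cpath :: "('o, 'v, 'h, 'c) vdc \<Rightarrow> 'v \<Rightarrow> 'c list \<Rightarrow> 'v \<Rightarrow> bool" where
  "cpath A = chain (Ver A) (Cell A) (clft A) (crgt A)"

definition cell :: "('o, 'v, 'h, 'c) vdc \<Rightarrow> 'c \<Rightarrow> 'h list \<Rightarrow> 'h \<Rightarrow> 'v \<Rightarrow> 'v \<Rightarrow> bool" where
  "cell A \<theta> \<Gamma>s \<Delta> u u' \<longleftrightarrow>
    \<theta> \<in> Cell A \<and> ctop A \<theta> = \<Gamma>s \<and> cbot A \<theta> = \<Delta> \<and> clft A \<theta> = u \<and> crgt A \<theta> = u'"

text \<open>\<open>u'\<close> is the rightmost vertical side of \<open>\<theta>s\<close>.\<close>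

definition composable ::
  "('o, 'v, 'h, 'c) vdc \<Rightarrow> 'c \<Rightarrow> 'v \<Rightarrow> 'c list \<Rightarrow> 'v \<Rightarrow> bool" where
  "composable A \<kappa> u \<theta>s u' \<longleftrightarrow> \<kappa> \<in> Cell A \<and> cpath A u \<theta>s u' \<and> map (cbot A) \<theta>s = ctop A \<kappa>
    \<and> vcod A u = vdom A (clft A \<kappa>)"

text \<open>
  In \<open>ccomp_assoc\<close>, \<open>\<xi>ss ! i\<close> is the list of multicells composed with \<open>\<theta>s ! i\<close>; its
  leftmost and rightmost sides are \<open>ws ! i\<close> and \<open>ws ! Suc i\<close>.
\<close>

locale virtual_double_category =
  fixes A :: "('o, 'v, 'h, 'c) vdc"
  assumes vdom_in: "u \<in> Ver A \<Longrightarrow> vdom A u \<in> Ob A"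
    and vcod_in: "u \<in> Ver A \<Longrightarrow> vcod A u \<in> Ob A"
    and vid_ver: "a \<in> Ob A \<Longrightarrow> ver A (vid A a) a a"
    and vcomp_ver: "\<lbrakk>ver A f a b; ver A g b c\<rbrakk> \<Longrightarrow> ver A (vcomp A g f) a c"
    and vcomp_id_left: "ver A f a b \<Longrightarrow> vcomp A (vid A b) f = f"
    and vcomp_id_right: "ver A f a b \<Longrightarrow> vcomp A f (vid A a) = f"
    and vcomp_assoc: "\<lbrakk>ver A f a b; ver A g b c; ver A h c d\<rbrakk>
      \<Longrightarrow> vcomp A (vcomp A h g) f = vcomp A h (vcomp A g f)"
    and hsrc_in: "\<Gamma> \<in> Hor A \<Longrightarrow> hsrc A \<Gamma> \<in> Ob A"
    and htrg_in: "\<Gamma> \<in> Hor A \<Longrightarrow> htrg A \<Gamma> \<in> Ob A"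
    and clft_in: "\<theta> \<in> Cell A \<Longrightarrow> clft A \<theta> \<in> Ver A"
    and crgt_in: "\<theta> \<in> Cell A \<Longrightarrow> crgt A \<theta> \<in> Ver A"
    and cbot_in: "\<theta> \<in> Cell A \<Longrightarrow> cbot A \<theta> \<in> Hor A"
    and ctop_path: "\<theta> \<in> Cell A
      \<Longrightarrow> hpath A (vdom A (clft A \<theta>)) (ctop A \<theta>) (vdom A (crgt A \<theta>))"
    and cbot_src: "\<theta> \<in> Cell A \<Longrightarrow> hsrc A (cbot A \<theta>) = vcod A (clft A \<theta>)"
    and cbot_trg: "\<theta> \<in> Cell A \<Longrightarrow> htrg A (cbot A \<theta>) = vcod A (crgt A \<theta>)"
    and cid_cell: "\<Gamma> \<in> Hor A
      \<Longrightarrow> cell A (cid A \<Gamma>) [\<Gamma>] \<Gamma> (vid A (hsrc A \<Gamma>)) (vid A (htrg A \<Gamma>))"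
    and ccomp_cell: "composable A \<kappa> u \<theta>s u'
      \<Longrightarrow> cell A (ccomp A \<kappa> u \<theta>s) (concat (map (ctop A) \<theta>s)) (cbot A \<kappa>)
            (vcomp A (clft A \<kappa>) u) (vcomp A (crgt A \<kappa>) u')"
    and ccomp_id_left: "\<theta> \<in> Cell A \<Longrightarrow> ccomp A (cid A (cbot A \<theta>)) (clft A \<theta>) [\<theta>] = \<theta>"
    and ccomp_id_right: "\<theta> \<in> Cell A
      \<Longrightarrow> ccomp A \<theta> (vid A (vdom A (clft A \<theta>))) (map (cid A) (ctop A \<theta>)) = \<theta>"
    and ccomp_assoc: "\<lbrakk>composable A \<kappa> u \<theta>s u'; length \<xi>ss = length \<theta>s; length ws = Suc (length \<theta>s);
        ws ! 0 \<in> Ver A; vcod A (ws ! 0) = vdom A u;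
        \<And>i. i < length \<theta>s \<Longrightarrow> composable A (\<theta>s ! i) (ws ! i) (\<xi>ss ! i) (ws ! Suc i)\<rbrakk>
      \<Longrightarrow> ccomp A (ccomp A \<kappa> u \<theta>s) (ws ! 0) (concat \<xi>ss) =
          ccomp A \<kappa> (vcomp A u (ws ! 0))
            (map (\<lambda>i. ccomp A (\<theta>s ! i) (ws ! i) (\<xi>ss ! i)) [0..<length \<theta>s])"

text \<open>
  All structure maps are undefined outside their intended domains, so that equality of records
  is equality of virtual double categories.
\<close>

definition vdc_extensional :: "('o, 'v, 'h, 'c) vdc \<Rightarrow> bool" where
  "vdc_extensional A \<longleftrightarrow>
    vdom A \<in> extensional (Ver A) \<and> vcod A \<in> extensional (Ver A) \<and> vid A \<in> extensional (Ob A) \<and>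
    (\<forall>g f. \<not> (f \<in> Ver A \<and> g \<in> Ver A \<and> vcod A f = vdom A g) \<longrightarrow> vcomp A g f = undefined) \<and>
    hsrc A \<in> extensional (Hor A) \<and> htrg A \<in> extensional (Hor A) \<and>
    ctop A \<in> extensional (Cell A) \<and> cbot A \<in> extensional (Cell A) \<and>
    clft A \<in> extensional (Cell A) \<and> crgt A \<in> extensional (Cell A) \<and>
    cid A \<in> extensional (Hor A) \<and>
    (\<forall>\<kappa> u \<theta>s. (\<nexists>u'. composable A \<kappa> u \<theta>s u') \<longrightarrow> ccomp A \<kappa> u \<theta>s = undefined)"

record ('o, 'v, 'h, 'c, 'p, 'w, 'k, 'd) vd_map =
  fo :: "'o \<Rightarrow> 'p"
  fv :: "'v \<Rightarrow> 'w"
  fh :: "'h \<Rightarrow> 'k"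
  fc :: "'c \<Rightarrow> 'd"

locale virtual_double_functor =
  fixes A :: "('o, 'v, 'h, 'c) vdc"
    and B :: "('p, 'w, 'k, 'd) vdc"
    and F :: "('o, 'v, 'h, 'c, 'p, 'w, 'k, 'd) vd_map"
  assumes fo_ext: "fo F \<in> extensional (Ob A)"
    and fv_ext: "fv F \<in> extensional (Ver A)"
    and fh_ext: "fh F \<in> extensional (Hor A)"
    and fc_ext: "fc F \<in> extensional (Cell A)"
    and fo_in: "a \<in> Ob A \<Longrightarrow> fo F a \<in> Ob B"
    and fv_ver: "ver A u a b \<Longrightarrow> ver B (fv F u) (fo F a) (fo F b)"
    and fv_vid: "a \<in> Ob A \<Longrightarrow> fv F (vid A a) = vid B (fo F a)"
    and fv_vcomp: "\<lbrakk>ver A f a b; ver A g b c\<rbrakk> \<Longrightarrow> fv F (vcomp A g f) = vcomp B (fv F g) (fv F f)"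
    and fh_in: "\<Gamma> \<in> Hor A \<Longrightarrow> fh F \<Gamma> \<in> Hor B"
    and fh_src: "\<Gamma> \<in> Hor A \<Longrightarrow> hsrc B (fh F \<Gamma>) = fo F (hsrc A \<Gamma>)"
    and fh_trg: "\<Gamma> \<in> Hor A \<Longrightarrow> htrg B (fh F \<Gamma>) = fo F (htrg A \<Gamma>)"
    and fc_cell: "cell A \<theta> \<Gamma>s \<Delta> u u'
      \<Longrightarrow> cell B (fc F \<theta>) (map (fh F) \<Gamma>s) (fh F \<Delta>) (fv F u) (fv F u')"
    and fc_cid: "\<Gamma> \<in> Hor A \<Longrightarrow> fc F (cid A \<Gamma>) = cid B (fh F \<Gamma>)"
    and fc_ccomp: "composable A \<kappa> u \<theta>s u'
      \<Longrightarrow> fc F (ccomp A \<kappa> u \<theta>s) = ccomp B (fc F \<kappa>) (fv F u) (map (fc F) \<theta>s)"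

record ('o, 'h, 'w, 'd) vd_trans =
  tv :: "'o \<Rightarrow> 'w"
  tc :: "'h \<Rightarrow> 'd"

locale vertical_transformation =
  fixes A :: "('o, 'v, 'h, 'c) vdc"
    and B :: "('p, 'w, 'k, 'd) vdc"
    and F G :: "('o, 'v, 'h, 'c, 'p, 'w, 'k, 'd) vd_map"
    and \<alpha> :: "('o, 'h, 'w, 'd) vd_trans"
  assumes tv_ext: "tv \<alpha> \<in> extensional (Ob A)"
    and tc_ext: "tc \<alpha> \<in> extensional (Hor A)"
    and tv_ver: "a \<in> Ob A \<Longrightarrow> ver B (tv \<alpha> a) (fo F a) (fo G a)"
    and tv_natural: "ver A u a b \<Longrightarrow> vcomp B (tv \<alpha> b) (fv F u) = vcomp B (fv G u) (tv \<alpha> a)"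
    and tc_cell: "\<Gamma> \<in> Hor A
      \<Longrightarrow> cell B (tc \<alpha> \<Gamma>) [fh F \<Gamma>] (fh G \<Gamma>) (tv \<alpha> (hsrc A \<Gamma>)) (tv \<alpha> (htrg A \<Gamma>))"
    and tc_natural: "\<theta> \<in> Cell A
      \<Longrightarrow> ccomp B (tc \<alpha> (cbot A \<theta>)) (fv F (clft A \<theta>)) [fc F \<theta>] =
          ccomp B (fc G \<theta>) (tv \<alpha> (vdom A (clft A \<theta>))) (map (tc \<alpha>) (ctop A \<theta>))"

section \<open>Grothendieck universes\<close>

text \<open>
  Elements of the type \<open>'V\<close> are the sets belonging to the universe of large sets, and \<open>elts x\<close> is
  the set of members of \<open>x\<close>. The sets of HOL with elements in \<open>'V\<close> are the subsets of this
  universe; such a set is large iff it lies in \<open>range elts\<close>.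
  The condition on power sets says that \<open>z\<close> consists exactly of the sets
  with members in \<open>elts x\<close>, and that every HOL subset of \<open>elts x\<close> is among them.
\<close>

definition grothendieck_universe :: "('V \<Rightarrow> 'V set) \<Rightarrow> 'V set \<Rightarrow> bool" where
  "grothendieck_universe elts U \<longleftrightarrow>
    (\<forall>x\<in>U. elts x \<subseteq> U) \<and>
    (\<forall>x\<in>U. \<forall>y\<in>U. \<exists>z\<in>U. elts z = {x, y}) \<and>
    (\<forall>x\<in>U. \<exists>z\<in>U. elts ` elts z = Pow (elts x)) \<and>
    (\<forall>I\<in>U. \<forall>f. f ` elts I \<subseteq> U \<longrightarrow> (\<exists>z\<in>U. elts z = (\<Union>i\<in>elts I. elts (f i)))) \<and>
    (\<exists>x\<in>U. infinite (elts x))"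

text \<open>The type \<open>'V\<close> plays the role of the larger universe, of which the smaller one \<open>U1\<close> is an
  element.\<close>

locale grothendieck_universes =
  fixes elts :: "'V \<Rightarrow> 'V set" and U1 :: 'V
  assumes extensionality: "inj elts"
    and foundation: "wf {(x, y). x \<in> elts y}"
    and universe_large: "grothendieck_universe elts UNIV"
    and universe_small: "grothendieck_universe elts (elts U1)"
begin

subsection \<open>Coding of tuples and families as sets\<close>

definition large :: "'V set \<Rightarrow> bool" where
  "large X \<longleftrightarrow> X \<in> range elts"

definition vset :: "'V set \<Rightarrow> 'V" where
  "vset X = (THE x. elts x = X)"

definition vpair :: "'V \<Rightarrow> 'V \<Rightarrow> 'V" where
  "vpair x y = vset {vset {x}, vset {x, y}}"

primrec vlist :: "'V list \<Rightarrow> 'V" where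
  "vlist [] = vset {}"
| "vlist (x # xs) = vpair x (vlist xs)"

definition unlist :: "'V \<Rightarrow> 'V list" where
  "unlist z = (THE xs. vlist xs = z)"

definition part :: "nat \<Rightarrow> 'V \<Rightarrow> 'V" where
  "part n z = unlist z ! n"

text \<open>A family indexed by \<open>S\<close> is coded by its graph.\<close>

definition vfam :: "'V set \<Rightarrow> ('V \<Rightarrow> 'V) \<Rightarrow> 'V" where
  "vfam S f = vset ((\<lambda>i. vpair i (f i)) ` S)"

definition vapp :: "'V \<Rightarrow> 'V \<Rightarrow> 'V" where
  "vapp g i = (THE y. vpair i y \<in> elts g)"

definition vfams :: "'V set \<Rightarrow> ('V \<Rightarrow> 'V set) \<Rightarrow> 'V set" where
  "vfams S T = {vfam S f | f. \<forall>i\<in>S. f i \<in> T i}"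

subsection \<open>The 2-category of large virtual double categories\<close>

type_synonym 'a VDC = "('a, 'a, 'a, 'a) vdc"
type_synonym 'a VDMap = "('a, 'a, 'a, 'a, 'a, 'a, 'a, 'a) vd_map"
type_synonym 'a VDFun = "'a VDC \<times> 'a VDMap \<times> 'a VDC"
type_synonym 'a VDTrans = "'a VDFun \<times> ('a, 'a, 'a, 'a) vd_trans \<times> 'a VDFun"

definition large_vdc :: "'V VDC \<Rightarrow> bool" where
  "large_vdc A \<longleftrightarrow> virtual_double_category A \<and> vdc_extensional A \<and>
    large (Ob A) \<and> large (Ver A) \<and> large (Hor A) \<and> large (Cell A)"

definition id_map :: "'V VDC \<Rightarrow> 'V VDMap" where
  "id_map A = \<lparr>fo = restrict id (Ob A), fv = restrict id (Ver A), fh = restrict id (Hor A),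
               fc = restrict id (Cell A)\<rparr>"

definition comp_map :: "'V VDC \<Rightarrow> 'V VDMap \<Rightarrow> 'V VDMap \<Rightarrow> 'V VDMap" where
  "comp_map A G F = \<lparr>fo = restrict (fo G \<circ> fo F) (Ob A), fv = restrict (fv G \<circ> fv F) (Ver A),
     fh = restrict (fh G \<circ> fh F) (Hor A), fc = restrict (fc G \<circ> fc F) (Cell A)\<rparr>"

definition VDBL :: "('V VDC, 'V VDFun, 'V VDTrans) two_cat" where
  "VDBL = \<lparr>
    C0 = {A. large_vdc A},
    C1 = {(A, F, B). large_vdc A \<and> large_vdc B \<and> virtual_double_functor A B F},
    C2 = {((A, F, B), \<alpha>, (A', G, B')). A' = A \<and> B' = B \<and> large_vdc A \<and> large_vdc B
            \<and> virtual_double_functor A B F \<and> virtual_double_functor A B G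
            \<and> vertical_transformation A B F G \<alpha>},
    src1 = (\<lambda>(A, F, B). A),
    trg1 = (\<lambda>(A, F, B). B),
    src2 = (\<lambda>(M, \<alpha>, N). M),
    trg2 = (\<lambda>(M, \<alpha>, N). N),
    id1 = (\<lambda>A. (A, id_map A, A)),
    cmp1 = (\<lambda>(B, G, C) (A, F, B'). (A, comp_map A G F, C)),
    id2 = (\<lambda>(A, F, B). ((A, F, B),
            \<lparr>tv = (\<lambda>a\<in>Ob A. vid B (fo F a)), tc = (\<lambda>\<Gamma>\<in>Hor A. cid B (fh F \<Gamma>))\<rparr>,
            (A, F, B))),
    vcmp = (\<lambda>(_, \<beta>, N) (M, \<alpha>, _). (M,
            (case M of (A, F, B) \<Rightarrow>
              \<lparr>tv = (\<lambda>a\<in>Ob A. vcomp B (tv \<beta> a) (tv \<alpha> a)),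
               tc = (\<lambda>\<Gamma>\<in>Hor A. ccomp B (tc \<beta> \<Gamma>) (tv \<alpha> (hsrc A \<Gamma>)) [tc \<alpha> \<Gamma>])\<rparr>),
            N)),
    hcmp = (\<lambda>((B, H, C), \<beta>, (_, K, _)) ((A, F, _), \<alpha>, (_, G, _)).
            ((A, comp_map A H F, C),
             \<lparr>tv = (\<lambda>a\<in>Ob A. vcomp C (tv \<beta> (fo G a)) (fv H (tv \<alpha> a))),
              tc = (\<lambda>\<Gamma>\<in>Hor A. ccomp C (tc \<beta> (fh G \<Gamma>)) (fv H (tv \<alpha> (hsrc A \<Gamma>))) [fc H (tc \<alpha> \<Gamma>)])\<rparr>,
             (A, comp_map A K G, C))) \<rparr>"

subsection \<open>Matrices\<close>

text \<open>
  The 2-functor \<open>Mat\<close> is the polynomial 2-functor given by the projection from pointed small sets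
  to small sets, with the right 2-adjoint to pullback along it described explicitly: \<open>mat A\<close> has
  as objects the small families of objects of \<open>A\<close>, and composition as well as the action of
  \<open>Mat\<close> on virtual double functors and vertical transformations are componentwise.

  Coding of the data of the virtual double category of matrices in \<open>A\<close>:
  \<^item> the object \<open>(I, (A\<^sub>i))\<close> is \<open>x = [I, (A\<^sub>i)\<^sub>i]\<close>, with \<open>I = part 0 x\<close> and \<open>A\<^sub>i = oent x i\<close>;
  \<^item> the vertical morphism \<open>(v, f)\<close> from \<open>x\<close> to \<open>y\<close> is \<open>[x, y, v, (f\<^sub>i)\<^sub>i]\<close>;
  \<^item> the horizontal morphism \<open>(\<Gamma>\<^sub>i\<^sub>j)\<close> from \<open>x\<close> to \<open>y\<close> is \<open>[x, y, (\<Gamma>\<^sub>i\<^sub>j)\<^sub>i\<^sub>j]\<close>;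
  \<^item> the multicell \<open>\<theta> : \<Gamma>s \<Rightarrow> \<Delta>\<close> over \<open>(l, r)\<close> is \<open>[\<Gamma>s, \<Delta>, l, r, (\<theta>\<^sub>i\<^sub>s)\<^sub>i\<^sub>s]\<close>, the family being
    indexed by the (coded) tuples \<open>is = [i\<^sub>0, \<dots>, i\<^sub>n]\<close> in the product of the index sets of the
    \<open>n + 1\<close> vertices of the path \<open>\<Gamma>s\<close>.
\<close>

definition oent :: "'V \<Rightarrow> 'V \<Rightarrow> 'V" where
  "oent x i = vapp (part 1 x) i"

definition vidx :: "'V \<Rightarrow> 'V \<Rightarrow> 'V" where
  "vidx g i = vapp (part 2 g) i"

definition vent :: "'V \<Rightarrow> 'V \<Rightarrow> 'V" where
  "vent g i = vapp (part 3 g) i"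

definition hent :: "'V \<Rightarrow> 'V \<Rightarrow> 'V \<Rightarrow> 'V" where
  "hent \<Gamma> i j = vapp (part 2 \<Gamma>) (vlist [i, j])"

definition cent :: "'V \<Rightarrow> 'V list \<Rightarrow> 'V" where
  "cent \<theta> is = vapp (part 4 \<theta>) (vlist is)"

definition idx :: "'V \<Rightarrow> 'V set" where
  "idx x = elts (part 0 x)"

definition tuples :: "'V list \<Rightarrow> 'V set" where
  "tuples xs = vlist ` listset (map idx xs)"

text \<open>The vertices of a path \<open>\<Gamma>s\<close> starting at \<open>x\<close>.\<close>

definition vertices :: "'V \<Rightarrow> 'V list \<Rightarrow> 'V list" where
  "vertices x \<Gamma>s = x # map (part 1) \<Gamma>s"

definition mat_Ob :: "'V VDC \<Rightarrow> 'V set" where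
  "mat_Ob A = {vlist [I, a] | I a. I \<in> elts U1 \<and> a \<in> vfams (elts I) (\<lambda>i. Ob A)}"

definition mat_Ver :: "'V VDC \<Rightarrow> 'V set" where
  "mat_Ver A = {vlist [x, y, v, f] | x y v f. x \<in> mat_Ob A \<and> y \<in> mat_Ob A
     \<and> v \<in> vfams (idx x) (\<lambda>i. idx y)
     \<and> f \<in> vfams (idx x) (\<lambda>i. {u. ver A u (oent x i) (oent y (vapp v i))})}"

definition mat_Hor :: "'V VDC \<Rightarrow> 'V set" where
  "mat_Hor A = {vlist [x, y, \<Gamma>] | x y \<Gamma>. x \<in> mat_Ob A \<and> y \<in> mat_Ob A
     \<and> \<Gamma> \<in> vfams (tuples [x, y])
          (\<lambda>s. {h \<in> Hor A. hsrc A h = oent x (part 0 s) \<and> htrg A h = oent y (part 1 s)})}"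

definition mat_entry :: "'V list \<Rightarrow> 'V list \<Rightarrow> 'V list" where
  "mat_entry \<Gamma>s is = map (\<lambda>k. hent (\<Gamma>s ! k) (is ! k) (is ! Suc k)) [0..<length \<Gamma>s]"

definition mat_Cell :: "'V VDC \<Rightarrow> 'V set" where
  "mat_Cell A = {vlist [vlist \<Gamma>s, \<Delta>, l, r, \<theta>] | \<Gamma>s \<Delta> l r \<theta>.
     \<Delta> \<in> mat_Hor A \<and> l \<in> mat_Ver A \<and> r \<in> mat_Ver A
     \<and> chain (mat_Ob A) (mat_Hor A) (part 0) (part 1) (part 0 l) \<Gamma>s (part 0 r)
     \<and> part 0 \<Delta> = part 1 l \<and> part 1 \<Delta> = part 1 r
     \<and> \<theta> \<in> vfams (tuples (vertices (part 0 l) \<Gamma>s))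
          (\<lambda>s. let is = unlist s in
             {\<xi>. cell A \<xi> (mat_entry \<Gamma>s is) (hent \<Delta> (vidx l (hd is)) (vidx r (last is)))
                    (vent l (hd is)) (vent r (last is))})}"

definition mat_vid :: "'V VDC \<Rightarrow> 'V \<Rightarrow> 'V" where
  "mat_vid A x = vlist [x, x, vfam (idx x) id, vfam (idx x) (\<lambda>i. vid A (oent x i))]"

definition mat_vcomp :: "'V VDC \<Rightarrow> 'V \<Rightarrow> 'V \<Rightarrow> 'V" where
  "mat_vcomp A g f = vlist [part 0 f, part 1 g,
     vfam (idx (part 0 f)) (\<lambda>i. vidx g (vidx f i)),
     vfam (idx (part 0 f)) (\<lambda>i. vcomp A (vent g (vidx f i)) (vent f i))]"

definition mat_cid :: "'V VDC \<Rightarrow> 'V \<Rightarrow> 'V" where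
  "mat_cid A \<Gamma> = vlist [vlist [\<Gamma>], \<Gamma>, mat_vid A (part 0 \<Gamma>), mat_vid A (part 1 \<Gamma>),
     vfam (tuples [part 0 \<Gamma>, part 1 \<Gamma>]) (\<lambda>s. cid A (hent \<Gamma> (part 0 s) (part 1 s)))]"

definition mat_ctop :: "'V \<Rightarrow> 'V list" where
  "mat_ctop \<theta> = unlist (part 0 \<theta>)"

text \<open>
  For \<open>ns = [n\<^sub>1, \<dots>, n\<^sub>m]\<close>, a tuple \<open>(i\<^sub>0, \<dots>, i\<^sub>N)\<close> with \<open>N = n\<^sub>1 + \<dots> + n\<^sub>m\<close> is cut into \<open>m\<close> blocks
  of lengths \<open>n\<^sub>1 + 1, \<dots>, n\<^sub>m + 1\<close>, consecutive blocks sharing one entry.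
\<close>

primrec blocks :: "nat list \<Rightarrow> 'V list \<Rightarrow> 'V list list" where
  "blocks [] is = []"
| "blocks (n # ns) is = take (Suc n) is # blocks ns (drop n is)"

text \<open>
  The component of \<open>\<kappa> \<circ> (\<theta>\<^sub>1, \<dots>, \<theta>\<^sub>m)\<close> at \<open>is\<close> is the composite in \<open>A\<close> of the components of the
  \<open>\<theta>\<^sub>k\<close> at the blocks of \<open>is\<close> and of the component of \<open>\<kappa>\<close> at \<open>js\<close>, the image under the vertical
  sides of the \<open>m + 1\<close> endpoints of these blocks.
\<close>

definition mat_ccomp :: "'V VDC \<Rightarrow> 'V \<Rightarrow> 'V \<Rightarrow> 'V list \<Rightarrow> 'V" where
  "mat_ccomp A \<kappa> u \<theta>s =
    (let \<Gamma>s = concat (map mat_ctop \<theta>s);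
         u' = (if \<theta>s = [] then u else part 3 (last \<theta>s))
     in vlist [vlist \<Gamma>s, part 1 \<kappa>, mat_vcomp A (part 2 \<kappa>) u, mat_vcomp A (part 3 \<kappa>) u',
          vfam (tuples (vertices (part 0 u) \<Gamma>s))
            (\<lambda>s. let is = unlist s;
                     bs = blocks (map (length \<circ> mat_ctop) \<theta>s) is;
                     js = vidx u (hd is) # map2 (\<lambda>\<theta> b. vidx (part 3 \<theta>) (last b)) \<theta>s bs
                 in ccomp A (cent \<kappa> js) (vent u (hd is)) (map2 cent \<theta>s bs))])"

definition mat :: "'V VDC \<Rightarrow> 'V VDC" where
  "mat A = \<lparr>
    Ob = mat_Ob A,
    Ver = mat_Ver A,
    vdom = restrict (part 0) (mat_Ver A),
    vcod = restrict (part 1) (mat_Ver A),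
    vid = restrict (mat_vid A) (mat_Ob A),
    vcomp = (\<lambda>g f. if f \<in> mat_Ver A \<and> g \<in> mat_Ver A \<and> part 1 f = part 0 g
                   then mat_vcomp A g f else undefined),
    Hor = mat_Hor A,
    hsrc = restrict (part 0) (mat_Hor A),
    htrg = restrict (part 1) (mat_Hor A),
    Cell = mat_Cell A,
    ctop = restrict mat_ctop (mat_Cell A),
    cbot = restrict (part 1) (mat_Cell A),
    clft = restrict (part 2) (mat_Cell A),
    crgt = restrict (part 3) (mat_Cell A),
    cid = restrict (mat_cid A) (mat_Hor A),
    ccomp = (\<lambda>\<kappa> u \<theta>s.
      if \<kappa> \<in> mat_Cell A \<and> (\<exists>u'. chain (mat_Ver A) (mat_Cell A) (part 2) (part 3) u \<theta>s u')
         \<and> map (part 1) \<theta>s = mat_ctop \<kappa> \<and> part 1 u = part 0 (part 2 \<kappa>)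
      then mat_ccomp A \<kappa> u \<theta>s else undefined) \<rparr>"

definition mat_fo :: "'V VDMap \<Rightarrow> 'V \<Rightarrow> 'V" where
  "mat_fo F x = vlist [part 0 x, vfam (idx x) (\<lambda>i. fo F (oent x i))]"

definition mat_fv :: "'V VDMap \<Rightarrow> 'V \<Rightarrow> 'V" where
  "mat_fv F g = vlist [mat_fo F (part 0 g), mat_fo F (part 1 g), part 2 g,
     vfam (idx (part 0 g)) (\<lambda>i. fv F (vent g i))]"

definition mat_fh :: "'V VDMap \<Rightarrow> 'V \<Rightarrow> 'V" where
  "mat_fh F \<Gamma> = vlist [mat_fo F (part 0 \<Gamma>), mat_fo F (part 1 \<Gamma>),
     vfam (tuples [part 0 \<Gamma>, part 1 \<Gamma>]) (\<lambda>s. fh F (hent \<Gamma> (part 0 s) (part 1 s)))]"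

definition mat_fc :: "'V VDMap \<Rightarrow> 'V \<Rightarrow> 'V" where
  "mat_fc F \<theta> = vlist [vlist (map (mat_fh F) (mat_ctop \<theta>)), mat_fh F (part 1 \<theta>),
     mat_fv F (part 2 \<theta>), mat_fv F (part 3 \<theta>),
     vfam (tuples (vertices (part 0 (part 2 \<theta>)) (mat_ctop \<theta>))) (\<lambda>s. fc F (cent \<theta> (unlist s)))]"

definition mat_map :: "'V VDC \<Rightarrow> 'V VDMap \<Rightarrow> 'V VDMap" where
  "mat_map A F = \<lparr>fo = restrict (mat_fo F) (mat_Ob A), fv = restrict (mat_fv F) (mat_Ver A),
     fh = restrict (mat_fh F) (mat_Hor A), fc = restrict (mat_fc F) (mat_Cell A)\<rparr>"

definition mat_tv :: "'V VDMap \<Rightarrow> ('V, 'V, 'V, 'V) vd_trans \<Rightarrow> 'V VDMap \<Rightarrow> 'V \<Rightarrow> 'V" where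
  "mat_tv F \<alpha> G x = vlist [mat_fo F x, mat_fo G x, vfam (idx x) id,
     vfam (idx x) (\<lambda>i. tv \<alpha> (oent x i))]"

definition mat_tc :: "'V VDMap \<Rightarrow> ('V, 'V, 'V, 'V) vd_trans \<Rightarrow> 'V VDMap \<Rightarrow> 'V \<Rightarrow> 'V" where
  "mat_tc F \<alpha> G \<Gamma> = vlist [vlist [mat_fh F \<Gamma>], mat_fh G \<Gamma>,
     mat_tv F \<alpha> G (part 0 \<Gamma>), mat_tv F \<alpha> G (part 1 \<Gamma>),
     vfam (tuples [part 0 \<Gamma>, part 1 \<Gamma>]) (\<lambda>s. tc \<alpha> (hent \<Gamma> (part 0 s) (part 1 s)))]"

definition mat_trans ::
  "'V VDC \<Rightarrow> 'V VDMap \<Rightarrow> ('V, 'V, 'V, 'V) vd_trans \<Rightarrow> 'V VDMap \<Rightarrow> ('V, 'V, 'V, 'V) vd_trans" where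
  "mat_trans A F \<alpha> G = \<lparr>tv = restrict (mat_tv F \<alpha> G) (mat_Ob A),
     tc = restrict (mat_tc F \<alpha> G) (mat_Hor A)\<rparr>"

definition Mat :: "('V VDC, 'V VDFun, 'V VDTrans, 'V VDC, 'V VDFun, 'V VDTrans) two_fun" where
  "Mat = \<lparr>
    F0 = mat,
    F1 = (\<lambda>(A, F, B). (mat A, mat_map A F, mat B)),
    F2 = (\<lambda>((A, F, B), \<alpha>, (_, G, _)).
           ((mat A, mat_map A F, mat B), mat_trans A F \<alpha> G, (mat A, mat_map A G, mat B))) \<rparr>"

end

end

theory Submission
  imports Defs
begin

text \<open>
  Let \<open>t\<close> be a terminal virtual double category. An object of \<open>mat A\<close> is a family of objects of
  \<open>A\<close>, and the projection \<open>mat A \<rightarrow> mat t\<close> forgets all entries: since \<open>t\<close> has one object, one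
  vertical and one horizontal morphism and one multicell of each arity, what remains of a family is
  its index set and what remains of a vertical morphism is its function between index sets, while
  horizontal morphisms and multicells of \<open>mat t\<close> carry no information beyond their boundary. So
  \<open>mat t\<close> is the virtual double category \<open>Set_hc\<close>, and familiality of \<open>Mat\<close> amounts to two facts
  about families.

  The left 2-adjoint of \<open>A \<mapsto> (mat A \<rightarrow> mat t)\<close>. A functor \<open>p : X \<rightarrow> mat t\<close> is a set-valued
  functor on the vertical category of \<open>X\<close>; let \<open>el X p\<close> be its pullback along pointed sets, whose
  objects are the pairs of an object \<open>x\<close> and an index in \<open>p x\<close>, and whose multicells are multicells
  of \<open>X\<close> with an index at each vertex of the top. A functor \<open>X \<rightarrow> mat A\<close> over \<open>p\<close> chooses an entry of
  \<open>A\<close> for exactly these data, so it is a functor \<open>el X p \<rightarrow> A\<close>. The two directions of this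
  correspondence are \<open>tab\<close> and \<open>untab\<close>, and the unit \<open>X \<rightarrow> mat (el X p)\<close> is the \<open>tab\<close> of the
  identity. The 2-dimensional part is \<open>unit_universal2\<close>: a transformation into \<open>mat A\<close> whose index
  functions are identities is a transformation out of \<open>el X p\<close>.

  The split fibration. Given \<open>E : X \<rightarrow> mat A\<close> and a transformation \<open>\<beta>\<close> into its image in \<open>mat t\<close>,
  that is, functions \<open>\<beta>\<^sub>x\<close> into the index sets of the families \<open>E x\<close>, reindex these families along
  \<open>\<beta>\<^sub>x\<close>. The resulting transformation \<open>P \<rightarrow> E\<close> has identities of \<open>A\<close> as all its entries, and this
  property characterizes it among the lifts of \<open>\<beta>\<close> (\<open>reindexing_unique\<close>). The transformations with
  identity entries are cartesian (\<open>reindexing_cartesian\<close>), contain the identities and are closed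
  under composition, whiskering with functors \<open>Y \<rightarrow> X\<close> and application of functors \<open>A \<rightarrow> C\<close>. Such a
  class of 2-cells with unique lifts is a splitting (\<open>split_fibration_chosen_lift\<close>).

  A general criterion (\<open>familial_atI\<close>, using the construction of a 2-adjunction from universal arrows)
  assembles both facts. It remains that \<open>VDBL\<close> is a 2-category, that \<open>Mat\<close> is a 2-functor, and that
  a terminal object exists. The laborious point is associativity of composition in \<open>mat A\<close>, where a
  tuple of indices of a composite is cut into blocks at two levels.

  Throughout, \<open>q\<close> and \<open>qs\<close> stand for multicells and lists of them, \<open>J\<close> and \<open>Js\<close> for horizontal
  morphisms. An index tuple of a multicell whose top has length \<open>n\<close> is written \<open>i # r\<close>, where \<open>i\<close> is
  the leftmost index and \<open>r\<close> lists the other \<open>n\<close> ones.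
\<close>

context grothendieck_universes
begin

section \<open>Sets and families in a universe\<close>

lemma vset_elts [simp]: "vset (elts x) = x"
  unfolding vset_def using extensionality by (auto simp: inj_def)

lemma elts_vset [simp]: "large X \<Longrightarrow> elts (vset X) = X"
  unfolding large_def by auto

lemma large_elts [simp]: "large (elts x)"
  by (simp add: large_def)

lemma large_subset: assumes "large Y" "X \<subseteq> Y" shows "large X"
proof -
  obtain y where y: "Y = elts y" using assms(1) by (auto simp: large_def)
  obtain z where "elts ` elts z = Pow Y"
    using universe_large y unfolding grothendieck_universe_def by (metis UNIV_I)
  then have "X \<in> elts ` elts z" using assms(2) by simp
  then show ?thesis by (auto simp: large_def)
qed

lemma large_doubleton: "large {x, y}"
  using universe_large unfolding grothendieck_universe_def large_def by (metis UNIV_I rangeI)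

lemma large_singleton [simp]: "large {x}"
  using large_doubleton[of x x] by simp

lemma large_empty [simp]: "large {}"
  by (rule large_subset[OF large_singleton]) simp

lemma large_UN: assumes "large I" "\<And>i. i \<in> I \<Longrightarrow> large (X i)" shows "large (\<Union>i\<in>I. X i)"
proof -
  obtain w where w: "I = elts w" using assms(1) by (auto simp: large_def)
  have "\<exists>z. elts z = (\<Union>i\<in>elts w. elts (vset (X i)))"
    using universe_large[unfolded grothendieck_universe_def] by simp
  then obtain z where "elts z = (\<Union>i\<in>elts w. elts (vset (X i)))" ..
  moreover have "(\<Union>i\<in>elts w. elts (vset (X i))) = (\<Union>i\<in>I. X i)" using assms(2) w by simp
  ultimately show ?thesis by (metis large_elts)
qed

lemma large_image: "large X \<Longrightarrow> large (f ` X)"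
  using large_UN[of X "\<lambda>x. {f x}"] by (simp add: UNION_singleton_eq_range)

lemma large_Pow: "large X \<Longrightarrow> large (vset ` Pow X)"
proof -
  assume "large X"
  then obtain x where x: "X = elts x" by (auto simp: large_def)
  obtain z where "elts ` elts z = Pow X"
    using universe_large x unfolding grothendieck_universe_def by (metis UNIV_I)
  then have "vset ` Pow X = vset ` elts ` elts z" by simp
  also have "\<dots> = elts z" by (simp add: image_comp)
  finally show ?thesis by simp
qed

lemma vpair_eq [simp]: "vpair x y = vpair x' y' \<longleftrightarrow> x = x' \<and> y = y'"
proof
  assume "vpair x y = vpair x' y'"
  then have "{vset {x}, vset {x, y}} = {vset {x'}, vset {x', y'}}"
    unfolding vpair_def by (metis elts_vset large_doubleton)
  then have "elts ` {vset {x}, vset {x, y}} = elts ` {vset {x'}, vset {x', y'}}" by simp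
  then have "{{x}, {x, y}} = {{x'}, {x', y'}}" by (simp add: large_doubleton)
  then show "x = x' \<and> y = y'" by (auto simp: doubleton_eq_iff)
qed simp

lemma vpair_neq_empty [simp]: "vpair x y \<noteq> vset {}" "vset {} \<noteq> vpair x y"
proof -
  have "elts (vpair x y) \<noteq> elts (vset {})" unfolding vpair_def by (simp add: large_doubleton)
  then show "vpair x y \<noteq> vset {}" "vset {} \<noteq> vpair x y" by metis+
qed

lemma vlist_eq [simp]: "vlist xs = vlist ys \<longleftrightarrow> xs = ys"
proof (induction xs arbitrary: ys)
  case Nil then show ?case by (cases ys) auto
next
  case (Cons x xs) then show ?case by (cases ys) auto
qed

lemma unlist_vlist [simp]: "unlist (vlist xs) = xs"
  unfolding unlist_def by simp

lemma part_vlist [simp]: "part n (vlist xs) = xs ! n"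
  unfolding part_def by simp

declare vlist.simps [simp del]

lemma large_times:
  assumes "large X" "\<And>x. x \<in> X \<Longrightarrow> large (Y x)" shows "large {vpair x y | x y. x \<in> X \<and> y \<in> Y x}"
proof -
  have "{vpair x y | x y. x \<in> X \<and> y \<in> Y x} = (\<Union>x\<in>X. vpair x ` Y x)" by auto
  then show ?thesis using assms by (simp add: large_UN large_image)
qed

lemma vapp_vfam [simp]: "\<lbrakk>large S; i \<in> S\<rbrakk> \<Longrightarrow> vapp (vfam S f) i = f i"
  unfolding vapp_def vfam_def by (rule the_equality) (auto simp: large_image)

lemma vfam_cong: "(\<And>i. i \<in> S \<Longrightarrow> f i = g i) \<Longrightarrow> vfam S f = vfam S g"
  unfolding vfam_def by (intro arg_cong[where f = vset] image_cong) auto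

lemma vfam_eq_iff: "large S \<Longrightarrow> vfam S f = vfam S g \<longleftrightarrow> (\<forall>i\<in>S. f i = g i)"
  using vapp_vfam[of S _ f] vapp_vfam[of S _ g] vfam_cong[of S f g] by metis

lemma vfam_in_vfams [simp]: "large S \<Longrightarrow> vfam S f \<in> vfams S T \<longleftrightarrow> (\<forall>i\<in>S. f i \<in> T i)"
  unfolding vfams_def by (auto simp: vfam_eq_iff)

lemma vfams_iff: "large S \<Longrightarrow> x \<in> vfams S T \<longleftrightarrow> x = vfam S (vapp x) \<and> (\<forall>i\<in>S. vapp x i \<in> T i)"
  unfolding vfams_def by (auto simp: vfam_eq_iff)

text \<open>
  A family is coded by its graph, a set of pairs, so the families form a subset of a power set.
\<close>

lemma large_vfams:
  assumes "large S" "\<And>i. i \<in> S \<Longrightarrow> large (T i)" shows "large (vfams S T)"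
proof (rule large_subset)
  let ?P = "{vpair x y | x y. x \<in> S \<and> y \<in> T x}"
  show "large (vset ` Pow ?P)" using assms by (intro large_Pow large_times)
  show "vfams S T \<subseteq> vset ` Pow ?P" unfolding vfams_def vfam_def by blast
qed

lemma large_nat_range: "large (range (f :: nat \<Rightarrow> 'V))"
proof -
  obtain x where x: "infinite (elts x)"
    using universe_large[unfolded grothendieck_universe_def] by auto
  from infinite_countable_subset[OF x] obtain g :: "nat \<Rightarrow> 'V"
    where g: "inj g" "range g \<subseteq> elts x" by auto
  have "(f \<circ> inv g) ` range g = f ` inv g ` range g" by (rule image_comp[symmetric])
  also have "inv g ` range g = UNIV" using g(1) by (simp add: image_comp)
  finally have "(f \<circ> inv g) ` range g = range f" .
  then show ?thesis using large_image[OF large_subset[OF large_elts g(2)], of "f \<circ> inv g"] by simp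
qed

text \<open>
  The lists of each length form a large set by induction, and the union over all lengths is indexed
  by the natural numbers, which are large because the universe contains an infinite set.
\<close>

lemma large_lists: assumes "large X" shows "large (vlist ` lists X)"
proof -
  define W where "W n = vlist ` {xs. length xs = n \<and> set xs \<subseteq> X}" for n
  have W: "large (W n)" for n
  proof (induction n)
    case 0
    have "W 0 \<subseteq> {vlist []}" by (auto simp: W_def)
    then show ?case using large_subset large_singleton by blast
  next
    case (Suc n)
    have "W (Suc n) \<subseteq> {vpair x y | x y. x \<in> X \<and> y \<in> W n}"
    proof
      fix z assume "z \<in> W (Suc n)"
      then obtain x xs where "z = vlist (x # xs)" "x \<in> X" "set xs \<subseteq> X" "length xs = n"
        unfolding W_def by (auto simp: length_Suc_conv)
      then have "z = vpair x (vlist xs)" "x \<in> X" "vlist xs \<in> W n"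
        unfolding W_def by (simp_all add: vlist.simps)
      then show "z \<in> {vpair x y | x y. x \<in> X \<and> y \<in> W n}" by blast
    qed
    then show ?case by (rule large_subset[OF large_times[OF assms Suc]])
  qed
  obtain c :: "nat \<Rightarrow> 'V" where c: "inj c"
  proof -
    obtain x where x: "infinite (elts x)"
      using universe_large[unfolded grothendieck_universe_def] by auto
    from infinite_countable_subset[OF x] show ?thesis using that by auto
  qed
  have "large (\<Union>i\<in>range c. W (inv c i))"
    by (rule large_UN[OF large_nat_range W])
  moreover have "vlist ` lists X \<subseteq> (\<Union>i\<in>range c. W (inv c i))"
  proof
    fix z assume "z \<in> vlist ` lists X"
    then obtain xs where "z = vlist xs" "set xs \<subseteq> X" by (auto simp: lists_eq_set)
    then have "z \<in> W (inv c (c (length xs)))" using c by (auto simp: W_def)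
    then show "z \<in> (\<Union>i\<in>range c. W (inv c i))" by blast
  qed
  ultimately show ?thesis using large_subset by blast
qed

lemma large_Un: "\<lbrakk>large X; large Y\<rbrakk> \<Longrightarrow> large (X \<union> Y)"
proof -
  assume "large X" "large Y"
  moreover have "elts (vset {vset {}}) \<noteq> elts (vset {})" by simp
  then have "vset {vset {}} \<noteq> vset {}" by metis
  ultimately show ?thesis
    using large_UN[OF large_doubleton, of "vset {}" "vset {vset {}}" "\<lambda>i. if i = vset {} then X else Y"]
    by (simp add: Un_commute)
qed

end

section \<open>Cutting tuples into blocks\<close>

lemma listset_iff: "is \<in> listset Ds \<longleftrightarrow> list_all2 (\<in>) is Ds"
  by (induction Ds arbitrary: "is") (auto simp: set_Cons_def list_all2_Cons2)

text \<open>
  A tuple \<open>i # concat rs\<close> along a concatenation of paths is cut into overlapping pieces, each starting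
  with the last index of the preceding one. Recursion on the list of tails avoids the index
  arithmetic of \<open>blocks\<close>.
\<close>

primrec blk :: "'a \<Rightarrow> 'a list list \<Rightarrow> 'a list list" where
  "blk i [] = []"
| "blk i (r # rs) = (i # r) # blk (last (i # r)) rs"

lemma length_blk [simp]: "length (blk i rs) = length rs"
  by (induction rs arbitrary: i) auto

lemma map_tl_blk [simp]: "map tl (blk i rs) = rs"
  by (induction rs arbitrary: i) auto

lemma blk_nth: "k < length rs \<Longrightarrow> blk i rs ! k = last (i # concat (take k rs)) # rs ! k"
proof (induction rs arbitrary: i k)
  case (Cons r rs)
  show ?case
  proof (cases k)
    case (Suc k')
    have "last (last (i # r) # concat (take k' rs)) = last (i # r @ concat (take k' rs))"
      by (simp add: last_append)
    then show ?thesis using Cons Suc by (simp del: last.simps)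
  qed simp
qed simp

context grothendieck_universes begin

lemma blocks_blk: "blocks (map length rs) (i # concat rs) = blk i rs"
proof (induction rs arbitrary: i)
  case (Cons r rs)
  have "drop (length r) (i # r @ concat rs) = last (i # r) # concat rs"
    by (cases r rule: rev_cases) auto
  then show ?case using Cons by simp
qed simp

end

section \<open>Strict 2-categories and adjunctions\<close>

lemma arr2D: "arr2 K \<alpha> f g \<Longrightarrow> \<alpha> \<in> C2 K \<and> src2 K \<alpha> = f \<and> trg2 K \<alpha> = g"
  by (simp add: arr2_def)

context two_category
begin

lemma arr1_ob: assumes "arr1 K f a b" shows "a \<in> C0 K" "b \<in> C0 K"
  using assms src1_in trg1_in by (auto simp: arr1_def)

lemma arr1_self: "f \<in> C1 K \<Longrightarrow> arr1 K f (src1 K f) (trg1 K f)"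
  by (simp add: arr1_def)

lemma arr2_arr1: assumes "arr2 K \<alpha> f g"
  shows "arr1 K f (src1 K f) (trg1 K f)" "arr1 K g (src1 K f) (trg1 K f)"
  using assms src2_in trg2_in parallel_src parallel_trg by (auto simp: arr1_def arr2_def)

lemma arr2_arr1':
  assumes "arr2 K \<alpha> f g" "arr1 K f a b" shows "arr1 K g a b"
  using arr2_arr1[OF assms(1)] assms(2) by (auto simp: arr1_def)

lemma whisk_left_arr: "\<lbrakk>arr2 K \<alpha> f f'; arr1 K f a b; arr1 K g b c\<rbrakk>
  \<Longrightarrow> arr2 K (whisk_left K g \<alpha>) (cmp1 K g f) (cmp1 K g f')"
  unfolding whisk_left_def by (intro hcmp_arr id2_arr) (auto simp: arr1_def)

lemma whisk_right_arr: "\<lbrakk>arr2 K \<alpha> g g'; arr1 K f a b; arr1 K g b c\<rbrakk>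
  \<Longrightarrow> arr2 K (whisk_right K \<alpha> f) (cmp1 K g f) (cmp1 K g' f)"
  unfolding whisk_right_def by (intro hcmp_arr id2_arr) (auto simp: arr1_def)

lemma whisk_left_id2: "\<lbrakk>arr1 K f a b; arr1 K g b c\<rbrakk> \<Longrightarrow> whisk_left K g (id2 K f) = id2 K (cmp1 K g f)"
  unfolding whisk_left_def by (rule hcmp_id2)

lemma whisk_right_id2: "\<lbrakk>arr1 K f a b; arr1 K g b c\<rbrakk> \<Longrightarrow> whisk_right K (id2 K g) f = id2 K (cmp1 K g f)"
  unfolding whisk_right_def by (rule hcmp_id2)

lemma whisk_left_hcmp:
  assumes "arr2 K \<alpha> f f'" "arr2 K \<beta> g g'" "trg1 K f = src1 K g" "arr1 K h (trg1 K g) d"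
  shows "whisk_left K h (hcmp K \<beta> \<alpha>) = hcmp K (whisk_left K h \<beta>) \<alpha>"
  using hcmp_assoc[OF assms(1,2) id2_arr assms(3), of h] assms(4) by (auto simp: whisk_left_def arr1_def)

lemma whisk_right_hcmp:
  assumes "arr2 K \<alpha> f f'" "arr2 K \<beta> g g'" "trg1 K f = src1 K g" "arr1 K h d (src1 K f)"
  shows "whisk_right K (hcmp K \<beta> \<alpha>) h = hcmp K \<beta> (whisk_right K \<alpha> h)"
  using hcmp_assoc[OF id2_arr assms(1,2), of h] assms(3,4) by (auto simp: whisk_right_def arr1_def)

lemma hcmp_whisk:
  assumes "arr2 K \<alpha> f f'" "arr2 K \<beta> g g'" "trg1 K f = src1 K h" "trg1 K h = src1 K g" "h \<in> C1 K"
  shows "hcmp K (whisk_right K \<beta> h) \<alpha> = hcmp K \<beta> (whisk_left K h \<alpha>)"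
  using hcmp_assoc[OF assms(1) id2_arr assms(2), of h] assms(3-5) by (auto simp: whisk_left_def whisk_right_def)

lemma whisk_left_vcmp:
  assumes "arr2 K \<alpha> f g" "arr2 K \<beta> g h" "arr1 K f a b" "arr1 K k b c"
  shows "whisk_left K k (vcmp K \<beta> \<alpha>) = vcmp K (whisk_left K k \<beta>) (whisk_left K k \<alpha>)"
proof -
  have k: "arr2 K (id2 K k) k k" using assms id2_arr by (auto simp: arr1_def)
  have "whisk_left K k (vcmp K \<beta> \<alpha>) = hcmp K (vcmp K (id2 K k) (id2 K k)) (vcmp K \<beta> \<alpha>)"
    unfolding whisk_left_def by (simp only: vcmp_id_left[OF k])
  also have "\<dots> = vcmp K (hcmp K (id2 K k) \<beta>) (hcmp K (id2 K k) \<alpha>)"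
    by (rule interchange[OF assms(1,2) k k]) (use assms in \<open>auto simp: arr1_def\<close>)
  finally show ?thesis by (simp add: whisk_left_def)
qed

lemma whisk_right_vcmp:
  assumes "arr2 K \<alpha> f g" "arr2 K \<beta> g h" "arr1 K f b c" "arr1 K k a b"
  shows "whisk_right K (vcmp K \<beta> \<alpha>) k = vcmp K (whisk_right K \<beta> k) (whisk_right K \<alpha> k)"
proof -
  have k: "arr2 K (id2 K k) k k" using assms id2_arr by (auto simp: arr1_def)
  have "whisk_right K (vcmp K \<beta> \<alpha>) k = hcmp K (vcmp K \<beta> \<alpha>) (vcmp K (id2 K k) (id2 K k))"
    unfolding whisk_right_def by (simp only: vcmp_id_left[OF k])
  also have "\<dots> = vcmp K (hcmp K \<beta> (id2 K k)) (hcmp K \<alpha> (id2 K k))"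
    by (rule interchange[OF k k assms(1,2)]) (use assms in \<open>auto simp: arr1_def\<close>)
  finally show ?thesis by (simp add: whisk_right_def)
qed

end

lemma slice_arr1: "arr1 (slice L B) F p q \<longleftrightarrow>
    (\<exists>f. F = (p, f, q) \<and> p \<in> C1 L \<and> trg1 L p = B \<and> q \<in> C1 L \<and> trg1 L q = B
       \<and> arr1 L f (src1 L p) (src1 L q) \<and> cmp1 L q f = p)"
  by (auto simp: arr1_def slice_def)

lemma slice_arr2: "arr2 (slice L B) A F F' \<longleftrightarrow>
    (\<exists>p \<alpha> q f f'. A = (p, \<alpha>, q) \<and> F = (p, f, q) \<and> F' = (p, f', q)
       \<and> p \<in> C1 L \<and> trg1 L p = B \<and> q \<in> C1 L \<and> trg1 L q = B
       \<and> arr2 L \<alpha> f f' \<and> arr1 L f (src1 L p) (src1 L q) \<and> whisk_left L q \<alpha> = id2 L p)"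
  by (auto simp: arr2_def slice_def)

lemma slice_ops [simp]:
  "p \<in> C0 (slice L B) \<longleftrightarrow> p \<in> C1 L \<and> trg1 L p = B"
  "src1 (slice L B) (p, f, q) = p" "trg1 (slice L B) (p, f, q) = q"
  "src2 (slice L B) (p, \<alpha>, q) = (p, src2 L \<alpha>, q)" "trg2 (slice L B) (p, \<alpha>, q) = (p, trg2 L \<alpha>, q)"
  "id1 (slice L B) p = (p, id1 L (src1 L p), p)"
  "cmp1 (slice L B) (q, g, r) (p, f, q) = (p, cmp1 L g f, r)"
  "id2 (slice L B) (p, f, q) = (p, id2 L f, q)"
  "vcmp (slice L B) (p, \<beta>, q) (p, \<alpha>, q) = (p, vcmp L \<beta> \<alpha>, q)"
  "hcmp (slice L B) (q, \<beta>, r) (p, \<alpha>, q) = (p, hcmp L \<beta> \<alpha>, r)"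
  by (auto simp: slice_def)

lemma slice_C1: "F \<in> C1 (slice L B) \<longleftrightarrow> (\<exists>p q. arr1 (slice L B) F p q)"
  unfolding arr1_def by blast

lemma slice_C2: "A \<in> C2 (slice L B) \<longleftrightarrow> (\<exists>F F'. arr2 (slice L B) A F F')"
  unfolding arr2_def by blast

lemma (in two_category) slice_over:
  assumes "arr2 K \<alpha> f f'" "arr1 K f a b" "arr1 K q b c" "whisk_left K q \<alpha> = id2 K p" "p \<in> C1 K"
  shows "cmp1 K q f = p" "cmp1 K q f' = p"
  using whisk_left_arr[OF assms(1-3)] id2_arr[OF assms(5)] assms(4) by (auto simp: arr2_def)

lemma two_category_slice:
  assumes "two_category L" shows "two_category (slice L B)"
proof -
  interpret L: two_category L by fact
  have over: "cmp1 L q f = p \<and> cmp1 L q f' = p \<and> arr1 L f' (src1 L p) (src1 L q)"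
    if "arr2 L \<alpha> f f'" "arr1 L f (src1 L p) (src1 L q)" "whisk_left L q \<alpha> = id2 L p"
      "p \<in> C1 L" "q \<in> C1 L" for p q f f' \<alpha>
    using L.slice_over[OF that(1,2) L.arr1_self[OF that(5)] that(3,4)] L.arr2_arr1'[OF that(1,2)] by simp
  show ?thesis
  proof (unfold_locales, goal_cases)
    case (1 f) then show ?case by (auto simp: slice_C1 slice_arr1)
  next
    case (2 f) then show ?case by (auto simp: slice_C1 slice_arr1)
  next
    case (3 \<alpha>)
    then obtain p \<alpha>0 q where "\<alpha> = (p, \<alpha>0, q)" by (cases \<alpha>)
    with 3 show ?case using over[of \<alpha>0 "src2 L \<alpha>0" "trg2 L \<alpha>0" p q]
      by (auto simp: slice_def arr1_def arr2_def)
  next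
    case (4 \<alpha>)
    then obtain p \<alpha>0 q where "\<alpha> = (p, \<alpha>0, q)" by (cases \<alpha>)
    with 4 show ?case using over[of \<alpha>0 "src2 L \<alpha>0" "trg2 L \<alpha>0" p q]
      by (auto simp: slice_def arr1_def arr2_def)
  next
    case (5 \<alpha>) then show ?case by (auto simp: slice_C2 slice_arr2 dest: arr2D)
  next
    case (6 \<alpha>) then show ?case by (auto simp: slice_C2 slice_arr2 dest: arr2D)
  next
    case (7 a) then show ?case
      using L.id1_arr L.src1_in L.cmp1_id_right[OF L.arr1_self] by (auto simp: slice_arr1)
  next
    case (8 f a b g c)
    then obtain f0 g0 where e: "f = (a, f0, b)" "g = (b, g0, c)"
      and c: "a \<in> C1 L" "trg1 L a = B" "c \<in> C1 L" "trg1 L c = B"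
      and f: "arr1 L f0 (src1 L a) (src1 L b)" "cmp1 L b f0 = a"
      and g: "arr1 L g0 (src1 L b) (src1 L c)" "cmp1 L c g0 = b"
      unfolding slice_arr1 by blast
    show ?case using e c L.cmp1_arr[OF f(1) g(1)] L.cmp1_assoc[OF f(1) g(1) L.arr1_self[OF c(3)]] f(2) g(2)
      by (simp add: slice_arr1)
  next
    case (9 f a b) then show ?case using L.cmp1_id_left by (auto simp: slice_arr1)
  next
    case (10 f a b) then show ?case using L.cmp1_id_right by (auto simp: slice_arr1)
  next
    case (11 f a b g c h d) then show ?case using L.cmp1_assoc by (auto simp: slice_arr1)
  next
    case (12 f)
    then obtain p f0 q where f: "f = (p, f0, q)" "p \<in> C1 L" "trg1 L p = B" "q \<in> C1 L" "trg1 L q = B"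
      "arr1 L f0 (src1 L p) (src1 L q)" "cmp1 L q f0 = p" by (auto simp: slice_C1 slice_arr1)
    have "f0 \<in> C1 L" using f by (simp add: arr1_def)
    then show ?case using f L.id2_arr L.whisk_left_id2[OF f(6) L.arr1_self[OF f(4)]] by (simp add: slice_arr2)
  next
    case (13 \<alpha> f g \<beta> h)
    then obtain p \<alpha>0 q f0 g0 \<beta>0 h0 where
      e: "\<alpha> = (p, \<alpha>0, q)" "f = (p, f0, q)" "g = (p, g0, q)" "\<beta> = (p, \<beta>0, q)" "h = (p, h0, q)"
      and c: "p \<in> C1 L" "q \<in> C1 L" "trg1 L p = B" "trg1 L q = B"
      and a: "arr2 L \<alpha>0 f0 g0" "arr1 L f0 (src1 L p) (src1 L q)" "whisk_left L q \<alpha>0 = id2 L p"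
      and b: "arr2 L \<beta>0 g0 h0" "whisk_left L q \<beta>0 = id2 L p"
      by (auto simp: slice_arr2)
    show ?case using e c a(2) L.vcmp_arr[OF a(1) b(1)] L.vcmp_id_left[OF L.id2_arr[OF c(1)]]
      L.whisk_left_vcmp[OF a(1) b(1) a(2) L.arr1_self[OF c(2)]] a(3) b(2) by (simp add: slice_arr2)
  next
    case (14 \<alpha> f g) then show ?case using L.vcmp_id_left by (auto simp: slice_arr2)
  next
    case (15 \<alpha> f g) then show ?case using L.vcmp_id_right by (auto simp: slice_arr2)
  next
    case (16 \<alpha> f g \<beta> h \<gamma> k) then show ?case using L.vcmp_assoc by (auto simp: slice_arr2)
  next
    case (17 \<alpha> f f' \<beta> g g')
    then obtain p \<alpha>0 q f0 f0' \<beta>0 r g0 g0' where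
      e: "\<alpha> = (p, \<alpha>0, q)" "f = (p, f0, q)" "f' = (p, f0', q)"
         "\<beta> = (q, \<beta>0, r)" "g = (q, g0, r)" "g' = (q, g0', r)"
      and c: "p \<in> C1 L" "q \<in> C1 L" "r \<in> C1 L" "trg1 L p = B" "trg1 L q = B" "trg1 L r = B"
      and a: "arr2 L \<alpha>0 f0 f0'" "arr1 L f0 (src1 L p) (src1 L q)" "whisk_left L q \<alpha>0 = id2 L p"
      and b: "arr2 L \<beta>0 g0 g0'" "arr1 L g0 (src1 L q) (src1 L r)" "whisk_left L r \<beta>0 = id2 L q"
      by (auto simp: slice_arr2)
    have fg: "trg1 L f0 = src1 L g0" using a b by (auto simp: arr1_def)
    have "whisk_left L r (hcmp L \<beta>0 \<alpha>0) = hcmp L (whisk_left L r \<beta>0) \<alpha>0"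
      by (rule L.whisk_left_hcmp[OF a(1) b(1) fg]) (use c b in \<open>auto simp: arr1_def\<close>)
    also have "\<dots> = id2 L p" unfolding b(3) using a(3) by (simp add: whisk_left_def)
    finally show ?case using e c L.hcmp_arr[OF a(1) b(1) fg] L.cmp1_arr[OF a(2) b(2)]
      by (auto simp: slice_arr2)
  next
    case (18 \<alpha> f g b) then show ?case using L.hcmp_id_left by (auto simp: slice_arr2 arr1_def)
  next
    case (19 \<alpha> f g b) then show ?case using L.hcmp_id_right by (auto simp: slice_arr2 arr1_def)
  next
    case (20 \<alpha> f f' \<beta> g g' \<gamma> h h') then show ?case using L.hcmp_assoc by (auto simp: slice_arr2 arr1_def)
  next
    case (21 f a b g c) then show ?case using L.hcmp_id2 by (auto simp: slice_arr1)
  next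
    case (22 \<alpha> f f' \<alpha>' f'' \<beta> g g' \<beta>' g'') then show ?case
      using L.interchange by (auto simp: slice_arr2 arr1_def)
  qed
qed

text \<open>
  A left 2-adjoint need not be given as a 2-functor: it is enough to have, for each object \<open>b\<close>, a
  universal arrow \<open>\<eta> b\<close> into \<open>G\<close> that induces an isomorphism of hom-categories. The action on 1-cells and
  2-cells, the counit and all naturality and triangle equations then follow by comparing composites
  with \<open>\<eta>\<close>.
\<close>

locale universal_arrows = K: two_category K + L: two_category L + G: two_functor K L G
  for K :: "('o, 'm, 'c) two_cat" and L :: "('p, 'n, 'd) two_cat" and G +
  fixes Fo :: "'p \<Rightarrow> 'o" and \<eta> :: "'p \<Rightarrow> 'n"
  assumes Fo_in: "b \<in> C0 L \<Longrightarrow> Fo b \<in> C0 K"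
    and \<eta>_arr: "b \<in> C0 L \<Longrightarrow> arr1 L (\<eta> b) b (F0 G (Fo b))"
    and universal1: "\<lbrakk>b \<in> C0 L; a \<in> C0 K; arr1 L g b (F0 G a)\<rbrakk>
      \<Longrightarrow> \<exists>!f. arr1 K f (Fo b) a \<and> cmp1 L (F1 G f) (\<eta> b) = g"
    and universal2: "\<lbrakk>b \<in> C0 L; arr1 K f (Fo b) a; arr1 K f' (Fo b) a;
        arr2 L \<gamma> (cmp1 L (F1 G f) (\<eta> b)) (cmp1 L (F1 G f') (\<eta> b))\<rbrakk>
      \<Longrightarrow> \<exists>!\<alpha>. arr2 K \<alpha> f f' \<and> whisk_right L (F2 G \<alpha>) (\<eta> b) = \<gamma>"
begin

definition transpose :: "'p \<Rightarrow> 'o \<Rightarrow> 'n \<Rightarrow> 'm" where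
  "transpose b a g = (THE f. arr1 K f (Fo b) a \<and> cmp1 L (F1 G f) (\<eta> b) = g)"

lemma transpose:
  assumes "b \<in> C0 L" "a \<in> C0 K" "arr1 L g b (F0 G a)"
  shows "arr1 K (transpose b a g) (Fo b) a" "cmp1 L (F1 G (transpose b a g)) (\<eta> b) = g"
  using theI'[OF universal1[OF assms]] unfolding transpose_def by auto

lemma eq1:
  assumes "b \<in> C0 L" "arr1 K f (Fo b) a" "arr1 K f' (Fo b) a"
    "cmp1 L (F1 G f) (\<eta> b) = cmp1 L (F1 G f') (\<eta> b)"
  shows "f = f'"
  using universal1[OF assms(1) K.arr1_ob(2)[OF assms(2)] L.cmp1_arr[OF \<eta>_arr[OF assms(1)] G.F1_arr[OF assms(2)]]]
    assms by metis

lemma eq2: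
  assumes "b \<in> C0 L" "arr1 K f (Fo b) a" "arr2 K \<alpha> f f'" "arr2 K \<alpha>' f f'"
    "whisk_right L (F2 G \<alpha>) (\<eta> b) = whisk_right L (F2 G \<alpha>') (\<eta> b)"
  shows "\<alpha> = \<alpha>'"
proof -
  have "arr2 L (whisk_right L (F2 G \<alpha>) (\<eta> b)) (cmp1 L (F1 G f) (\<eta> b)) (cmp1 L (F1 G f') (\<eta> b))"
    by (rule L.whisk_right_arr[OF G.F2_arr[OF assms(3)] \<eta>_arr[OF assms(1)] G.F1_arr[OF assms(2)]])
  from universal2[OF assms(1,2) K.arr2_arr1'[OF assms(3,2)] this] show ?thesis using assms by metis
qed

definition act1 :: "'n \<Rightarrow> 'm" where
  "act1 g = transpose (src1 L g) (Fo (trg1 L g)) (cmp1 L (\<eta> (trg1 L g)) g)"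

lemma act1:
  assumes "arr1 L g b c"
  shows "arr1 K (act1 g) (Fo b) (Fo c)" "cmp1 L (F1 G (act1 g)) (\<eta> b) = cmp1 L (\<eta> c) g"
  using transpose[OF L.arr1_ob(1)[OF assms] Fo_in[OF L.arr1_ob(2)[OF assms]]
      L.cmp1_arr[OF assms \<eta>_arr[OF L.arr1_ob(2)[OF assms]]]] assms
  unfolding act1_def by (auto simp: arr1_def)

definition act2 :: "'d \<Rightarrow> 'c" where
  "act2 \<gamma> = (THE \<alpha>. arr2 K \<alpha> (act1 (src2 L \<gamma>)) (act1 (trg2 L \<gamma>)) \<and>
     whisk_right L (F2 G \<alpha>) (\<eta> (src1 L (src2 L \<gamma>))) = whisk_left L (\<eta> (trg1 L (src2 L \<gamma>))) \<gamma>)"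

lemma act2:
  assumes "arr2 L \<gamma> g g'" "arr1 L g b c"
  shows "arr2 K (act2 \<gamma>) (act1 g) (act1 g')"
    "whisk_right L (F2 G (act2 \<gamma>)) (\<eta> b) = whisk_left L (\<eta> c) \<gamma>" (is ?P1)
proof -
  note g' = L.arr2_arr1'[OF assms] note ob = L.arr1_ob[OF assms(2)]
  have w: "arr2 L (whisk_left L (\<eta> c) \<gamma>) (cmp1 L (\<eta> c) g) (cmp1 L (\<eta> c) g')"
    by (rule L.whisk_left_arr[OF assms \<eta>_arr[OF ob(2)]])
  have ex: "\<exists>!\<alpha>. arr2 K \<alpha> (act1 g) (act1 g') \<and> whisk_right L (F2 G \<alpha>) (\<eta> b) = whisk_left L (\<eta> c) \<gamma>"
    by (rule universal2[OF ob(1) act1(1)[OF assms(2)] act1(1)[OF g']])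
      (simp only: act1(2)[OF assms(2)] act1(2)[OF g'] w)
  have "act2 \<gamma> = (THE \<alpha>. arr2 K \<alpha> (act1 g) (act1 g') \<and>
      whisk_right L (F2 G \<alpha>) (\<eta> b) = whisk_left L (\<eta> c) \<gamma>)"
    unfolding act2_def using assms by (simp add: arr1_def arr2_def)
  with theI'[OF ex] show "arr2 K (act2 \<gamma>) (act1 g) (act1 g')" "?P1" by (simp_all only:)
qed

definition counit :: "'o \<Rightarrow> 'm" where
  "counit a = transpose (F0 G a) a (id1 L (F0 G a))"

lemma counit:
  assumes "a \<in> C0 K"
  shows "arr1 K (counit a) (Fo (F0 G a)) a" "cmp1 L (F1 G (counit a)) (\<eta> (F0 G a)) = id1 L (F0 G a)"
  unfolding counit_def by (rule transpose[OF G.F0_in[OF assms] assms L.id1_arr[OF G.F0_in[OF assms]]])+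

lemma cmp_transpose:
  assumes "b \<in> C0 L" "arr1 K f (Fo b) a" "arr1 K h a a'"
  shows "cmp1 L (F1 G (cmp1 K h f)) (\<eta> b) = cmp1 L (F1 G h) (cmp1 L (F1 G f) (\<eta> b))"
  using G.F1_cmp1[OF assms(2,3)] L.cmp1_assoc[OF \<eta>_arr[OF assms(1)] G.F1_arr[OF assms(2)] G.F1_arr[OF assms(3)]]
  by simp

lemma act1_cmp:
  assumes f: "arr1 L f b c" and g: "arr1 L g c d"
  shows "act1 (cmp1 L g f) = cmp1 K (act1 g) (act1 f)"
proof (rule eq1)
  note ob = L.arr1_ob[OF f] L.arr1_ob[OF g]
  note \<eta> = \<eta>_arr[OF ob(1)] \<eta>_arr[OF ob(2)] \<eta>_arr[OF ob(4)]
  show "b \<in> C0 L" by fact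
  show "arr1 K (act1 (cmp1 L g f)) (Fo b) (Fo d)" by (rule act1(1)[OF L.cmp1_arr[OF f g]])
  show "arr1 K (cmp1 K (act1 g) (act1 f)) (Fo b) (Fo d)" by (rule K.cmp1_arr[OF act1(1)[OF f] act1(1)[OF g]])
  show "cmp1 L (F1 G (act1 (cmp1 L g f))) (\<eta> b) = cmp1 L (F1 G (cmp1 K (act1 g) (act1 f))) (\<eta> b)"
    unfolding act1(2)[OF L.cmp1_arr[OF f g]] cmp_transpose[OF ob(1) act1(1)[OF f] act1(1)[OF g]]
      act1(2)[OF f] L.cmp1_assoc[OF f g \<eta>(3), symmetric] act1(2)[OF g, symmetric]
    by (rule L.cmp1_assoc[OF f \<eta>(2) G.F1_arr[OF act1(1)[OF g]]])
qed

lemma act1_id: assumes "b \<in> C0 L" shows "act1 (id1 L b) = id1 K (Fo b)"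
proof (rule eq1[OF assms])
  show "arr1 K (act1 (id1 L b)) (Fo b) (Fo b)" by (rule act1(1)[OF L.id1_arr[OF assms]])
  show "arr1 K (id1 K (Fo b)) (Fo b) (Fo b)" by (rule K.id1_arr[OF Fo_in[OF assms]])
  show "cmp1 L (F1 G (act1 (id1 L b))) (\<eta> b) = cmp1 L (F1 G (id1 K (Fo b))) (\<eta> b)"
    using act1(2)[OF L.id1_arr[OF assms]] \<eta>_arr[OF assms]
    by (simp add: L.cmp1_id_right L.cmp1_id_left G.F1_id1[OF Fo_in[OF assms]])
qed

lemma act2_id: assumes "g \<in> C1 L" shows "act2 (id2 L g) = id2 K (act1 g)"
proof -
  note g = L.arr1_self[OF assms] note ob = L.arr1_ob[OF g] note m = act1(1)[OF g]
  have mc: "act1 g \<in> C1 K" using m by (simp add: arr1_def)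
  note i = act2[OF L.id2_arr[OF assms] g]
  show ?thesis
  proof (rule eq2[OF ob(1) m i(1) K.id2_arr[OF mc]])
    show "whisk_right L (F2 G (act2 (id2 L g))) (\<eta> (src1 L g)) = whisk_right L (F2 G (id2 K (act1 g))) (\<eta> (src1 L g))"
      unfolding i(2) G.F2_id2[OF mc]
      by (simp add: L.whisk_left_id2[OF g \<eta>_arr[OF ob(2)]]
          L.whisk_right_id2[OF \<eta>_arr[OF ob(1)] G.F1_arr[OF m]] act1(2)[OF g])
  qed
qed

lemma act2_vcmp:
  assumes \<alpha>: "arr2 L \<alpha> f g" and \<beta>: "arr2 L \<beta> g h"
  shows "act2 (vcmp L \<beta> \<alpha>) = vcmp K (act2 \<beta>) (act2 \<alpha>)"
proof -
  note f = L.arr2_arr1(1)[OF \<alpha>] note g = L.arr2_arr1(2)[OF \<alpha>]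
  note ob = L.arr1_ob[OF f]
  note i = act2[OF L.vcmp_arr[OF \<alpha> \<beta>] f] and ia = act2[OF \<alpha> f] and ib = act2[OF \<beta> g]
  show ?thesis
  proof (rule eq2[OF ob(1) act1(1)[OF f] i(1) K.vcmp_arr[OF ia(1) ib(1)]])
    show "whisk_right L (F2 G (act2 (vcmp L \<beta> \<alpha>))) (\<eta> (src1 L f))
        = whisk_right L (F2 G (vcmp K (act2 \<beta>) (act2 \<alpha>))) (\<eta> (src1 L f))"
      by (simp add: i(2) G.F2_vcmp[OF ia(1) ib(1)] ia(2) ib(2) L.whisk_left_vcmp[OF \<alpha> \<beta> f \<eta>_arr[OF ob(2)]]
          L.whisk_right_vcmp[OF G.F2_arr[OF ia(1)] G.F2_arr[OF ib(1)] G.F1_arr[OF act1(1)[OF f]] \<eta>_arr[OF ob(1)]])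
  qed
qed

lemma act2_hcmp:
  assumes \<alpha>: "arr2 L \<alpha> f f'" and \<beta>: "arr2 L \<beta> g g'" and t: "trg1 L f = src1 L g"
  shows "act2 (hcmp L \<beta> \<alpha>) = hcmp K (act2 \<beta>) (act2 \<alpha>)"
proof -
  note f = L.arr2_arr1[OF \<alpha>] note g = L.arr2_arr1[OF \<beta>, folded t]
  note ob = L.arr1_ob[OF f(1)] L.arr1_ob[OF g(1)]
  note fg = L.cmp1_arr[OF f(1) g(1)] and fg' = L.cmp1_arr[OF f(2) g(2)]
  note i = act2[OF L.hcmp_arr[OF \<alpha> \<beta> t] fg] and ia = act2[OF \<alpha> f(1)] and ib = act2[OF \<beta> g(1)]
  have mt: "trg1 K (act1 f) = src1 K (act1 g)" using act1(1)[OF f(1)] act1(1)[OF g(1)] by (simp add: arr1_def)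
  note ic = K.hcmp_arr[OF ia(1) ib(1) mt, folded act1_cmp[OF f(1) g(1)] act1_cmp[OF f(2) g(2)]]
  note Ga = G.F2_arr[OF ia(1)] and Gb = G.F2_arr[OF ib(1)]
  show ?thesis
  proof (rule eq2[OF ob(1) act1(1)[OF fg] i(1) ic])
    let ?s = "src1 L f" and ?m = "trg1 L f" and ?t = "trg1 L g"
    have "whisk_right L (F2 G (hcmp K (act2 \<beta>) (act2 \<alpha>))) (\<eta> ?s)
        = whisk_right L (hcmp L (F2 G (act2 \<beta>)) (F2 G (act2 \<alpha>))) (\<eta> ?s)"
      by (simp only: G.F2_hcmp[OF ia(1) ib(1) mt])
    also have "\<dots> = hcmp L (F2 G (act2 \<beta>)) (whisk_right L (F2 G (act2 \<alpha>)) (\<eta> ?s))"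
      by (rule L.whisk_right_hcmp[OF Ga Gb])
        (use G.F1_arr[OF act1(1)[OF f(1)]] G.F1_arr[OF act1(1)[OF g(1)]] \<eta>_arr[OF ob(1)] in \<open>auto simp: arr1_def\<close>)
    also have "\<dots> = hcmp L (whisk_right L (F2 G (act2 \<beta>)) (\<eta> ?m)) \<alpha>"
      unfolding ia(2) by (rule L.hcmp_whisk[OF \<alpha> Gb, symmetric])
        (use G.F1_arr[OF act1(1)[OF g(1)]] \<eta>_arr[OF ob(2)] in \<open>auto simp: arr1_def\<close>)
    also have "\<dots> = whisk_left L (\<eta> ?t) (hcmp L \<beta> \<alpha>)"
      unfolding ib(2) by (rule L.whisk_left_hcmp[OF \<alpha> \<beta> t, symmetric, OF \<eta>_arr[OF ob(4)]])
    finally show "whisk_right L (F2 G (act2 (hcmp L \<beta> \<alpha>))) (\<eta> ?s)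
        = whisk_right L (F2 G (hcmp K (act2 \<beta>) (act2 \<alpha>))) (\<eta> ?s)" by (simp only: i(2))
  qed
qed

lemma counit_natural1:
  assumes f: "arr1 K f a b"
  shows "cmp1 K (counit b) (act1 (F1 G f)) = cmp1 K f (counit a)"
proof -
  note ob = K.arr1_ob[OF f] note Gf = G.F1_arr[OF f]
  note Gob = G.F0_in[OF ob(1)] G.F0_in[OF ob(2)]
  note ca = counit[OF ob(1)] and cb = counit[OF ob(2)]
  show ?thesis
  proof (rule eq1[OF Gob(1)])
    show "arr1 K (cmp1 K (counit b) (act1 (F1 G f))) (Fo (F0 G a)) b"
      by (rule K.cmp1_arr[OF act1(1)[OF Gf] cb(1)])
    show "arr1 K (cmp1 K f (counit a)) (Fo (F0 G a)) b" by (rule K.cmp1_arr[OF ca(1) f])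
    show "cmp1 L (F1 G (cmp1 K (counit b) (act1 (F1 G f)))) (\<eta> (F0 G a))
        = cmp1 L (F1 G (cmp1 K f (counit a))) (\<eta> (F0 G a))"
      by (simp add: cmp_transpose[OF Gob(1) act1(1)[OF Gf] cb(1)] cmp_transpose[OF Gob(1) ca(1) f]
          ca(2) act1(2)[OF Gf] L.cmp1_id_right[OF Gf] L.cmp1_id_left[OF Gf] cb(2)
          L.cmp1_assoc[OF Gf \<eta>_arr[OF Gob(2)] G.F1_arr[OF cb(1)], symmetric])
  qed
qed

lemma counit_natural2:
  assumes \<alpha>: "arr2 K \<alpha> f g" and f: "arr1 K f a b"
  shows "whisk_left K (counit b) (act2 (F2 G \<alpha>)) = whisk_right K \<alpha> (counit a)"
proof -
  note ob = K.arr1_ob[OF f] note Gf = G.F1_arr[OF f] note g = K.arr2_arr1'[OF \<alpha> f] note Gg = G.F1_arr[OF g]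
  note Gob = G.F0_in[OF ob(1)] G.F0_in[OF ob(2)]
  note ca = counit[OF ob(1)] and cb = counit[OF ob(2)] and Ga = G.F2_arr[OF \<alpha>]
  note m = act2[OF Ga Gf]
  have w1: "arr2 K (whisk_left K (counit b) (act2 (F2 G \<alpha>))) (cmp1 K f (counit a)) (cmp1 K g (counit a))"
    unfolding counit_natural1[OF f, symmetric] counit_natural1[OF g, symmetric]
    by (rule K.whisk_left_arr[OF m(1) act1(1)[OF Gf] cb(1)])
  have w2: "arr2 K (whisk_right K \<alpha> (counit a)) (cmp1 K f (counit a)) (cmp1 K g (counit a))"
    by (rule K.whisk_right_arr[OF \<alpha> ca(1) f])
  have idb: "arr2 K (id2 K (counit b)) (counit b) (counit b)" and ida: "arr2 K (id2 K (counit a)) (counit a) (counit a)"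
    using K.id2_arr cb(1) ca(1) by (auto simp: arr1_def)
  have Gidb: "F2 G (id2 K (counit b)) = id2 L (F1 G (counit b))" and Gida: "F2 G (id2 K (counit a)) = id2 L (F1 G (counit a))"
    using G.F2_id2 cb(1) ca(1) by (auto simp: arr1_def)
  note Lidb = L.id2_arr[of "F1 G (counit b)"] and Lida = L.id2_arr[of "F1 G (counit a)"]
  note Gcb = G.F1_arr[OF cb(1)] and Gca = G.F1_arr[OF ca(1)]
  show ?thesis
  proof (rule eq2[OF Gob(1) K.cmp1_arr[OF ca(1) f] w1 w2])
    have "whisk_right L (F2 G (whisk_left K (counit b) (act2 (F2 G \<alpha>)))) (\<eta> (F0 G a))
       = whisk_right L (hcmp L (id2 L (F1 G (counit b))) (F2 G (act2 (F2 G \<alpha>)))) (\<eta> (F0 G a))"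
      unfolding whisk_left_def
      by (subst G.F2_hcmp[OF m(1) idb]) (use act1(1)[OF Gf] cb(1) Gidb in \<open>auto simp: arr1_def\<close>)
    also have "\<dots> = hcmp L (id2 L (F1 G (counit b))) (whisk_right L (F2 G (act2 (F2 G \<alpha>))) (\<eta> (F0 G a)))"
      by (rule L.whisk_right_hcmp[OF G.F2_arr[OF m(1)] Lidb])
        (use Gcb G.F1_arr[OF act1(1)[OF Gf]] \<eta>_arr[OF Gob(1)] in \<open>auto simp: arr1_def\<close>)
    also have "\<dots> = hcmp L (whisk_right L (id2 L (F1 G (counit b))) (\<eta> (F0 G b))) (F2 G \<alpha>)"
      unfolding m(2) by (rule L.hcmp_whisk[OF Ga Lidb, symmetric])
        (use Gcb Gf \<eta>_arr[OF Gob(2)] in \<open>auto simp: arr1_def\<close>)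
    also have "\<dots> = F2 G \<alpha>"
      by (simp add: L.whisk_right_id2[OF \<eta>_arr[OF Gob(2)] Gcb] cb(2))
        (rule L.hcmp_id_left[OF Ga], use Gf in \<open>simp add: arr1_def\<close>)
    also have "\<dots> = hcmp L (F2 G \<alpha>) (whisk_right L (id2 L (F1 G (counit a))) (\<eta> (F0 G a)))"
      by (simp add: L.whisk_right_id2[OF \<eta>_arr[OF Gob(1)] Gca] ca(2))
        (rule L.hcmp_id_right[OF Ga, symmetric], use Gf in \<open>simp add: arr1_def\<close>)
    also have "\<dots> = whisk_right L (hcmp L (F2 G \<alpha>) (id2 L (F1 G (counit a)))) (\<eta> (F0 G a))"
      by (rule L.whisk_right_hcmp[OF Lida Ga, symmetric])
        (use Gca Gf \<eta>_arr[OF Gob(1)] in \<open>auto simp: arr1_def\<close>)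
    also have "\<dots> = whisk_right L (F2 G (whisk_right K \<alpha> (counit a))) (\<eta> (F0 G a))"
      unfolding whisk_right_def[of K]
      by (subst G.F2_hcmp[OF ida \<alpha>]) (use f ca(1) Gida in \<open>auto simp: arr1_def\<close>)
    finally show "whisk_right L (F2 G (whisk_left K (counit b) (act2 (F2 G \<alpha>)))) (\<eta> (F0 G a))
      = whisk_right L (F2 G (whisk_right K \<alpha> (counit a))) (\<eta> (F0 G a))" .
  qed
qed

theorem has_left_two_adjoint: "has_left_two_adjoint K L G"
proof -
  let ?F = "\<lparr>F0 = Fo, F1 = act1, F2 = act2\<rparr>"
  interpret F: two_functor L K ?F
  proof (unfold_locales, goal_cases)
    case (3 \<alpha> f g) then show ?case using act2(1)[OF 3 L.arr2_arr1(1)[OF 3]] by simp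
  qed (simp_all add: Fo_in act1 act1_id act1_cmp act2_id act2_vcmp act2_hcmp)
  have "two_adjunction K L ?F G \<eta> counit"
  proof (unfold_locales, goal_cases)
    case (3 \<alpha> f g a b) then show ?case using act2(2)[OF 3] by (simp add: id_two_fun_def comp_two_fun_def)
  next
    case (6 \<alpha> f g a b) then show ?case by (simp add: id_two_fun_def comp_two_fun_def counit_natural2)
  next
    case (7 b)
    note ob = Fo_in[OF 7] note \<eta> = \<eta>_arr[OF 7] note c = counit[OF ob] note m = act1[OF \<eta>]
    have "cmp1 K (counit (Fo b)) (act1 (\<eta> b)) = id1 K (Fo b)"
    proof (rule eq1[OF 7])
      show "arr1 K (cmp1 K (counit (Fo b)) (act1 (\<eta> b))) (Fo b) (Fo b)" by (rule K.cmp1_arr[OF m(1) c(1)])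
      show "arr1 K (id1 K (Fo b)) (Fo b) (Fo b)" by (rule K.id1_arr[OF ob])
      show "cmp1 L (F1 G (cmp1 K (counit (Fo b)) (act1 (\<eta> b)))) (\<eta> b) = cmp1 L (F1 G (id1 K (Fo b))) (\<eta> b)"
        by (simp add: cmp_transpose[OF 7 m(1) c(1)] m(2) c(2) L.cmp1_id_left[OF \<eta>] G.F1_id1[OF ob]
            L.cmp1_assoc[OF \<eta> \<eta>_arr[OF G.F0_in[OF ob]] G.F1_arr[OF c(1)], symmetric])
    qed
    then show ?case by simp
  next
    case (8 a) then show ?case using counit(2) by simp
  qed (auto simp: id_two_fun_def comp_two_fun_def \<eta>_arr act1 counit counit_natural1)
  then show ?thesis unfolding has_left_two_adjoint_def by blast
qed

end

section \<open>A criterion for familiality\<close>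

lemma to_terminal:
  assumes "terminal K t" "a \<in> C0 K" shows "arr1 K (to_terminal K t a) a t"
  using assms theI' unfolding terminal_def to_terminal_def by (metis (no_types, lifting))

lemma to_terminal_eq:
  assumes "terminal K t" "a \<in> C0 K" "arr1 K f a t" shows "to_terminal K t a = f"
  using assms to_terminal unfolding terminal_def by metis

locale functor_with_terminal = K: two_category K + L: two_category L + R: two_functor K L R
  for K :: "('o, 'm, 'c) two_cat" and L :: "('p, 'n, 'd) two_cat" and R +
  fixes t :: 'o
  assumes t: "terminal K t"
begin

abbreviation proj :: "'o \<Rightarrow> 'n" where "proj a \<equiv> F1 R (to_terminal K t a)"

lemma proj_arr: "a \<in> C0 K \<Longrightarrow> arr1 L (proj a) (F0 R a) (F0 R t)"
  by (rule R.F1_arr[OF to_terminal[OF t]])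

lemma proj_C1: "a \<in> C0 K \<Longrightarrow> proj a \<in> C1 L \<and> src1 L (proj a) = F0 R a \<and> trg1 L (proj a) = F0 R t"
  using proj_arr by (simp add: arr1_def)

lemma cmp_proj: assumes "arr1 K f a b" shows "cmp1 L (proj b) (F1 R f) = proj a"
proof -
  note ob = K.arr1_ob[OF assms] note tb = to_terminal[OF t ob(2)]
  have "cmp1 K (to_terminal K t b) f = to_terminal K t a"
    by (rule to_terminal_eq[OF t ob(1) K.cmp1_arr[OF assms tb], symmetric])
  then show ?thesis using R.F1_cmp1[OF assms tb] by simp
qed

lemma whisk_proj:
  assumes "arr2 K \<alpha> f g" "arr1 K f a b" shows "whisk_left L (proj b) (F2 R \<alpha>) = id2 L (proj a)"
proof -
  note ob = K.arr1_ob[OF assms(2)] note tb = to_terminal[OF t ob(2)] and ta = to_terminal[OF t ob(1)]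
  note g = K.arr2_arr1'[OF assms]
  have e: "cmp1 K (to_terminal K t b) h = to_terminal K t a" if "arr1 K h a b" for h
    by (rule to_terminal_eq[OF t ob(1) K.cmp1_arr[OF that tb], symmetric])
  have "arr2 K (whisk_left K (to_terminal K t b) \<alpha>) (to_terminal K t a) (to_terminal K t a)"
    using K.whisk_left_arr[OF assms tb] by (simp only: e[OF assms(2)] e[OF g])
  moreover have "arr2 K (id2 K (to_terminal K t a)) (to_terminal K t a) (to_terminal K t a)"
    using K.id2_arr ta by (simp add: arr1_def)
  ultimately have "whisk_left K (to_terminal K t b) \<alpha> = id2 K (to_terminal K t a)"
    using t ta ob(1) unfolding terminal_def by metis
  then have "F2 R (whisk_left K (to_terminal K t b) \<alpha>) = id2 L (proj a)"
    using R.F2_id2 ta by (simp add: arr1_def)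
  moreover have "F2 R (whisk_left K (to_terminal K t b) \<alpha>) = whisk_left L (proj b) (F2 R \<alpha>)"
    unfolding whisk_left_def
    by (subst R.F2_hcmp[OF assms(1) K.id2_arr]) (use tb assms(2) R.F2_id2 in \<open>auto simp: arr1_def\<close>)
  ultimately show ?thesis by simp
qed

lemma slice_fun_sel:
  "F0 (slice_fun K R t) a = proj a"
  "arr1 K f a b \<Longrightarrow> F1 (slice_fun K R t) f = (proj a, F1 R f, proj b)"
  "\<lbrakk>arr2 K \<alpha> f g; arr1 K f a b\<rbrakk> \<Longrightarrow> F2 (slice_fun K R t) \<alpha> = (proj a, F2 R \<alpha>, proj b)"
  by (auto simp: slice_fun_def Let_def arr1_def arr2_def)

lemma two_functor_slice_fun: "two_functor K (slice L (F0 R t)) (slice_fun K R t)"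
proof (unfold_locales, goal_cases)
  case (1 a) then show ?case using proj_C1 by (simp add: slice_fun_sel)
next
  case (2 f a b) then show ?case
    using proj_C1 K.arr1_ob[OF 2] R.F1_arr[OF 2] cmp_proj[OF 2] by (simp add: slice_fun_sel slice_arr1)
next
  case (3 \<alpha> f g)
  note f = K.arr2_arr1[OF 3] note ob = K.arr1_ob[OF f(1)]
  show ?case
    using proj_C1[OF ob(1)] proj_C1[OF ob(2)] R.F1_arr[OF f(1)] R.F2_arr[OF 3] whisk_proj[OF 3 f(1)]
    by (auto simp: slice_fun_sel(2)[OF f(1)] slice_fun_sel(2)[OF f(2)] slice_fun_sel(3)[OF 3 f(1)] slice_arr2)
next
  case (4 a) then show ?case
    using proj_C1[OF 4] R.F1_id1 by (simp add: slice_fun_sel(1) slice_fun_sel(2)[OF K.id1_arr])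
next
  case (5 f a b g c) then show ?case
    using R.F1_cmp1[OF 5] by (simp add: slice_fun_sel(2)[OF 5(1)] slice_fun_sel(2)[OF 5(2)] slice_fun_sel(2)[OF K.cmp1_arr[OF 5]])
next
  case (6 f)
  note f = K.arr1_self[OF 6]
  show ?case using R.F2_id2[OF 6] by (simp add: slice_fun_sel(2)[OF f] slice_fun_sel(3)[OF K.id2_arr[OF 6] f])
next
  case (7 \<alpha> f g \<beta> h)
  note f = K.arr2_arr1[OF 7(1)]
  show ?case using R.F2_vcmp[OF 7]
    by (simp add: slice_fun_sel(3)[OF 7(1) f(1)] slice_fun_sel(3)[OF 7(2) f(2)] slice_fun_sel(3)[OF K.vcmp_arr[OF 7] f(1)])
next
  case (8 \<alpha> f f' \<beta> g g')
  note f = K.arr2_arr1[OF 8(1)] and g = K.arr2_arr1[OF 8(2)]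
  note g' = g(1)[folded 8(3)]
  show ?case using R.F2_hcmp[OF 8]
    by (simp add: slice_fun_sel(3)[OF 8(1) f(1)] slice_fun_sel(3)[OF 8(2) g'] slice_fun_sel(3)[OF K.hcmp_arr[OF 8] K.cmp1_arr[OF f(1) g']])
qed

text \<open>
  Both halves of familiality unfolded in terms of \<open>K\<close> and \<open>L\<close> only, with the slices gone. A 1-cell of the
  slice into \<open>proj a\<close> is a 1-cell \<open>g\<close> of \<open>L\<close> with \<open>proj a g = p\<close>, and a 2-cell is one that \<open>proj a\<close> sends
  to an identity; this gives the side conditions of \<open>univ1\<close> and \<open>univ2\<close>. As 1-cells and 2-cells of
  \<open>Spl\<close> carry no structure besides that of the slice, a lift of the 2-functor to \<open>Spl\<close> is a choice of
  splittings that the images of 1-cells preserve.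
\<close>

lemma familial_atI:
  assumes Fo: "\<And>p. \<lbrakk>p \<in> C1 L; trg1 L p = F0 R t\<rbrakk> \<Longrightarrow> Fo p \<in> C0 K"
    and \<eta>: "\<And>p. \<lbrakk>p \<in> C1 L; trg1 L p = F0 R t\<rbrakk>
      \<Longrightarrow> arr1 L (\<eta> p) (src1 L p) (F0 R (Fo p)) \<and> cmp1 L (proj (Fo p)) (\<eta> p) = p"
    and univ1: "\<And>p a g. \<lbrakk>p \<in> C1 L; trg1 L p = F0 R t; a \<in> C0 K;
        arr1 L g (src1 L p) (F0 R a); cmp1 L (proj a) g = p\<rbrakk>
      \<Longrightarrow> \<exists>!f. arr1 K f (Fo p) a \<and> cmp1 L (F1 R f) (\<eta> p) = g"
    and univ2: "\<And>p a f f' \<gamma>. \<lbrakk>p \<in> C1 L; trg1 L p = F0 R t; arr1 K f (Fo p) a; arr1 K f' (Fo p) a;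
        arr2 L \<gamma> (cmp1 L (F1 R f) (\<eta> p)) (cmp1 L (F1 R f') (\<eta> p)); whisk_left L (proj a) \<gamma> = id2 L p\<rbrakk>
      \<Longrightarrow> \<exists>!\<alpha>. arr2 K \<alpha> f f' \<and> whisk_right L (F2 R \<alpha>) (\<eta> p) = \<gamma>"
    and split: "\<And>a. a \<in> C0 K \<Longrightarrow> split_fibration L (proj a) (c a)"
    and split_mor: "\<And>f a b e \<beta>. \<lbrakk>arr1 K f a b; liftable L (proj a) e \<beta>\<rbrakk>
      \<Longrightarrow> whisk_left L (F1 R f) (c a e \<beta>) = c b (cmp1 L (F1 R f) e) \<beta>"
  shows "familial_at K L R t"
proof -
  let ?S = "slice L (F0 R t)" and ?G = "slice_fun K R t" and ?e = "\<lambda>p. (p, \<eta> p, proj (Fo p))"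
  interpret S: two_category ?S by (rule two_category_slice[OF L.two_category_axioms])
  interpret G: two_functor K ?S ?G by (rule two_functor_slice_fun)
  have e: "arr1 ?S (?e p) p (F0 ?G (Fo p))" if "p \<in> C0 ?S" for p
    using that \<eta>[of p] proj_C1[OF Fo] by (auto simp: slice_arr1 slice_fun_sel)
  have cmp_e: "cmp1 ?S (F1 ?G f) (?e p) = (p, cmp1 L (F1 R f) (\<eta> p), proj a)" if "arr1 K f (Fo p) a" for p f a
    by (simp add: slice_fun_sel(2)[OF that])
  have wh_e: "whisk_right ?S (F2 ?G \<alpha>) (?e p) = (p, whisk_right L (F2 R \<alpha>) (\<eta> p), proj a)"
    if "arr2 K \<alpha> f f'" "arr1 K f (Fo p) a" for p f f' a \<alpha>
    by (simp add: whisk_right_def slice_fun_sel(3)[OF that])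
  interpret U: universal_arrows K ?S ?G Fo ?e
  proof (unfold_locales, goal_cases)
    case (1 b) then show ?case using Fo by simp
  next
    case (2 b) then show ?case by (rule e)
  next
    case (3 p a g)
    then obtain g0 where g: "g = (p, g0, proj a)" "arr1 L g0 (src1 L p) (F0 R a)" "cmp1 L (proj a) g0 = p"
      using proj_C1[of a] by (auto simp: slice_arr1 slice_fun_sel)
    have "\<exists>!f. arr1 K f (Fo p) a \<and> cmp1 L (F1 R f) (\<eta> p) = g0"
      by (rule univ1) (use 3 g in auto)
    moreover have "(arr1 K f (Fo p) a \<and> cmp1 ?S (F1 ?G f) (?e p) = g) \<longleftrightarrow>
        (arr1 K f (Fo p) a \<and> cmp1 L (F1 R f) (\<eta> p) = g0)" for f
      using cmp_e g(1) by auto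
    ultimately show ?case by simp
  next
    case (4 p f a f' \<gamma>)
    from 4(4) obtain g0 where g: "\<gamma> = (p, g0, proj a)" "arr2 L g0 (cmp1 L (F1 R f) (\<eta> p)) (cmp1 L (F1 R f') (\<eta> p))"
       "whisk_left L (proj a) g0 = id2 L p"
      unfolding cmp_e[OF 4(2)] cmp_e[OF 4(3)] by (auto simp: slice_arr2)
    have "\<exists>!\<alpha>. arr2 K \<alpha> f f' \<and> whisk_right L (F2 R \<alpha>) (\<eta> p) = g0"
      by (rule univ2[of p f a f']) (use 4 g in auto)
    moreover have "(arr2 K \<alpha> f f' \<and> whisk_right ?S (F2 ?G \<alpha>) (?e p) = \<gamma>) \<longleftrightarrow>
        (arr2 K \<alpha> f f' \<and> whisk_right L (F2 R \<alpha>) (\<eta> p) = g0)" for \<alpha>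
      using wh_e 4(2) g(1) by auto
    ultimately show ?case by simp
  qed
  define P where "P a = (proj a, c a)" for a
  have mor: "Spl_mor L (P a) (F1 R f) (P b)" if "arr1 K f a b" for f a b
    using split_mor[OF that] cmp_proj[OF that] R.F1_arr[OF that] proj_C1[OF K.arr1_ob(1)[OF that]]
      proj_C1[OF K.arr1_ob(2)[OF that]] by (simp add: Spl_mor_def P_def)
  have Pob: "case P a of (p, c) \<Rightarrow> split_fibration L p c \<and> trg1 L p = F0 R t" if "a \<in> C0 K" for a
    using split[OF that] proj_C1[OF that] by (simp add: P_def)
  define S where "S = \<lparr>F0 = P, F1 = (\<lambda>f. (P (src1 K f), F1 R f, P (trg1 K f))),
    F2 = (\<lambda>\<alpha>. (P (src1 K (src2 K \<alpha>)), F2 R \<alpha>, P (trg1 K (src2 K \<alpha>))))\<rparr>"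
  have "two_functor K (Spl L (F0 R t)) S"
  proof (unfold_locales, goal_cases)
    case (1 a) then show ?case using Pob by (simp add: S_def Spl_def)
  next
    case (2 f a b) then show ?case using Pob mor K.arr1_ob[OF 2] by (auto simp: S_def Spl_def arr1_def)
  next
    case (3 \<alpha> f g)
    note f = K.arr2_arr1[OF 3] note ob = K.arr1_ob[OF f(1)]
    show ?case
      using Pob[OF ob(1)] Pob[OF ob(2)] mor[OF f(1)] mor[OF f(2)] R.F2_arr[OF 3] whisk_proj[OF 3 f(1)] 3 f
      by (auto simp: S_def Spl_def arr1_def arr2_def P_def)
  next
    case (4 a) then show ?case
      using proj_C1[OF 4] R.F1_id1 K.id1_arr[OF 4] by (auto simp: S_def Spl_def arr1_def P_def)
  next
    case (5 f a b g c) then show ?case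
      using R.F1_cmp1 K.cmp1_arr[OF 5] by (simp add: S_def Spl_def arr1_def)
  next
    case (6 f)
    then show ?case using R.F2_id2[OF 6] K.id2_arr[OF 6] by (simp add: S_def Spl_def arr2_def)
  next
    case (7 \<alpha> f g \<beta> h)
    then show ?case using R.F2_vcmp[OF 7] K.vcmp_arr[OF 7] K.arr2_arr1[OF 7(1)]
      by (simp add: S_def Spl_def arr2_def arr1_def)
  next
    case (8 \<alpha> f f' \<beta> g g')
    note f = K.arr2_arr1[OF 8(1)] and g = K.arr2_arr1[OF 8(2)]
    show ?case using R.F2_hcmp[OF 8] K.hcmp_arr[OF 8] K.cmp1_arr[OF f(1) g(1)[folded 8(3)]] 8 f g
      by (simp add: S_def Spl_def arr2_def arr1_def)
  qed
  moreover have "two_fun_eq K (comp_two_fun Spl_forget S) (slice_fun K R t)"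
    by (simp add: two_fun_eq_def comp_two_fun_def Spl_forget_def S_def slice_fun_def Let_def P_def)
  ultimately show ?thesis
    unfolding familial_at_def parametric_right_two_adjoint_at_def using U.has_left_two_adjoint by blast
qed

end

section \<open>Virtual double categories\<close>

lemma chain_append:
  "chain S Ar s t a (xs @ ys) c \<longleftrightarrow> (\<exists>b. chain S Ar s t a xs b \<and> chain S Ar s t b ys c)"
proof (induction xs arbitrary: a)
  case Nil
  have "chain S Ar s t a ys c \<Longrightarrow> a \<in> S" by (cases ys) auto
  then show ?case by auto
qed auto

lemma chain_ends: assumes "chain S Ar s t a xs b" shows "a \<in> S" "b \<in> S" "set xs \<subseteq> Ar"
proof -
  have "a \<in> S \<and> b \<in> S \<and> set xs \<subseteq> Ar" using assms by (induction xs arbitrary: a) auto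
  then show "a \<in> S" "b \<in> S" "set xs \<subseteq> Ar" by auto
qed

lemma chain_end: "chain S Ar s t a xs b \<Longrightarrow> b = last (a # map t xs)"
  by (induction xs arbitrary: a) auto

lemma chain_det: "\<lbrakk>chain S Ar s t a xs b; chain S Ar s t a xs b'\<rbrakk> \<Longrightarrow> b = b'"
  by (metis chain_end)

lemma chain_map:
  assumes "chain S Ar s t a xs b"
    and "\<And>a. a \<in> S \<Longrightarrow> f a \<in> S'" "\<And>x. x \<in> Ar \<Longrightarrow> g x \<in> Ar' \<and> s' (g x) = f (s x) \<and> t' (g x) = f (t x)"
  shows "chain S' Ar' s' t' (f a) (map g xs) (f b)"
  using assms(1) by (induction xs arbitrary: a) (auto simp: assms(2,3))

lemma cellD:
  assumes "cell A q Js \<Delta> u u'"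
  shows "q \<in> Cell A" "ctop A q = Js" "cbot A q = \<Delta>" "clft A q = u" "crgt A q = u'"
  using assms by (auto simp: cell_def)

lemma verD: assumes "ver A u a b" shows "u \<in> Ver A" "vdom A u = a" "vcod A u = b"
  using assms by (auto simp: ver_def)

text \<open>
  Composition with a single multicell, the only case needed for cells \<open>(J) \<Rightarrow> J'\<close> such as the
  components of a transformation.
\<close>

definition ucomp :: "('o, 'v, 'h, 'c) vdc \<Rightarrow> 'c \<Rightarrow> 'c \<Rightarrow> 'c" where
  "ucomp A \<kappa> q = ccomp A \<kappa> (clft A q) [q]"

context virtual_double_category
begin

lemma cell_self: "q \<in> Cell A \<Longrightarrow> cell A q (ctop A q) (cbot A q) (clft A q) (crgt A q)"
  by (simp add: cell_def)

lemma ver_self: "u \<in> Ver A \<Longrightarrow> ver A u (vdom A u) (vcod A u)"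
  by (simp add: ver_def)

lemma ver_ob: assumes "ver A u a b" shows "a \<in> Ob A" "b \<in> Ob A"
  using assms vdom_in vcod_in by (auto simp: ver_def)

lemma cell_ver:
  assumes "cell A q Js \<Delta> u u'" shows "u \<in> Ver A" "u' \<in> Ver A" "\<Delta> \<in> Hor A"
    "hsrc A \<Delta> = vcod A u" "htrg A \<Delta> = vcod A u'" "hpath A (vdom A u) Js (vdom A u')"
  using clft_in crgt_in cbot_in cbot_src cbot_trg ctop_path assms by (auto simp: cell_def)

lemma ctop_in: "q \<in> Cell A \<Longrightarrow> set (ctop A q) \<subseteq> Hor A"
  using ctop_path chain_ends(3) by (fastforce simp: hpath_def)

lemma cell_unary:
  assumes "cell A q [J] \<Delta> u u'" shows "J \<in> Hor A" "hsrc A J = vdom A u" "htrg A J = vdom A u'"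
  using cell_ver(6)[OF assms] by (auto simp: hpath_def)

lemma composable_unary:
  assumes "cell A \<kappa> [\<Delta>] \<Lambda> v v'" "cell A q Js \<Delta> u u'"
  shows "composable A \<kappa> u [q] u'"
  using assms cell_ver[OF assms(1)] cell_ver[OF assms(2)]
  by (auto simp: composable_def cpath_def cell_def hpath_def)

lemma ucomp_cell:
  assumes "cell A \<kappa> [\<Delta>] \<Lambda> v v'" "cell A q Js \<Delta> u u'"
  shows "cell A (ucomp A \<kappa> q) Js \<Lambda> (vcomp A v u) (vcomp A v' u')"
  using ccomp_cell[OF composable_unary[OF assms]] assms by (simp add: ucomp_def cell_def)

lemma ccomp_ucomp:
  assumes "cell A \<kappa> [\<Delta>] \<Lambda> v v'" "cell A q Js \<Delta> u u'" "composable A q w \<xi>s w'"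
  shows "ccomp A (ucomp A \<kappa> q) w \<xi>s = ucomp A \<kappa> (ccomp A q w \<xi>s)"
proof -
  have w: "w \<in> Ver A" "vcod A w = vdom A u"
    using assms(2,3) chain_ends(1) by (fastforce simp: composable_def cpath_def cell_def)+
  have "clft A (ccomp A q w \<xi>s) = vcomp A u w"
    using cellD(4)[OF ccomp_cell[OF assms(3)]] cellD[OF assms(2)] by simp
  then show ?thesis
    using ccomp_assoc[OF composable_unary[OF assms(1,2)], of "[\<xi>s]" "[w, w']"] assms w
    by (simp add: ucomp_def cell_def)
qed

lemma ucomp_assoc:
  assumes "cell A \<kappa> [\<Delta>] \<Lambda> v v'" "cell A q [J] \<Delta> u u'" "cell A \<xi> Js J w w'"
  shows "ucomp A (ucomp A \<kappa> q) \<xi> = ucomp A \<kappa> (ucomp A q \<xi>)"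
  using ccomp_ucomp[OF assms(1,2) composable_unary[OF assms(2,3)]] cellD[OF assms(3)]
  by (simp add: ucomp_def)

lemma ucomp_id_left: "cell A q Js \<Delta> u u' \<Longrightarrow> ucomp A (cid A \<Delta>) q = q"
  using ccomp_id_left by (auto simp: ucomp_def cell_def)

lemma ucomp_id_right:
  assumes "cell A q [J] \<Delta> u u'" shows "ucomp A q (cid A J) = q"
  using ccomp_id_right[OF cellD(1)[OF assms]] cellD[OF assms] cell_unary[OF assms] cellD(4)[OF cid_cell]
  by (simp add: ucomp_def)

text \<open>
  The instance of associativity in which every multicell in the middle row has a unary top. In
  \<open>vtr_vcomp\<close> it merges the rows of components of two transformations into one.
\<close>

lemma ccomp_unary_family:
  assumes "composable A \<kappa> u qs u'" "composable A (ccomp A \<kappa> u qs) w \<xi>s w'" "length \<xi>s = length qs"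
    and "\<And>i. i < length qs \<Longrightarrow> \<exists>J \<Delta> v v' x x'. cell A (qs ! i) [J] \<Delta> v v'"
  shows "ccomp A (ccomp A \<kappa> u qs) w \<xi>s = ccomp A \<kappa> (vcomp A u w) (map2 (ucomp A) qs \<xi>s)"
proof -
  let ?ws = "w # map (crgt A) \<xi>s"
  have cx: "chain (Ver A) (Cell A) (clft A) (crgt A) w \<xi>s w'"
    and m: "map (cbot A) \<xi>s = ctop A (ccomp A \<kappa> u qs)" and d: "vcod A w = vdom A (clft A (ccomp A \<kappa> u qs))"
    using assms(2) by (auto simp: composable_def cpath_def)
  note cc = ccomp_cell[OF assms(1)]
  have u: "u \<in> Ver A" "vcod A u = vdom A (clft A \<kappa>)" "\<kappa> \<in> Cell A" "chain (Ver A) (Cell A) (clft A) (crgt A) u qs u'"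
    using assms(1) chain_ends(1) by (auto simp: composable_def cpath_def)
  have "ver A (vcomp A (clft A \<kappa>) u) (vdom A u) (vcod A (clft A \<kappa>))"
    using vcomp_ver[OF ver_self[OF u(1)]] u clft_in[OF u(3)] by (simp add: ver_def)
  then have w: "w \<in> Ver A" "vcod A w = vdom A u"
    using chain_ends(1)[OF cx] d cellD(4)[OF cc] by (auto simp: ver_def)
  have top: "concat (map (ctop A) qs) = map (cbot A) \<xi>s" using m cellD(2)[OF cc] by simp
  have "concat (map (ctop A) qs) = map (\<lambda>q. hd (ctop A q)) qs"
  proof -
    have "\<forall>q\<in>set qs. ctop A q = [hd (ctop A q)]" using assms(4) by (metis cellD(2) in_set_conv_nth list.sel(1))
    then show ?thesis by (induction qs) auto
  qed
  then have bt: "cbot A (\<xi>s ! i) = hd (ctop A (qs ! i))" if "i < length qs" for i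
    using top that assms(3) by (metis nth_map)
  have lw: "?ws ! i = clft A (\<xi>s ! i) \<and> \<xi>s ! i \<in> Cell A" if "i < length \<xi>s" for i
    using cx that
  proof (induction \<xi>s arbitrary: w i)
    case (Cons \<xi> \<xi>s) then show ?case by (cases i) auto
  qed simp
  have "composable A (qs ! i) (?ws ! i) [\<xi>s ! i] (?ws ! Suc i)" if i: "i < length qs" for i
  proof -
    obtain J \<Delta> v v' where c: "cell A (qs ! i) [J] \<Delta> v v'" using assms(4)[OF i] by blast
    then have "cbot A (\<xi>s ! i) = J" using bt[OF i] by (simp add: cell_def)
    then have "cell A (\<xi>s ! i) (ctop A (\<xi>s ! i)) J (?ws ! i) (crgt A (\<xi>s ! i))"
      using lw[of i] i assms(3) by (simp add: cell_def)
    from composable_unary[OF c this] show ?thesis using i assms(3) by simp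
  qed
  then have "ccomp A (ccomp A \<kappa> u qs) (?ws ! 0) (concat (map (\<lambda>\<xi>. [\<xi>]) \<xi>s)) =
      ccomp A \<kappa> (vcomp A u (?ws ! 0)) (map (\<lambda>i. ccomp A (qs ! i) (?ws ! i) (map (\<lambda>\<xi>. [\<xi>]) \<xi>s ! i)) [0..<length qs])"
    by (intro ccomp_assoc[OF assms(1)]) (use w assms(3) in auto)
  moreover have "map (\<lambda>i. ccomp A (qs ! i) (?ws ! i) (map (\<lambda>\<xi>. [\<xi>]) \<xi>s ! i)) [0..<length qs] = map2 (ucomp A) qs \<xi>s"
    using lw assms(3) by (intro nth_equalityI) (auto simp: ucomp_def)
  ultimately show ?thesis by (simp add: concat_map_singleton)
qed

end

lemma vd_map_eqI:
  assumes "virtual_double_functor A B F" "virtual_double_functor A B' F'"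
    and "\<And>a. a \<in> Ob A \<Longrightarrow> fo F a = fo F' a" "\<And>u. u \<in> Ver A \<Longrightarrow> fv F u = fv F' u"
    and "\<And>J. J \<in> Hor A \<Longrightarrow> fh F J = fh F' J" "\<And>q. q \<in> Cell A \<Longrightarrow> fc F q = fc F' q"
  shows "F = F'"
proof -
  interpret F: virtual_double_functor A B F by fact
  interpret F': virtual_double_functor A B' F' by fact
  show ?thesis
    using extensionalityI[OF F.fo_ext F'.fo_ext assms(3)] extensionalityI[OF F.fv_ext F'.fv_ext assms(4)]
      extensionalityI[OF F.fh_ext F'.fh_ext assms(5)] extensionalityI[OF F.fc_ext F'.fc_ext assms(6)]
    by (simp add: vd_map.equality)
qed

lemma vd_trans_eqI:
  fixes \<alpha> \<beta> :: "('o, 'h, 'w, 'd) vd_trans"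
  assumes "tv \<alpha> \<in> extensional (Ob A)" "tc \<alpha> \<in> extensional (Hor A)" "tv \<beta> \<in> extensional (Ob A)" "tc \<beta> \<in> extensional (Hor A)"
    and "\<And>a. a \<in> Ob A \<Longrightarrow> tv \<alpha> a = tv \<beta> a" "\<And>J. J \<in> Hor A \<Longrightarrow> tc \<alpha> J = tc \<beta> J"
  shows "\<alpha> = \<beta>"
  using extensionalityI[OF assms(1,3,5)] extensionalityI[OF assms(2,4,6)] by (cases \<alpha>, cases \<beta>) simp

context virtual_double_functor
begin

lemma fv_Ver: "u \<in> Ver A \<Longrightarrow> fv F u \<in> Ver B \<and> vdom B (fv F u) = fo F (vdom A u) \<and> vcod B (fv F u) = fo F (vcod A u)"
  using fv_ver[of u "vdom A u" "vcod A u"] by (simp add: ver_def)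

lemma fc_Cell: "q \<in> Cell A \<Longrightarrow> fc F q \<in> Cell B \<and> ctop B (fc F q) = map (fh F) (ctop A q)
    \<and> cbot B (fc F q) = fh F (cbot A q) \<and> clft B (fc F q) = fv F (clft A q) \<and> crgt B (fc F q) = fv F (crgt A q)"
  using fc_cell[of q "ctop A q" "cbot A q" "clft A q" "crgt A q"] by (simp add: cell_def)

lemma cpath_map: "cpath A u qs u' \<Longrightarrow> cpath B (fv F u) (map (fc F) qs) (fv F u')"
  unfolding cpath_def by (erule chain_map) (auto simp: fv_Ver fc_Cell)

lemma composable_map:
  assumes "virtual_double_category A" "composable A \<kappa> u qs u'"
  shows "composable B (fc F \<kappa>) (fv F u) (map (fc F) qs) (fv F u')"
proof -
  interpret A: virtual_double_category A by fact
  have c: "\<kappa> \<in> Cell A" "cpath A u qs u'" "map (cbot A) qs = ctop A \<kappa>" "vcod A u = vdom A (clft A \<kappa>)"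
    using assms(2) by (auto simp: composable_def)
  have "u \<in> Ver A" "set qs \<subseteq> Cell A" using chain_ends c(2) unfolding cpath_def by metis+
  then have "map (cbot B) (map (fc F) qs) = map (fh F) (map (cbot A) qs)"
    by (auto simp: fc_Cell subset_iff)
  then show ?thesis
    using c cpath_map[OF c(2)] fc_Cell[OF c(1)] fv_Ver[OF \<open>u \<in> Ver A\<close>] fv_Ver[OF A.clft_in[OF c(1)]]
    by (simp add: composable_def)
qed

lemma fc_ucomp:
  assumes "virtual_double_category A" "cell A \<kappa> [\<Delta>] \<Lambda> v v'" "cell A q Js \<Delta> u u'"
  shows "fc F (ucomp A \<kappa> q) = ucomp B (fc F \<kappa>) (fc F q)"
  using fc_ccomp[OF virtual_double_category.composable_unary[OF assms]] fc_Cell[OF cellD(1)[OF assms(3)]] cellD(4)[OF assms(3)]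
  by (simp add: ucomp_def)

end

lemma (in vertical_transformation) tc_natural_ucomp:
  assumes "q \<in> Cell A" "virtual_double_functor A B F"
  shows "ucomp B (tc \<alpha> (cbot A q)) (fc F q)
      = ccomp B (fc G q) (tv \<alpha> (vdom A (clft A q))) (map (tc \<alpha>) (ctop A q))"
  using tc_natural[OF assms(1)] virtual_double_functor.fc_Cell[OF assms(2,1)] by (simp add: ucomp_def)

lemma (in vertical_transformation) tc_path:
  assumes "virtual_double_category A" "virtual_double_category B" "hpath A a Js b"
  shows "cpath B (tv \<alpha> a) (map (tc \<alpha>) Js) (tv \<alpha> b)"
proof -
  have "tc \<alpha> J \<in> Cell B \<and> clft B (tc \<alpha> J) = tv \<alpha> (hsrc A J) \<and> crgt B (tc \<alpha> J) = tv \<alpha> (htrg A J)"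
    if "J \<in> Hor A" for J using tc_cell[OF that] by (simp add: cell_def)
  then show ?thesis using assms(3) tv_ver unfolding hpath_def cpath_def
    by (elim chain_map) (auto simp: ver_def)
qed

lemma (in vertical_transformation) tc_composable:
  assumes "virtual_double_category A" "virtual_double_category B" "virtual_double_functor A B G" "q \<in> Cell A"
  shows "composable B (fc G q) (tv \<alpha> (vdom A (clft A q))) (map (tc \<alpha>) (ctop A q)) (tv \<alpha> (vdom A (crgt A q)))"
proof -
  interpret A: virtual_double_category A by fact
  interpret G: virtual_double_functor A B G by fact
  have "map (cbot B) (map (tc \<alpha>) (ctop A q)) = map (fh G) (ctop A q)"
    using A.ctop_in[OF assms(4)] tc_cell by (auto simp: cell_def subset_iff)
  then show ?thesis
    using tc_path[OF assms(1,2) A.ctop_path[OF assms(4)]] G.fc_Cell[OF assms(4)] G.fv_Ver[OF A.clft_in[OF assms(4)]]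
      tv_ver[OF A.vdom_in[OF A.clft_in[OF assms(4)]]] by (auto simp: composable_def ver_def)
qed

section \<open>The 2-category of virtual double categories\<close>

context grothendieck_universes
begin

abbreviation vdc :: "'V VDC \<Rightarrow> bool" where "vdc \<equiv> virtual_double_category"
abbreviation vdf :: "'V VDC \<Rightarrow> 'V VDC \<Rightarrow> 'V VDMap \<Rightarrow> bool" where "vdf \<equiv> virtual_double_functor"
abbreviation vtr :: "'V VDC \<Rightarrow> 'V VDC \<Rightarrow> 'V VDMap \<Rightarrow> 'V VDMap \<Rightarrow> ('V, 'V, 'V, 'V) vd_trans \<Rightarrow> bool"
  where "vtr \<equiv> vertical_transformation"
abbreviation ix :: "'V VDMap \<Rightarrow> 'V \<Rightarrow> 'V set" where "ix p x \<equiv> idx (fo p x)"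

lemma vdf_id: assumes "vdc A" shows "vdf A A (id_map A)"
proof -
  interpret A: virtual_double_category A by fact
  show ?thesis
  proof (unfold_locales, goal_cases)
    case (8 f a b g c) then show ?case using A.vcomp_ver[OF 8] by (auto simp: id_map_def ver_def)
  next
    case (12 q Js \<Delta> u u')
    then have "map (fh (id_map A)) Js = Js"
      using A.ctop_in by (auto simp: cell_def id_map_def subset_iff intro!: map_idI)
    then show ?case using 12 A.cell_ver[OF 12] by (simp add: id_map_def cell_def)
  next
    case (13 J) then show ?case using A.cid_cell[OF 13] by (simp add: id_map_def cell_def)
  next
    case (14 \<kappa> u qs u')
    have "u \<in> Ver A" "set qs \<subseteq> Cell A" using 14 chain_ends unfolding composable_def cpath_def by metis+
    then have "map (fc (id_map A)) qs = qs" by (auto simp: id_map_def subset_iff intro!: map_idI)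
    then show ?case using 14 A.ccomp_cell[OF 14] \<open>u \<in> Ver A\<close> by (simp add: id_map_def cell_def composable_def)
  qed (use A.ver_ob A.vid_ver A.hsrc_in A.htrg_in in \<open>auto simp: id_map_def ver_def\<close>)
qed

lemma vdf_comp: assumes "vdc A" "vdf A B F" "vdf B C G" shows "vdf A C (comp_map A G F)"
proof -
  interpret A: virtual_double_category A by fact
  interpret F: virtual_double_functor A B F by fact
  interpret G: virtual_double_functor B C G by fact
  show ?thesis
  proof (unfold_locales, goal_cases)
    case (6 u a b) then show ?case using A.ver_ob[OF 6] G.fv_ver[OF F.fv_ver[OF 6]] by (simp add: comp_map_def verD(1))
  next
    case (7 a) then show ?case using A.vid_ver[OF 7] by (simp add: comp_map_def verD F.fv_vid G.fv_vid F.fo_in)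
  next
    case (8 f a b g c) then show ?case
      using A.vcomp_ver[OF 8] F.fv_vcomp[OF 8] G.fv_vcomp[OF 8[THEN F.fv_ver]] by (simp add: comp_map_def verD(1))
  next
    case (12 q Js \<Delta> u u')
    have "set Js \<subseteq> Hor A" using A.ctop_in 12 by (auto simp: cell_def)
    then have m: "map (fh (comp_map A G F)) Js = map (fh G) (map (fh F) Js)" by (auto simp: comp_map_def subset_iff)
    show ?case unfolding m using A.cell_ver[OF 12] cellD(1)[OF 12] G.fc_cell[OF F.fc_cell[OF 12]] by (simp add: comp_map_def)
  next
    case (13 J) then show ?case using A.cid_cell[OF 13] by (simp add: comp_map_def cellD F.fc_cid G.fc_cid F.fh_in)
  next
    case (14 \<kappa> u qs u')
    have "u \<in> Ver A" "set qs \<subseteq> Cell A" using 14 chain_ends unfolding composable_def cpath_def by metis+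
    then have m: "map (fc (comp_map A G F)) qs = map (fc G) (map (fc F) qs)" by (auto simp: comp_map_def subset_iff)
    show ?case unfolding m
      using A.ccomp_cell[OF 14] 14 \<open>u \<in> Ver A\<close> F.fc_ccomp[OF 14] G.fc_ccomp[OF F.composable_map[OF A.virtual_double_category_axioms 14]]
      by (simp add: comp_map_def composable_def cell_def)
  qed (auto simp: comp_map_def A.hsrc_in A.htrg_in F.fo_in G.fo_in F.fh_in G.fh_in F.fh_src F.fh_trg G.fh_src G.fh_trg)
qed

definition id_trans :: "'V VDC \<Rightarrow> 'V VDC \<Rightarrow> 'V VDMap \<Rightarrow> ('V, 'V, 'V, 'V) vd_trans" where
  "id_trans A B F = \<lparr>tv = (\<lambda>a\<in>Ob A. vid B (fo F a)), tc = (\<lambda>J\<in>Hor A. cid B (fh F J))\<rparr>"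

definition vcomp_trans :: "'V VDC \<Rightarrow> 'V VDC \<Rightarrow> ('V, 'V, 'V, 'V) vd_trans \<Rightarrow> ('V, 'V, 'V, 'V) vd_trans
    \<Rightarrow> ('V, 'V, 'V, 'V) vd_trans" where
  "vcomp_trans A B \<beta> \<alpha> = \<lparr>tv = (\<lambda>a\<in>Ob A. vcomp B (tv \<beta> a) (tv \<alpha> a)),
     tc = (\<lambda>J\<in>Hor A. ccomp B (tc \<beta> J) (tv \<alpha> (hsrc A J)) [tc \<alpha> J])\<rparr>"

definition hcomp_trans :: "'V VDC \<Rightarrow> 'V VDC \<Rightarrow> 'V VDMap \<Rightarrow> ('V, 'V, 'V, 'V) vd_trans \<Rightarrow> 'V VDMap
    \<Rightarrow> ('V, 'V, 'V, 'V) vd_trans \<Rightarrow> ('V, 'V, 'V, 'V) vd_trans" where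
  "hcomp_trans A C H \<beta> G \<alpha> = \<lparr>tv = (\<lambda>a\<in>Ob A. vcomp C (tv \<beta> (fo G a)) (fv H (tv \<alpha> a))),
     tc = (\<lambda>J\<in>Hor A. ccomp C (tc \<beta> (fh G J)) (fv H (tv \<alpha> (hsrc A J))) [fc H (tc \<alpha> J)])\<rparr>"

definition post_trans :: "'V VDC \<Rightarrow> 'V VDMap \<Rightarrow> ('V, 'V, 'V, 'V) vd_trans \<Rightarrow> ('V, 'V, 'V, 'V) vd_trans" where
  "post_trans A H \<alpha> = \<lparr>tv = (\<lambda>a\<in>Ob A. fv H (tv \<alpha> a)), tc = (\<lambda>J\<in>Hor A. fc H (tc \<alpha> J))\<rparr>"

definition pre_trans :: "'V VDC \<Rightarrow> ('V, 'V, 'V, 'V) vd_trans \<Rightarrow> 'V VDMap \<Rightarrow> ('V, 'V, 'V, 'V) vd_trans" where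
  "pre_trans A \<beta> G = \<lparr>tv = (\<lambda>a\<in>Ob A. tv \<beta> (fo G a)), tc = (\<lambda>J\<in>Hor A. tc \<beta> (fh G J))\<rparr>"

lemmas trans_defs = id_trans_def vcomp_trans_def hcomp_trans_def post_trans_def pre_trans_def

lemma vtr_id: assumes "vdc A" "vdc B" "vdf A B F" shows "vtr A B F F (id_trans A B F)"
proof -
  interpret A: virtual_double_category A by fact
  interpret B: virtual_double_category B by fact
  interpret F: virtual_double_functor A B F by fact
  have cid: "cell B (cid B (fh F J)) [fh F J] (fh F J) (vid B (fo F (hsrc A J))) (vid B (fo F (htrg A J)))"
    if "J \<in> Hor A" for J
    using B.cid_cell[OF F.fh_in[OF that]] F.fh_src[OF that] F.fh_trg[OF that] by simp
  show ?thesis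
  proof (unfold_locales, goal_cases)
    case (4 u a b) then show ?case
      using A.ver_ob[OF 4] B.vcomp_id_left B.vcomp_id_right F.fv_ver[OF 4] by (simp add: id_trans_def)
  next
    case (6 q)
    note c = F.fc_cell[OF A.cell_self[OF 6]]
    have m: "map (tc (id_trans A B F)) (ctop A q) = map (cid B) (ctop B (fc F q))"
      using A.ctop_in[OF 6] F.fc_Cell[OF 6] by (auto simp: id_trans_def subset_iff)
    show ?case
      unfolding m using B.ccomp_id_left[OF cellD(1)[OF c]] B.ccomp_id_right[OF cellD(1)[OF c]]
        F.fc_Cell[OF 6] A.cbot_in[OF 6] A.vdom_in[OF A.clft_in[OF 6]] F.fv_Ver[OF A.clft_in[OF 6]]
      by (simp add: id_trans_def)
  qed (auto simp: id_trans_def B.vid_ver F.fo_in F.fh_in A.hsrc_in A.htrg_in F.fh_src F.fh_trg cid)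
qed

lemma vtr_vcomp:
  assumes "vdc A" "vdc B" "vdf A B F" "vdf A B G" "vdf A B H" "vtr A B F G \<alpha>" "vtr A B G H \<beta>"
  shows "vtr A B F H (vcomp_trans A B \<beta> \<alpha>)"
proof -
  interpret A: virtual_double_category A by fact
  interpret B: virtual_double_category B by fact
  interpret F: virtual_double_functor A B F by fact
  interpret G: virtual_double_functor A B G by fact
  interpret H: virtual_double_functor A B H by fact
  interpret a: vertical_transformation A B F G \<alpha> by fact
  interpret b: vertical_transformation A B G H \<beta> by fact
  have tc: "tc (vcomp_trans A B \<beta> \<alpha>) J = ucomp B (tc \<beta> J) (tc \<alpha> J)" if "J \<in> Hor A" for J
    using that cellD(4)[OF a.tc_cell[OF that]] by (simp add: vcomp_trans_def ucomp_def)
  show ?thesis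
  proof (unfold_locales, goal_cases)
    case (3 x) then show ?case using B.vcomp_ver[OF a.tv_ver b.tv_ver] by (simp add: vcomp_trans_def)
  next
    case (4 u x y)
    note ob = A.ver_ob[OF 4]
    note v = F.fv_ver[OF 4] G.fv_ver[OF 4] H.fv_ver[OF 4] a.tv_ver[OF ob(1)] a.tv_ver[OF ob(2)] b.tv_ver[OF ob(1)] b.tv_ver[OF ob(2)]
    show ?case
      using ob B.vcomp_assoc[OF v(1,5,7)] B.vcomp_assoc[OF v(4,6,3)] B.vcomp_assoc[OF v(4,2,7)] a.tv_natural[OF 4] b.tv_natural[OF 4]
      by (simp add: vcomp_trans_def)
  next
    case (5 J)
    then show ?case unfolding tc[OF 5] using B.ucomp_cell[OF b.tc_cell[OF 5] a.tc_cell[OF 5]] A.hsrc_in A.htrg_in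
      by (simp add: vcomp_trans_def)
  next
    case (6 q)
    let ?\<gamma> = "vcomp_trans A B \<beta> \<alpha>"
    note bot = A.cbot_in[OF 6] and x = A.vdom_in[OF A.clft_in[OF 6]]
    note c = a.tc_cell[OF bot] b.tc_cell[OF bot] F.fc_cell[OF A.cell_self[OF 6]] G.fc_cell[OF A.cell_self[OF 6]]
    have mt: "map2 (ucomp B) (map (tc \<beta>) (ctop A q)) (map (tc \<alpha>) (ctop A q)) = map (tc ?\<gamma>) (ctop A q)"
      using A.ctop_in[OF 6] tc by (auto simp: map2_map_map subset_iff)
    note ka = a.tc_composable[OF A.virtual_double_category_axioms B.virtual_double_category_axioms assms(4) 6]
    note kb = b.tc_composable[OF A.virtual_double_category_axioms B.virtual_double_category_axioms assms(5) 6]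
    have ka': "composable B (ccomp B (fc H q) (tv \<beta> (vdom A (clft A q))) (map (tc \<beta>) (ctop A q)))
        (tv \<alpha> (vdom A (clft A q))) (map (tc \<alpha>) (ctop A q)) (tv \<alpha> (vdom A (crgt A q)))"
    proof -
      note k = B.ucomp_cell[OF c(2,4)]
      have "vdom B (vcomp B (tv \<beta> (hsrc A (cbot A q))) (fv G (clft A q))) = vdom B (fv G (clft A q))"
        using verD(2)[OF B.vcomp_ver[OF G.fv_ver[OF A.ver_self[OF A.clft_in[OF 6]]] b.tv_ver]] A.cbot_src[OF 6]
          A.vcod_in[OF A.clft_in[OF 6]] G.fv_Ver[OF A.clft_in[OF 6]] by simp
      then show ?thesis using ka k c(4) unfolding b.tc_natural_ucomp[OF 6 assms(4), symmetric]
        by (simp add: composable_def cell_def)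
    qed
    have ex: "\<exists>J \<Delta> v v'. cell B (tc \<beta> (ctop A q ! i)) [J] \<Delta> v v'" if "i < length (ctop A q)" for i
      using b.tc_cell[OF subsetD[OF A.ctop_in[OF 6] nth_mem[OF that]]] by blast
    have "ccomp B (tc ?\<gamma> (cbot A q)) (fv F (clft A q)) [fc F q] = ucomp B (ucomp B (tc \<beta> (cbot A q)) (tc \<alpha> (cbot A q))) (fc F q)"
      using tc[OF bot] F.fc_Cell[OF 6] by (simp add: ucomp_def)
    also have "\<dots> = ucomp B (tc \<beta> (cbot A q)) (ucomp B (tc \<alpha> (cbot A q)) (fc F q))"
      by (rule B.ucomp_assoc[OF c(2,1,3)])
    also have "\<dots> = ucomp B (tc \<beta> (cbot A q)) (ccomp B (fc G q) (tv \<alpha> (vdom A (clft A q))) (map (tc \<alpha>) (ctop A q)))"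
      by (simp only: a.tc_natural_ucomp[OF 6 assms(3)])
    also have "\<dots> = ccomp B (ucomp B (tc \<beta> (cbot A q)) (fc G q)) (tv \<alpha> (vdom A (clft A q))) (map (tc \<alpha>) (ctop A q))"
      by (rule B.ccomp_ucomp[OF c(2,4) ka, symmetric])
    also have "\<dots> = ccomp B (ccomp B (fc H q) (tv \<beta> (vdom A (clft A q))) (map (tc \<beta>) (ctop A q))) (tv \<alpha> (vdom A (clft A q))) (map (tc \<alpha>) (ctop A q))"
      by (simp only: b.tc_natural_ucomp[OF 6 assms(4)])
    also have "\<dots> = ccomp B (fc H q) (tv ?\<gamma> (vdom A (clft A q))) (map (tc ?\<gamma>) (ctop A q))"
      unfolding mt[symmetric] using x
      by (subst B.ccomp_unary_family[OF kb ka']) (use ex in \<open>auto simp: vcomp_trans_def\<close>)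
    finally show ?case .
  qed (auto simp: vcomp_trans_def)
qed

lemma vtr_post:
  assumes "vdc A" "vdc B" "vdf A B F" "vdf A B G" "vdf B C H" "vtr A B F G \<alpha>"
  shows "vtr A C (comp_map A H F) (comp_map A H G) (post_trans A H \<alpha>)"
proof -
  interpret A: virtual_double_category A by fact
  interpret B: virtual_double_category B by fact
  interpret F: virtual_double_functor A B F by fact
  interpret G: virtual_double_functor A B G by fact
  interpret H: virtual_double_functor B C H by fact
  interpret a: vertical_transformation A B F G \<alpha> by fact
  show ?thesis
  proof (unfold_locales, goal_cases)
    case (3 x) then show ?case using H.fv_ver[OF a.tv_ver[OF 3]] by (simp add: post_trans_def comp_map_def)
  next
    case (4 u x y)
    note ob = A.ver_ob[OF 4]
    show ?case using ob verD(1)[OF 4] a.tv_natural[OF 4] H.fv_vcomp[OF F.fv_ver[OF 4] a.tv_ver[OF ob(2)]]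
      H.fv_vcomp[OF a.tv_ver[OF ob(1)] G.fv_ver[OF 4]] by (simp add: post_trans_def comp_map_def)
  next
    case (5 J)
    then show ?case using H.fc_cell[OF a.tc_cell[OF 5]] A.hsrc_in A.htrg_in by (simp add: post_trans_def comp_map_def)
  next
    case (6 q)
    note bot = A.cbot_in[OF 6] and x = A.vdom_in[OF A.clft_in[OF 6]]
    have m: "map (tc (post_trans A H \<alpha>)) (ctop A q) = map (fc H) (map (tc \<alpha>) (ctop A q))"
      using A.ctop_in[OF 6] by (auto simp: post_trans_def subset_iff)
    show ?case unfolding m
      using H.fc_ccomp[OF a.tc_composable[OF assms(1,2,4) 6]] a.tc_natural[OF 6]
        H.fc_ccomp[OF B.composable_unary[OF a.tc_cell[OF bot] F.fc_cell[OF A.cell_self[OF 6]]]] x bot 6 A.clft_in[OF 6]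
      by (simp add: post_trans_def comp_map_def)
  qed (auto simp: post_trans_def)
qed

lemma vtr_pre:
  assumes "vdc A" "vdf A B G" "vtr B C H K \<beta>"
  shows "vtr A C (comp_map A H G) (comp_map A K G) (pre_trans A \<beta> G)"
proof -
  interpret A: virtual_double_category A by fact
  interpret G: virtual_double_functor A B G by fact
  interpret b: vertical_transformation B C H K \<beta> by fact
  show ?thesis
  proof (unfold_locales, goal_cases)
    case (3 x) then show ?case using b.tv_ver[OF G.fo_in[OF 3]] by (simp add: pre_trans_def comp_map_def)
  next
    case (4 u x y)
    show ?case using A.ver_ob[OF 4] verD(1)[OF 4] b.tv_natural[OF G.fv_ver[OF 4]] by (simp add: pre_trans_def comp_map_def)
  next
    case (5 J)
    then show ?case using b.tc_cell[OF G.fh_in[OF 5]] G.fh_src G.fh_trg A.hsrc_in A.htrg_in by (simp add: pre_trans_def comp_map_def)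
  next
    case (6 q)
    note bot = A.cbot_in[OF 6] and x = A.vdom_in[OF A.clft_in[OF 6]]
    have m: "map (tc (pre_trans A \<beta> G)) (ctop A q) = map (tc \<beta>) (ctop B (fc G q))"
      using A.ctop_in[OF 6] G.fc_Cell[OF 6] by (auto simp: pre_trans_def subset_iff)
    show ?case unfolding m
      using b.tc_natural[of "fc G q"] G.fc_Cell[OF 6] G.fv_Ver[OF A.clft_in[OF 6]] x bot 6 A.clft_in[OF 6]
      by (simp add: pre_trans_def comp_map_def)
  qed (auto simp: pre_trans_def)
qed

text \<open>
  Horizontal composition reduces to the two whiskerings, which is why only these are shown to be
  transformations directly.
\<close>

lemma hcomp_eq_whisker:
  assumes "vdc A" shows "hcomp_trans A C H \<beta> G \<alpha> = vcomp_trans A C (pre_trans A \<beta> G) (post_trans A H \<alpha>)"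
proof -
  interpret A: virtual_double_category A by fact
  show ?thesis by (auto simp: trans_defs A.hsrc_in restrict_def fun_eq_iff)
qed

lemma vtr_hcomp:
  assumes "vdc A" "vdc B" "vdc C" "vdf A B F" "vdf A B G" "vdf B C H" "vdf B C K" "vtr A B F G \<alpha>" "vtr B C H K \<beta>"
  shows "vtr A C (comp_map A H F) (comp_map A K G) (hcomp_trans A C H \<beta> G \<alpha>)"
  unfolding hcomp_eq_whisker[OF assms(1)]
  by (rule vtr_vcomp[OF assms(1,3) vdf_comp[OF assms(1,4,6)] vdf_comp[OF assms(1,5,6)] vdf_comp[OF assms(1,5,7)]
        vtr_post[OF assms(1,2,4,5,6,8)] vtr_pre[OF assms(1,5,9)]])

lemma comp_map_sel:
  "a \<in> Ob A \<Longrightarrow> fo (comp_map A G F) a = fo G (fo F a)" "u \<in> Ver A \<Longrightarrow> fv (comp_map A G F) u = fv G (fv F u)"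
  "J \<in> Hor A \<Longrightarrow> fh (comp_map A G F) J = fh G (fh F J)" "q \<in> Cell A \<Longrightarrow> fc (comp_map A G F) q = fc G (fc F q)"
  by (auto simp: comp_map_def)

lemma comp_map_id_left: assumes "vdc A" "vdc B" "vdf A B F" shows "comp_map A (id_map B) F = F"
proof -
  interpret F: virtual_double_functor A B F by fact
  show ?thesis
    by (rule vd_map_eqI[OF vdf_comp[OF assms(1,3) vdf_id[OF assms(2)]] assms(3)])
      (auto simp: comp_map_def id_map_def F.fo_in F.fv_Ver F.fh_in F.fc_Cell)
qed

lemma comp_map_id_right: assumes "vdc A" "vdf A B F" shows "comp_map A F (id_map A) = F"
  by (rule vd_map_eqI[OF vdf_comp[OF assms(1) vdf_id[OF assms(1)] assms(2)] assms(2)])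
    (auto simp: comp_map_def id_map_def)

lemma comp_map_assoc:
  assumes "vdc A" "vdc B" "vdf A B F" "vdf B C G" "vdf C D H"
  shows "comp_map A (comp_map B H G) F = comp_map A H (comp_map A G F)"
proof -
  interpret F: virtual_double_functor A B F by fact
  show ?thesis
    by (rule vd_map_eqI[OF vdf_comp[OF assms(1,3) vdf_comp[OF assms(2,4,5)]] vdf_comp[OF assms(1) vdf_comp[OF assms(1,3,4)] assms(5)]])
      (auto simp: comp_map_def F.fo_in F.fv_Ver F.fh_in F.fc_Cell)
qed

lemma trans_ext [simp]:
  "tv (id_trans A B F) \<in> extensional (Ob A)" "tc (id_trans A B F) \<in> extensional (Hor A)"
  "tv (vcomp_trans A B \<beta> \<alpha>) \<in> extensional (Ob A)" "tc (vcomp_trans A B \<beta> \<alpha>) \<in> extensional (Hor A)"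
  "tv (hcomp_trans A C H \<beta> G \<alpha>) \<in> extensional (Ob A)" "tc (hcomp_trans A C H \<beta> G \<alpha>) \<in> extensional (Hor A)"
  "tv (post_trans A H \<alpha>) \<in> extensional (Ob A)" "tc (post_trans A H \<alpha>) \<in> extensional (Hor A)"
  "tv (pre_trans A \<beta> G) \<in> extensional (Ob A)" "tc (pre_trans A \<beta> G) \<in> extensional (Hor A)"
  by (auto simp: trans_defs)

lemma vcomp_trans_sel:
  assumes "vtr A B F G \<alpha>"
  shows "a \<in> Ob A \<Longrightarrow> tv (vcomp_trans A B \<beta> \<alpha>) a = vcomp B (tv \<beta> a) (tv \<alpha> a)"
    "J \<in> Hor A \<Longrightarrow> tc (vcomp_trans A B \<beta> \<alpha>) J = ucomp B (tc \<beta> J) (tc \<alpha> J)"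
  using vertical_transformation.tc_cell[OF assms] by (auto simp: vcomp_trans_def ucomp_def cell_def)

lemma hcomp_trans_sel:
  assumes "vdc A" "vdf B C H" "vtr A B F G \<alpha>"
  shows "a \<in> Ob A \<Longrightarrow> tv (hcomp_trans A C H \<beta> G \<alpha>) a = vcomp C (tv \<beta> (fo G a)) (fv H (tv \<alpha> a))"
    "J \<in> Hor A \<Longrightarrow> tc (hcomp_trans A C H \<beta> G \<alpha>) J = ucomp C (tc \<beta> (fh G J)) (fc H (tc \<alpha> J))"
  using virtual_double_functor.fc_cell[OF assms(2) vertical_transformation.tc_cell[OF assms(3)]]
  by (auto simp: hcomp_trans_def ucomp_def cell_def)

lemma whisker_sel:
  "a \<in> Ob A \<Longrightarrow> tv (post_trans A H \<alpha>) a = fv H (tv \<alpha> a)" "J \<in> Hor A \<Longrightarrow> tc (post_trans A H \<alpha>) J = fc H (tc \<alpha> J)"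
  "a \<in> Ob A \<Longrightarrow> tv (pre_trans A \<beta> G) a = tv \<beta> (fo G a)" "J \<in> Hor A \<Longrightarrow> tc (pre_trans A \<beta> G) J = tc \<beta> (fh G J)"
  "a \<in> Ob A \<Longrightarrow> tv (id_trans A B F) a = vid B (fo F a)" "J \<in> Hor A \<Longrightarrow> tc (id_trans A B F) J = cid B (fh F J)"
  by (auto simp: trans_defs)

lemma hcomp_id_left_eq_post:
  assumes "vdc A" "vdc C" "vdf A B G" "vdf B C H" "vtr A B F G \<alpha>"
  shows "hcomp_trans A C H (id_trans B C H) G \<alpha> = post_trans A H \<alpha>"
proof -
  interpret C: virtual_double_category C by fact
  interpret G: virtual_double_functor A B G by fact
  interpret H: virtual_double_functor B C H by fact
  interpret a: vertical_transformation A B F G \<alpha> by fact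
  show ?thesis
  proof (rule vd_trans_eqI[of _ A])
    fix a assume "a \<in> Ob A"
    then show "tv (hcomp_trans A C H (id_trans B C H) G \<alpha>) a = tv (post_trans A H \<alpha>) a"
      using C.vcomp_id_left[OF H.fv_ver[OF a.tv_ver]] by (simp add: trans_defs G.fo_in)
  next
    fix J assume "J \<in> Hor A"
    then show "tc (hcomp_trans A C H (id_trans B C H) G \<alpha>) J = tc (post_trans A H \<alpha>) J"
      using C.ucomp_id_left[OF H.fc_cell[OF a.tc_cell]]
      by (simp add: hcomp_trans_sel[OF assms(1,4,5)] whisker_sel G.fh_in)
  qed simp_all
qed

lemma hcomp_id_right_eq_pre:
  assumes "vdc A" "vdc C" "vdc B" "vdf A B G" "vdf B C H" "vtr B C H K \<beta>"
  shows "hcomp_trans A C H \<beta> G (id_trans A B G) = pre_trans A \<beta> G"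
proof -
  interpret C: virtual_double_category C by fact
  interpret G: virtual_double_functor A B G by fact
  interpret H: virtual_double_functor B C H by fact
  interpret b: vertical_transformation B C H K \<beta> by fact
  note i = vtr_id[OF assms(1,3,4)]
  show ?thesis
  proof (rule vd_trans_eqI[of _ A])
    fix a assume "a \<in> Ob A"
    then show "tv (hcomp_trans A C H \<beta> G (id_trans A B G)) a = tv (pre_trans A \<beta> G) a"
      using C.vcomp_id_right[OF b.tv_ver] by (simp add: hcomp_trans_sel[OF assms(1,5) i] whisker_sel G.fo_in H.fv_vid)
  next
    fix J assume "J \<in> Hor A"
    then show "tc (hcomp_trans A C H \<beta> G (id_trans A B G)) J = tc (pre_trans A \<beta> G) J"
      using C.ucomp_id_right[OF b.tc_cell] by (simp add: hcomp_trans_sel[OF assms(1,5) i] whisker_sel G.fh_in H.fc_cid)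
  qed simp_all
qed

lemma VDBL_arr1: "arr1 VDBL f A B \<longleftrightarrow> (\<exists>F. f = (A, F, B) \<and> large_vdc A \<and> large_vdc B \<and> vdf A B F)"
  by (auto simp: arr1_def VDBL_def)

lemma VDBL_arr2: "arr2 VDBL x f g \<longleftrightarrow> (\<exists>A F B \<alpha> G. x = ((A, F, B), \<alpha>, (A, G, B)) \<and> f = (A, F, B) \<and> g = (A, G, B)
    \<and> large_vdc A \<and> large_vdc B \<and> vdf A B F \<and> vdf A B G \<and> vtr A B F G \<alpha>)"
  by (auto simp: arr2_def VDBL_def)

lemma VDBL_C [simp]:
  "A \<in> C0 VDBL \<longleftrightarrow> large_vdc A"
  "(A, F, B) \<in> C1 VDBL \<longleftrightarrow> large_vdc A \<and> large_vdc B \<and> vdf A B F"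
  "((A, F, B), \<alpha>, (A', G, B')) \<in> C2 VDBL \<longleftrightarrow>
     A' = A \<and> B' = B \<and> large_vdc A \<and> large_vdc B \<and> vdf A B F \<and> vdf A B G \<and> vtr A B F G \<alpha>"
  by (auto simp: VDBL_def)

lemma VDBL_ops [simp]:
  "src1 VDBL (A, F, B) = A" "trg1 VDBL (A, F, B) = B" "src2 VDBL (M, \<alpha>, N) = M" "trg2 VDBL (M, \<alpha>, N) = N"
  "id1 VDBL A = (A, id_map A, A)" "cmp1 VDBL (B, G, C) (A, F, B') = (A, comp_map A G F, C)"
  "id2 VDBL (A, F, B) = ((A, F, B), id_trans A B F, (A, F, B))"
  "vcmp VDBL (X, \<beta>, N) ((A, F, B), \<alpha>, Y) = ((A, F, B), vcomp_trans A B \<beta> \<alpha>, N)"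
  "hcmp VDBL ((B, H, C), \<beta>, (B', K, C')) ((A, F, D), \<alpha>, (E, G, D'))
    = ((A, comp_map A H F, C), hcomp_trans A C H \<beta> G \<alpha>, (A, comp_map A K G, C))"
  by (auto simp: VDBL_def trans_defs)

lemma large_vdcD: "large_vdc A \<Longrightarrow> vdc A" by (simp add: large_vdc_def)

lemma VDBL_C1: "f \<in> C1 VDBL \<longleftrightarrow> (\<exists>A F B. f = (A, F, B) \<and> large_vdc A \<and> large_vdc B \<and> vdf A B F)"
  by (cases f) auto

lemma VDBL_C2: "x \<in> C2 VDBL \<longleftrightarrow> (\<exists>A F B \<alpha> G. x = ((A, F, B), \<alpha>, (A, G, B))
    \<and> large_vdc A \<and> large_vdc B \<and> vdf A B F \<and> vdf A B G \<and> vtr A B F G \<alpha>)"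
  by (cases x) auto

lemma two_category_VDBL: "two_category VDBL"
proof (unfold_locales, goal_cases)
  case (7 a) then show ?case using vdf_id large_vdcD by (simp add: VDBL_arr1)
next
  case (8 f a b g c) then show ?case using vdf_comp large_vdcD by (auto simp: VDBL_arr1)
next
  case (9 f a b) then show ?case using comp_map_id_left large_vdcD by (auto simp: VDBL_arr1)
next
  case (10 f a b) then show ?case using comp_map_id_right[OF large_vdcD] by (auto simp: VDBL_arr1)
next
  case (11 f a b g c h d) then show ?case using comp_map_assoc large_vdcD by (auto simp: VDBL_arr1)
next
  case (12 f) then show ?case using vtr_id large_vdcD by (auto simp: VDBL_C1 VDBL_arr2)
next
  case (13 x f g y h) then show ?case
    using vtr_vcomp[OF large_vdcD large_vdcD] by (fastforce simp: VDBL_arr2)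
next
  case (14 x f g)
  then obtain A B F G \<alpha> where e: "x = ((A, F, B), \<alpha>, (A, G, B))" "g = (A, G, B)"
    and A: "vdc A" "vdc B" "vdf A B F" "vdf A B G" "vtr A B F G \<alpha>" by (auto simp: VDBL_arr2 large_vdcD)
  interpret B: virtual_double_category B by fact
  interpret a: vertical_transformation A B F G \<alpha> by fact
  have "vcomp_trans A B (id_trans A B G) \<alpha> = \<alpha>"
    by (rule vd_trans_eqI[of _ A])
      (auto simp: a.tv_ext a.tc_ext vcomp_trans_sel[OF A(5)] whisker_sel B.vcomp_id_left[OF a.tv_ver] B.ucomp_id_left[OF a.tc_cell])
  then show ?case by (simp add: e)
next
  case (15 x f g)
  then obtain A B F G \<alpha> where e: "x = ((A, F, B), \<alpha>, (A, G, B))" "f = (A, F, B)"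
    and A: "vdc A" "vdc B" "vdf A B F" "vdf A B G" "vtr A B F G \<alpha>" by (auto simp: VDBL_arr2 large_vdcD)
  interpret B: virtual_double_category B by fact
  interpret a: vertical_transformation A B F G \<alpha> by fact
  have "vcomp_trans A B \<alpha> (id_trans A B F) = \<alpha>"
    by (rule vd_trans_eqI[of _ A])
      (auto simp: a.tv_ext a.tc_ext vcomp_trans_sel[OF vtr_id[OF A(1-3)]] whisker_sel B.vcomp_id_right[OF a.tv_ver] B.ucomp_id_right[OF a.tc_cell])
  then show ?case by (simp add: e)
next
  case (16 x f g y h z k)
  then obtain A B F G H K \<alpha> \<beta> \<gamma> where e: "x = ((A, F, B), \<alpha>, (A, G, B))" "y = ((A, G, B), \<beta>, (A, H, B))" "z = ((A, H, B), \<gamma>, (A, K, B))"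
    and A: "vdc A" "vdc B" "vdf A B F" "vdf A B G" "vdf A B H" and t: "vtr A B F G \<alpha>" "vtr A B G H \<beta>" "vtr A B H K \<gamma>"
    by (auto simp: VDBL_arr2 large_vdcD)
  interpret B: virtual_double_category B by fact
  interpret a: vertical_transformation A B F G \<alpha> by fact
  interpret b: vertical_transformation A B G H \<beta> by fact
  interpret c: vertical_transformation A B H K \<gamma> by fact
  have "vcomp_trans A B (vcomp_trans A B \<gamma> \<beta>) \<alpha> = vcomp_trans A B \<gamma> (vcomp_trans A B \<beta> \<alpha>)"
    by (rule vd_trans_eqI[of _ A])
      (auto simp: vcomp_trans_sel[OF t(1)] vcomp_trans_sel[OF t(2)] vcomp_trans_sel[OF vtr_vcomp[OF A t(1,2)]]
        B.vcomp_assoc[OF a.tv_ver b.tv_ver c.tv_ver] B.ucomp_assoc[OF c.tc_cell b.tc_cell a.tc_cell])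
  then show ?case by (simp add: e)
next
  case (17 x f f' y g g')
  then obtain A B C F G H K \<alpha> \<beta> where e: "x = ((A, F, B), \<alpha>, (A, G, B))" "y = ((B, H, C), \<beta>, (B, K, C))"
      "f = (A, F, B)" "f' = (A, G, B)" "g = (B, H, C)" "g' = (B, K, C)"
    and A: "large_vdc A" "large_vdc B" "large_vdc C" "vdf A B F" "vdf A B G" "vdf B C H" "vdf B C K" and t: "vtr A B F G \<alpha>" "vtr B C H K \<beta>"
    by (auto simp: VDBL_arr2)
  note v = A(1-3)[THEN large_vdcD]
  show ?case using A vdf_comp[OF v(1) A(4,6)] vdf_comp[OF v(1) A(5,7)] vtr_hcomp[OF v A(4-7) t]
    by (auto simp: VDBL_arr2 e)
next
  case (18 x f g b)
  then obtain A B F G \<alpha> where e: "x = ((A, F, B), \<alpha>, (A, G, B))" "b = B"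
    and A: "vdc A" "vdc B" "vdf A B F" "vdf A B G" "vtr A B F G \<alpha>" by (auto simp: VDBL_arr2 large_vdcD)
  interpret a: vertical_transformation A B F G \<alpha> by fact
  have "post_trans A (id_map B) \<alpha> = \<alpha>"
    by (rule vd_trans_eqI[of _ A]) (auto simp: whisker_sel a.tv_ext a.tc_ext id_map_def verD[OF a.tv_ver] cellD[OF a.tc_cell])
  then show ?case using hcomp_id_left_eq_post[OF A(1,2,4) vdf_id[OF A(2)] A(5)] A
    by (simp add: e comp_map_id_left)
next
  case (19 x f g a)
  then obtain A B F G \<alpha> where e: "x = ((A, F, B), \<alpha>, (A, G, B))" "a = A"
    and A: "vdc A" "vdc B" "vdf A B F" "vdf A B G" "vtr A B F G \<alpha>" by (auto simp: VDBL_arr2 large_vdcD)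
  interpret a: vertical_transformation A B F G \<alpha> by fact
  have "pre_trans A \<alpha> (id_map A) = \<alpha>"
    by (rule vd_trans_eqI[of _ A]) (auto simp: whisker_sel a.tv_ext a.tc_ext id_map_def)
  then show ?case using hcomp_id_right_eq_pre[OF A(1,2,1) vdf_id[OF A(1)] A(3,5)] A
    by (simp add: e comp_map_id_right[OF A(1,3)] comp_map_id_right[OF A(1,4)])
next
  case (20 x f f' y g g' z h h')
  then obtain A B C D F F' G G' H H' \<alpha> \<beta> \<gamma> where e: "x = ((A, F, B), \<alpha>, (A, F', B))" "y = ((B, G, C), \<beta>, (B, G', C))"
      "z = ((C, H, D), \<gamma>, (C, H', D))"
    and A: "vdc A" "vdc B" "vdc C" "vdc D" and F: "vdf A B F" "vdf A B F'" "vdf B C G" "vdf B C G'" "vdf C D H" "vdf C D H'"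
    and t: "vtr A B F F' \<alpha>" "vtr B C G G' \<beta>" "vtr C D H H' \<gamma>"
    by (auto simp: VDBL_arr2 large_vdcD)
  interpret B: virtual_double_category B by fact
  interpret C: virtual_double_category C by fact
  interpret D: virtual_double_category D by fact
  interpret F: virtual_double_functor A B F by fact
  interpret F': virtual_double_functor A B F' by fact
  interpret G: virtual_double_functor B C G by fact
  interpret G': virtual_double_functor B C G' by fact
  interpret H: virtual_double_functor C D H by fact
  interpret a: vertical_transformation A B F F' \<alpha> by fact
  interpret b: vertical_transformation B C G G' \<beta> by fact
  interpret c: vertical_transformation C D H H' \<gamma> by fact
  note GH = vdf_comp[OF A(2) F(3,5)]
  note s1 = hcomp_trans_sel[OF A(1) GH t(1)] hcomp_trans_sel[OF A(1) F(5) vtr_hcomp[OF A(1-3) F(1-4) t(1,2)]]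
    hcomp_trans_sel[OF A(2) F(5) t(2)] hcomp_trans_sel[OF A(1) F(3) t(1)]
  have "hcomp_trans A D (comp_map B H G) (hcomp_trans B D H \<gamma> G' \<beta>) F' \<alpha>
      = hcomp_trans A D H \<gamma> (comp_map A G' F') (hcomp_trans A C G \<beta> F' \<alpha>)"
  proof (rule vd_trans_eqI[of _ A])
    fix a assume a: "a \<in> Ob A"
    note v = a.tv_ver[OF a] b.tv_ver[OF F'.fo_in[OF a]] c.tv_ver[OF G'.fo_in[OF F'.fo_in[OF a]]]
    show "tv (hcomp_trans A D (comp_map B H G) (hcomp_trans B D H \<gamma> G' \<beta>) F' \<alpha>) a
      = tv (hcomp_trans A D H \<gamma> (comp_map A G' F') (hcomp_trans A C G \<beta> F' \<alpha>)) a"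
      using a verD(1)[OF v(1)] H.fv_vcomp[OF G.fv_ver[OF v(1)] v(2)]
        D.vcomp_assoc[OF H.fv_ver[OF G.fv_ver[OF v(1)]] H.fv_ver[OF v(2)] v(3)]
      by (simp add: s1 comp_map_sel F'.fo_in)
  next
    fix J assume J: "J \<in> Hor A"
    note v = a.tc_cell[OF J] b.tc_cell[OF F'.fh_in[OF J]] c.tc_cell[OF G'.fh_in[OF F'.fh_in[OF J]]]
    note Gv = G.fc_cell[OF v(1), simplified]
    show "tc (hcomp_trans A D (comp_map B H G) (hcomp_trans B D H \<gamma> G' \<beta>) F' \<alpha>) J
      = tc (hcomp_trans A D H \<gamma> (comp_map A G' F') (hcomp_trans A C G \<beta> F' \<alpha>)) J"
      using J cellD(1)[OF v(1)] H.fc_ucomp[OF A(3) v(2) Gv]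
        D.ucomp_assoc[OF v(3) H.fc_cell[OF v(2), simplified] H.fc_cell[OF Gv, simplified]]
      by (simp add: s1 comp_map_sel F'.fh_in)
  qed simp_all
  then show ?case using comp_map_assoc[OF A(1,2)] F by (simp add: e)
next
  case (21 f a b g c)
  then obtain A B C F G where e: "f = (A, F, B)" "g = (B, G, C)"
    and A: "vdc A" "vdc B" "vdc C" "vdf A B F" "vdf B C G" by (auto simp: VDBL_arr1 large_vdcD)
  interpret F: virtual_double_functor A B F by fact
  have "hcomp_trans A C G (id_trans B C G) F (id_trans A B F) = pre_trans A (id_trans B C G) F"
    by (rule hcomp_id_right_eq_pre[OF A(1,3,2,4,5) vtr_id[OF A(2,3,5)]])
  also have "\<dots> = id_trans A C (comp_map A G F)"
    by (rule vd_trans_eqI[of _ A]) (auto simp: whisker_sel comp_map_sel F.fo_in F.fh_in)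
  finally show ?case by (simp add: e)
next
  case (22 x f f' x' f'' y g g' y' g'')
  then obtain A B C F F' F'' G G' G'' \<alpha> \<alpha>' \<beta> \<beta>' where e: "x = ((A, F, B), \<alpha>, (A, F', B))" "x' = ((A, F', B), \<alpha>', (A, F'', B))"
     "y = ((B, G, C), \<beta>, (B, G', C))" "y' = ((B, G', C), \<beta>', (B, G'', C))"
    and A: "vdc A" "vdc B" "vdc C"
    and F: "vdf A B F" "vdf A B F'" "vdf A B F''" "vdf B C G" "vdf B C G'" "vdf B C G''"
    and t: "vtr A B F F' \<alpha>" "vtr A B F' F'' \<alpha>'" "vtr B C G G' \<beta>" "vtr B C G' G'' \<beta>'"
    by (auto simp: VDBL_arr2 large_vdcD)
  interpret B: virtual_double_category B by fact
  interpret C: virtual_double_category C by fact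
  interpret F': virtual_double_functor A B F' by fact
  interpret F'': virtual_double_functor A B F'' by fact
  interpret G: virtual_double_functor B C G by fact
  interpret G': virtual_double_functor B C G' by fact
  interpret a: vertical_transformation A B F F' \<alpha> by fact
  interpret a': vertical_transformation A B F' F'' \<alpha>' by fact
  interpret b: vertical_transformation B C G G' \<beta> by fact
  interpret b': vertical_transformation B C G' G'' \<beta>' by fact
  note s = hcomp_trans_sel[OF A(1) F(4) vtr_vcomp[OF A(1,2) F(1-3) t(1,2)]] hcomp_trans_sel[OF A(1) F(4) t(1)]
    hcomp_trans_sel[OF A(1) F(5) t(2)] vcomp_trans_sel[OF vtr_hcomp[OF A F(1,2,4,5) t(1,3)]] vcomp_trans_sel[OF t(1)] vcomp_trans_sel[OF t(3)]
  have "hcomp_trans A C G (vcomp_trans B C \<beta>' \<beta>) F'' (vcomp_trans A B \<alpha>' \<alpha>)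
      = vcomp_trans A C (hcomp_trans A C G' \<beta>' F'' \<alpha>') (hcomp_trans A C G \<beta> F' \<alpha>)"
  proof (rule vd_trans_eqI[of _ A])
    fix a assume a: "a \<in> Ob A"
    note v = G.fv_ver[OF a.tv_ver[OF a]] G.fv_ver[OF a'.tv_ver[OF a]] G'.fv_ver[OF a'.tv_ver[OF a]]
    note w = b.tv_ver[OF F'.fo_in[OF a]] b.tv_ver[OF F''.fo_in[OF a]] b'.tv_ver[OF F''.fo_in[OF a]]
    show "tv (hcomp_trans A C G (vcomp_trans B C \<beta>' \<beta>) F'' (vcomp_trans A B \<alpha>' \<alpha>)) a
      = tv (vcomp_trans A C (hcomp_trans A C G' \<beta>' F'' \<alpha>') (hcomp_trans A C G \<beta> F' \<alpha>)) a"
      using a b.tv_natural[OF a'.tv_ver[OF a]] G.fv_vcomp[OF a.tv_ver[OF a] a'.tv_ver[OF a]]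
      by (simp add: s F''.fo_in C.vcomp_assoc[OF v(1,2) C.vcomp_ver[OF w(2,3)], symmetric]
          C.vcomp_assoc[OF v(2) w(2,3)] C.vcomp_assoc[OF v(1) w(1) C.vcomp_ver[OF v(3) w(3)], symmetric] C.vcomp_assoc[OF w(1) v(3) w(3)])
  next
    fix J assume J: "J \<in> Hor A"
    note v = G.fc_cell[OF a.tc_cell[OF J], simplified] G.fc_cell[OF a'.tc_cell[OF J], simplified] G'.fc_cell[OF a'.tc_cell[OF J], simplified]
    note w = b.tc_cell[OF F'.fh_in[OF J]] b.tc_cell[OF F''.fh_in[OF J]] b'.tc_cell[OF F''.fh_in[OF J]]
    have n: "ucomp C (tc \<beta> (fh F'' J)) (fc G (tc \<alpha>' J)) = ucomp C (fc G' (tc \<alpha>' J)) (tc \<beta> (fh F' J))"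
      using b.tc_natural_ucomp[OF cellD(1)[OF a'.tc_cell[OF J]] F(4)] cellD[OF a'.tc_cell[OF J]] cellD(4)[OF w(1)]
        B.cell_unary(2)[OF a'.tc_cell[OF J]] by (simp add: ucomp_def)
    note k = C.ucomp_cell[OF w(3,2)] and k' = C.ucomp_cell[OF w(3) v(3)]
    show "tc (hcomp_trans A C G (vcomp_trans B C \<beta>' \<beta>) F'' (vcomp_trans A B \<alpha>' \<alpha>)) J
      = tc (vcomp_trans A C (hcomp_trans A C G' \<beta>' F'' \<alpha>') (hcomp_trans A C G \<beta> F' \<alpha>)) J"
      using J n G.fc_ucomp[OF A(2) a'.tc_cell[OF J] a.tc_cell[OF J]]
      by (simp add: s F''.fh_in C.ucomp_assoc[OF k v(2,1), symmetric]
          C.ucomp_assoc[OF w(3,2) v(2)] C.ucomp_assoc[OF k' w(1) v(1), symmetric] C.ucomp_assoc[OF w(3) v(3) w(1)])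
  qed simp_all
  then show ?case by (simp add: e)
qed (auto simp: VDBL_C1 VDBL_C2)

lemma VDBL_whisk_left:
  assumes "vdc A" "vdc C" "vdf A B G" "vdf B C H" "vtr A B F G \<alpha>"
  shows "whisk_left VDBL (B, H, C) ((A, F, B), \<alpha>, (A, G, B))
    = ((A, comp_map A H F, C), post_trans A H \<alpha>, (A, comp_map A H G, C))"
  by (simp add: whisk_left_def hcomp_id_left_eq_post[OF assms])

lemma VDBL_whisk_right:
  assumes "vdc A" "vdc C" "vdc B" "vdf A B G" "vdf B C H" "vtr B C H K \<beta>"
  shows "whisk_right VDBL ((B, H, C), \<beta>, (B, K, C)) (A, G, B)
    = ((A, comp_map A H G, C), pre_trans A \<beta> G, (A, comp_map A K G, C))"
  by (simp add: whisk_right_def hcomp_id_right_eq_pre[OF assms])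

end

section \<open>Pasting multicells\<close>

lemma chain_nthI:
  assumes "length vs = Suc (length xs)" "\<And>k. k \<le> length xs \<Longrightarrow> vs ! k \<in> S"
    "\<And>k. k < length xs \<Longrightarrow> xs ! k \<in> Ar \<and> s (xs ! k) = vs ! k \<and> t (xs ! k) = vs ! Suc k"
  shows "chain S Ar s t (vs ! 0) xs (vs ! length xs)"
  using assms
proof (induction xs arbitrary: vs)
  case (Cons x xs)
  then obtain v vs' where vs: "vs = v # vs'" by (cases vs) auto
  have "chain S Ar s t (vs' ! 0) xs (vs' ! length xs)"
  proof (rule Cons.IH)
    show "vs' ! k \<in> S" if "k \<le> length xs" for k using Cons.prems(2)[of "Suc k"] that vs by simp
    show "xs ! k \<in> Ar \<and> s (xs ! k) = vs' ! k \<and> t (xs ! k) = vs' ! Suc k" if "k < length xs" for k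
      using Cons.prems(3)[of "Suc k"] that vs by simp
  qed (use Cons.prems vs in simp)
  then show ?case using Cons.prems(2)[of 0] Cons.prems(3)[of 0] vs by simp
qed simp

lemma chain_nthD:
  assumes "chain S Ar s t a xs b" "k < length xs"
  shows "xs ! k \<in> Ar" "s (xs ! k) = (a # map t xs) ! k" "t (xs ! k) = (a # map t xs) ! Suc k"
    "(a # map t xs) ! k \<in> S" "(a # map t xs) ! Suc k \<in> S"
proof -
  have "xs ! k \<in> Ar \<and> s (xs ! k) = (a # map t xs) ! k \<and> (a # map t xs) ! k \<in> S \<and> t (xs ! k) \<in> S"
    using assms
  proof (induction xs arbitrary: a k)
    case (Cons x xs)
    have "t x \<in> S" using Cons.prems(1) chain_ends(1) by fastforce
    then show ?case using Cons by (cases k) auto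
  qed simp
  then show "xs ! k \<in> Ar" "s (xs ! k) = (a # map t xs) ! k" "t (xs ! k) = (a # map t xs) ! Suc k"
    "(a # map t xs) ! k \<in> S" "(a # map t xs) ! Suc k \<in> S" using assms(2) by auto
qed

lemma chain_concat:
  assumes "length ws = Suc (length xss)" "ws ! 0 \<in> S"
    "\<And>k. k < length xss \<Longrightarrow> chain S Ar s t (ws ! k) (xss ! k) (ws ! Suc k)"
  shows "chain S Ar s t (ws ! 0) (concat xss) (ws ! length xss)"
  using assms
proof (induction xss arbitrary: ws)
  case (Cons xs xss)
  then obtain w ws' where ws: "ws = w # ws'" by (cases ws) auto
  have c: "chain S Ar s t w xs (ws' ! 0)" using Cons.prems(3)[of 0] ws by simp
  have "chain S Ar s t (ws' ! 0) (concat xss) (ws' ! length xss)"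
  proof (rule Cons.IH)
    show "ws' ! 0 \<in> S" using chain_ends(2)[OF c] .
    show "chain S Ar s t (ws' ! k) (xss ! k) (ws' ! Suc k)" if "k < length xss" for k
      using Cons.prems(3)[of "Suc k"] that ws by simp
  qed (use Cons.prems ws in simp)
  then show ?case using c ws by (auto simp: chain_append)
qed simp

lemma chain_cong:
  "\<lbrakk>\<And>x. x \<in> Ar \<Longrightarrow> s x = s' x \<and> t x = t' x\<rbrakk> \<Longrightarrow> chain S Ar s t a xs b \<longleftrightarrow> chain S Ar s' t' a xs b"
  by (induction xs arbitrary: a) auto

lemma composable_path:
  assumes "composable A \<kappa> u qs u'"
  shows "chain (Ver A) (Cell A) (clft A) (crgt A) u qs u'" "\<kappa> \<in> Cell A" "map (cbot A) qs = ctop A \<kappa>"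
    "vcod A u = vdom A (clft A \<kappa>)" "u \<in> Ver A" "u' \<in> Ver A" "set qs \<subseteq> Cell A"
  using assms chain_ends[of "Ver A" "Cell A" "clft A" "crgt A" u qs u'] unfolding composable_def cpath_def by auto

text \<open>
  The parts of a virtual double category that concern boundaries only. They are isolated because the
  associativity law of \<open>mat A\<close> and \<open>el X p\<close> needs the composability of nested composites before
  these are known to be virtual double categories.
\<close>

locale multicell_boundary =
  fixes A :: "('o, 'v, 'h, 'c) vdc"
  assumes ctop_path': "q \<in> Cell A
      \<Longrightarrow> hpath A (vdom A (clft A q)) (ctop A q) (vdom A (crgt A q))"
    and cbot_trg': "q \<in> Cell A \<Longrightarrow> htrg A (cbot A q) = vcod A (crgt A q)"
begin

lemma composable_right:
  assumes "composable A \<kappa> u qs u'" shows "vcod A u' = vdom A (crgt A \<kappa>)"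
proof -
  note p = composable_path[OF assms]
  have "b = vcod A u'" if "chain (Ob A) (Hor A) (hsrc A) (htrg A) (vcod A u) (map (cbot A) qs) b"
    "chain (Ver A) (Cell A) (clft A) (crgt A) u qs u'" for u b
    using that by (induction qs arbitrary: u) (auto simp: cbot_trg')
  from this[OF _ p(1)] show ?thesis using ctop_path'[OF p(2)] p(3,4) unfolding hpath_def by simp
qed

end

locale multicell_composition = multicell_boundary A for A :: "('o, 'v, 'h, 'c) vdc" +
  assumes clft_in': "q \<in> Cell A \<Longrightarrow> clft A q \<in> Ver A"
    and crgt_in': "q \<in> Cell A \<Longrightarrow> crgt A q \<in> Ver A"
    and vcomp_ver': "\<lbrakk>ver A f a b; ver A g b c\<rbrakk> \<Longrightarrow> ver A (vcomp A g f) a c"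
    and ccomp_cell': "composable A \<kappa> u qs u'
      \<Longrightarrow> cell A (ccomp A \<kappa> u qs) (concat (map (ctop A) qs)) (cbot A \<kappa>)
            (vcomp A (clft A \<kappa>) u) (vcomp A (crgt A \<kappa>) u')"
begin

lemma vcomp_Ver: "\<lbrakk>f \<in> Ver A; g \<in> Ver A; vcod A f = vdom A g\<rbrakk>
  \<Longrightarrow> vcomp A g f \<in> Ver A \<and> vdom A (vcomp A g f) = vdom A f \<and> vcod A (vcomp A g f) = vcod A g"
  using vcomp_ver'[of f "vdom A f" "vcod A f" g "vcod A g"] by (simp add: ver_def)

text \<open>
  The two sides of the associativity law are composites of composable data. The seams match because
  the right side of the \<open>k\<close>-th composite and the left side of the next one are both \<open>us ! Suc k\<close>
  composed with \<open>ws ! Suc k\<close>.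
\<close>

lemma nested_composable:
  assumes k: "composable A \<kappa> u qs u'" and len: "length \<xi>ss = length qs" "length ws = Suc (length qs)"
    and w: "ws ! 0 \<in> Ver A" "vcod A (ws ! 0) = vdom A u"
    and c: "\<And>i. i < length qs \<Longrightarrow> composable A (qs ! i) (ws ! i) (\<xi>ss ! i) (ws ! Suc i)"
  shows "composable A (ccomp A \<kappa> u qs) (ws ! 0) (concat \<xi>ss) (ws ! length qs)"
    "composable A \<kappa> (vcomp A u (ws ! 0)) (map (\<lambda>i. ccomp A (qs ! i) (ws ! i) (\<xi>ss ! i)) [0..<length qs])
      (vcomp A u' (ws ! length qs))"
proof -
  let ?n = "length qs"
  define us where "us = u # map (crgt A) qs"
  define \<phi> where "\<phi> = (\<lambda>i. ccomp A (qs ! i) (ws ! i) (\<xi>ss ! i))"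
  define vs where "vs = map (\<lambda>i. vcomp A (us ! i) (ws ! i)) [0..<Suc ?n]"
  note kp = composable_path[OF k]
  have us: "us ! 0 = u" "us ! ?n = u'" using chain_end[OF kp(1)] by (simp_all add: us_def last_conv_nth)
  have side: "qs ! i \<in> Cell A" "clft A (qs ! i) = us ! i" "crgt A (qs ! i) = us ! Suc i" if "i < ?n" for i
    using chain_nthD[OF kp(1) that] unfolding us_def by auto
  have usV: "us ! i \<in> Ver A" if "i \<le> ?n" for i
    using that kp(5) kp(7) crgt_in' unfolding us_def by (cases i) (auto simp: subset_iff)
  have vs: "vs ! i = vcomp A (us ! i) (ws ! i)" if "i \<le> ?n" for i
    unfolding vs_def using that by (simp del: upt_Suc)
  have cell\<phi>: "cell A (\<phi> i) (concat (map (ctop A) (\<xi>ss ! i))) (cbot A (qs ! i)) (vs ! i) (vs ! Suc i)" if "i < ?n" for i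
    using ccomp_cell'[OF c[OF that]] side[OF that] that vs[of i] vs[of "Suc i"] by (simp add: \<phi>_def)
  have wsV: "ws ! i \<in> Ver A" if "i \<le> ?n" for i
    using that w(1) composable_path(6)[OF c, of "i - 1"] by (cases i) simp_all
  have cod: "vcod A (ws ! i) = vdom A (us ! i)" if "i \<le> ?n" for i
    using that w(2) composable_right[OF c, of "i - 1"] side(3)[of "i - 1"] us(1) by (cases i) simp_all
  have vsV: "vs ! i \<in> Ver A" if "i \<le> ?n" for i
    using vcomp_Ver[OF wsV[OF that] usV[OF that] cod[OF that]] vs[OF that] by simp
  note ck = ccomp_cell'[OF k]
  have clk: "vdom A (vcomp A (clft A \<kappa>) u) = vdom A u"
    using vcomp_Ver[OF kp(5) clft_in'[OF kp(2)] kp(4)] by simp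
  have "chain (Ver A) (Cell A) (clft A) (crgt A) (ws ! 0) (concat \<xi>ss) (ws ! length \<xi>ss)"
    by (rule chain_concat) (use len w(1) composable_path(1)[OF c] in auto)
  moreover have "map (cbot A) (concat \<xi>ss) = concat (map (ctop A) qs)"
  proof -
    have "map (map (cbot A)) \<xi>ss = map (ctop A) qs"
      by (rule nth_equalityI) (use len composable_path(3)[OF c] in auto)
    then show ?thesis by (simp add: map_concat)
  qed
  ultimately show "composable A (ccomp A \<kappa> u qs) (ws ! 0) (concat \<xi>ss) (ws ! ?n)"
    using cellD[OF ck] clk w len(1) by (simp add: composable_def cpath_def)
  have "chain (Ver A) (Cell A) (clft A) (crgt A) (vs ! 0) (map \<phi> [0..<?n]) (vs ! length (map \<phi> [0..<?n]))"
    by (rule chain_nthI) (use vsV cellD[OF cell\<phi>] in \<open>simp_all add: vs_def del: upt_Suc\<close>)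
  moreover have "map (cbot A) (map \<phi> [0..<?n]) = map (cbot A) qs"
    by (rule nth_equalityI) (use cellD[OF cell\<phi>] in auto)
  moreover have "vcod A (vcomp A u (ws ! 0)) = vcod A u" using vcomp_Ver[OF w(1) kp(5) w(2)] by simp
  moreover have "vs ! 0 = vcomp A u (ws ! 0)" "vs ! ?n = vcomp A u' (ws ! ?n)"
    using us vs by simp_all
  ultimately have "composable A \<kappa> (vcomp A u (ws ! 0)) (map \<phi> [0..<?n]) (vcomp A u' (ws ! ?n))"
    using kp(2,3,4) by (simp add: composable_def cpath_def del: map_map)
  then show "composable A \<kappa> (vcomp A u (ws ! 0)) (map (\<lambda>i. ccomp A (qs ! i) (ws ! i) (\<xi>ss ! i)) [0..<?n]) (vcomp A u' (ws ! ?n))"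
    by (simp add: \<phi>_def)
qed

end

section \<open>Tuples of indices\<close>

lemma list_all2_concat:
  "list_all2 P rs (concat Ds) \<longleftrightarrow> (\<exists>rss. rs = concat rss \<and> list_all2 (list_all2 P) rss Ds)"
proof (induction Ds arbitrary: rs)
  case (Cons D Ds)
  show ?case
  proof
    assume "list_all2 P rs (concat (D # Ds))"
    then obtain us vs where "rs = us @ vs" "list_all2 P us D" "list_all2 P vs (concat Ds)"
      by (auto simp: list_all2_append2)
    then show "\<exists>rss. rs = concat rss \<and> list_all2 (list_all2 P) rss (D # Ds)"
      using Cons.IH by (metis concat.simps(2) list_all2_Cons)
  next
    assume "\<exists>rss. rs = concat rss \<and> list_all2 (list_all2 P) rss (D # Ds)"
    then obtain r rss where "rs = r @ concat rss" "list_all2 P r D" "list_all2 (list_all2 P) rss Ds"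
      by (auto simp: list_all2_Cons2)
    moreover from this Cons.IH have "list_all2 P (concat rss) (concat Ds)" by blast
    ultimately show "list_all2 P rs (concat (D # Ds))" by (auto intro: list_all2_appendI)
  qed
qed auto

lemma blk_append: "blk i (rs @ ss) = blk i rs @ blk (last (i # concat rs)) ss"
proof (induction rs arbitrary: i)
  case (Cons r rs)
  have "last (last (i # r) # concat rs) = last (i # r @ concat rs)" by (simp add: last_append)
  then show ?case using Cons by (simp del: last.simps)
qed simp

text \<open>
  Cutting twice is the same as cutting once: the blocks of a concatenation are grouped into the blocks
  of its members, the \<open>k\<close>-th group starting at the index where the preceding ones end. This is the
  combinatorial content of associativity in \<open>mat A\<close>.
\<close>

lemma blk_concat:
  "blk i (concat rss) = concat (map (\<lambda>k. blk (last (i # concat (concat (take k rss)))) (rss ! k)) [0..<length rss])"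
proof (induction rss arbitrary: i)
  case (Cons rs rss)
  have "last (last (i # concat rs) # concat (concat (take k rss))) = last (i # concat rs @ concat (concat (take k rss)))" for k
    by (simp add: last_append)
  then show ?case
    by (simp add: blk_append Cons map_upt_Suc del: last.simps upt_Suc) simp
qed simp

lemma map2_concat:
  assumes "list_all2 (\<lambda>xs ys. length xs = length ys) xss yss"
  shows "map2 f (concat xss) (concat yss) = concat (map2 (map2 f) xss yss)"
  using assms by (induction rule: list_all2_induct) auto

context grothendieck_universes
begin

lemma mat_entry_simps [simp]:
  "mat_entry [] is = []" "mat_entry (J # Js) (i # j # r) = hent J i j # mat_entry Js (j # r)"
  by (simp_all add: mat_entry_def map_upt_Suc del: upt_Suc)

lemma length_mat_entry [simp]: "length (mat_entry Js is) = length Js"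
  by (simp add: mat_entry_def)

lemma mat_entry_append:
  "length r = length Js \<Longrightarrow> mat_entry (Js @ \<Delta>s) (i # r @ s) = mat_entry Js (i # r) @ mat_entry \<Delta>s (last (i # r) # s)"
  by (induction Js arbitrary: i r) (auto simp: length_Suc_conv)

lemma mat_entry_concat:
  assumes "list_all2 (\<lambda>r Js. length r = length Js) rs Jss"
  shows "mat_entry (concat Jss) (i # concat rs) = concat (map2 mat_entry Jss (blk i rs))"
  using assms by (induction rs arbitrary: i Jss) (auto simp: list_all2_Cons1 mat_entry_append)

text \<open>
  Index tuples \<open>i # r\<close> of a path \<open>Js\<close> of matrices, without the leftmost index \<open>i\<close>. Separating \<open>i\<close> makes
  concatenation of paths the concatenation of the tails.
\<close>

definition tails :: "'V list \<Rightarrow> 'V list \<Rightarrow> bool" where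
  "tails Js r \<longleftrightarrow> list_all2 (\<lambda>i J. i \<in> idx (part 1 J)) r Js"

lemma tails_simps [simp]: "tails [] r \<longleftrightarrow> r = []" "tails (J # Js) r \<longleftrightarrow> (\<exists>i r'. r = i # r' \<and> i \<in> idx (part 1 J) \<and> tails Js r')"
  by (auto simp: tails_def list_all2_Cons2)

lemma tails_length: "tails Js r \<Longrightarrow> length r = length Js"
  by (auto simp: tails_def dest: list_all2_lengthD)

lemma tails_concat: "tails (concat Jss) r \<longleftrightarrow> (\<exists>rs. r = concat rs \<and> list_all2 (\<lambda>r Js. tails Js r) rs Jss)"
  unfolding tails_def list_all2_concat by simp

lemma listset_vertices: "is \<in> listset (map idx (vertices x Js)) \<longleftrightarrow> (\<exists>i r. is = i # r \<and> i \<in> idx x \<and> tails Js r)"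
  by (auto simp: listset_iff vertices_def list_all2_Cons2 tails_def list_all2_map2 simp del: listset.simps)

lemma in_tuples: "s \<in> tuples xs \<longleftrightarrow> (\<exists>is. s = vlist is \<and> is \<in> listset (map idx xs))"
  by (auto simp: tuples_def)

lemma large_finite: "finite X \<Longrightarrow> large X"
  by (induction rule: finite_induct) (auto intro: large_Un[OF large_singleton, simplified])

lemma ball_tuples2: "(\<forall>s\<in>tuples [x, y]. P s) \<longleftrightarrow> (\<forall>i\<in>idx x. \<forall>j\<in>idx y. P (vlist [i, j]))"
proof -
  have "tuples [x, y] = {vlist [i, j] | i j. i \<in> idx x \<and> j \<in> idx y}" by (auto simp: tuples_def set_Cons_def)
  then show ?thesis by auto
qed

lemma ball_tuples_vertices:
  "(\<forall>s\<in>tuples (vertices x Js). P s) \<longleftrightarrow> (\<forall>i\<in>idx x. \<forall>r. tails Js r \<longrightarrow> P (vlist (i # r)))"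
proof -
  have "tuples (vertices x Js) = {vlist (i # r) | i r. i \<in> idx x \<and> tails Js r}"
    by (auto simp: tuples_def listset_vertices image_iff)
  then show ?thesis by auto
qed

lemma large_idx [simp]: "large (idx x)" by (simp add: idx_def)

lemma large_tuples [simp]: "large (tuples xs)"
proof (rule large_subset)
  show "large (vlist ` lists (\<Union>x\<in>set xs. idx x))" by (intro large_lists large_UN large_idx large_finite finite_set)
  have "is \<in> lists (\<Union>x\<in>set xs. idx x)" if "is \<in> listset (map idx xs)" for "is"
    using that by (induction xs arbitrary: "is") (fastforce simp: set_Cons_def)+
  then show "tuples xs \<subseteq> vlist ` lists (\<Union>x\<in>set xs. idx x)" by (auto simp: tuples_def)
qed

section \<open>Matrices\<close>

text \<open>
  Matrices are coded as lists of sets in the universe, with \<open>idx\<close>, \<open>oent\<close>, \<open>vent\<close>, \<open>hent\<close> and \<open>cent\<close>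
  extracting their data. The following operations build codes from functions; the rules
  \<open>oent_ext\<close>, \<open>vent_ext\<close>, \<open>hent_ext\<close> and \<open>cent_ext\<close> below state that a code is determined by its boundary
  and entries.
\<close>

definition mkO :: "'V \<Rightarrow> ('V \<Rightarrow> 'V) \<Rightarrow> 'V" where
  "mkO I a = vlist [I, vfam (elts I) a]"

definition mkV :: "'V \<Rightarrow> 'V \<Rightarrow> ('V \<Rightarrow> 'V) \<Rightarrow> ('V \<Rightarrow> 'V) \<Rightarrow> 'V" where
  "mkV x y v f = vlist [x, y, vfam (idx x) v, vfam (idx x) f]"

definition mkH :: "'V \<Rightarrow> 'V \<Rightarrow> ('V \<Rightarrow> 'V \<Rightarrow> 'V) \<Rightarrow> 'V" where
  "mkH x y g = vlist [x, y, vfam (tuples [x, y]) (\<lambda>s. g (part 0 s) (part 1 s))]"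

definition mkC :: "'V list \<Rightarrow> 'V \<Rightarrow> 'V \<Rightarrow> 'V \<Rightarrow> ('V list \<Rightarrow> 'V) \<Rightarrow> 'V" where
  "mkC Js \<Delta> l r c = vlist [vlist Js, \<Delta>, l, r, vfam (tuples (vertices (part 0 l) Js)) (\<lambda>s. c (unlist s))]"

lemma mkO_sel [simp]: "part 0 (mkO I a) = I" "idx (mkO I a) = elts I" "i \<in> elts I \<Longrightarrow> oent (mkO I a) i = a i"
  by (auto simp: mkO_def idx_def oent_def)

lemma mkV_sel [simp]: "part 0 (mkV x y v f) = x" "part (Suc 0) (mkV x y v f) = y"
  "i \<in> idx x \<Longrightarrow> vidx (mkV x y v f) i = v i" "i \<in> idx x \<Longrightarrow> vent (mkV x y v f) i = f i"
  by (auto simp: mkV_def vidx_def vent_def)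

lemma mkH_sel [simp]: "part 0 (mkH x y g) = x" "part (Suc 0) (mkH x y g) = y"
  "\<lbrakk>i \<in> idx x; j \<in> idx y\<rbrakk> \<Longrightarrow> hent (mkH x y g) i j = g i j"
  by (auto simp: mkH_def hent_def in_tuples set_Cons_def)

lemma mkC_sel [simp]: "mat_ctop (mkC Js \<Delta> l r c) = Js" "part 0 (mkC Js \<Delta> l r c) = vlist Js"
  "part (Suc 0) (mkC Js \<Delta> l r c) = \<Delta>" "part 2 (mkC Js \<Delta> l r c) = l" "part 3 (mkC Js \<Delta> l r c) = r"
  "\<lbrakk>i \<in> idx (part 0 l); tails Js s\<rbrakk> \<Longrightarrow> cent (mkC Js \<Delta> l r c) (i # s) = c (i # s)"
  by (auto simp: mkC_def cent_def mat_ctop_def in_tuples listset_vertices)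

lemma mkO_in: "mkO I a \<in> mat_Ob A \<longleftrightarrow> I \<in> elts U1 \<and> (\<forall>i\<in>elts I. a i \<in> Ob A)"
  by (auto simp: mkO_def mat_Ob_def)

lemma mkV_in: "mkV x y v f \<in> mat_Ver A \<longleftrightarrow> x \<in> mat_Ob A \<and> y \<in> mat_Ob A
    \<and> (\<forall>i\<in>idx x. v i \<in> idx y \<and> ver A (f i) (oent x i) (oent y (v i)))"
  by (auto simp: mkV_def mat_Ver_def)

lemma mkH_in: "mkH x y g \<in> mat_Hor A \<longleftrightarrow> x \<in> mat_Ob A \<and> y \<in> mat_Ob A
    \<and> (\<forall>i\<in>idx x. \<forall>j\<in>idx y. g i j \<in> Hor A \<and> hsrc A (g i j) = oent x i \<and> htrg A (g i j) = oent y j)"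
  by (simp add: mkH_def mat_Hor_def ball_tuples2)

abbreviation mpath :: "'V VDC \<Rightarrow> 'V \<Rightarrow> 'V list \<Rightarrow> 'V \<Rightarrow> bool" where
  "mpath A \<equiv> chain (mat_Ob A) (mat_Hor A) (part 0) (part (Suc 0))"

lemma mkC_in: "mkC Js \<Delta> l r c \<in> mat_Cell A \<longleftrightarrow> \<Delta> \<in> mat_Hor A \<and> l \<in> mat_Ver A \<and> r \<in> mat_Ver A
     \<and> mpath A (part 0 l) Js (part 0 r) \<and> part 0 \<Delta> = part (Suc 0) l \<and> part (Suc 0) \<Delta> = part (Suc 0) r
     \<and> (\<forall>i\<in>idx (part 0 l). \<forall>s. tails Js s \<longrightarrow> cell A (c (i # s)) (mat_entry Js (i # s))
          (hent \<Delta> (vidx l i) (vidx r (last (i # s)))) (vent l i) (vent r (last (i # s))))"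
proof -
  let ?T = "\<lambda>s. let is = unlist s in {\<xi>. cell A \<xi> (mat_entry Js is) (hent \<Delta> (vidx l (hd is)) (vidx r (last is))) (vent l (hd is)) (vent r (last is))}"
  have "vfam (tuples (vertices (part 0 l) Js)) (\<lambda>s. c (unlist s)) \<in> vfams (tuples (vertices (part 0 l) Js)) ?T
    \<longleftrightarrow> (\<forall>i\<in>idx (part 0 l). \<forall>s. tails Js s \<longrightarrow> cell A (c (i # s)) (mat_entry Js (i # s))
          (hent \<Delta> (vidx l i) (vidx r (last (i # s)))) (vent l i) (vent r (last (i # s))))"
    by (simp add: ball_tuples_vertices Let_def)
  then show ?thesis unfolding mkC_def mat_Cell_def by (simp add: One_nat_def)
qed

lemma mat_Ob_eta: assumes "x \<in> mat_Ob A" shows "mkO (part 0 x) (oent x) = x"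
proof -
  obtain I a where x: "x = vlist [I, a]" "a = vfam (elts I) (vapp a)" using assms by (auto simp: mat_Ob_def vfams_iff)
  then show ?thesis by (auto simp: mkO_def oent_def cong: vfam_cong)
qed

lemma mat_Ver_eta: assumes "g \<in> mat_Ver A" shows "mkV (part 0 g) (part (Suc 0) g) (vidx g) (vent g) = g"
proof -
  obtain x y v f where g: "g = vlist [x, y, v, f]" "v = vfam (idx x) (vapp v)" "f = vfam (idx x) (vapp f)"
    using assms by (auto simp: mat_Ver_def vfams_iff)
  have "vidx g = vapp v" "vent g = vapp f" by (auto simp: g(1) vidx_def vent_def)
  then show ?thesis using g(2,3) by (simp add: mkV_def g(1))
qed

lemma mat_Hor_eta: assumes "J \<in> mat_Hor A" shows "mkH (part 0 J) (part (Suc 0) J) (hent J) = J"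
proof -
  obtain x y g where g: "J = vlist [x, y, g]" "g = vfam (tuples [x, y]) (vapp g)"
    using assms by (auto simp: mat_Hor_def vfams_iff)
  have "vfam (tuples [x, y]) (\<lambda>s. hent J (part 0 s) (part 1 s)) = vfam (tuples [x, y]) (vapp g)"
    by (rule vfam_cong) (auto simp: in_tuples set_Cons_def g(1) hent_def)
  then show ?thesis using g(2) by (simp add: mkH_def g(1))
qed

lemma mat_Cell_eta: assumes "q \<in> mat_Cell A"
  shows "mkC (mat_ctop q) (part (Suc 0) q) (part 2 q) (part 3 q) (cent q) = q"
proof -
  obtain Js \<Delta> l r c T where g: "q = vlist [vlist Js, \<Delta>, l, r, c]" "c \<in> vfams (tuples (vertices (part 0 l) Js)) T"
    using assms unfolding mat_Cell_def by blast
  have "vfam (tuples (vertices (part 0 l) Js)) (\<lambda>s. cent q (unlist s)) = vfam (tuples (vertices (part 0 l) Js)) (vapp c)"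
    by (rule vfam_cong) (auto simp: in_tuples g(1) cent_def)
  then show ?thesis using g(2) by (simp add: mkC_def g(1) vfams_iff mat_ctop_def)
qed

lemma oent_ext:
  assumes "x \<in> mat_Ob A" "y \<in> mat_Ob B" "part 0 x = part 0 y" "\<And>i. i \<in> idx x \<Longrightarrow> oent x i = oent y i"
  shows "x = y"
proof -
  have "mkO (part 0 x) (oent x) = mkO (part 0 y) (oent y)"
    unfolding mkO_def using assms(3,4) by (simp add: vfam_eq_iff idx_def)
  then show ?thesis using mat_Ob_eta[OF assms(1)] mat_Ob_eta[OF assms(2)] by simp
qed

lemma vent_ext:
  assumes "g \<in> mat_Ver A" "h \<in> mat_Ver B" "part 0 g = part 0 h" "part (Suc 0) g = part (Suc 0) h"
    "\<And>i. i \<in> idx (part 0 g) \<Longrightarrow> vidx g i = vidx h i" "\<And>i. i \<in> idx (part 0 g) \<Longrightarrow> vent g i = vent h i"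
  shows "g = h"
proof -
  have "mkV (part 0 g) (part (Suc 0) g) (vidx g) (vent g) = mkV (part 0 h) (part (Suc 0) h) (vidx h) (vent h)"
    unfolding mkV_def using assms(3-6) by (simp add: vfam_eq_iff)
  then show ?thesis using mat_Ver_eta[OF assms(1)] mat_Ver_eta[OF assms(2)] by simp
qed

lemma hent_ext:
  assumes "g \<in> mat_Hor A" "h \<in> mat_Hor B" "part 0 g = part 0 h" "part (Suc 0) g = part (Suc 0) h"
    "\<And>i j. \<lbrakk>i \<in> idx (part 0 g); j \<in> idx (part (Suc 0) g)\<rbrakk> \<Longrightarrow> hent g i j = hent h i j"
  shows "g = h"
proof -
  have "mkH (part 0 g) (part (Suc 0) g) (hent g) = mkH (part 0 h) (part (Suc 0) h) (hent h)"
    unfolding mkH_def using assms(3-5) by (simp add: vfam_eq_iff ball_tuples2)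
  then show ?thesis using mat_Hor_eta[OF assms(1)] mat_Hor_eta[OF assms(2)] by simp
qed

lemma cent_ext:
  assumes "g \<in> mat_Cell A" "h \<in> mat_Cell B" "mat_ctop g = mat_ctop h" "part (Suc 0) g = part (Suc 0) h"
    "part 2 g = part 2 h" "part 3 g = part 3 h"
    "\<And>i r. \<lbrakk>i \<in> idx (part 0 (part 2 g)); tails (mat_ctop g) r\<rbrakk> \<Longrightarrow> cent g (i # r) = cent h (i # r)"
  shows "g = h"
proof -
  have "mkC (mat_ctop g) (part (Suc 0) g) (part 2 g) (part 3 g) (cent g) = mkC (mat_ctop h) (part (Suc 0) h) (part 2 h) (part 3 h) (cent h)"
    unfolding mkC_def using assms(3-7) by (simp add: vfam_eq_iff ball_tuples_vertices)
  then show ?thesis using mat_Cell_eta[OF assms(1)] mat_Cell_eta[OF assms(2)] by simp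
qed

lemma mat_ObD: assumes "x \<in> mat_Ob A" shows "part 0 x \<in> elts U1" "\<And>i. i \<in> idx x \<Longrightarrow> oent x i \<in> Ob A"
  using assms mkO_in[of "part 0 x" "oent x"] mat_Ob_eta[OF assms] by (auto simp: idx_def)

lemma mat_VerD: assumes "g \<in> mat_Ver A"
  shows "part 0 g \<in> mat_Ob A" "part (Suc 0) g \<in> mat_Ob A"
    "\<And>i. i \<in> idx (part 0 g) \<Longrightarrow> vidx g i \<in> idx (part (Suc 0) g)"
    "\<And>i. i \<in> idx (part 0 g) \<Longrightarrow> ver A (vent g i) (oent (part 0 g) i) (oent (part (Suc 0) g) (vidx g i))"
  using assms mkV_in[of "part 0 g" "part (Suc 0) g" "vidx g" "vent g" A] mat_Ver_eta[OF assms] by auto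

lemma mat_HorD: assumes "J \<in> mat_Hor A"
  shows "part 0 J \<in> mat_Ob A" "part (Suc 0) J \<in> mat_Ob A"
    "\<And>i j. \<lbrakk>i \<in> idx (part 0 J); j \<in> idx (part (Suc 0) J)\<rbrakk> \<Longrightarrow> hent J i j \<in> Hor A"
    "\<And>i j. \<lbrakk>i \<in> idx (part 0 J); j \<in> idx (part (Suc 0) J)\<rbrakk> \<Longrightarrow> hsrc A (hent J i j) = oent (part 0 J) i"
    "\<And>i j. \<lbrakk>i \<in> idx (part 0 J); j \<in> idx (part (Suc 0) J)\<rbrakk> \<Longrightarrow> htrg A (hent J i j) = oent (part (Suc 0) J) j"
  using assms mkH_in[of "part 0 J" "part (Suc 0) J" "hent J" A] mat_Hor_eta[OF assms] by auto

lemma mat_CellD: assumes "q \<in> mat_Cell A"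
  shows "part (Suc 0) q \<in> mat_Hor A" "part 2 q \<in> mat_Ver A" "part 3 q \<in> mat_Ver A"
    "mpath A (part 0 (part 2 q)) (mat_ctop q) (part 0 (part 3 q))" (is ?P1)
    "part 0 (part (Suc 0) q) = part (Suc 0) (part 2 q)" (is ?P3) "part (Suc 0) (part (Suc 0) q) = part (Suc 0) (part 3 q)" (is ?P2)
    "\<And>i r. \<lbrakk>i \<in> idx (part 0 (part 2 q)); tails (mat_ctop q) r\<rbrakk> \<Longrightarrow>
       cell A (cent q (i # r)) (mat_entry (mat_ctop q) (i # r))
         (hent (part (Suc 0) q) (vidx (part 2 q) i) (vidx (part 3 q) (last (i # r)))) (vent (part 2 q) i) (vent (part 3 q) (last (i # r)))"
proof -
  have "mkC (mat_ctop q) (part (Suc 0) q) (part 2 q) (part 3 q) (cent q) \<in> mat_Cell A"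
    unfolding mat_Cell_eta[OF assms] by (rule assms)
  note m = this[unfolded mkC_in]
  show "part (Suc 0) q \<in> mat_Hor A" "part 2 q \<in> mat_Ver A" "part 3 q \<in> mat_Ver A" "?P1"
    "?P3" "?P2"
    using m by blast+
  show "cell A (cent q (i # r)) (mat_entry (mat_ctop q) (i # r))
         (hent (part (Suc 0) q) (vidx (part 2 q) i) (vidx (part 3 q) (last (i # r)))) (vent (part 2 q) i) (vent (part 3 q) (last (i # r)))"
    if "i \<in> idx (part 0 (part 2 q))" "tails (mat_ctop q) r" for i r
    using m that by blast
qed

lemma mat_sel [simp]:
  "Ob (mat A) = mat_Ob A" "Ver (mat A) = mat_Ver A" "Hor (mat A) = mat_Hor A" "Cell (mat A) = mat_Cell A"
  "g \<in> mat_Ver A \<Longrightarrow> vdom (mat A) g = part 0 g" "g \<in> mat_Ver A \<Longrightarrow> vcod (mat A) g = part (Suc 0) g"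
  "x \<in> mat_Ob A \<Longrightarrow> vid (mat A) x = mat_vid A x"
  "J \<in> mat_Hor A \<Longrightarrow> hsrc (mat A) J = part 0 J" "J \<in> mat_Hor A \<Longrightarrow> htrg (mat A) J = part (Suc 0) J"
  "q \<in> mat_Cell A \<Longrightarrow> ctop (mat A) q = mat_ctop q" "q \<in> mat_Cell A \<Longrightarrow> cbot (mat A) q = part (Suc 0) q"
  "q \<in> mat_Cell A \<Longrightarrow> clft (mat A) q = part 2 q" "q \<in> mat_Cell A \<Longrightarrow> crgt (mat A) q = part 3 q"
  "J \<in> mat_Hor A \<Longrightarrow> cid (mat A) J = mat_cid A J"
  by (simp_all add: mat_def)

lemma mat_vcomp_eq: "\<lbrakk>f \<in> mat_Ver A; g \<in> mat_Ver A; part (Suc 0) f = part 0 g\<rbrakk> \<Longrightarrow> vcomp (mat A) g f = mat_vcomp A g f"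
  by (simp add: mat_def)

lemma ver_mat: "ver (mat A) g x y \<longleftrightarrow> g \<in> mat_Ver A \<and> part 0 g = x \<and> part (Suc 0) g = y"
  by (auto simp: ver_def)

lemma cell_mat: "cell (mat A) q Js \<Delta> l r \<longleftrightarrow>
    q \<in> mat_Cell A \<and> mat_ctop q = Js \<and> part (Suc 0) q = \<Delta> \<and> part 2 q = l \<and> part 3 q = r"
  by (auto simp: cell_def)

lemma hpath_mat: "hpath (mat A) = mpath A"
  by (intro ext, unfold hpath_def mat_sel, rule chain_cong) simp

abbreviation mcpath :: "'V VDC \<Rightarrow> 'V \<Rightarrow> 'V list \<Rightarrow> 'V \<Rightarrow> bool" where
  "mcpath A \<equiv> chain (mat_Ver A) (mat_Cell A) (part 2) (part 3)"

lemma cpath_mat: "cpath (mat A) = mcpath A"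
  by (intro ext, unfold cpath_def mat_sel, rule chain_cong) simp

lemma composable_mat: "composable (mat A) \<kappa> u qs u' \<longleftrightarrow> \<kappa> \<in> mat_Cell A \<and> mcpath A u qs u'
    \<and> map (part (Suc 0)) qs = mat_ctop \<kappa> \<and> part (Suc 0) u = part 0 (part 2 \<kappa>)"
proof -
  have "map (cbot (mat A)) qs = map (part (Suc 0)) qs \<and> vcod (mat A) u = part (Suc 0) u" if "mcpath A u qs u'"
    using chain_ends[OF that] by auto
  moreover have "\<kappa> \<in> mat_Cell A \<Longrightarrow> vdom (mat A) (part 2 \<kappa>) = part 0 (part 2 \<kappa>)" using mat_CellD(2) by simp
  ultimately show ?thesis unfolding composable_def cpath_mat by (auto simp del: map_eq_conv)
qed

lemma mat_ccomp_eq: "composable (mat A) \<kappa> u qs u' \<Longrightarrow> ccomp (mat A) \<kappa> u qs = mat_ccomp A \<kappa> u qs"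
  unfolding composable_mat by (auto simp: mat_def)

lemma mat_vid_mk: "mat_vid A x = mkV x x id (\<lambda>i. vid A (oent x i))"
  by (simp add: mat_vid_def mkV_def)

lemma mat_vcomp_mk: "mat_vcomp A g f = mkV (part 0 f) (part (Suc 0) g) (\<lambda>i. vidx g (vidx f i)) (\<lambda>i. vcomp A (vent g (vidx f i)) (vent f i))"
  by (simp add: mat_vcomp_def mkV_def)

lemma mat_cid_mk: "mat_cid A J = mkC [J] J (mat_vid A (part 0 J)) (mat_vid A (part (Suc 0) J)) (\<lambda>is. cid A (hent J (is ! 0) (is ! 1)))"
  by (simp add: mat_cid_def mkC_def vertices_def mat_vid_mk flip: part_def)

section \<open>Composition of matrices\<close>

text \<open>
  When matrix multicells \<open>qs\<close> are composed with \<open>\<kappa>\<close>, a tuple \<open>i # concat rs\<close> at the top is transported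
  by the vertical sides to the tuple \<open>vidx u i # ends qs i rs\<close> at the top of \<open>\<kappa>\<close>: the last index of each
  block is moved along the right side of the corresponding multicell.
\<close>

definition ends :: "'V list \<Rightarrow> 'V \<Rightarrow> 'V list list \<Rightarrow> 'V list" where
  "ends qs i rs = map2 (\<lambda>q b. vidx (part 3 q) (last b)) qs (blk i rs)"

lemma ends_simps [simp]: "ends [] i rs = []"
  "ends (q # qs) i (r # rs) = vidx (part 3 q) (last (i # r)) # ends qs (last (i # r)) rs"
  by (simp_all add: ends_def)

definition tailss :: "'V list \<Rightarrow> 'V list list \<Rightarrow> bool" where
  "tailss qs rs \<longleftrightarrow> list_all2 (\<lambda>r q. tails (mat_ctop q) r) rs qs"

lemma tailss_simps [simp]: "tailss [] rs \<longleftrightarrow> rs = []"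
  "tailss (q # qs) rs \<longleftrightarrow> (\<exists>r rs'. rs = r # rs' \<and> tails (mat_ctop q) r \<and> tailss qs rs')"
  by (auto simp: tailss_def list_all2_Cons2)

lemma tailss_length: "tailss qs rs \<Longrightarrow> length rs = length qs"
  by (auto simp: tailss_def dest: list_all2_lengthD)

lemma tails_concat_ctop: "tails (concat (map mat_ctop qs)) r \<longleftrightarrow> (\<exists>rs. r = concat rs \<and> tailss qs rs)"
  by (simp add: tails_concat tailss_def list_all2_map2)

lemma tailss_concat: "tailss (concat \<xi>ss) rs \<longleftrightarrow> (\<exists>rss. rs = concat rss \<and> list_all2 (\<lambda>rs \<xi>s. tailss \<xi>s rs) rss \<xi>ss)"
  by (simp add: tailss_def list_all2_concat)

lemma blocks_ctop: assumes "tailss qs rs" shows "blocks (map (length \<circ> mat_ctop) qs) (i # concat rs) = blk i rs"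
proof -
  have "map (length \<circ> mat_ctop) qs = map length rs"
    using assms by (induction qs arbitrary: rs) (auto simp: tails_length)
  then show ?thesis by (simp add: blocks_blk)
qed

lemma tails_last: "\<lbrakk>mpath A x Js y; i \<in> idx x; tails Js r\<rbrakk> \<Longrightarrow> last (i # r) \<in> idx y"
  by (induction Js arbitrary: x i r) auto

text \<open>
  For a fixed tuple of indices, the entries of a path of matrix multicells form a path in \<open>A\<close>. The
  vertices are the entries of the sides at the indices where the blocks meet.
\<close>

lemma path_components:
  assumes "mcpath A u qs u'" "i \<in> idx (part 0 u)" "tailss qs rs"
  shows "last (i # concat rs) \<in> idx (part 0 u')"
    "cpath A (vent u i) (map2 cent qs (blk i rs)) (vent u' (last (i # concat rs)))" (is ?P3)
    "map (cbot A) (map2 cent qs (blk i rs)) = mat_entry (map (part (Suc 0)) qs) (vidx u i # ends qs i rs)" (is ?P1)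
    "map (ctop A) (map2 cent qs (blk i rs)) = map2 mat_entry (map mat_ctop qs) (blk i rs)" (is ?P2)
    "tails (map (part (Suc 0)) qs) (ends qs i rs)" (is ?P5)
    "last (vidx u i # ends qs i rs) = vidx u' (last (i # concat rs))" (is ?P4)
proof -
  have "last (i # concat rs) \<in> idx (part 0 u') \<and>
    ?P3 \<and> ?P1 \<and> ?P2 \<and> ?P5 \<and> ?P4"
    using assms
  proof (induction qs arbitrary: u i rs)
    case Nil
    then show ?case using mat_VerD(4)[of u] by (auto simp: cpath_def ver_def)
  next
    case (Cons q qs)
    then obtain r rs' where r: "rs = r # rs'" "tails (mat_ctop q) r" "tailss qs rs'" by auto
    have q: "u \<in> mat_Ver A" "q \<in> mat_Cell A" "part 2 q = u" "mcpath A (part 3 q) qs u'" using Cons.prems(1) by auto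
    note d = mat_CellD[OF q(2), unfolded q(3)]
    have l: "last (i # r) \<in> idx (part 0 (part 3 q))" by (rule tails_last[OF d(4) Cons.prems(2) r(2)])
    note IH = Cons.IH[OF q(4) l r(3)]
    note c = d(7)[OF Cons.prems(2) r(2)]
    have e: "last (last (i # r) # concat rs') = last (i # concat rs)" by (simp add: r(1) last_append)
    have v: "vent u i \<in> Ver A" using mat_VerD(4)[OF q(1) Cons.prems(2)] by (simp add: ver_def)
    have m: "vidx (part 3 q) (last (i # r)) \<in> idx (part (Suc 0) (part (Suc 0) q))"
      using mat_VerD(3)[OF d(3) l] d(6) by simp
    show ?case using IH c cellD[OF c] v m unfolding e by (simp add: r(1) cpath_def del: last.simps) (simp add: last_ConsR)
  qed
  then show "last (i # concat rs) \<in> idx (part 0 u')" "?P3"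
    "?P1" "?P2"
    "?P5" "?P4" by blast+
qed

lemma mat_ccomp_mk:
  assumes "mcpath A u qs u'"
  shows "mat_ccomp A \<kappa> u qs = mkC (concat (map mat_ctop qs)) (part (Suc 0) \<kappa>) (mat_vcomp A (part 2 \<kappa>) u) (mat_vcomp A (part 3 \<kappa>) u')
    (\<lambda>is. let bs = blocks (map (length \<circ> mat_ctop) qs) is;
              js = vidx u (hd is) # map2 (\<lambda>q b. vidx (part 3 q) (last b)) qs bs
          in ccomp A (cent \<kappa> js) (vent u (hd is)) (map2 cent qs bs))"
proof -
  have "u' = (if qs = [] then u else part 3 (last qs))"
    using chain_end[OF assms] by (simp add: last_map)
  then show ?thesis by (simp add: mat_ccomp_def mkC_def Let_def mat_vcomp_mk)
qed

lemma composable_components: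
  assumes "composable (mat A) \<kappa> u qs u'" "i \<in> idx (part 0 u)" "tailss qs rs"
  shows "composable A (cent \<kappa> (vidx u i # ends qs i rs)) (vent u i) (map2 cent qs (blk i rs)) (vent u' (last (i # concat rs)))"
proof -
  have k: "\<kappa> \<in> mat_Cell A" "mcpath A u qs u'" "map (part (Suc 0)) qs = mat_ctop \<kappa>" "part (Suc 0) u = part 0 (part 2 \<kappa>)"
    using assms(1) by (auto simp: composable_mat)
  note p = path_components[OF k(2) assms(2,3)]
  note u = mat_VerD[OF chain_ends(1)[OF k(2)]]
  have j: "vidx u i \<in> idx (part 0 (part 2 \<kappa>))" using u(3)[OF assms(2)] k(4) by simp
  note c = mat_CellD(7)[OF k(1) j p(5)[unfolded k(3)]]
  show ?thesis
    using p(2,3) k(3,4) cellD[OF c] u(4)[OF assms(2)] mat_VerD(4)[OF mat_CellD(2)[OF k(1)] j]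
    by (simp add: composable_def ver_def del: last.simps)
qed

text \<open>
  Composition of matrices is componentwise: each entry of a composite is the composite in \<open>A\<close> of the
  entries at the blocks and at the transported tuple. All equations between composites of matrices
  are reduced to equations in \<open>A\<close> by this lemma together with \<open>composable_components\<close>.
\<close>

lemma cent_mat_ccomp:
  assumes "composable (mat A) \<kappa> u qs u'" "i \<in> idx (part 0 u)" "tailss qs rs"
  shows "cent (mat_ccomp A \<kappa> u qs) (i # concat rs)
    = ccomp A (cent \<kappa> (vidx u i # ends qs i rs)) (vent u i) (map2 cent qs (blk i rs))"
proof -
  have "mcpath A u qs u'" using assms(1) by (auto simp: composable_mat)
  moreover have "tails (concat (map mat_ctop qs)) (concat rs)" using assms(3) by (auto simp: tails_concat_ctop)
  ultimately show ?thesis using assms(2,3)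
    by (simp add: mat_ccomp_mk mat_vcomp_mk blocks_ctop ends_def Let_def)
qed

lemma mat_vcomp_in:
  assumes "vdc A" "f \<in> mat_Ver A" "g \<in> mat_Ver A" "part (Suc 0) f = part 0 g" shows "mat_vcomp A g f \<in> mat_Ver A"
proof -
  interpret virtual_double_category A by fact
  note f = mat_VerD[OF assms(2), unfolded assms(4)] and g = mat_VerD[OF assms(3)]
  show ?thesis unfolding mat_vcomp_mk mkV_in using f g vcomp_ver[OF f(4) g(4)[OF f(3)]] by auto
qed

lemma mat_vcomp_sel [simp]:
  "part 0 (mat_vcomp A g f) = part 0 f" "part (Suc 0) (mat_vcomp A g f) = part (Suc 0) g"
  "i \<in> idx (part 0 f) \<Longrightarrow> vidx (mat_vcomp A g f) i = vidx g (vidx f i)"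
  "i \<in> idx (part 0 f) \<Longrightarrow> vent (mat_vcomp A g f) i = vcomp A (vent g (vidx f i)) (vent f i)"
  by (simp_all add: mat_vcomp_mk)

lemma mat_vid_sel [simp]:
  "part 0 (mat_vid A x) = x" "part (Suc 0) (mat_vid A x) = x" "i \<in> idx x \<Longrightarrow> vidx (mat_vid A x) i = i"
  "i \<in> idx x \<Longrightarrow> vent (mat_vid A x) i = vid A (oent x i)"
  by (simp_all add: mat_vid_mk)

lemma mat_vid_in: assumes "vdc A" "x \<in> mat_Ob A" shows "mat_vid A x \<in> mat_Ver A"
proof -
  interpret virtual_double_category A by fact
  show ?thesis unfolding mat_vid_mk mkV_in using assms(2) mat_ObD[OF assms(2)] vid_ver by auto
qed

lemma mat_composable_boundary:
  assumes "composable (mat A) \<kappa> u qs u'"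
  shows "mpath A (part 0 u) (concat (map mat_ctop qs)) (part 0 u')" (is ?P1) "part (Suc 0) u' = part 0 (part 3 \<kappa>)"
proof -
  have k: "\<kappa> \<in> mat_Cell A" "mcpath A u qs u'" "map (part (Suc 0)) qs = mat_ctop \<kappa>" "part (Suc 0) u = part 0 (part 2 \<kappa>)"
    using assms by (auto simp: composable_mat)
  have pc: "?P1 \<and> mpath A (part (Suc 0) u) (map (part (Suc 0)) qs) (part (Suc 0) u')"
    using k(2)
  proof (induction qs arbitrary: u)
    case Nil then show ?case using mat_VerD by auto
  next
    case (Cons q qs)
    then have q: "q \<in> mat_Cell A" "part 2 q = u" "mcpath A (part 3 q) qs u'" by auto
    note e = mat_CellD[OF q(1), unfolded q(2)]
    show ?case using Cons.IH[OF q(3)] e mat_VerD[OF e(2)] by (auto simp: chain_append)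
  qed
  then show "?P1" by blast
  show "part (Suc 0) u' = part 0 (part 3 \<kappa>)"
    using chain_det[OF _ mat_CellD(4)[OF k(1)]] pc unfolding k(3,4) by blast
qed

lemma mat_ccomp_cell:
  assumes "vdc A" "composable (mat A) \<kappa> u qs u'"
  shows "cell (mat A) (mat_ccomp A \<kappa> u qs) (concat (map mat_ctop qs)) (part (Suc 0) \<kappa>)
    (mat_vcomp A (part 2 \<kappa>) u) (mat_vcomp A (part 3 \<kappa>) u')"
proof -
  interpret virtual_double_category A by fact
  have k: "\<kappa> \<in> mat_Cell A" "mcpath A u qs u'" "map (part (Suc 0)) qs = mat_ctop \<kappa>" "part (Suc 0) u = part 0 (part 2 \<kappa>)"
    using assms(2) by (auto simp: composable_mat)
  note d = mat_CellD[OF k(1)] and uu = chain_ends[OF k(2)]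
  note r = mat_composable_boundary(2)[OF assms(2)]
  note vl = mat_vcomp_in[OF assms(1) uu(1) d(2) k(4)] and vr = mat_vcomp_in[OF assms(1) uu(2) d(3) r]
  have "mat_ccomp A \<kappa> u qs \<in> mat_Cell A"
    unfolding mat_ccomp_mk[OF k(2)] mkC_in
  proof (intro conjI ballI allI impI d(1) vl vr)
    fix i s assume i: "i \<in> idx (part 0 (mat_vcomp A (part 2 \<kappa>) u))" and s: "tails (concat (map mat_ctop qs)) s"
    have i: "i \<in> idx (part 0 u)" using i by simp
    obtain rs where rs: "s = concat rs" "tailss qs rs" using s by (auto simp: tails_concat_ctop)
    note p = path_components[OF k(2) i rs(2)]
    have j: "vidx u i \<in> idx (part 0 (part 2 \<kappa>))" using mat_VerD(3)[OF uu(1) i] k(4) by simp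
    note c = ccomp_cell[OF composable_components[OF assms(2) i rs(2)]]
    note ck = d(7)[OF j p(5)[unfolded k(3)]]
    have len: "list_all2 (\<lambda>r Js. length r = length Js) rs (map mat_ctop qs)"
      using rs(2) unfolding tailss_def list_all2_map2 by (rule list_all2_mono) (simp add: tails_length)
    show "cell A (let bs = blocks (map (length \<circ> mat_ctop) qs) (i # s); js = vidx u (hd (i # s)) # map2 (\<lambda>q b. vidx (part 3 q) (last b)) qs bs
              in ccomp A (cent \<kappa> js) (vent u (hd (i # s))) (map2 cent qs bs))
       (mat_entry (concat (map mat_ctop qs)) (i # s))
       (hent (part (Suc 0) \<kappa>) (vidx (mat_vcomp A (part 2 \<kappa>) u) i) (vidx (mat_vcomp A (part 3 \<kappa>) u') (last (i # s))))
       (vent (mat_vcomp A (part 2 \<kappa>) u) i) (vent (mat_vcomp A (part 3 \<kappa>) u') (last (i # s)))"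
      using c i p cellD[OF ck] by (simp add: rs blocks_ctop ends_def[symmetric] mat_entry_concat[OF len] del: last.simps)
  qed (use mat_composable_boundary(1)[OF assms(2)] d r k(4) in auto)
  then show ?thesis unfolding cell_mat by (simp add: mat_ccomp_mk[OF k(2)])
qed

lemma mat_cid_cell:
  assumes "vdc A" "J \<in> mat_Hor A"
  shows "cell (mat A) (mat_cid A J) [J] J (mat_vid A (part 0 J)) (mat_vid A (part (Suc 0) J))"
proof -
  interpret virtual_double_category A by fact
  note d = mat_HorD[OF assms(2)]
  have "mat_cid A J \<in> mat_Cell A"
    unfolding mat_cid_mk mkC_in using assms(2) d mat_vid_in[OF assms(1)] cid_cell[OF d(3)] by auto
  then show ?thesis unfolding cell_mat by (simp add: mat_cid_mk)
qed

lemma cent_mat_cid: "\<lbrakk>i \<in> idx (part 0 J); j \<in> idx (part (Suc 0) J)\<rbrakk> \<Longrightarrow> cent (mat_cid A J) [i, j] = cid A (hent J i j)"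
  by (simp add: mat_cid_mk)

lemma multicell_composition_mat: assumes "vdc A" shows "multicell_composition (mat A)"
proof (unfold_locales, goal_cases)
  case (1 q) then show ?case using mat_CellD[of q A] by (simp add: hpath_mat)
next
  case (5 f a b g c)
  then show ?case using mat_vcomp_in[OF assms, of f g] by (auto simp: ver_mat mat_vcomp_eq)
next
  case (6 \<kappa> u qs u')
  have "q \<in> set qs \<Longrightarrow> q \<in> mat_Cell A" for q using composable_path(7)[OF 6] by auto
  then have "map (ctop (mat A)) qs = map mat_ctop qs" by simp
  moreover have "mat_vcomp A (part 2 \<kappa>) u = vcomp (mat A) (part 2 \<kappa>) u" "mat_vcomp A (part 3 \<kappa>) u' = vcomp (mat A) (part 3 \<kappa>) u'"
    using 6 chain_ends[of "mat_Ver A" "mat_Cell A" "part 2" "part 3" u qs u'] mat_CellD(2,3)[of \<kappa> A] mat_composable_boundary(2)[OF 6]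
    unfolding composable_mat by (simp_all add: mat_vcomp_eq)
  ultimately show ?case using mat_ccomp_cell[OF assms 6] composable_path(2)[OF 6] by (simp add: mat_ccomp_eq[OF 6] del: map_eq_conv)
qed (use mat_CellD in auto)

text \<open>
  The tuple seen by a row of unary multicells: each block consists of two neighbouring indices. For
  identity cells this gives the unit law \<open>mat_ccomp_id_right\<close>.
\<close>

lemma unary_tops:
  assumes "mpath A x Js y" "i \<in> idx x" "tails Js r"
    and c: "\<And>J j. \<lbrakk>J \<in> mat_Hor A; j \<in> idx (part (Suc 0) J)\<rbrakk> \<Longrightarrow> tails (mat_ctop (c J)) [j] \<and> vidx (part 3 (c J)) j = j"
    and c': "\<And>J i j. \<lbrakk>J \<in> mat_Hor A; i \<in> idx (part 0 J); j \<in> idx (part (Suc 0) J)\<rbrakk> \<Longrightarrow> cent (c J) [i, j] = c' (hent J i j)"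
  shows "tailss (map c Js) (map (\<lambda>j. [j]) r)" (is ?P3) "ends (map c Js) i (map (\<lambda>j. [j]) r) = r" (is ?P2)
    "map2 cent (map c Js) (blk i (map (\<lambda>j. [j]) r)) = map c' (mat_entry Js (i # r))" (is ?P1)
proof -
  have "?P3 \<and> ?P2 \<and> ?P1"
    using assms(1-3)
  proof (induction Js arbitrary: x i r)
    case (Cons J Js)
    then obtain j s where r: "r = j # s" "j \<in> idx (part (Suc 0) J)" "tails Js s" by auto
    have h: "J \<in> mat_Hor A" "part 0 J = x" "mpath A (part (Suc 0) J) Js y" using Cons.prems by auto
    show ?case using Cons.IH[OF h(3) r(2,3)] c[OF h(1) r(2)] c'[OF h(1) _ r(2), of i] h(2) r(1) Cons.prems(2) by simp
  qed simp
  then show "?P3" "?P2" "?P1" by auto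
qed

lemma mat_vcomp_id_left: assumes "vdc A" "f \<in> mat_Ver A" shows "mat_vcomp A (mat_vid A (part (Suc 0) f)) f = f"
proof -
  interpret virtual_double_category A by fact
  note f = mat_VerD[OF assms(2)]
  show ?thesis
    by (rule vent_ext[OF mat_vcomp_in[OF assms(1,2) mat_vid_in[OF assms(1) f(2)]] assms(2)])
      (use f vcomp_id_left[OF f(4)] in auto)
qed

lemma mat_vcomp_id_right: assumes "vdc A" "f \<in> mat_Ver A" shows "mat_vcomp A f (mat_vid A (part 0 f)) = f"
proof -
  interpret virtual_double_category A by fact
  note f = mat_VerD[OF assms(2)]
  show ?thesis
    by (rule vent_ext[OF mat_vcomp_in[OF assms(1) mat_vid_in[OF assms(1) f(1)] assms(2)] assms(2)])
      (use f vcomp_id_right[OF f(4)] in auto)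
qed

lemma mat_ccomp_id_left:
  assumes "vdc A" "q \<in> mat_Cell A"
  shows "ccomp (mat A) (mat_cid A (part (Suc 0) q)) (part 2 q) [q] = q"
proof -
  interpret virtual_double_category A by fact
  note d = mat_CellD[OF assms(2)]
  note ci = mat_cid_cell[OF assms(1) d(1), unfolded cell_mat]
  let ?\<kappa> = "mat_cid A (part (Suc 0) q)"
  have k: "composable (mat A) ?\<kappa> (part 2 q) [q] (part 3 q)"
    unfolding composable_mat using ci assms(2) d by simp
  note cc = mat_ccomp_cell[OF assms(1) k, unfolded cell_mat]
  have "mat_ccomp A ?\<kappa> (part 2 q) [q] = q"
  proof (rule cent_ext[of _ A _ A])
    fix i r assume "i \<in> idx (part 0 (part 2 (mat_ccomp A ?\<kappa> (part 2 q) [q])))" "tails (mat_ctop (mat_ccomp A ?\<kappa> (part 2 q) [q])) r"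
    then have i: "i \<in> idx (part 0 (part 2 q))" and r: "tails (mat_ctop q) r" using cc by simp_all
    note c = d(7)[OF i r]
    have "vidx (part 2 q) i \<in> idx (part 0 (part (Suc 0) q))" "vidx (part 3 q) (last (i # r)) \<in> idx (part (Suc 0) (part (Suc 0) q))"
      using mat_VerD(3)[OF d(2) i] mat_VerD(3)[OF d(3) tails_last[OF d(4) i r]] d(5,6) by simp_all
    then show "cent (mat_ccomp A ?\<kappa> (part 2 q) [q]) (i # r) = cent q (i # r)"
      using cent_mat_ccomp[OF k i, of "[r]"] r ucomp_id_left[OF c] cellD(4)[OF c]
      by (simp add: cent_mat_cid ucomp_def del: last.simps)
  qed (use cc assms mat_vcomp_id_left[OF assms(1) d(2)] mat_vcomp_id_left[OF assms(1) d(3)] ci d in auto)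
  then show ?thesis by (simp add: mat_ccomp_eq[OF k])
qed

lemma mat_ccomp_id_right:
  assumes "vdc A" "q \<in> mat_Cell A"
  shows "ccomp (mat A) q (mat_vid A (part 0 (part 2 q))) (map (mat_cid A) (mat_ctop q)) = q"
proof -
  interpret virtual_double_category A by fact
  note d = mat_CellD[OF assms(2)]
  note l = mat_VerD[OF d(2)] and r = mat_VerD[OF d(3)]
  let ?u = "mat_vid A (part 0 (part 2 q))" and ?qs = "map (mat_cid A) (mat_ctop q)"
  have p: "mcpath A ?u ?qs (mat_vid A (part 0 (part 3 q)))"
    using mat_vid_in[OF assms(1)] mat_cid_cell[OF assms(1)] by (intro chain_map[OF d(4)]) (auto simp: cell_mat)
  have sel: "mat_ctop (mat_cid A J) = [J]" "part (Suc 0) (mat_cid A J) = J" "part 3 (mat_cid A J) = mat_vid A (part (Suc 0) J)" for J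
    by (simp_all add: mat_cid_mk)
  have k: "composable (mat A) q ?u ?qs (mat_vid A (part 0 (part 3 q)))"
    unfolding composable_mat using p assms(2) by (simp add: sel comp_def)
  note cc = mat_ccomp_cell[OF assms(1) k, unfolded cell_mat]
  have top: "concat (map mat_ctop ?qs) = mat_ctop q" by (simp add: sel comp_def concat_map_singleton)
  have "mat_ccomp A q ?u ?qs = q"
  proof (rule cent_ext[of _ A _ A])
    fix i r assume "i \<in> idx (part 0 (part 2 (mat_ccomp A q ?u ?qs)))" "tails (mat_ctop (mat_ccomp A q ?u ?qs)) r"
    then have i: "i \<in> idx (part 0 (part 2 q))" and r: "tails (mat_ctop q) r" using cc top by simp_all
    note c = d(7)[OF i r]
    have u: "tailss ?qs (map (\<lambda>j. [j]) r)" "ends ?qs i (map (\<lambda>j. [j]) r) = r"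
      "map2 cent ?qs (blk i (map (\<lambda>j. [j]) r)) = map (cid A) (mat_entry (mat_ctop q) (i # r))"
      by (rule unary_tops[OF d(4) i r]; simp add: sel cent_mat_cid)+
    have "vdom A (vent (part 2 q) i) = oent (part 0 (part 2 q)) i" using l(4)[OF i] by (simp add: ver_def)
    then show "cent (mat_ccomp A q ?u ?qs) (i # r) = cent q (i # r)"
      using cent_mat_ccomp[OF k _ u(1), of i] i ccomp_id_right[OF cellD(1)[OF c]] cellD[OF c]
      by (simp add: u(2,3))
  qed (use cc top assms mat_vcomp_id_right[OF assms(1) d(2)] mat_vcomp_id_right[OF assms(1) d(3)] in auto)
  then show ?thesis by (simp add: mat_ccomp_eq[OF k])
qed

lemma mat_vcomp_assoc:
  assumes "vdc A" "w \<in> mat_Ver A" "f \<in> mat_Ver A" "g \<in> mat_Ver A" "part (Suc 0) w = part 0 f" "part (Suc 0) f = part 0 g"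
  shows "mat_vcomp A (mat_vcomp A g f) w = mat_vcomp A g (mat_vcomp A f w)"
proof -
  interpret A: virtual_double_category A by fact
  note that = assms(2-6)
  show ?thesis
  proof (rule vent_ext[OF mat_vcomp_in[OF assms(1) that(1) mat_vcomp_in[OF assms(1) that(2,3,5)]] mat_vcomp_in[OF assms(1) mat_vcomp_in[OF assms(1) that(1,2,4)] that(3)]])
    fix i assume "i \<in> idx (part 0 (mat_vcomp A (mat_vcomp A g f) w))"
    then have i: "i \<in> idx (part 0 w)" by simp
    note j = mat_VerD(3)[OF that(1) i, unfolded that(4)]
    note k = mat_VerD(3)[OF that(2) j, unfolded that(5)]
    show "vidx (mat_vcomp A (mat_vcomp A g f) w) i = vidx (mat_vcomp A g (mat_vcomp A f w)) i"
      using i j by simp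
    show "vent (mat_vcomp A (mat_vcomp A g f) w) i = vent (mat_vcomp A g (mat_vcomp A f w)) i"
      using i j A.vcomp_assoc[OF mat_VerD(4)[OF that(1) i, unfolded that(4)] mat_VerD(4)[OF that(2) j, unfolded that(5)] mat_VerD(4)[OF that(3) k]]
      by simp
  qed (use that in auto)
qed

lemma concat_map_concat_map: "concat (map (\<lambda>xs. concat (map f xs)) xss) = concat (map f (concat xss))"
  by (induction xss) auto

lemma concat_map_concat: "concat (map concat xss) = concat (concat xss)"
  by (induction xss) auto

text \<open>
  Both sides have the same boundary, so it suffices to compare entries at a tuple \<open>i # r\<close>. With \<open>r\<close> cut at
  both levels, the entries are the two sides of the associativity law of \<open>A\<close> for the components
  \<open>\<Theta>\<close> of \<open>qs\<close>, \<open>X\<close> of \<open>\<xi>ss\<close> and \<open>W\<close> of \<open>ws\<close>. The remaining work is to identify the tuples: \<open>h k\<close> is the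
  index where the \<open>k\<close>-th outer block starts, and \<open>ss ! k\<close> is the \<open>k\<close>-th block transported to the top of
  \<open>qs ! k\<close>.
\<close>

lemma mat_ccomp_assoc:
  assumes A: "vdc A" and k: "composable (mat A) \<kappa> u qs u'" and len: "length \<xi>ss = length qs" "length ws = Suc (length qs)"
    and w: "ws ! 0 \<in> mat_Ver A" "part (Suc 0) (ws ! 0) = part 0 u"
    and c: "\<And>i. i < length qs \<Longrightarrow> composable (mat A) (qs ! i) (ws ! i) (\<xi>ss ! i) (ws ! Suc i)"
  shows "ccomp (mat A) (ccomp (mat A) \<kappa> u qs) (ws ! 0) (concat \<xi>ss) =
      ccomp (mat A) \<kappa> (vcomp (mat A) u (ws ! 0)) (map (\<lambda>i. ccomp (mat A) (qs ! i) (ws ! i) (\<xi>ss ! i)) [0..<length qs])"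
proof -
  interpret A: virtual_double_category A by fact
  interpret M: multicell_composition "mat A" by (rule multicell_composition_mat[OF A])
  define n where "n = length qs"
  define \<phi> where "\<phi> = (\<lambda>i. mat_ccomp A (qs ! i) (ws ! i) (\<xi>ss ! i))"
  have len': "length qs = n" "length \<xi>ss = n" "length ws = Suc n" using len by (simp_all add: n_def)
  note kp = k[unfolded composable_mat]
  have u: "u \<in> mat_Ver A" "u' \<in> mat_Ver A" using kp chain_ends(1,2)[of "mat_Ver A" "mat_Cell A" "part 2" "part 3" u qs u'] by blast+
  note ku = mat_composable_boundary[OF k]
  have \<phi>: "map (\<lambda>i. ccomp (mat A) (qs ! i) (ws ! i) (\<xi>ss ! i)) [0..<length qs] = map \<phi> [0..<n]"
    using mat_ccomp_eq[OF c] by (simp add: \<phi>_def n_def)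
  have vc: "vcomp (mat A) u (ws ! 0) = mat_vcomp A u (ws ! 0)" using mat_vcomp_eq[OF w(1) u(1) w(2)] .
  have w': "ws ! 0 \<in> Ver (mat A)" "vcod (mat A) (ws ! 0) = vdom (mat A) u" using w u by simp_all
  note nc = M.nested_composable[OF k len w' c, unfolded \<phi> vc mat_ccomp_eq[OF k], folded n_def]
  let ?L = "mat_ccomp A (mat_ccomp A \<kappa> u qs) (ws ! 0) (concat \<xi>ss)"
  let ?R = "mat_ccomp A \<kappa> (mat_vcomp A u (ws ! 0)) (map \<phi> [0..<n])"
  have cell\<phi>: "cell (mat A) (\<phi> i) (concat (map mat_ctop (\<xi>ss ! i))) (part (Suc 0) (qs ! i))
      (mat_vcomp A (part 2 (qs ! i)) (ws ! i)) (mat_vcomp A (part 3 (qs ! i)) (ws ! Suc i))" if "i < n" for i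
    unfolding \<phi>_def by (rule mat_ccomp_cell[OF A]) (use c that len' in auto)
  note cell\<phi>D = cell\<phi>[unfolded cell_mat]
  have L: "cell (mat A) ?L (concat (map mat_ctop (concat \<xi>ss))) (part (Suc 0) \<kappa>)
      (mat_vcomp A (mat_vcomp A (part 2 \<kappa>) u) (ws ! 0)) (mat_vcomp A (mat_vcomp A (part 3 \<kappa>) u') (ws ! n))"
    using mat_ccomp_cell[OF A nc(1)] mat_ccomp_cell[OF A k] by (simp add: cell_mat)
  have R: "cell (mat A) ?R (concat (map mat_ctop (map \<phi> [0..<n]))) (part (Suc 0) \<kappa>)
      (mat_vcomp A (part 2 \<kappa>) (mat_vcomp A u (ws ! 0))) (mat_vcomp A (part 3 \<kappa>) (vcomp (mat A) u' (ws ! n)))"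
    using mat_ccomp_cell[OF A nc(2)] by (simp add: cell_mat)
  have wn: "ws ! n \<in> mat_Ver A" using composable_path(6)[OF nc(1)] by simp
  have wnc: "part (Suc 0) (ws ! n) = part 0 u'"
    using mat_composable_boundary(2)[OF nc(1)] mat_ccomp_cell[OF A k] by (simp add: cell_mat)
  have tops: "concat (map mat_ctop (map \<phi> [0..<n])) = concat (map mat_ctop (concat \<xi>ss))"
  proof -
    have "map mat_ctop (map \<phi> [0..<n]) = map (\<lambda>\<xi>s. concat (map mat_ctop \<xi>s)) \<xi>ss"
      by (rule nth_equalityI) (use cell\<phi>D len' in auto)
    then show ?thesis by (simp only: concat_map_concat_map)
  qed
  have "?L = ?R"
  proof (rule cent_ext[of _ A _ A])
    fix i r assume "i \<in> idx (part 0 (part 2 ?L))" "tails (mat_ctop ?L) r"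
    then have i: "i \<in> idx (part 0 (ws ! 0))" and "tails (concat (map mat_ctop (concat \<xi>ss))) r" using L by (simp_all add: cell_mat)
    then obtain rss where r: "r = concat (concat rss)" and "list_all2 (\<lambda>rs \<xi>s. tailss \<xi>s rs) rss \<xi>ss"
      by (auto simp: tails_concat_ctop tailss_concat)
    then have rss: "length rss = n" "\<And>k. k < n \<Longrightarrow> tailss (\<xi>ss ! k) (rss ! k)" "tailss (concat \<xi>ss) (concat rss)"
      by (auto simp: tailss_concat list_all2_conv_all_nth len'(2))
    define h where "h = (\<lambda>k. last (i # concat (concat (take k rss))))"
    define ss where "ss = map (\<lambda>k. ends (\<xi>ss ! k) (h k) (rss ! k)) [0..<n]"
    have h0: "h 0 = i" by (simp add: h_def)
    have hS: "h (Suc k) = last (h k # concat (rss ! k))" if "k < n" for k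
      using that rss(1) by (simp add: h_def take_Suc_conv_app_nth last_append)
    have bw: "blk i (concat rss) = concat (map (\<lambda>k. blk (h k) (rss ! k)) [0..<n])" unfolding blk_concat h_def rss(1) by simp
    have bo: "blk i (map concat rss) ! k = h k # concat (rss ! k)" if "k < n" for k
      using blk_nth[of k "map concat rss" i] that rss(1) by (simp add: h_def take_map concat_map_concat del: last.simps)
    have cp: "mcpath A (ws ! k) (\<xi>ss ! k) (ws ! Suc k)" if "k < n" for k using c[of k] that len' by (simp add: composable_mat)
    have hk: "h k \<in> idx (part 0 (ws ! k))" if "k \<le> n" for k
      using that
    proof (induction k)
      case (Suc k) then show ?case using path_components(1)[OF cp[of k] _ rss(2)[of k], of "h k"] hS[of k] by (simp del: last.simps)
    qed (use i h0 in simp)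
    \<comment> \<open>Transport commutes with cutting: the transported blocks start at the transported indices.\<close>
    have lss: "last (vidx (ws ! 0) i # concat (take k ss)) = vidx (ws ! k) (h k)" if "k \<le> n" for k
      using that
    proof (induction k)
      case (Suc k)
      then have kn: "k < n" by simp
      have "last (vidx (ws ! 0) i # concat (take (Suc k) ss)) = last (last (vidx (ws ! 0) i # concat (take k ss)) # ss ! k)"
        using kn by (simp add: take_Suc_conv_app_nth ss_def last_append)
      also have "\<dots> = vidx (ws ! Suc k) (h (Suc k))"
        using Suc kn path_components(6)[OF cp[OF kn] hk rss(2)[OF kn]] hS[OF kn] by (simp add: ss_def)
      finally show ?case .
    qed (simp add: h0)
    have bs: "blk (vidx (ws ! 0) i) ss ! k = vidx (ws ! k) (h k) # ss ! k" if "k < n" for k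
      using blk_nth[of k ss "vidx (ws ! 0) i"] that lss[of k] by (simp add: ss_def)
    have tss: "tailss qs ss"
      unfolding tailss_def list_all2_conv_all_nth
      using path_components(5)[OF cp hk rss(2)] c len' by (simp add: ss_def composable_mat)
    let ?B = "map (\<lambda>k. blk (h k) (rss ! k)) [0..<n]"
    have lB: "list_all2 (\<lambda>xs ys. length xs = length ys) \<xi>ss ?B"
      using rss(2)[THEN tailss_length] len' by (simp add: list_all2_conv_all_nth)
    have es: "ends (concat \<xi>ss) i (concat rss) = concat ss"
    proof -
      have "map2 (map2 (\<lambda>q b. vidx (part 3 q) (last b))) \<xi>ss ?B = ss"
        by (rule nth_equalityI) (use len' in \<open>simp_all add: ss_def ends_def\<close>)
      then show ?thesis by (simp add: ends_def bw map2_concat[OF lB])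
    qed
    define X where "X = map (\<lambda>k. map2 cent (\<xi>ss ! k) (blk (h k) (rss ! k))) [0..<n]"
    have X: "map2 cent (concat \<xi>ss) (blk i (concat rss)) = concat X"
    proof -
      have "map2 (map2 cent) \<xi>ss ?B = X" by (rule nth_equalityI) (use len' in \<open>simp_all add: X_def\<close>)
      then show ?thesis by (simp add: bw map2_concat[OF lB])
    qed
    define W where "W = map (\<lambda>k. vent (ws ! k) (h k)) [0..<Suc n]"
    have W: "W ! k = vent (ws ! k) (h k)" if "k \<le> n" for k unfolding W_def using that by (simp del: upt_Suc)
    define \<Theta> where "\<Theta> = map2 cent qs (blk (vidx (ws ! 0) i) ss)"
    have \<Theta>: "length \<Theta> = n" "\<And>k. k < n \<Longrightarrow> \<Theta> ! k = cent (qs ! k) (vidx (ws ! k) (h k) # ss ! k)"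
      using bs len' by (simp_all add: \<Theta>_def ss_def)
    have ca: "composable A (\<Theta> ! k) (W ! k) (X ! k) (W ! Suc k)" if "k < n" for k
      using composable_components[OF c[of k] hk[of k] rss(2)[of k]] that len' by (simp add: \<Theta> X_def W ss_def hS)
    have t\<phi>: "tailss (map \<phi> [0..<n]) (map concat rss)"
      using rss cell\<phi>D by (auto simp: tailss_def[of "map \<phi> [0..<n]"] list_all2_conv_all_nth tails_concat_ctop)
    have e\<phi>: "ends (map \<phi> [0..<n]) i (map concat rss) = ends qs (vidx (ws ! 0) i) ss"
    proof (rule nth_equalityI)
      fix k assume "k < length (ends (map \<phi> [0..<n]) i (map concat rss))"
      then have kn: "k < n" using rss(1) by (simp add: ends_def)
      have "vidx (part 3 (\<phi> k)) (h (Suc k)) = vidx (part 3 (qs ! k)) (vidx (ws ! Suc k) (h (Suc k)))"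
        using cell\<phi>D[OF kn] hk[of "Suc k"] kn by simp
      also have "vidx (ws ! Suc k) (h (Suc k)) = last (vidx (ws ! k) (h k) # ss ! k)"
        using path_components(6)[OF cp[OF kn] hk rss(2)[OF kn]] hS[OF kn] kn by (simp add: ss_def)
      finally show "ends (map \<phi> [0..<n]) i (map concat rss) ! k = ends qs (vidx (ws ! 0) i) ss ! k"
        using kn rss(1) len' bo[OF kn] bs[OF kn] hS[OF kn] by (simp add: ends_def ss_def del: last.simps)
    qed (use rss(1) len' in \<open>simp add: ends_def ss_def\<close>)
    have c\<phi>: "map2 cent (map \<phi> [0..<n]) (blk i (map concat rss)) = map (\<lambda>k. ccomp A (\<Theta> ! k) (W ! k) (X ! k)) [0..<length \<Theta>]"
    proof (rule nth_equalityI)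
      fix k assume "k < length (map2 cent (map \<phi> [0..<n]) (blk i (map concat rss)))"
      then have kn: "k < n" using rss(1) by simp
      show "map2 cent (map \<phi> [0..<n]) (blk i (map concat rss)) ! k = map (\<lambda>k. ccomp A (\<Theta> ! k) (W ! k) (X ! k)) [0..<length \<Theta>] ! k"
        using cent_mat_ccomp[OF c[of k] hk[of k] rss(2)[of k]] kn len' rss(1) bo[OF kn] by (simp add: \<Theta> X_def W ss_def \<phi>_def)
    qed (use rss(1) \<Theta>(1) in simp)
    have i': "vidx (ws ! 0) i \<in> idx (part 0 u)" using mat_VerD(3)[OF w(1) i] w(2) by simp
    have "cent ?L (i # r) = ccomp A (ccomp A (cent \<kappa> (vidx u (vidx (ws ! 0) i) # ends qs (vidx (ws ! 0) i) ss))
        (vent u (vidx (ws ! 0) i)) (map2 cent qs (blk (vidx (ws ! 0) i) ss))) (vent (ws ! 0) i) (map2 cent (concat \<xi>ss) (blk i (concat rss)))"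
      using cent_mat_ccomp[OF nc(1) i rss(3)] cent_mat_ccomp[OF k i' tss] by (simp only: r es)
    also have "\<dots> = ccomp A (cent \<kappa> (vidx u (vidx (ws ! 0) i) # ends qs (vidx (ws ! 0) i) ss))
        (vcomp A (vent u (vidx (ws ! 0) i)) (W ! 0)) (map (\<lambda>k. ccomp A (\<Theta> ! k) (W ! k) (X ! k)) [0..<length \<Theta>])"
      unfolding X \<Theta>_def[symmetric]
      using A.ccomp_assoc[OF composable_components[OF k i' tss, folded \<Theta>_def], of X W]
        ca \<Theta>(1) W[of 0] h0 mat_VerD(4)[OF w(1) i] mat_VerD(4)[OF u(1) i'] w(2)
      by (simp add: X_def W_def ver_def del: upt_Suc)
    also have "\<dots> = cent ?R (i # concat (map concat rss))"
      using cent_mat_ccomp[OF nc(2) _ t\<phi>, of i] i W[of 0] h0 by (simp add: e\<phi> c\<phi>)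
    also have "concat (map concat rss) = r" unfolding r by (rule concat_map_concat)
    finally show "cent ?L (i # r) = cent ?R (i # r)" .
  qed (use L R tops mat_vcomp_assoc[OF A] mat_CellD u w wn wnc ku kp mat_vcomp_eq[OF wn u(2) wnc] in \<open>auto simp: cell_mat\<close>)
  then show ?thesis by (simp add: \<phi> vc mat_ccomp_eq[OF k] mat_ccomp_eq[OF nc(1)] mat_ccomp_eq[OF nc(2)])
qed

lemma vdc_mat: assumes "vdc A" shows "vdc (mat A)"
proof -
  interpret M: multicell_composition "mat A" by (rule multicell_composition_mat[OF assms])
  show ?thesis
  proof (unfold_locales, goal_cases)
    case (3 a) then show ?case using mat_vid_in[OF assms] by (simp add: ver_mat)
  next
    case (4 f a b g c) then show ?case by (rule M.vcomp_ver')
  next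
    case (5 f a b)
    then show ?case using mat_vcomp_id_left[OF assms] mat_VerD mat_vid_in[OF assms] by (auto simp: ver_mat mat_vcomp_eq)
  next
    case (6 f a b)
    then show ?case using mat_vcomp_id_right[OF assms] mat_VerD mat_vid_in[OF assms] by (auto simp: ver_mat mat_vcomp_eq)
  next
    case (7 f a b g c h d)
    then show ?case using mat_vcomp_assoc[OF assms] mat_vcomp_in[OF assms] by (auto simp: ver_mat mat_vcomp_eq)
  next
    case (13 q) then show ?case by (rule M.ctop_path')
  next
    case (16 J) then show ?case using mat_cid_cell[OF assms] mat_HorD by auto
  next
    case (17 \<kappa> u qs u') then show ?case by (rule M.ccomp_cell')
  next
    case (18 q) then show ?case using mat_ccomp_id_left[OF assms] mat_CellD by auto
  next
    case (19 q)
    then have q: "q \<in> mat_Cell A" by simp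
    have "map (cid (mat A)) (mat_ctop q) = map (mat_cid A) (mat_ctop q)"
      using chain_ends(3)[OF mat_CellD(4)[OF q]] by auto
    then show ?case using mat_ccomp_id_right[OF assms q] q mat_CellD(2)[OF q] mat_VerD(1)[OF mat_CellD(2)[OF q]]
      by (simp del: map_eq_conv)
  next
    case (20 \<kappa> u qs u' \<xi>ss ws)
    then show ?case using composable_path(5)[OF 20(1)] by (intro mat_ccomp_assoc[OF assms 20(1-3) _ _ 20(6)]) auto
  qed (use mat_CellD mat_HorD mat_VerD in auto)
qed

lemma vdc_extensional_mat: "vdc_extensional (mat A)"
proof -
  have "ccomp (mat A) \<kappa> u qs = undefined" if "\<nexists>u'. composable (mat A) \<kappa> u qs u'" for \<kappa> u qs
  proof -
    have "\<not> (\<kappa> \<in> mat_Cell A \<and> (\<exists>u'. mcpath A u qs u') \<and> map (part 1) qs = mat_ctop \<kappa> \<and> part 1 u = part 0 (part 2 \<kappa>))"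
      using that by (auto simp: composable_mat)
    then show ?thesis by (auto simp: mat_def)
  qed
  then show ?thesis unfolding vdc_extensional_def by (auto simp: mat_def)
qed

section \<open>Size\<close>

lemma large_vfams_UN:
  assumes "large I" "\<And>x. x \<in> I \<Longrightarrow> large (S x)" "large T"
  shows "large (\<Union>x\<in>I. vfams (S x) (\<lambda>_. T))"
  using assms by (intro large_UN large_vfams)

lemma vfams_mono: "(\<And>i. i \<in> S \<Longrightarrow> T i \<subseteq> T' i) \<Longrightarrow> vfams S T \<subseteq> vfams S T'"
  by (auto simp: vfams_def)

text \<open>
  Codes of matrices are lists whose members are index sets and families; \<open>U1\<close> being an element of
  the large universe, each kind of member ranges over a large set. The other three kinds of data are
  handled in the same way.
\<close>

lemma large_mat_Ob: assumes "large (Ob A)" shows "large (mat_Ob A)"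
proof (rule large_subset)
  show "large (vlist ` lists (elts U1 \<union> (\<Union>I\<in>elts U1. vfams (elts I) (\<lambda>_. Ob A))))"
    using assms by (intro large_lists large_Un large_vfams_UN) auto
  show "mat_Ob A \<subseteq> vlist ` lists (elts U1 \<union> (\<Union>I\<in>elts U1. vfams (elts I) (\<lambda>_. Ob A)))"
  proof
    fix z assume "z \<in> mat_Ob A"
    then obtain I a where "z = vlist [I, a]" "I \<in> elts U1" "a \<in> vfams (elts I) (\<lambda>_. Ob A)" by (auto simp: mat_Ob_def)
    then show "z \<in> vlist ` lists (elts U1 \<union> (\<Union>I\<in>elts U1. vfams (elts I) (\<lambda>_. Ob A)))"
      by (intro image_eqI[of _ _ "[I, a]"]) auto
  qed
qed

lemma large_mat_Ver: assumes "large (Ob A)" "large (Ver A)" shows "large (mat_Ver A)"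
proof (rule large_subset)
  let ?O = "mat_Ob A"
  let ?I = "\<Union>x\<in>?O. idx x"
  show "large (vlist ` lists (?O \<union> (\<Union>x\<in>?O. vfams (idx x) (\<lambda>_. ?I)) \<union> (\<Union>x\<in>?O. vfams (idx x) (\<lambda>_. Ver A))))"
    using large_mat_Ob[OF assms(1)] assms by (intro large_lists large_Un large_vfams_UN large_UN) auto
  show "mat_Ver A \<subseteq> vlist ` lists (?O \<union> (\<Union>x\<in>?O. vfams (idx x) (\<lambda>_. ?I)) \<union> (\<Union>x\<in>?O. vfams (idx x) (\<lambda>_. Ver A)))"
  proof
    fix z assume "z \<in> mat_Ver A"
    then obtain x y v f where z: "z = vlist [x, y, v, f]" "x \<in> ?O" "y \<in> ?O" and v: "v \<in> vfams (idx x) (\<lambda>_. idx y)"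
      and f: "f \<in> vfams (idx x) (\<lambda>i. {u. ver A u (oent x i) (oent y (vapp v i))})"
      unfolding mat_Ver_def by blast
    have "v \<in> vfams (idx x) (\<lambda>_. ?I)" by (rule subsetD[OF vfams_mono v]) (use z(3) in auto)
    moreover have "f \<in> vfams (idx x) (\<lambda>_. Ver A)" by (rule subsetD[OF vfams_mono f]) (auto simp: ver_def)
    ultimately show "z \<in> vlist ` lists (?O \<union> (\<Union>x\<in>?O. vfams (idx x) (\<lambda>_. ?I)) \<union> (\<Union>x\<in>?O. vfams (idx x) (\<lambda>_. Ver A)))"
      using z by (intro image_eqI[of _ _ "[x, y, v, f]"]) auto
  qed
qed

lemma large_mat_Hor: assumes "large (Ob A)" "large (Hor A)" shows "large (mat_Hor A)"
proof (rule large_subset)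
  let ?O = "mat_Ob A"
  let ?F = "\<Union>x\<in>?O. \<Union>y\<in>?O. vfams (tuples [x, y]) (\<lambda>_. Hor A)"
  show "large (vlist ` lists (?O \<union> ?F))"
    using large_mat_Ob[OF assms(1)] assms by (intro large_lists large_Un large_vfams_UN large_UN) auto
  show "mat_Hor A \<subseteq> vlist ` lists (?O \<union> ?F)"
  proof
    fix z assume "z \<in> mat_Hor A"
    then obtain x y g where z: "z = vlist [x, y, g]" "x \<in> ?O" "y \<in> ?O"
      and g: "g \<in> vfams (tuples [x, y]) (\<lambda>s. {h \<in> Hor A. hsrc A h = oent x (part 0 s) \<and> htrg A h = oent y (part 1 s)})"
      unfolding mat_Hor_def by blast
    have "g \<in> vfams (tuples [x, y]) (\<lambda>_. Hor A)" by (rule subsetD[OF vfams_mono g]) auto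
    then show "z \<in> vlist ` lists (?O \<union> ?F)" using z by (intro image_eqI[of _ _ "[x, y, g]"]) auto
  qed
qed

lemma large_mat_Cell: assumes "large (Ob A)" "large (Ver A)" "large (Hor A)" "large (Cell A)" shows "large (mat_Cell A)"
proof (rule large_subset)
  let ?O = "mat_Ob A" and ?H = "mat_Hor A" and ?V = "mat_Ver A"
  let ?F = "\<Union>x\<in>?O. \<Union>z\<in>vlist ` lists ?H. vfams (tuples (vertices x (unlist z))) (\<lambda>_. Cell A)"
  let ?S = "vlist ` lists ?H \<union> ?H \<union> ?V \<union> ?F"
  show "large (vlist ` lists ?S)"
    using large_mat_Ob[OF assms(1)] large_mat_Hor[OF assms(1,3)] large_mat_Ver[OF assms(1,2)] assms
    by (intro large_lists large_Un large_vfams_UN large_UN) auto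
  show "mat_Cell A \<subseteq> vlist ` lists ?S"
  proof
    fix z assume z: "z \<in> mat_Cell A"
    note d = mat_CellD[OF z]
    let ?x = "part 0 (part 2 z)" and ?T = "tuples (vertices (part 0 (part 2 z)) (mat_ctop z))"
    have "vfam ?T (\<lambda>s. cent z (unlist s)) \<in> vfams ?T (\<lambda>_. Cell A)"
      using d(7) by (auto simp: ball_tuples_vertices cell_def)
    then have "vfam ?T (\<lambda>s. cent z (unlist s)) \<in> ?F"
      using mat_VerD(1)[OF d(2)] chain_ends(3)[OF d(4)] by (intro UN_I[of ?x] UN_I[of "vlist (mat_ctop z)"]) auto
    moreover have "vlist (mat_ctop z) \<in> vlist ` lists ?H" using chain_ends(3)[OF d(4)] by auto
    ultimately have "[vlist (mat_ctop z), part (Suc 0) z, part 2 z, part 3 z, vfam ?T (\<lambda>s. cent z (unlist s))] \<in> lists ?S"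
      using d(1-3) by simp
    then have "vlist [vlist (mat_ctop z), part (Suc 0) z, part 2 z, part 3 z, vfam ?T (\<lambda>s. cent z (unlist s))] \<in> vlist ` lists ?S"
      by (rule imageI)
    then show "z \<in> vlist ` lists ?S" using mat_Cell_eta[OF z] unfolding mkC_def by simp
  qed
qed

lemma large_vdc_mat: "large_vdc A \<Longrightarrow> large_vdc (mat A)"
  unfolding large_vdc_def by (simp add: vdc_mat vdc_extensional_mat large_mat_Ob large_mat_Ver large_mat_Hor large_mat_Cell)

section \<open>Functors and transformations into matrices are determined by entries\<close>

text \<open>
  The boundaries of the values of a functor are forced by its values on objects and horizontal
  morphisms, hence index sets, index functions and entries determine it.
\<close>

lemma mat_functor_eqI:
  assumes F: "vdf X (mat B) F" and G: "vdf X (mat B) G" and X: "vdc X"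
    and o: "\<And>x. x \<in> Ob X \<Longrightarrow> part 0 (fo F x) = part 0 (fo G x)"
      "\<And>x i. \<lbrakk>x \<in> Ob X; i \<in> ix F x\<rbrakk> \<Longrightarrow> oent (fo F x) i = oent (fo G x) i"
    and v: "\<And>u i. \<lbrakk>u \<in> Ver X; i \<in> ix F (vdom X u)\<rbrakk> \<Longrightarrow> vidx (fv F u) i = vidx (fv G u) i"
      "\<And>u i. \<lbrakk>u \<in> Ver X; i \<in> ix F (vdom X u)\<rbrakk> \<Longrightarrow> vent (fv F u) i = vent (fv G u) i"
    and h: "\<And>J i j. \<lbrakk>J \<in> Hor X; i \<in> ix F (hsrc X J); j \<in> ix F (htrg X J)\<rbrakk> \<Longrightarrow> hent (fh F J) i j = hent (fh G J) i j"
    and c: "\<And>q i r. \<lbrakk>q \<in> Cell X; i \<in> ix F (vdom X (clft X q)); tails (map (fh F) (ctop X q)) r\<rbrakk>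
      \<Longrightarrow> cent (fc F q) (i # r) = cent (fc G q) (i # r)"
  shows "F = G"
proof -
  interpret X: virtual_double_category X by fact
  interpret F: virtual_double_functor X "mat B" F by fact
  interpret G: virtual_double_functor X "mat B" G by fact
  have fo: "fo F x = fo G x" if "x \<in> Ob X" for x
    by (rule oent_ext[of _ B _ B]) (use that o F.fo_in G.fo_in in auto)
  have fv: "fv F u = fv G u" if u: "u \<in> Ver X" for u
  proof -
    note Fu = F.fv_ver[OF X.ver_self[OF u], unfolded ver_mat] and Gu = G.fv_ver[OF X.ver_self[OF u], unfolded ver_mat]
    show ?thesis by (rule vent_ext[of _ B _ B]) (use u v Fu Gu fo X.vdom_in X.vcod_in in auto)
  qed
  have Fh: "fh F J \<in> mat_Hor B" "part 0 (fh F J) = fo F (hsrc X J)" "part (Suc 0) (fh F J) = fo F (htrg X J)" if "J \<in> Hor X" for J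
    using F.fh_in[OF that] F.fh_src[OF that] F.fh_trg[OF that] by auto
  have Gh: "fh G J \<in> mat_Hor B" "part 0 (fh G J) = fo G (hsrc X J)" "part (Suc 0) (fh G J) = fo G (htrg X J)" if "J \<in> Hor X" for J
    using G.fh_in[OF that] G.fh_src[OF that] G.fh_trg[OF that] by auto
  have fh: "fh F J = fh G J" if "J \<in> Hor X" for J
    by (rule hent_ext[of _ B _ B]) (use that h Fh[OF that] Gh[OF that] fo X.hsrc_in X.htrg_in in auto)
  have fc: "fc F q = fc G q" if t: "q \<in> Cell X" for q
  proof -
    note Fc = F.fc_cell[OF X.cell_self[OF t], unfolded cell_mat] and Gc = G.fc_cell[OF X.cell_self[OF t], unfolded cell_mat]
    have top: "map (fh F) (ctop X q) = map (fh G) (ctop X q)" using X.ctop_in[OF t] fh by auto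
    have l: "part 0 (fv F (clft X q)) = fo F (vdom X (clft X q))"
      using F.fv_ver[OF X.ver_self[OF X.clft_in[OF t]]] by (simp add: ver_mat)
    show ?thesis
      by (rule cent_ext[of _ B _ B]) (use t c Fc Gc top l fh[OF X.cbot_in] fv[OF X.clft_in] fv[OF X.crgt_in] in \<open>simp_all del: map_eq_conv\<close>)
  qed
  show ?thesis by (rule vd_map_eqI[OF F G fo fv fh fc])
qed

lemma mat_trans_eqI:
  assumes a: "vtr X (mat B) P Q \<alpha>" and b: "vtr X (mat B) P Q \<beta>" and X: "vdc X" and P: "vdf X (mat B) P"
    and v: "\<And>x i. \<lbrakk>x \<in> Ob X; i \<in> ix P x\<rbrakk> \<Longrightarrow> vidx (tv \<alpha> x) i = vidx (tv \<beta> x) i"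
      "\<And>x i. \<lbrakk>x \<in> Ob X; i \<in> ix P x\<rbrakk> \<Longrightarrow> vent (tv \<alpha> x) i = vent (tv \<beta> x) i"
    and c: "\<And>J i j. \<lbrakk>J \<in> Hor X; i \<in> ix P (hsrc X J); j \<in> ix P (htrg X J)\<rbrakk> \<Longrightarrow> cent (tc \<alpha> J) [i, j] = cent (tc \<beta> J) [i, j]"
  shows "\<alpha> = \<beta>"
proof -
  interpret X: virtual_double_category X by fact
  interpret P: virtual_double_functor X "mat B" P by fact
  interpret a: vertical_transformation X "mat B" P Q \<alpha> by fact
  interpret b: vertical_transformation X "mat B" P Q \<beta> by fact
  have tv: "tv \<alpha> x = tv \<beta> x" if "x \<in> Ob X" for x
    by (rule vent_ext[of _ B _ B]) (use a.tv_ver[OF that] b.tv_ver[OF that] v that in \<open>auto simp: ver_mat\<close>)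
  have tc: "tc \<alpha> J = tc \<beta> J" if g: "J \<in> Hor X" for J
  proof (rule cent_ext[of _ B _ B])
    note ac = a.tc_cell[OF g, unfolded cell_mat] and bc = b.tc_cell[OF g, unfolded cell_mat]
    note at = a.tv_ver[OF X.hsrc_in[OF g], unfolded ver_mat]
    have h: "part (Suc 0) (fh P J) = fo P (htrg X J)" using P.fh_trg[OF g] P.fh_in[OF g] by simp
    show "cent (tc \<alpha> J) (i # r) = cent (tc \<beta> J) (i # r)" if "i \<in> idx (part 0 (part 2 (tc \<alpha> J)))" "tails (mat_ctop (tc \<alpha> J)) r" for i r
      using that ac at h c[OF g] by auto
  qed (use a.tc_cell[OF g] b.tc_cell[OF g] tv[OF X.hsrc_in[OF g]] tv[OF X.htrg_in[OF g]] in \<open>simp_all add: cell_mat\<close>)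
  show ?thesis by (rule vd_trans_eqI[OF a.tv_ext a.tc_ext b.tv_ext b.tc_ext tv tc])
qed

lemma ucomp_mat:
  assumes "vdc A" "cell (mat A) \<kappa> [\<Delta>] \<Lambda> v v'" "cell (mat A) q Js \<Delta> u u'" "i \<in> idx (part 0 u)" "tails Js r"
  shows "cent (ucomp (mat A) \<kappa> q) (i # r) = ucomp A (cent \<kappa> [vidx u i, vidx u' (last (i # r))]) (cent q (i # r))"
proof -
  interpret M: virtual_double_category "mat A" by (rule vdc_mat[OF assms(1)])
  note k = M.composable_unary[OF assms(2,3)]
  note t = assms(3)[unfolded cell_mat]
  have tt: "tailss [q] [r]" using t assms(5) by simp
  have d: "cell A (cent q (i # r)) (mat_entry Js (i # r)) (hent \<Delta> (vidx u i) (vidx u' (last (i # r)))) (vent u i) (vent u' (last (i # r)))"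
    using mat_CellD(7)[of q A i r] t assms(4,5) by (simp del: last.simps)
  show ?thesis using cent_mat_ccomp[OF k assms(4) tt] t cellD(4)[OF d]
    by (simp add: ucomp_def mat_ccomp_eq[OF k] del: last.simps)
qed

lemma map2_cong_all2:
  assumes "list_all2 P xs ys" "\<And>x y. \<lbrakk>x \<in> set xs; P x y\<rbrakk> \<Longrightarrow> f x y = g x y" shows "map2 f xs ys = map2 g xs ys"
  using assms by (induction rule: list_all2_induct) auto

lemma map2_map1: "map2 f (map g xs) ys = map2 (\<lambda>x. f (g x)) xs ys"
  by (simp add: zip_map1 comp_def split_def)

section \<open>The pullback along pointed sets\<close>

lemma vlist_in_lists [simp]: "vlist xs \<in> vlist ` lists S \<longleftrightarrow> set xs \<subseteq> S"
  by (auto simp: lists_eq_set image_iff)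

definition el_tail :: "'V VDC \<Rightarrow> 'V VDMap \<Rightarrow> 'V list \<Rightarrow> 'V list \<Rightarrow> bool" where
  "el_tail X p Js r \<longleftrightarrow> list_all2 (\<lambda>j J. j \<in> ix p (htrg X J)) r Js"

definition el_entry :: "'V list \<Rightarrow> 'V list \<Rightarrow> 'V list" where
  "el_entry Js is = map (\<lambda>k. vlist [Js ! k, is ! k, is ! Suc k]) [0..<length Js]"

definition el_index :: "'V \<Rightarrow> 'V list" where
  "el_index z = unlist (part 1 z)"

definition el_Ob :: "'V VDC \<Rightarrow> 'V VDMap \<Rightarrow> 'V set" where
  "el_Ob X p = {vlist [x, i] | x i. x \<in> Ob X \<and> i \<in> ix p x}"

definition el_Ver :: "'V VDC \<Rightarrow> 'V VDMap \<Rightarrow> 'V set" where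
  "el_Ver X p = {vlist [u, i] | u i. u \<in> Ver X \<and> i \<in> ix p (vdom X u)}"

definition el_Hor :: "'V VDC \<Rightarrow> 'V VDMap \<Rightarrow> 'V set" where
  "el_Hor X p = {vlist [J, i, j] | J i j. J \<in> Hor X \<and> i \<in> ix p (hsrc X J) \<and> j \<in> ix p (htrg X J)}"

definition el_Cell :: "'V VDC \<Rightarrow> 'V VDMap \<Rightarrow> 'V set" where
  "el_Cell X p = {vlist [q, vlist (i # r)] | q i r. q \<in> Cell X \<and> i \<in> ix p (vdom X (clft X q)) \<and> el_tail X p (ctop X q) r}"

definition el_ccomp :: "'V VDC \<Rightarrow> 'V \<Rightarrow> 'V \<Rightarrow> 'V list \<Rightarrow> 'V" where
  "el_ccomp X \<kappa> u qs = vlist [ccomp X (part 0 \<kappa>) (part 0 u) (map (part 0) qs), vlist (part 1 u # concat (map (tl \<circ> el_index) qs))]"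

text \<open>
  The pullback of \<open>X\<close> along the forgetful functor from pointed sets, for \<open>p\<close> with values in \<open>mat t\<close>. A
  vertical morphism is determined by its index at the domain, since \<open>p\<close> transports that index to
  the codomain. The composition here is total; \<open>el\<close> makes it undefined on multicells that are not
  composable, which can only be said after the boundary maps are fixed.
\<close>

definition el_pre :: "'V VDC \<Rightarrow> 'V VDMap \<Rightarrow> 'V VDC" where
  "el_pre X p = \<lparr>Ob = el_Ob X p, Ver = el_Ver X p,
     vdom = \<lambda>z\<in>el_Ver X p. vlist [vdom X (part 0 z), part 1 z],
     vcod = \<lambda>z\<in>el_Ver X p. vlist [vcod X (part 0 z), vidx (fv p (part 0 z)) (part 1 z)],
     vid = \<lambda>z\<in>el_Ob X p. vlist [vid X (part 0 z), part 1 z],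
     vcomp = (\<lambda>g f. if f \<in> el_Ver X p \<and> g \<in> el_Ver X p \<and> vcod X (part 0 f) = vdom X (part 0 g)
         \<and> vidx (fv p (part 0 f)) (part 1 f) = part 1 g
       then vlist [vcomp X (part 0 g) (part 0 f), part 1 f] else undefined),
     Hor = el_Hor X p,
     hsrc = \<lambda>z\<in>el_Hor X p. vlist [hsrc X (part 0 z), part 1 z],
     htrg = \<lambda>z\<in>el_Hor X p. vlist [htrg X (part 0 z), part 2 z],
     Cell = el_Cell X p,
     ctop = \<lambda>z\<in>el_Cell X p. el_entry (ctop X (part 0 z)) (el_index z),
     cbot = \<lambda>z\<in>el_Cell X p. vlist [cbot X (part 0 z), vidx (fv p (clft X (part 0 z))) (hd (el_index z)),
        vidx (fv p (crgt X (part 0 z))) (last (el_index z))],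
     clft = \<lambda>z\<in>el_Cell X p. vlist [clft X (part 0 z), hd (el_index z)],
     crgt = \<lambda>z\<in>el_Cell X p. vlist [crgt X (part 0 z), last (el_index z)],
     cid = \<lambda>z\<in>el_Hor X p. vlist [cid X (part 0 z), vlist [part 1 z, part 2 z]],
     ccomp = el_ccomp X\<rparr>"

definition el :: "'V VDC \<Rightarrow> 'V VDMap \<Rightarrow> 'V VDC" where
  "el X p = (el_pre X p)\<lparr>ccomp := (\<lambda>\<kappa> u qs. if \<exists>u'. composable (el_pre X p) \<kappa> u qs u' then el_ccomp X \<kappa> u qs else undefined)\<rparr>"

lemma el_composable: "composable (el X p) = composable (el_pre X p)"
  by (intro ext) (simp add: el_def composable_def cpath_def)

lemma el_ccomp_eq: "composable (el X p) \<kappa> u qs u' \<Longrightarrow> ccomp (el X p) \<kappa> u qs = el_ccomp X \<kappa> u qs"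
  unfolding el_composable by (auto simp: el_def)

lemma el_in [simp]:
  "vlist [x, i] \<in> el_Ob X p \<longleftrightarrow> x \<in> Ob X \<and> i \<in> ix p x"
  "vlist [u, i] \<in> el_Ver X p \<longleftrightarrow> u \<in> Ver X \<and> i \<in> ix p (vdom X u)"
  "vlist [J, i, j] \<in> el_Hor X p \<longleftrightarrow> J \<in> Hor X \<and> i \<in> ix p (hsrc X J) \<and> j \<in> ix p (htrg X J)"
  "vlist [q, vlist (i # r)] \<in> el_Cell X p \<longleftrightarrow> q \<in> Cell X \<and> i \<in> ix p (vdom X (clft X q)) \<and> el_tail X p (ctop X q) r"
  by (auto simp: el_Ob_def el_Ver_def el_Hor_def el_Cell_def)

lemma el_index_vlist [simp]: "el_index (vlist [q, vlist is]) = is"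
  by (simp add: el_index_def)

lemma el_ObE: assumes "z \<in> el_Ob X p" obtains x i where "z = vlist [x, i]" "x \<in> Ob X" "i \<in> ix p x"
  using assms by (auto simp: el_Ob_def)
lemma el_VerE: assumes "z \<in> el_Ver X p" obtains u i where "z = vlist [u, i]" "u \<in> Ver X" "i \<in> ix p (vdom X u)"
  using assms by (auto simp: el_Ver_def)
lemma el_HorE: assumes "z \<in> el_Hor X p" obtains J i j where "z = vlist [J, i, j]" "J \<in> Hor X" "i \<in> ix p (hsrc X J)" "j \<in> ix p (htrg X J)"
  using assms by (auto simp: el_Hor_def)
lemma el_CellE: assumes "z \<in> el_Cell X p"
  obtains q i r where "z = vlist [q, vlist (i # r)]" "q \<in> Cell X" "i \<in> ix p (vdom X (clft X q))" "el_tail X p (ctop X q) r"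
  using assms by (auto simp: el_Cell_def)

lemma el_sel [simp]:
  "Ob (el X p) = el_Ob X p" "Ver (el X p) = el_Ver X p" "Hor (el X p) = el_Hor X p" "Cell (el X p) = el_Cell X p"
  "vlist [u, i] \<in> el_Ver X p \<Longrightarrow> vdom (el X p) (vlist [u, i]) = vlist [vdom X u, i]"
  "vlist [u, i] \<in> el_Ver X p \<Longrightarrow> vcod (el X p) (vlist [u, i]) = vlist [vcod X u, vidx (fv p u) i]"
  "vlist [x, i] \<in> el_Ob X p \<Longrightarrow> vid (el X p) (vlist [x, i]) = vlist [vid X x, i]"
  "\<lbrakk>vlist [u, i] \<in> el_Ver X p; vlist [v, j] \<in> el_Ver X p; vcod X u = vdom X v; vidx (fv p u) i = j\<rbrakk>
    \<Longrightarrow> vcomp (el X p) (vlist [v, j]) (vlist [u, i]) = vlist [vcomp X v u, i]"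
  "vlist [J, i, j] \<in> el_Hor X p \<Longrightarrow> hsrc (el X p) (vlist [J, i, j]) = vlist [hsrc X J, i]"
  "vlist [J, i, j] \<in> el_Hor X p \<Longrightarrow> htrg (el X p) (vlist [J, i, j]) = vlist [htrg X J, j]"
  "vlist [J, i, j] \<in> el_Hor X p \<Longrightarrow> cid (el X p) (vlist [J, i, j]) = vlist [cid X J, vlist [i, j]]"
  "vlist [q, vlist (i # r)] \<in> el_Cell X p \<Longrightarrow> ctop (el X p) (vlist [q, vlist (i # r)]) = el_entry (ctop X q) (i # r)"
  "vlist [q, vlist (i # r)] \<in> el_Cell X p \<Longrightarrow> cbot (el X p) (vlist [q, vlist (i # r)])
     = vlist [cbot X q, vidx (fv p (clft X q)) i, vidx (fv p (crgt X q)) (last (i # r))]"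
  "vlist [q, vlist (i # r)] \<in> el_Cell X p \<Longrightarrow> clft (el X p) (vlist [q, vlist (i # r)]) = vlist [clft X q, i]"
  "vlist [q, vlist (i # r)] \<in> el_Cell X p \<Longrightarrow> crgt (el X p) (vlist [q, vlist (i # r)]) = vlist [crgt X q, last (i # r)]"
  by (simp_all add: el_def el_pre_def del: last.simps)

lemma el_entry_simps [simp]: "el_entry [] is = []" "el_entry (J # Js) (i # j # r) = vlist [J, i, j] # el_entry Js (j # r)"
  by (simp_all add: el_entry_def map_upt_Suc del: upt_Suc)

lemma el_entry_append:
  "length r = length Js \<Longrightarrow> el_entry (Js @ \<Delta>s) (i # r @ s) = el_entry Js (i # r) @ el_entry \<Delta>s (last (i # r) # s)"
  by (induction Js arbitrary: i r) (auto simp: length_Suc_conv)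

lemma el_entry_concat:
  assumes "list_all2 (\<lambda>r Js. length r = length Js) rs Jss"
  shows "el_entry (concat Jss) (i # concat rs) = concat (map2 el_entry Jss (blk i rs))"
  using assms by (induction rs arbitrary: i Jss) (auto simp: list_all2_Cons1 el_entry_append)

lemma map_part_el_entry: "map (part 0) (el_entry Js is) = Js"
  by (rule nth_equalityI) (simp_all add: el_entry_def)

lemma el_tail_simps [simp]: "el_tail X p [] r \<longleftrightarrow> r = []"
  "el_tail X p (J # Js) r \<longleftrightarrow> (\<exists>j s. r = j # s \<and> j \<in> ix p (htrg X J) \<and> el_tail X p Js s)"
  by (auto simp: el_tail_def list_all2_Cons2)

lemma el_tail_length: "el_tail X p Js r \<Longrightarrow> length r = length Js"
  by (auto simp: el_tail_def dest: list_all2_lengthD)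

abbreviation el_cells :: "'V list \<Rightarrow> 'V list list \<Rightarrow> 'V list" where
  "el_cells \<equiv> map2 (\<lambda>q b. vlist [q, vlist b])"

context
  fixes X t :: "'V VDC" and p :: "'V VDMap"
  assumes X: "vdc X" and t: "vdc t" and p: "vdf X (mat t) p"
begin

interpretation X: virtual_double_category X by fact
interpretation p: virtual_double_functor X "mat t" p by fact

lemma act_in: assumes "u \<in> Ver X" "i \<in> ix p (vdom X u)" shows "vidx (fv p u) i \<in> ix p (vcod X u)"
  using p.fv_ver[OF X.ver_self[OF assms(1)]] mat_VerD(3)[of "fv p u" t i] assms(2) by (auto simp: ver_mat)

lemma act_id: assumes "x \<in> Ob X" "i \<in> ix p x" shows "vidx (fv p (vid X x)) i = i"
  using p.fv_vid[OF assms(1)] p.fo_in[OF assms(1)] assms(2) by simp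

lemma act_comp: assumes "ver X f a b" "ver X g b c" "i \<in> ix p a"
  shows "vidx (fv p (vcomp X g f)) i = vidx (fv p g) (vidx (fv p f) i)"
  using p.fv_vcomp[OF assms(1,2)] p.fv_ver[OF assms(1)] p.fv_ver[OF assms(2)] assms(3) by (auto simp: ver_mat mat_vcomp_eq)

lemma el_tail_last:
  assumes "hpath X x Js y" "i \<in> ix p x" "el_tail X p Js r" shows "last (i # r) \<in> ix p y"
  using assms unfolding hpath_def by (induction Js arbitrary: x i r) auto

lemma el_entry_path:
  assumes "hpath X x Js y" "i \<in> ix p x" "el_tail X p Js r"
  shows "hpath (el X p) (vlist [x, i]) (el_entry Js (i # r)) (vlist [y, last (i # r)])"
  using assms unfolding hpath_def by (induction Js arbitrary: x i r) auto

lemma el_cell_right: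
  assumes "q \<in> Cell X" "i \<in> ix p (vdom X (clft X q))" "el_tail X p (ctop X q) r"
  shows "last (i # r) \<in> ix p (vdom X (crgt X q))"
  by (rule el_tail_last[OF X.ctop_path[OF assms(1)] assms(2,3)])

text \<open>
  A path of multicells in \<open>el X p\<close> is a path in \<open>X\<close> with one tuple of indices, cut into blocks: the shared
  vertical sides make the last index of a block equal to the first one of the next.
\<close>

lemma el_cpath:
  assumes "chain (el_Ver X p) (el_Cell X p) (clft (el X p)) (crgt (el X p)) (vlist [u, i]) zs z'"
  shows "\<exists>qs rs u'. zs = el_cells qs (blk i rs) \<and> list_all2 (\<lambda>r q. el_tail X p (ctop X q) r) rs qs
    \<and> cpath X u qs u' \<and> z' = vlist [u', last (i # concat rs)]
    \<and> map (ctop (el X p)) zs = map2 el_entry (map (ctop X) qs) (blk i rs)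
    \<and> map (cbot (el X p)) zs = map2 (\<lambda>q b. vlist [cbot X q, vidx (fv p (clft X q)) (hd b), vidx (fv p (crgt X q)) (last b)]) qs (blk i rs)"
  using assms
proof (induction zs arbitrary: u i)
  case Nil
  then show ?case by (intro exI[of _ "[]"] exI[of _ u]) (auto simp: cpath_def)
next
  case (Cons z zs)
  then have z: "z \<in> el_Cell X p" and c: "clft (el X p) z = vlist [u, i]" and u: "vlist [u, i] \<in> el_Ver X p"
    and ch: "chain (el_Ver X p) (el_Cell X p) (clft (el X p)) (crgt (el X p)) (crgt (el X p) z) zs z'" by auto
  from z obtain q j r where zz: "z = vlist [q, vlist (j # r)]" "q \<in> Cell X" "j \<in> ix p (vdom X (clft X q))" "el_tail X p (ctop X q) r"
    by (rule el_CellE)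
  have e: "clft X q = u" "j = i" using c z by (simp_all add: zz(1))
  have "crgt (el X p) z = vlist [crgt X q, last (i # r)]" using z e by (simp add: zz(1))
  from Cons.IH[OF ch[unfolded this]] obtain qs rs u' where IH: "zs = el_cells qs (blk (last (i # r)) rs)"
    "list_all2 (\<lambda>r q. el_tail X p (ctop X q) r) rs qs" "cpath X (crgt X q) qs u'" "z' = vlist [u', last (last (i # r) # concat rs)]"
    "map (ctop (el X p)) zs = map2 el_entry (map (ctop X) qs) (blk (last (i # r)) rs)"
    "map (cbot (el X p)) zs = map2 (\<lambda>q b. vlist [cbot X q, vidx (fv p (clft X q)) (hd b), vidx (fv p (crgt X q)) (last b)]) qs (blk (last (i # r)) rs)"
    by blast
  have l: "last (last (i # r) # concat rs) = last (i # concat (r # rs))" by (simp add: last_append)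
  show ?case
    by (rule exI[of _ "q # qs"], rule exI[of _ "r # rs"], rule exI[of _ u'])
      (use IH zz e u z l in \<open>simp add: cpath_def del: last.simps\<close>)
qed

lemma multicell_boundary_el: "multicell_boundary (el X p)"
proof (unfold_locales, goal_cases)
  case (1 z)
  then obtain q i r where z: "z = vlist [q, vlist (i # r)]" "q \<in> Cell X" "i \<in> ix p (vdom X (clft X q))" "el_tail X p (ctop X q) r"
    by (auto elim: el_CellE)
  show ?case using el_entry_path[OF X.ctop_path[OF z(2)] z(3,4)] z el_cell_right[OF z(2-4)] X.clft_in[OF z(2)] X.crgt_in[OF z(2)]
    by (simp del: last.simps)
next
  case (2 z)
  then obtain q i r where z: "z = vlist [q, vlist (i # r)]" "q \<in> Cell X" "i \<in> ix p (vdom X (clft X q))" "el_tail X p (ctop X q) r"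
    by (auto elim: el_CellE)
  show ?case using z el_cell_right[OF z(2-4)] X.clft_in[OF z(2)] X.crgt_in[OF z(2)] X.cbot_src[OF z(2)] X.cbot_trg[OF z(2)] X.cbot_in[OF z(2)]
      act_in[of "clft X q" i] act_in[of "crgt X q" "last (i # r)"]
    by (simp del: last.simps)
qed

lemma el_composableD:
  assumes "composable (el X p) \<kappa> u qs u'"
  shows "\<exists>\<kappa>0 j s u0 i qs0 rs u0'. \<kappa> = vlist [\<kappa>0, vlist (j # s)] \<and> u = vlist [u0, i] \<and> qs = el_cells qs0 (blk i rs)
    \<and> u' = vlist [u0', last (i # concat rs)] \<and> composable X \<kappa>0 u0 qs0 u0' \<and> j = vidx (fv p u0) i
    \<and> vidx (fv p u0') (last (i # concat rs)) = last (j # s)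
    \<and> list_all2 (\<lambda>r q. el_tail X p (ctop X q) r) rs qs0
    \<and> \<kappa> \<in> el_Cell X p \<and> u \<in> el_Ver X p \<and> u' \<in> el_Ver X p
    \<and> map (ctop (el X p)) qs = map2 el_entry (map (ctop X) qs0) (blk i rs)
    \<and> el_entry (ctop X \<kappa>0) (j # s) = map2 (\<lambda>q b. vlist [cbot X q, vidx (fv p (clft X q)) (hd b), vidx (fv p (crgt X q)) (last b)]) qs0 (blk i rs)"
proof -
  interpret E: multicell_boundary "el X p" by (rule multicell_boundary_el)
  note c = composable_path[OF assms, unfolded el_sel]
  obtain \<kappa>0 j s where k: "\<kappa> = vlist [\<kappa>0, vlist (j # s)]" "\<kappa>0 \<in> Cell X" "j \<in> ix p (vdom X (clft X \<kappa>0))" "el_tail X p (ctop X \<kappa>0) s"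
    using c(2) by (rule el_CellE)
  obtain u0 i where u: "u = vlist [u0, i]" "u0 \<in> Ver X" "i \<in> ix p (vdom X u0)" using c(5) by (rule el_VerE)
  from el_cpath[OF c(1)[unfolded u(1)]] obtain qs0 rs u0' where th: "qs = el_cells qs0 (blk i rs)"
    "list_all2 (\<lambda>r q. el_tail X p (ctop X q) r) rs qs0" "cpath X u0 qs0 u0'" "u' = vlist [u0', last (i # concat rs)]"
    "map (ctop (el X p)) qs = map2 el_entry (map (ctop X) qs0) (blk i rs)"
    and bot: "map (cbot (el X p)) qs = map2 (\<lambda>q b. vlist [cbot X q, vidx (fv p (clft X q)) (hd b), vidx (fv p (crgt X q)) (last b)]) qs0 (blk i rs)"
    by blast
  have l: "length rs = length qs0" using th(2) by (rule list_all2_lengthD)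
  have e: "el_entry (ctop X \<kappa>0) (j # s) = map2 (\<lambda>q b. vlist [cbot X q, vidx (fv p (clft X q)) (hd b), vidx (fv p (crgt X q)) (last b)]) qs0 (blk i rs)"
    using c(2,3) unfolding bot by (simp add: k(1))
  have "ctop X \<kappa>0 = map (part 0) (map2 (\<lambda>q b. vlist [cbot X q, vidx (fv p (clft X q)) (hd b), vidx (fv p (crgt X q)) (last b)]) qs0 (blk i rs))"
    unfolding e[symmetric] by (rule map_part_el_entry[symmetric])
  also have "\<dots> = map (cbot X) qs0" by (rule nth_equalityI) (use l in simp_all)
  finally have top: "map (cbot X) qs0 = ctop X \<kappa>0" ..
  have cod: "vcod X u0 = vdom X (clft X \<kappa>0)" "j = vidx (fv p u0) i"
    using c(4) c(2,5) k u X.clft_in[OF k(2)] by auto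
  have r: "vidx (fv p u0') (last (i # concat rs)) = last (j # s)"
    using E.composable_right[OF assms] c(2,6) k X.crgt_in[OF k(2)] el_cell_right[OF k(2-4)]
    by (simp add: th(4) del: last.simps)
  have "composable X \<kappa>0 u0 qs0 u0'" using th(3) k(2) top cod(1) by (simp add: composable_def)
  then show ?thesis using k(1) u(1) th cod(2) r c(2,5,6) e by blast
qed

lemma el_ccomp_blk: "length qs = length rs \<Longrightarrow> el_ccomp X (vlist [\<kappa>, k]) (vlist [u, i]) (el_cells qs (blk i rs)) = vlist [ccomp X \<kappa> u qs, vlist (i # concat rs)]"
proof -
  assume l: "length qs = length rs"
  have "map (part 0) (el_cells qs (blk i rs)) = qs" by (rule nth_equalityI) (use l in simp_all)
  moreover have "map (tl \<circ> el_index) (el_cells qs (blk i rs)) = rs" by (rule nth_equalityI) (use l in \<open>simp_all add: blk_nth\<close>)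
  ultimately show ?thesis by (simp add: el_ccomp_def)
qed

lemma el_vcomp_ver: assumes "ver (el X p) f a b" "ver (el X p) g b c" shows "ver (el X p) (vcomp (el X p) g f) a c"
proof -
  obtain u i v j where f: "f = vlist [u, i]" "u \<in> Ver X" "i \<in> ix p (vdom X u)" and g: "g = vlist [v, j]" "v \<in> Ver X" "j \<in> ix p (vdom X v)"
    using assms by (auto simp: ver_def elim!: el_VerE)
  have e: "vcod X u = vdom X v" "vidx (fv p u) i = j" using assms f g by (auto simp: ver_def)
  have vv: "ver X u (vdom X u) (vdom X v)" "ver X v (vdom X v) (vcod X v)" using f g e by (auto simp: ver_def)
  note w = X.vcomp_ver[OF vv]
  show ?thesis using assms f g e verD[OF w] act_comp[OF vv f(3)] by (auto simp: ver_def)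
qed

lemma el_ccomp_cell:
  assumes "composable (el X p) \<kappa> u qs u'"
  shows "cell (el X p) (ccomp (el X p) \<kappa> u qs) (concat (map (ctop (el X p)) qs)) (cbot (el X p) \<kappa>) (vcomp (el X p) (clft (el X p) \<kappa>) u) (vcomp (el X p) (crgt (el X p) \<kappa>) u')"
proof -
  interpret E: multicell_boundary "el X p" by (rule multicell_boundary_el)
  from el_composableD[OF assms] obtain \<kappa>0 j s u0 i qs0 rs u0' where e: "\<kappa> = vlist [\<kappa>0, vlist (j # s)]" "u = vlist [u0, i]" "qs = el_cells qs0 (blk i rs)"
    "u' = vlist [u0', last (i # concat rs)]" and c: "composable X \<kappa>0 u0 qs0 u0'" and j: "j = vidx (fv p u0) i"
    "vidx (fv p u0') (last (i # concat rs)) = last (j # s)"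
    and tl: "list_all2 (\<lambda>r q. el_tail X p (ctop X q) r) rs qs0"
    and m: "\<kappa> \<in> el_Cell X p" "u \<in> el_Ver X p" "u' \<in> el_Ver X p" and top: "map (ctop (el X p)) qs = map2 el_entry (map (ctop X) qs0) (blk i rs)"
    by blast
  have l: "length qs0 = length rs" using tl list_all2_lengthD by force
  note cc = X.ccomp_cell[OF c] and cp = composable_path[OF c]
  have ec: "ccomp (el X p) \<kappa> u qs = vlist [ccomp X \<kappa>0 u0 qs0, vlist (i # concat rs)]"
    using el_ccomp_eq[OF assms] el_ccomp_blk[OF l] by (simp only: e(1-3))
  have k0: "\<kappa>0 \<in> Cell X" "j \<in> ix p (vdom X (clft X \<kappa>0))" "el_tail X p (ctop X \<kappa>0) s" using m(1) by (auto simp: e)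
  have u0: "u0 \<in> Ver X" "i \<in> ix p (vdom X u0)" "u0' \<in> Ver X" "last (i # concat rs) \<in> ix p (vdom X u0')" using m(2,3) by (auto simp: e)
  have cod': "vcod X u0' = vdom X (crgt X \<kappa>0)"
    using E.composable_right[OF assms] m k0 X.crgt_in[OF k0(1)] el_cell_right[OF k0] by (simp add: e del: last.simps)
  have vl: "ver X u0 (vdom X u0) (vdom X (clft X \<kappa>0))" "ver X (clft X \<kappa>0) (vdom X (clft X \<kappa>0)) (vcod X (clft X \<kappa>0))"
    using u0 cp X.clft_in[OF k0(1)] by (auto simp: ver_def)
  have vr: "ver X u0' (vdom X u0') (vdom X (crgt X \<kappa>0))" "ver X (crgt X \<kappa>0) (vdom X (crgt X \<kappa>0)) (vcod X (crgt X \<kappa>0))"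
    using u0 cod' X.crgt_in[OF k0(1)] by (auto simp: ver_def)
  have tc: "el_tail X p (concat (map (ctop X) qs0)) (concat rs)"
    using tl unfolding el_tail_def by (auto simp: list_all2_concat list_all2_map2 intro!: exI[of _ rs])
  have len: "list_all2 (\<lambda>r Js. length r = length Js) rs (map (ctop X) qs0)"
    using tl unfolding list_all2_map2 by (rule list_all2_mono) (simp add: el_tail_length)
  have cl: "vdom X (clft X (ccomp X \<kappa>0 u0 qs0)) = vdom X u0" using cellD(4)[OF cc] verD(2)[OF X.vcomp_ver[OF vl]] by simp
  have mem: "vlist [ccomp X \<kappa>0 u0 qs0, vlist (i # concat rs)] \<in> el_Cell X p" using cellD[OF cc] u0 tc cl by simp
  show ?thesis
    unfolding cell_def ec top el_entry_concat[OF len, symmetric]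
    using mem m cellD[OF cc] act_comp[OF vl u0(2)] act_comp[OF vr u0(4)] j cod' cp(4) X.clft_in[OF k0(1)] X.crgt_in[OF k0(1)] el_cell_right[OF k0]
    by (simp add: e del: last.simps)
qed

lemma multicell_composition_el: "multicell_composition (el X p)"
proof -
  interpret E: multicell_boundary "el X p" by (rule multicell_boundary_el)
  show ?thesis
  proof (unfold_locales, goal_cases)
    case (1 z) then show ?case using X.clft_in by (auto elim!: el_CellE)
  next
    case (2 z) then show ?case using X.crgt_in el_cell_right by (auto elim!: el_CellE simp del: last.simps)
  next
    case (3 f a b g c) then show ?case by (rule el_vcomp_ver)
  next
    case (4 \<kappa> u qs u') then show ?case by (rule el_ccomp_cell)
  qed
qed

text \<open>
  The projection \<open>el X p \<rightarrow> X\<close> preserves all operations. It is faithful on multicells with a given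
  boundary (\<open>el_Cell_eqI\<close>), so the unit and associativity laws for multicells are inherited from
  \<open>X\<close> once both sides of an equation have the same boundary.
\<close>

lemma el_proj:
  "z \<in> el_Ver X p \<Longrightarrow> part 0 (vdom (el X p) z) = vdom X (part 0 z) \<and> part 0 (vcod (el X p) z) = vcod X (part 0 z) \<and> part 0 z \<in> Ver X"
  "\<lbrakk>f \<in> el_Ver X p; g \<in> el_Ver X p; vcod (el X p) f = vdom (el X p) g\<rbrakk> \<Longrightarrow> part 0 (vcomp (el X p) g f) = vcomp X (part 0 g) (part 0 f)"
  "h \<in> el_Hor X p \<Longrightarrow> part 0 (cid (el X p) h) = cid X (part 0 h)"
  "z \<in> el_Cell X p \<Longrightarrow> part 0 (clft (el X p) z) = clft X (part 0 z) \<and> part 0 (crgt (el X p) z) = crgt X (part 0 z)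
    \<and> part 0 (cbot (el X p) z) = cbot X (part 0 z) \<and> map (part 0) (ctop (el X p) z) = ctop X (part 0 z) \<and> part 0 z \<in> Cell X"
  "composable (el X p) \<kappa> u qs u' \<Longrightarrow> part 0 (ccomp (el X p) \<kappa> u qs) = ccomp X (part 0 \<kappa>) (part 0 u) (map (part 0) qs)"
  by ((auto simp: el_def el_pre_def map_part_el_entry elim!: el_VerE el_HorE el_CellE simp del: last.simps)[4])
    (simp add: el_ccomp_eq el_ccomp_def)

lemma el_composable_proj:
  assumes "composable (el X p) \<kappa> u qs u'" shows "composable X (part 0 \<kappa>) (part 0 u) (map (part 0) qs) (part 0 u')"
proof -
  note c = composable_path[OF assms, unfolded el_sel]
  have "cpath X (part 0 u) (map (part 0) qs) (part 0 u')" unfolding cpath_def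
    by (rule chain_map[OF c(1)]) (simp_all add: el_proj)
  moreover have "map (cbot X) (map (part 0) qs) = map (part 0) (map (cbot (el X p)) qs)" using c(7) el_proj(4) by auto
  moreover have "clft (el X p) \<kappa> \<in> el_Ver X p" using c(2) X.clft_in by (auto elim!: el_CellE)
  ultimately show ?thesis using c(2-5) el_proj(1)[of u] el_proj(1)[of "clft (el X p) \<kappa>"] el_proj(4)[of \<kappa>]
    by (simp add: composable_def del: map_map)
qed

text \<open>
  The leftmost index is visible in the left side, and the others in the top.
\<close>

lemma el_Cell_eqI:
  assumes "z \<in> el_Cell X p" "z' \<in> el_Cell X p" "part 0 z = part 0 z'" "clft (el X p) z = clft (el X p) z'" "ctop (el X p) z = ctop (el X p) z'"
  shows "z = z'"
proof -
  have "map (part 2) (el_entry (ctop X q) (i # r)) = r" if "el_tail X p (ctop X q) r" for q i r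
    by (rule nth_equalityI) (use el_tail_length[OF that] in \<open>simp_all add: el_entry_def\<close>)
  moreover obtain q i r q' i' r' where "z = vlist [q, vlist (i # r)]" "el_tail X p (ctop X q) r" "z' = vlist [q', vlist (i' # r')]" "el_tail X p (ctop X q') r'"
    using assms(1,2) by (auto elim!: el_CellE)
  moreover from this have "q = q'" using assms(3) by simp
  ultimately show ?thesis using assms by simp metis
qed

lemma el_vcomp_assoc:
  assumes "ver (el X p) f a b" "ver (el X p) g b c" "ver (el X p) h c d"
  shows "vcomp (el X p) (vcomp (el X p) h g) f = vcomp (el X p) h (vcomp (el X p) g f)"
proof -
  obtain u i v j w k where f: "f = vlist [u, i]" "u \<in> Ver X" "i \<in> ix p (vdom X u)" and g: "g = vlist [v, j]" "v \<in> Ver X" "j \<in> ix p (vdom X v)"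
    and h: "h = vlist [w, k]" "w \<in> Ver X" "k \<in> ix p (vdom X w)"
    using assms by (auto simp: ver_def elim!: el_VerE)
  have e: "vcod X u = vdom X v" "vidx (fv p u) i = j" "vcod X v = vdom X w" "vidx (fv p v) j = k" using assms f g h by (auto simp: ver_def)
  have vv: "ver X u (vdom X u) (vdom X v)" "ver X v (vdom X v) (vdom X w)" "ver X w (vdom X w) (vcod X w)" using f g h e by (auto simp: ver_def)
  show ?thesis using f g h e X.vcomp_assoc[OF vv] verD[OF X.vcomp_ver[OF vv(1,2)]] verD[OF X.vcomp_ver[OF vv(2,3)]] act_comp[OF vv(1,2) f(3)]
    by simp
qed

lemma el_vcomp_id:
  assumes "ver (el X p) f a b" shows "vcomp (el X p) (vid (el X p) b) f = f" "vcomp (el X p) f (vid (el X p) a) = f"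
proof -
  obtain u i where f: "f = vlist [u, i]" "u \<in> Ver X" "i \<in> ix p (vdom X u)" using assms by (auto simp: ver_def elim!: el_VerE)
  note o = X.vdom_in[OF f(2)] X.vcod_in[OF f(2)]
  show "vcomp (el X p) (vid (el X p) b) f = f" "vcomp (el X p) f (vid (el X p) a) = f"
    using assms f o X.vcomp_id_left[OF X.ver_self[OF f(2)]] X.vcomp_id_right[OF X.ver_self[OF f(2)]] X.vid_ver[OF o(1)] X.vid_ver[OF o(2)]
      act_in[OF f(2,3)] act_id[OF o(1) f(3)]
    by (auto simp: ver_def)
qed

lemma vdc_el: "vdc (el X p)"
proof -
  interpret E: multicell_composition "el X p" by (rule multicell_composition_el)
  have vid: "ver (el X p) (vid (el X p) a) a a" if "a \<in> el_Ob X p" for a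
    using that X.vid_ver act_id by (auto elim!: el_ObE simp: ver_def)
  have bot: "cbot (el X p) z \<in> el_Hor X p \<and> hsrc (el X p) (cbot (el X p) z) = vcod (el X p) (clft (el X p) z)" if c: "z \<in> el_Cell X p" for z
  proof -
    obtain q i r where z: "z = vlist [q, vlist (i # r)]" "q \<in> Cell X" "i \<in> ix p (vdom X (clft X q))" "el_tail X p (ctop X q) r"
      using c by (rule el_CellE)
    show ?thesis using c z el_cell_right[OF z(2-4)] X.cbot_in[OF z(2)] X.cbot_src[OF z(2)] X.cbot_trg[OF z(2)] X.clft_in[OF z(2)] X.crgt_in[OF z(2)] act_in
      by (simp del: last.simps)
  qed
  have cid: "cell (el X p) (cid (el X p) z) [z] z (vid (el X p) (hsrc (el X p) z)) (vid (el X p) (htrg (el X p) z))" if h: "z \<in> el_Hor X p" for z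
  proof -
    obtain J i j where z: "z = vlist [J, i, j]" "J \<in> Hor X" "i \<in> ix p (hsrc X J)" "j \<in> ix p (htrg X J)"
      using h by (rule el_HorE)
    note c = X.cid_cell[OF z(2)]
    have "vlist [cid X J, vlist [i, j]] \<in> el_Cell X p"
      using cellD[OF c] z verD[OF X.vid_ver[OF X.hsrc_in[OF z(2)]]] by simp
    then show ?thesis unfolding cell_def using h z cellD[OF c] X.hsrc_in[OF z(2)] X.htrg_in[OF z(2)] act_id by simp
  qed
  have ob: "vdom (el X p) f \<in> el_Ob X p" "vcod (el X p) f \<in> el_Ob X p" if "f \<in> el_Ver X p" for f
    using that X.vdom_in X.vcod_in act_in by (auto elim!: el_VerE)
  have hob: "hsrc (el X p) h \<in> el_Ob X p" "htrg (el X p) h \<in> el_Ob X p" if "h \<in> el_Hor X p" for h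
    using that X.hsrc_in X.htrg_in by (auto elim!: el_HorE)
  have side: "clft (el X p) z \<in> el_Ver X p" "crgt (el X p) z \<in> el_Ver X p" if "z \<in> el_Cell X p" for z
    using E.clft_in'[of z] E.crgt_in'[of z] that by simp_all
  show ?thesis
  proof (unfold_locales, goal_cases)
    case (18 z)
    then have z: "z \<in> el_Cell X p" by simp
    note c = cid[OF conjunct1[OF bot[OF z]]] and s = side[OF z]
    have k: "composable (el X p) (cid (el X p) (cbot (el X p) z)) (clft (el X p) z) [z] (crgt (el X p) z)"
      using cellD[OF c] s z bot[OF z] verD[OF vid[OF ob(2)[OF s(1)]]] by (simp add: composable_def cpath_def)
    note l = E.ccomp_cell'[OF k]
    have "ver (el X p) (clft (el X p) z) (vdom (el X p) (clft (el X p) z)) (vcod (el X p) (clft (el X p) z))" using s by (simp add: ver_def)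
    note i = el_vcomp_id(1)[OF this]
    show ?case
      by (rule el_Cell_eqI) (use i cellD[OF l] cellD[OF c] z bot[OF z] in \<open>simp_all add: el_proj(5)[OF k] el_proj(3,4) X.ccomp_id_left\<close>)
  next
    case (19 z)
    then have z: "z \<in> el_Cell X p" by simp
    note s = side[OF z] and path = E.ctop_path'[of z, unfolded hpath_def el_sel, OF z]
    have H: "set (ctop (el X p) z) \<subseteq> el_Hor X p" using chain_ends(3)[OF path] .
    have "cpath (el X p) (vid (el X p) (vdom (el X p) (clft (el X p) z))) (map (cid (el X p)) (ctop (el X p) z)) (vid (el X p) (vdom (el X p) (crgt (el X p) z)))"
      unfolding cpath_def by (rule chain_map[OF path]) (use vid cid in \<open>auto simp: ver_def cell_def\<close>)
    moreover have "map (cbot (el X p)) (map (cid (el X p)) (ctop (el X p) z)) = ctop (el X p) z"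
      using H cid by (auto simp: cell_def subset_iff intro!: map_idI)
    ultimately have k: "composable (el X p) z (vid (el X p) (vdom (el X p) (clft (el X p) z))) (map (cid (el X p)) (ctop (el X p) z)) (vid (el X p) (vdom (el X p) (crgt (el X p) z)))"
      using z verD[OF vid[OF ob(1)[OF s(1)]]] by (simp add: composable_def)
    note l = E.ccomp_cell'[OF k]
    have "ver (el X p) (clft (el X p) z) (vdom (el X p) (clft (el X p) z)) (vcod (el X p) (clft (el X p) z))" using s by (simp add: ver_def)
    note i = el_vcomp_id(2)[OF this]
    have t: "concat (map (ctop (el X p)) (map (cid (el X p)) (ctop (el X p) z))) = ctop (el X p) z"
    proof -
      have "map (ctop (el X p)) (map (cid (el X p)) (ctop (el X p) z)) = map (\<lambda>h. [h]) (ctop (el X p) z)" using H cid by (auto simp: cell_def subset_iff)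
      then show ?thesis by (simp only: concat_map_singleton map_ident)
    qed
    have "ctop X (part 0 z) = map (part 0) (ctop (el X p) z)" using el_proj(4)[OF z] by simp
    then have "map (part 0) (map (cid (el X p)) (ctop (el X p) z)) = map (cid X) (ctop X (part 0 z))"
      using H el_proj(3) by (auto simp: subset_iff)
    note m = this
    have v: "part 0 (vid (el X p) (vdom (el X p) (clft (el X p) z))) = vid X (vdom X (clft X (part 0 z)))"
      using s(1) ob(1)[OF s(1)] el_proj(4)[OF z] by (auto elim!: el_VerE)
    show ?case
      by (rule el_Cell_eqI) (use m v cellD[OF l] z i t X.ccomp_id_right el_proj(4)[OF z] in \<open>simp_all add: el_proj(5)[OF k] del: map_map\<close>)
  next
    case (20 \<kappa> u qs u' \<xi>ss ws)
    note n = E.nested_composable[OF 20]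
    note l = cellD[OF E.ccomp_cell'[OF n(1)]] and r = cellD[OF E.ccomp_cell'[OF n(2)]] and cp = composable_path[OF 20(1)]
    have w: "ver (el X p) (ws ! 0) (vdom (el X p) (ws ! 0)) (vdom (el X p) u)" "ver (el X p) u (vdom (el X p) u) (vcod (el X p) u)"
      "ver (el X p) (clft (el X p) \<kappa>) (vcod (el X p) u) (vcod (el X p) (clft (el X p) \<kappa>))"
      using 20(4,5) cp side[of \<kappa>] by (auto simp: ver_def)
    let ?f = "\<lambda>i. ccomp (el X p) (qs ! i) (ws ! i) (\<xi>ss ! i)"
    have "map (ctop (el X p)) (map ?f [0..<length qs]) = map (\<lambda>\<xi>s. concat (map (ctop (el X p)) \<xi>s)) \<xi>ss"
      by (rule nth_equalityI) (use 20(2) cellD(2)[OF E.ccomp_cell'[OF 20(6)]] in auto)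
    then have t: "concat (map (ctop (el X p)) (map ?f [0..<length qs])) = concat (map (ctop (el X p)) (concat \<xi>ss))"
      by (simp only: concat_map_concat_map)
    note c = el_composable_proj[OF 20(1)] and c' = el_composable_proj[OF 20(6)]
    have u: "part 0 (vcomp (el X p) u (ws ! 0)) = vcomp X (part 0 u) (part 0 (ws ! 0))" using 20(4,5) cp by (simp add: el_proj)
    have "ccomp X (ccomp X (part 0 \<kappa>) (part 0 u) (map (part 0) qs)) (map (part 0) ws ! 0) (concat (map (map (part 0)) \<xi>ss))
      = ccomp X (part 0 \<kappa>) (vcomp X (part 0 u) (map (part 0) ws ! 0))
          (map (\<lambda>i. ccomp X (map (part 0) qs ! i) (map (part 0) ws ! i) (map (map (part 0)) \<xi>ss ! i)) [0..<length (map (part 0) qs)])"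
      by (rule X.ccomp_assoc[OF c]) (use 20(2-5) c' el_proj(1)[of "ws ! 0"] el_proj(1)[of u] cp(5) in simp_all)
    moreover have "map (\<lambda>i. ccomp X (map (part 0) qs ! i) (map (part 0) ws ! i) (map (map (part 0)) \<xi>ss ! i)) [0..<length (map (part 0) qs)]
      = map (part 0) (map ?f [0..<length qs])"
      by (rule nth_equalityI) (use 20(2,3) el_proj(5)[OF 20(6)] in auto)
    ultimately have "part 0 (ccomp (el X p) (ccomp (el X p) \<kappa> u qs) (ws ! 0) (concat \<xi>ss)) = part 0 (ccomp (el X p) \<kappa> (vcomp (el X p) u (ws ! 0)) (map ?f [0..<length qs]))"
      using 20(3) by (simp only: el_proj(5)[OF n(1)] el_proj(5)[OF n(2)] el_proj(5)[OF 20(1)] u map_concat) simp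
    note p = this
    show ?case
      by (rule el_Cell_eqI) (use p el_vcomp_assoc[OF w] l r t cellD[OF E.ccomp_cell'[OF 20(1)]] in \<open>simp_all del: map_map\<close>)
  qed (use vid bot cid ob hob side el_vcomp_ver el_vcomp_id el_vcomp_assoc E.ctop_path' E.cbot_trg' E.ccomp_cell' in auto)
qed

lemma large_vdc_el: assumes "large_vdc X" shows "large_vdc (el X p)"
proof -
  note L = assms[unfolded large_vdc_def]
  let ?I = "\<Union>x\<in>Ob X. ix p x"
  let ?S = "Ob X \<union> Ver X \<union> Hor X \<union> Cell X \<union> ?I \<union> vlist ` lists ?I"
  have big: "large (vlist ` lists ?S)" using L by (intro large_lists large_Un large_UN) auto
  have "el_Ob X p \<subseteq> vlist ` lists ?S" by (auto elim!: el_ObE)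
  moreover have "el_Ver X p \<subseteq> vlist ` lists ?S"
  proof
    fix z assume "z \<in> el_Ver X p"
    then obtain u i where z: "z = vlist [u, i]" "u \<in> Ver X" "i \<in> ix p (vdom X u)" by (rule el_VerE)
    have "i \<in> ?I" using z(3) X.vdom_in[OF z(2)] by blast
    then show "z \<in> vlist ` lists ?S" unfolding z(1) vlist_in_lists using z(2) by simp
  qed
  moreover have "el_Hor X p \<subseteq> vlist ` lists ?S"
  proof
    fix z assume "z \<in> el_Hor X p"
    then obtain J i j where z: "z = vlist [J, i, j]" "J \<in> Hor X" "i \<in> ix p (hsrc X J)" "j \<in> ix p (htrg X J)"
      by (rule el_HorE)
    have "i \<in> ?I" "j \<in> ?I" using z(3,4) X.hsrc_in[OF z(2)] X.htrg_in[OF z(2)] by blast+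
    then show "z \<in> vlist ` lists ?S" unfolding z(1) vlist_in_lists using z(2) by simp
  qed
  moreover have "el_Cell X p \<subseteq> vlist ` lists ?S"
  proof
    fix z assume "z \<in> el_Cell X p"
    then obtain q i r where z: "z = vlist [q, vlist (i # r)]" "q \<in> Cell X" "i \<in> ix p (vdom X (clft X q))" "el_tail X p (ctop X q) r"
      by (auto elim: el_CellE)
    have "set r \<subseteq> ?I" if "set Js \<subseteq> Hor X" "el_tail X p Js r" for Js r
      using that
    proof (induction Js arbitrary: r)
      case (Cons J Js)
      then obtain j s where r: "r = j # s" "j \<in> ix p (htrg X J)" "el_tail X p Js s" by auto
      have "j \<in> ?I" using r(2) X.htrg_in[of J] Cons.prems(1) by auto
      then show ?case using Cons.IH[OF _ r(3)] Cons.prems(1) r(1) by simp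
    qed simp
    from this[OF X.ctop_in[OF z(2)] z(4)]
    have "vlist (i # r) \<in> vlist ` lists ?I" using z(3) X.vdom_in[OF X.clft_in[OF z(2)]] by auto
    then show "z \<in> vlist ` lists ?S" unfolding z(1) vlist_in_lists using z(2) by simp
  qed
  moreover have "vdc_extensional (el X p)"
  proof -
    have "ccomp (el X p) \<kappa> u qs = undefined" if "\<nexists>u'. composable (el X p) \<kappa> u qs u'" for \<kappa> u qs
    proof -
      have "\<not> (\<exists>u'. composable (el_pre X p) \<kappa> u qs u')" using that unfolding el_composable .
      moreover have "ccomp (el X p) \<kappa> u qs = (if \<exists>u'. composable (el_pre X p) \<kappa> u qs u' then el_ccomp X \<kappa> u qs else undefined)"
        by (simp add: el_def)
      ultimately show ?thesis by (simp only: if_False)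
    qed
    moreover have "vcomp (el X p) g f = undefined" if "\<not> (f \<in> Ver (el X p) \<and> g \<in> Ver (el X p) \<and> vcod (el X p) f = vdom (el X p) g)" for g f
    proof (rule ccontr)
      assume n: "vcomp (el X p) g f \<noteq> undefined"
      then have "f \<in> el_Ver X p \<and> g \<in> el_Ver X p \<and> vcod X (part 0 f) = vdom X (part 0 g) \<and> vidx (fv p (part 0 f)) (part 1 f) = part 1 g"
        by (simp add: el_def el_pre_def split: if_splits)
      then show False using that by (auto elim!: el_VerE)
    qed
    moreover have "vdom (el X p) \<in> extensional (Ver (el X p))" "vcod (el X p) \<in> extensional (Ver (el X p))" "vid (el X p) \<in> extensional (Ob (el X p))"
      "hsrc (el X p) \<in> extensional (Hor (el X p))" "htrg (el X p) \<in> extensional (Hor (el X p))" "ctop (el X p) \<in> extensional (Cell (el X p))"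
      "cbot (el X p) \<in> extensional (Cell (el X p))" "clft (el X p) \<in> extensional (Cell (el X p))" "crgt (el X p) \<in> extensional (Cell (el X p))"
      "cid (el X p) \<in> extensional (Hor (el X p))"
      by (simp_all add: el_def el_pre_def)
    ultimately show ?thesis unfolding vdc_extensional_def by blast
  qed
  ultimately show ?thesis using vdc_el large_subset[OF big] by (simp add: large_vdc_def)
qed

end

section \<open>Functors into matrices and functors out of elements\<close>

abbreviation el_ends :: "'V VDC \<Rightarrow> 'V VDMap \<Rightarrow> 'V list \<Rightarrow> 'V \<Rightarrow> 'V list list \<Rightarrow> 'V list" where
  "el_ends X p qs i rs \<equiv> map2 (\<lambda>q b. vidx (fv p (crgt X q)) (last b)) qs (blk i rs)"

abbreviation el_tailss :: "'V VDC \<Rightarrow> 'V VDMap \<Rightarrow> 'V list \<Rightarrow> 'V list list \<Rightarrow> bool" where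
  "el_tailss X p qs rs \<equiv> list_all2 (\<lambda>r q. el_tail X p (ctop X q) r) rs qs"

lemma tails_fh: assumes "vdf X (mat A) G" "set Js \<subseteq> Hor X" shows "tails (map (fh G) Js) r \<longleftrightarrow> el_tail X G Js r"
proof -
  interpret G: virtual_double_functor X "mat A" G by fact
  have "part (Suc 0) (fh G J) = fo G (htrg X J)" if "J \<in> Hor X" for J using G.fh_trg[OF that] G.fh_in[OF that] by simp
  then show ?thesis using assms(2) by (auto simp: tails_def el_tail_def list_all2_conv_all_nth subset_iff)
qed

lemma map_part2_el_entry: "length s = length Js \<Longrightarrow> map (part 2) (el_entry Js (j # s)) = s"
  by (rule nth_equalityI) (simp_all add: el_entry_def)

context
  fixes X t :: "'V VDC" and p :: "'V VDMap"
  assumes X: "vdc X" and t: "vdc t" and p: "vdf X (mat t) p"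
begin

interpretation X: virtual_double_category X by fact
interpretation p: virtual_double_functor X "mat t" p by fact

lemma el_path:
  assumes "cpath X u qs u'" "i \<in> ix p (vdom X u)" "el_tailss X p qs rs"
  shows "chain (el_Ver X p) (el_Cell X p) (clft (el X p)) (crgt (el X p)) (vlist [u, i]) (el_cells qs (blk i rs)) (vlist [u', last (i # concat rs)])" (is ?P2)
    "map (cbot (el X p)) (el_cells qs (blk i rs)) = el_entry (map (cbot X) qs) (vidx (fv p u) i # el_ends X p qs i rs)" (is ?P3)
    "el_tail X p (map (cbot X) qs) (el_ends X p qs i rs)" (is ?P4)
    "list_all2 (\<lambda>q b. \<exists>h r. b = h # r \<and> h \<in> ix p (vdom X (clft X q)) \<and> el_tail X p (ctop X q) r
       \<and> last b \<in> ix p (vdom X (crgt X q))) qs (blk i rs)" (is ?P1)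
proof -
  have "?P2 \<and> ?P3 \<and> ?P4 \<and> ?P1"
    using assms
  proof (induction qs arbitrary: u i rs)
    case Nil then show ?case by (auto simp: cpath_def)
  next
    case (Cons q qs)
    then obtain r rs' where r: "rs = r # rs'" "el_tail X p (ctop X q) r" "el_tailss X p qs rs'" by (auto simp: list_all2_Cons2)
    have q: "u \<in> Ver X" "q \<in> Cell X" "clft X q = u" "cpath X (crgt X q) qs u'" using Cons.prems(1) by (auto simp: cpath_def)
    have l: "last (i # r) \<in> ix p (vdom X (crgt X q))"
      by (rule el_cell_right[OF X t p q(2) _ r(2)]) (use Cons.prems(2) q(3) in simp)
    note IH = Cons.IH[OF q(4) l r(3)]
    have e: "last (last (i # r) # concat rs') = last (i # concat (r # rs'))" by (simp add: last_append)
    have b: "vidx (fv p (crgt X q)) (last (i # r)) \<in> ix p (htrg X (cbot X q))"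
      using act_in[OF X t p X.crgt_in[OF q(2)] l] X.cbot_trg[OF q(2)] by simp
    show ?case using IH r(2) q(1-3) l b Cons.prems(2) unfolding r(1) blk.simps e
      by (simp del: last.simps)
  qed
  then show "?P2" "?P3"
    "?P4" "?P1" by blast+
qed

text \<open>
  The counterpart of \<open>el_composableD\<close>: decorating composable multicells of \<open>X\<close> with a tuple of indices gives
  composable multicells of \<open>el X p\<close>, where the indices of \<open>\<kappa>\<close> are forced to be the transported ones.
\<close>

lemma el_composableI:
  assumes c: "composable X \<kappa> u qs u'" and i: "i \<in> ix p (vdom X u)" and r: "el_tailss X p qs rs"
  shows "composable (el X p) (vlist [\<kappa>, vlist (vidx (fv p u) i # el_ends X p qs i rs)]) (vlist [u, i]) (el_cells qs (blk i rs)) (vlist [u', last (i # concat rs)])" (is ?P2)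
    "ccomp (el X p) (vlist [\<kappa>, vlist (vidx (fv p u) i # el_ends X p qs i rs)]) (vlist [u, i]) (el_cells qs (blk i rs)) = vlist [ccomp X \<kappa> u qs, vlist (i # concat rs)]" (is ?P1)
    "vlist [\<kappa>, vlist (vidx (fv p u) i # el_ends X p qs i rs)] \<in> el_Cell X p" (is ?P3)
proof -
  note cp = composable_path[OF c]
  have "cpath X u qs u'" using c by (simp add: composable_def)
  note e = el_path[OF this i r]
  have j: "vidx (fv p u) i \<in> ix p (vdom X (clft X \<kappa>))" using act_in[OF X t p cp(5) i] cp(4) by simp
  show m: "?P3"
    using e(3) cp(2,3) j by simp
  show k: "?P2"
    unfolding composable_def cpath_def el_sel using e(1,2) m cp i j X.clft_in[OF cp(2)] by (simp add: cp(3) del: last.simps)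
  have "length qs = length rs" using r list_all2_lengthD by force
  then show "?P1"
    unfolding el_ccomp_eq[OF k] by (rule el_ccomp_blk[OF X t p])
qed

end

definition tab_fo :: "'V VDMap \<Rightarrow> 'V VDMap \<Rightarrow> 'V \<Rightarrow> 'V" where
  "tab_fo p F x = mkO (part 0 (fo p x)) (\<lambda>i. fo F (vlist [x, i]))"

definition tab_fv :: "'V VDC \<Rightarrow> 'V VDMap \<Rightarrow> 'V VDMap \<Rightarrow> 'V \<Rightarrow> 'V" where
  "tab_fv X p F u = mkV (tab_fo p F (vdom X u)) (tab_fo p F (vcod X u)) (vidx (fv p u)) (\<lambda>i. fv F (vlist [u, i]))"

definition tab_fh :: "'V VDC \<Rightarrow> 'V VDMap \<Rightarrow> 'V VDMap \<Rightarrow> 'V \<Rightarrow> 'V" where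
  "tab_fh X p F J = mkH (tab_fo p F (hsrc X J)) (tab_fo p F (htrg X J)) (\<lambda>i j. fh F (vlist [J, i, j]))"

definition tab_fc :: "'V VDC \<Rightarrow> 'V VDMap \<Rightarrow> 'V VDMap \<Rightarrow> 'V \<Rightarrow> 'V" where
  "tab_fc X p F q = mkC (map (tab_fh X p F) (ctop X q)) (tab_fh X p F (cbot X q)) (tab_fv X p F (clft X q)) (tab_fv X p F (crgt X q))
     (\<lambda>is. fc F (vlist [q, vlist is]))"

text \<open>
  The functor \<open>X \<rightarrow> mat A\<close> over \<open>p\<close> that tabulates a functor \<open>F\<close> out of \<open>el X p\<close>: its entry at some data
  of \<open>X\<close> and indices is the value of \<open>F\<close> at these.
\<close>

definition tab :: "'V VDC \<Rightarrow> 'V VDMap \<Rightarrow> 'V VDMap \<Rightarrow> 'V VDMap" where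
  "tab X p F = \<lparr>fo = restrict (tab_fo p F) (Ob X), fv = restrict (tab_fv X p F) (Ver X),
     fh = restrict (tab_fh X p F) (Hor X), fc = restrict (tab_fc X p F) (Cell X)\<rparr>"

abbreviation el_unit :: "'V VDC \<Rightarrow> 'V VDMap \<Rightarrow> 'V VDMap" where
  "el_unit X p \<equiv> tab X p (id_map (el X p))"

lemma tab_fo_sel [simp]: "part 0 (tab_fo p F x) = part 0 (fo p x)" "idx (tab_fo p F x) = ix p x"
  "i \<in> ix p x \<Longrightarrow> oent (tab_fo p F x) i = fo F (vlist [x, i])"
  by (simp_all add: tab_fo_def idx_def[of "fo p x"])

lemma tab_fv_sel [simp]: "part 0 (tab_fv X p F u) = tab_fo p F (vdom X u)" "part (Suc 0) (tab_fv X p F u) = tab_fo p F (vcod X u)"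
  "i \<in> ix p (vdom X u) \<Longrightarrow> vidx (tab_fv X p F u) i = vidx (fv p u) i"
  "i \<in> ix p (vdom X u) \<Longrightarrow> vent (tab_fv X p F u) i = fv F (vlist [u, i])"
  by (simp_all add: tab_fv_def)

lemma tab_fh_sel [simp]: "part 0 (tab_fh X p F J) = tab_fo p F (hsrc X J)" "part (Suc 0) (tab_fh X p F J) = tab_fo p F (htrg X J)"
  "\<lbrakk>i \<in> ix p (hsrc X J); j \<in> ix p (htrg X J)\<rbrakk> \<Longrightarrow> hent (tab_fh X p F J) i j = fh F (vlist [J, i, j])"
  by (simp_all add: tab_fh_def)

lemma tails_tab [simp]: "tails (map (tab_fh X p F) Js) r \<longleftrightarrow> el_tail X p Js r"
  by (simp add: tails_def el_tail_def list_all2_map2)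

lemma tab_fc_sel [simp]: "mat_ctop (tab_fc X p F q) = map (tab_fh X p F) (ctop X q)" "part (Suc 0) (tab_fc X p F q) = tab_fh X p F (cbot X q)"
  "part 2 (tab_fc X p F q) = tab_fv X p F (clft X q)" "part 3 (tab_fc X p F q) = tab_fv X p F (crgt X q)"
  "\<lbrakk>i \<in> ix p (vdom X (clft X q)); el_tail X p (ctop X q) r\<rbrakk> \<Longrightarrow> cent (tab_fc X p F q) (i # r) = fc F (vlist [q, vlist (i # r)])"
  by (simp_all add: tab_fc_def)

lemma tab_sel: "x \<in> Ob X \<Longrightarrow> fo (tab X p F) x = tab_fo p F x" "u \<in> Ver X \<Longrightarrow> fv (tab X p F) u = tab_fv X p F u"
  "J \<in> Hor X \<Longrightarrow> fh (tab X p F) J = tab_fh X p F J" "q \<in> Cell X \<Longrightarrow> fc (tab X p F) q = tab_fc X p F q"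
  by (simp_all add: tab_def)

context
  fixes X t A :: "'V VDC" and p F :: "'V VDMap"
  assumes X: "vdc X" and t: "vdc t" and p: "vdf X (mat t) p" and A: "vdc A" and F: "vdf (el X p) A F"
begin

interpretation X: virtual_double_category X by fact
interpretation A: virtual_double_category A by fact
interpretation p: virtual_double_functor X "mat t" p by fact
interpretation E: virtual_double_category "el X p" by (rule vdc_el[OF X t p])
interpretation F: virtual_double_functor "el X p" A F by fact

lemma tab_fo_in: "x \<in> Ob X \<Longrightarrow> tab_fo p F x \<in> mat_Ob A"
  unfolding tab_fo_def mkO_in using mat_ObD(1)[of "fo p x" t] p.fo_in[of x] F.fo_in[of "vlist [x, _]"] by (auto simp: idx_def)

lemma tab_fv_in: assumes "u \<in> Ver X" shows "tab_fv X p F u \<in> mat_Ver A"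
proof -
  have "ver A (fv F (vlist [u, i])) (fo F (vlist [vdom X u, i])) (fo F (vlist [vcod X u, vidx (fv p u) i]))"
    if "i \<in> ix p (vdom X u)" for i
    using F.fv_ver[OF E.ver_self[of "vlist [u, i]"]] that assms by simp
  then show ?thesis unfolding tab_fv_def mkV_in
    using assms tab_fo_in X.vdom_in X.vcod_in act_in[OF X t p assms] by auto
qed

lemma tab_fh_in: assumes "J \<in> Hor X" shows "tab_fh X p F J \<in> mat_Hor A"
proof -
  have "fh F (vlist [J, i, j]) \<in> Hor A \<and> hsrc A (fh F (vlist [J, i, j])) = fo F (vlist [hsrc X J, i]) \<and> htrg A (fh F (vlist [J, i, j])) = fo F (vlist [htrg X J, j])"
    if "i \<in> ix p (hsrc X J)" "j \<in> ix p (htrg X J)" for i j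
    using F.fh_in[of "vlist [J, i, j]"] F.fh_src[of "vlist [J, i, j]"] F.fh_trg[of "vlist [J, i, j]"] that assms by simp
  then show ?thesis unfolding tab_fh_def mkH_in
    using assms tab_fo_in X.hsrc_in X.htrg_in by auto
qed

lemma tab_entry:
  assumes "hpath X x Js y" "i \<in> ix p x" "el_tail X p Js r"
  shows "mat_entry (map (tab_fh X p F) Js) (i # r) = map (fh F) (el_entry Js (i # r))"
  using assms unfolding hpath_def by (induction Js arbitrary: x i r) auto

lemma tab_fc_in: assumes "q \<in> Cell X" shows "tab_fc X p F q \<in> mat_Cell A"
proof -
  note hp = X.ctop_path[OF assms] and l = X.clft_in[OF assms] and r = X.crgt_in[OF assms]
  have "mpath A (tab_fo p F (vdom X (clft X q))) (map (tab_fh X p F) (ctop X q)) (tab_fo p F (vdom X (crgt X q)))"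
    using hp unfolding hpath_def by (rule chain_map) (simp_all add: tab_fo_in tab_fh_in)
  moreover have "cell A (fc F (vlist [q, vlist (i # s)])) (mat_entry (map (tab_fh X p F) (ctop X q)) (i # s))
      (hent (tab_fh X p F (cbot X q)) (vidx (tab_fv X p F (clft X q)) i) (vidx (tab_fv X p F (crgt X q)) (last (i # s))))
      (vent (tab_fv X p F (clft X q)) i) (vent (tab_fv X p F (crgt X q)) (last (i # s)))"
    if i: "i \<in> ix p (vdom X (clft X q))" and s: "el_tail X p (ctop X q) s" for i s
    using F.fc_cell[OF E.cell_self[of "vlist [q, vlist (i # s)]"]] assms i s el_cell_right[OF X t p assms i s] tab_entry[OF hp i s]
      act_in[OF X t p l i] act_in[OF X t p r el_cell_right[OF X t p assms i s]] X.cbot_src[OF assms] X.cbot_trg[OF assms]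
    by (simp del: last.simps)
  ultimately show ?thesis unfolding tab_fc_def mkC_in
    using tab_fh_in[OF X.cbot_in[OF assms]] tab_fv_in[OF l] tab_fv_in[OF r] X.cbot_src[OF assms] X.cbot_trg[OF assms]
    by (simp del: last.simps)
qed

lemma vdf_tab: "vdf X (mat A) (tab X p F)"
proof -
  note sel = tab_sel tab_fo_in tab_fv_in tab_fh_in tab_fc_in
  have vid: "tab_fv X p F (vid X x) = mat_vid A (tab_fo p F x)" if x: "x \<in> Ob X" for x
  proof -
    note v = X.vid_ver[OF x] and w = verD[OF X.vid_ver[OF x]]
    show ?thesis
      by (rule vent_ext[OF tab_fv_in[OF w(1)] mat_vid_in[OF A tab_fo_in[OF x]]])
        (use w F.fv_vid[of "vlist [x, _]"] act_id[OF X t p x] x in simp_all)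
  qed
  have vcomp: "tab_fv X p F (vcomp X g f) = mat_vcomp A (tab_fv X p F g) (tab_fv X p F f)" if f: "ver X f a b" and g: "ver X g b c" for f g a b c
  proof -
    note fd = verD[OF f] and gd = verD[OF g] and w = verD[OF X.vcomp_ver[OF f g]]
    have e: "part (Suc 0) (tab_fv X p F f) = part 0 (tab_fv X p F g)" using fd gd by simp
    have "fv F (vlist [vcomp X g f, i]) = vcomp A (fv F (vlist [g, vidx (fv p f) i])) (fv F (vlist [f, i]))" if "i \<in> ix p a" for i
      using F.fv_vcomp[OF E.ver_self[of "vlist [f, i]"], of "vlist [g, vidx (fv p f) i]" "vlist [vcod X g, vidx (fv p g) (vidx (fv p f) i)]"]
        that fd gd act_in[OF X t p fd(1), of i] by (simp add: ver_def)
    then show ?thesis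
      by (intro vent_ext[OF tab_fv_in[OF w(1)] mat_vcomp_in[OF A tab_fv_in[OF fd(1)] tab_fv_in[OF gd(1)] e]])
        (use fd gd w act_comp[OF X t p f g] act_in[OF X t p fd(1)] in simp_all)
  qed
  show ?thesis
  proof (unfold_locales, goal_cases)
    case (6 u a b) then show ?case using X.vdom_in X.vcod_in by (auto simp: ver_def sel)
  next
    case (7 x) then show ?case using vid verD(1)[OF X.vid_ver[OF 7]] by (simp add: sel)
  next
    case (8 f a b g c)
    then show ?case using vcomp[OF 8] verD[OF X.vcomp_ver[OF 8]] verD[OF 8(1)] verD[OF 8(2)] by (simp add: sel mat_vcomp_eq)
  next
    case (12 q Js \<Delta> u u')
    note c = cellD[OF 12]
    have "map (fh (tab X p F)) Js = map (tab_fh X p F) Js" using X.ctop_in[OF c(1)] c(2) sel by auto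
    then show ?case using X.cell_ver[OF 12] c by (simp add: cell_mat sel del: map_eq_conv)
  next
    case (13 J)
    note c = cellD[OF X.cid_cell[OF 13]] and s = X.hsrc_in[OF 13] and tt = X.htrg_in[OF 13]
    note ci = mat_cid_cell[OF A tab_fh_in[OF 13], unfolded cell_mat]
    have "tab_fc X p F (cid X J) = mat_cid A (tab_fh X p F J)"
    proof (rule cent_ext[OF tab_fc_in[OF c(1)], of _ A])
      fix i r assume "i \<in> idx (part 0 (part 2 (tab_fc X p F (cid X J))))" "tails (mat_ctop (tab_fc X p F (cid X J))) r"
      then obtain j where ij: "i \<in> ix p (hsrc X J)" "r = [j]" "j \<in> ix p (htrg X J)"
        using c s verD[OF X.vid_ver[OF s]] by auto
      show "cent (tab_fc X p F (cid X J)) (i # r) = cent (mat_cid A (tab_fh X p F J)) (i # r)"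
        using F.fc_cid[of "vlist [J, i, j]"] ij c 13 verD[OF X.vid_ver[OF s]] by (simp add: cent_mat_cid)
    qed (use ci c vid[OF s] vid[OF tt] in auto)
    then show ?case using 13 c by (simp add: sel)
  next
    case (14 \<kappa> u qs u')
    note cp = composable_path[OF 14] and cc = X.ccomp_cell[OF 14]
    note c = cellD[OF cc]
    have cpx: "cpath X u qs u'" using 14 by (simp add: composable_def)
    note ue = chain_ends(2)[OF cp(1)]
    have e': "vcod X u' = vdom X (crgt X \<kappa>)"
    proof -
      interpret B: multicell_boundary X by unfold_locales (use X.ctop_path X.cbot_trg in auto)
      show ?thesis by (rule B.composable_right[OF 14])
    qed
    have vl: "ver X u (vdom X u) (vdom X (clft X \<kappa>))" "ver X (clft X \<kappa>) (vdom X (clft X \<kappa>)) (vcod X (clft X \<kappa>))"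
      using cp X.clft_in[OF cp(2)] by (auto simp: ver_def)
    have vr: "ver X u' (vdom X u') (vdom X (crgt X \<kappa>))" "ver X (crgt X \<kappa>) (vdom X (crgt X \<kappa>)) (vcod X (crgt X \<kappa>))"
      using cp X.crgt_in[OF cp(2)] e' by (auto simp: ver_def)
    have p': "mcpath A (tab_fv X p F u) (map (tab_fc X p F) qs) (tab_fv X p F u')"
      by (rule chain_map[OF cp(1)]) (simp_all add: tab_fv_in tab_fc_in)
    have "map (part (Suc 0)) (map (tab_fc X p F) qs) = map (tab_fh X p F) (map (cbot X) qs)" by simp
    then have k: "composable (mat A) (tab_fc X p F \<kappa>) (tab_fv X p F u) (map (tab_fc X p F) qs) (tab_fv X p F u')"
      unfolding composable_mat using p' cp by (simp add: tab_fc_in del: map_map)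
    note c' = mat_ccomp_cell[OF A k, unfolded cell_mat]
    have "tab_fc X p F (ccomp X \<kappa> u qs) = mat_ccomp A (tab_fc X p F \<kappa>) (tab_fv X p F u) (map (tab_fc X p F) qs)"
    proof (rule cent_ext[OF tab_fc_in[OF c(1)], of _ A])
      fix i r assume ir: "i \<in> idx (part 0 (part 2 (tab_fc X p F (ccomp X \<kappa> u qs))))" "tails (mat_ctop (tab_fc X p F (ccomp X \<kappa> u qs))) r"
      have i: "i \<in> ix p (vdom X u)" using ir(1) c verD[OF X.vcomp_ver[OF vl]] by simp
      have i': "i \<in> idx (part 0 (tab_fv X p F u))" using i by simp
      have "el_tail X p (concat (map (ctop X) qs)) r" using ir(2) c by simp
      then obtain rs where r: "r = concat rs" and rs: "el_tailss X p qs rs" by (auto simp: el_tail_def list_all2_concat list_all2_map2)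
      have rs': "tailss (map (tab_fc X p F) qs) rs" using rs by (simp add: tailss_def list_all2_map2)
      note ok = el_path(4)[OF X t p cpx i rs]
      have en: "ends (map (tab_fc X p F) qs) i rs = el_ends X p qs i rs"
        unfolding ends_def map2_map1 by (rule map2_cong_all2[OF ok]) auto
      have m: "map2 cent (map (tab_fc X p F) qs) (blk i rs) = map (fc F) (el_cells qs (blk i rs))"
      proof -
        have "map2 cent (map (tab_fc X p F) qs) (blk i rs) = map2 (\<lambda>q b. fc F (vlist [q, vlist b])) qs (blk i rs)"
          unfolding map2_map1 by (rule map2_cong_all2[OF ok]) auto
        then show ?thesis by (simp add: comp_def split_def)
      qed
      note I = el_composableI[OF X t p 14 i rs]
      have "cent (tab_fc X p F (ccomp X \<kappa> u qs)) (i # r) = fc F (vlist [ccomp X \<kappa> u qs, vlist (i # concat rs)])"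
        using ir unfolding r by simp
      also have "\<dots> = ccomp A (fc F (vlist [\<kappa>, vlist (vidx (fv p u) i # el_ends X p qs i rs)])) (fv F (vlist [u, i])) (map (fc F) (el_cells qs (blk i rs)))"
        unfolding I(2)[symmetric] by (rule F.fc_ccomp[OF I(1)])
      also have "\<dots> = cent (mat_ccomp A (tab_fc X p F \<kappa>) (tab_fv X p F u) (map (tab_fc X p F) qs)) (i # r)"
        unfolding r cent_mat_ccomp[OF k i' rs'] en m using I(3) i by simp
      finally show "cent (tab_fc X p F (ccomp X \<kappa> u qs)) (i # r) = cent (mat_ccomp A (tab_fc X p F \<kappa>) (tab_fv X p F u) (map (tab_fc X p F) qs)) (i # r)" .
    qed (use c c' vcomp[OF vl] vcomp[OF vr] in \<open>simp_all add: map_concat comp_def\<close>)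
    moreover have "map (fc (tab X p F)) qs = map (tab_fc X p F) qs" using cp(7) sel by auto
    ultimately show ?case using c cp by (simp add: sel mat_ccomp_eq[OF k] del: map_eq_conv)
  qed (use X.hsrc_in X.htrg_in in \<open>auto simp: sel\<close>, auto simp: tab_def)
qed

end

definition shift :: "'V VDC \<Rightarrow> ('V \<Rightarrow> 'V \<Rightarrow> 'V) \<Rightarrow> 'V list \<Rightarrow> 'V list \<Rightarrow> 'V list" where
  "shift X v Js r = map2 (\<lambda>J. v (htrg X J)) Js r"

lemma shift_simps [simp]: "shift X v [] r = []" "shift X v (J # Js) (j # r) = v (htrg X J) j # shift X v Js r"
  by (simp_all add: shift_def)

lemma shift_append: "length r = length Js \<Longrightarrow> shift X v (Js @ \<Delta>s) (r @ s) = shift X v Js r @ shift X v \<Delta>s s"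
  by (simp add: shift_def)

lemma shift_concat:
  "list_all2 (\<lambda>r Js. length r = length Js) rs Jss \<Longrightarrow> shift X v (concat Jss) (concat rs) = concat (map2 (shift X v) Jss rs)"
  by (induction rule: list_all2_induct) (auto simp: shift_append)

lemma shift_last: "\<lbrakk>hpath X x Js y; el_tail X p Js r\<rbrakk> \<Longrightarrow> last (v x i # shift X v Js r) = v y (last (i # r))"
  unfolding hpath_def by (induction Js arbitrary: x i r) auto

text \<open>
  The functor out of \<open>el X p\<close> that reads off the entries of \<open>G : X \<rightarrow> mat A\<close> at indices moved along
  \<open>v x : p x \<rightarrow> G x\<close>. If \<open>G\<close> lies over \<open>p\<close> and \<open>v\<close> consists of identities,
  this inverts \<open>tab\<close>; for general \<open>v\<close> its tabulation is the reindexing of \<open>G\<close>. One proof of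
  functoriality serves both purposes.
\<close>

definition untab :: "'V VDC \<Rightarrow> 'V VDMap \<Rightarrow> 'V VDMap \<Rightarrow> ('V \<Rightarrow> 'V \<Rightarrow> 'V) \<Rightarrow> 'V VDMap" where
  "untab X p G v = \<lparr>fo = \<lambda>z\<in>el_Ob X p. oent (fo G (part 0 z)) (v (part 0 z) (part 1 z)),
     fv = \<lambda>z\<in>el_Ver X p. vent (fv G (part 0 z)) (v (vdom X (part 0 z)) (part 1 z)),
     fh = \<lambda>z\<in>el_Hor X p. hent (fh G (part 0 z)) (v (hsrc X (part 0 z)) (part 1 z)) (v (htrg X (part 0 z)) (part 2 z)),
     fc = \<lambda>z\<in>el_Cell X p. cent (fc G (part 0 z)) (v (vdom X (clft X (part 0 z))) (hd (el_index z)) # shift X v (ctop X (part 0 z)) (tl (el_index z)))\<rparr>"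

lemma untab_sel [simp]:
  "vlist [x, i] \<in> el_Ob X p \<Longrightarrow> fo (untab X p G v) (vlist [x, i]) = oent (fo G x) (v x i)"
  "vlist [u, i] \<in> el_Ver X p \<Longrightarrow> fv (untab X p G v) (vlist [u, i]) = vent (fv G u) (v (vdom X u) i)"
  "vlist [J, i, j] \<in> el_Hor X p \<Longrightarrow> fh (untab X p G v) (vlist [J, i, j]) = hent (fh G J) (v (hsrc X J) i) (v (htrg X J) j)"
  "vlist [q, vlist (i # r)] \<in> el_Cell X p \<Longrightarrow> fc (untab X p G v) (vlist [q, vlist (i # r)])
     = cent (fc G q) (v (vdom X (clft X q)) i # shift X v (ctop X q) r)"
  by (simp_all add: untab_def)

lemma fh_sel:
  assumes "vdf X (mat A) G" "J \<in> Hor X"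
  shows "fh G J \<in> mat_Hor A" "part 0 (fh G J) = fo G (hsrc X J)" "part (Suc 0) (fh G J) = fo G (htrg X J)"
  using virtual_double_functor.fh_in[OF assms] virtual_double_functor.fh_src[OF assms] virtual_double_functor.fh_trg[OF assms] by auto

lemma fv_sel_into_mat:
  assumes "vdf X (mat A) G" "u \<in> Ver X"
  shows "fv G u \<in> mat_Ver A" "part 0 (fv G u) = fo G (vdom X u)" "part (Suc 0) (fv G u) = fo G (vcod X u)"
  using virtual_double_functor.fv_Ver[OF assms] by auto

lemma fc_sel_into_mat:
  assumes "vdf X (mat A) G" "q \<in> Cell X"
  shows "fc G q \<in> mat_Cell A" "mat_ctop (fc G q) = map (fh G) (ctop X q)" "part (Suc 0) (fc G q) = fh G (cbot X q)"
    "part 2 (fc G q) = fv G (clft X q)" "part 3 (fc G q) = fv G (crgt X q)"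
  using virtual_double_functor.fc_Cell[OF assms] by auto

context
  fixes X t A :: "'V VDC" and p G :: "'V VDMap" and v :: "'V \<Rightarrow> 'V \<Rightarrow> 'V"
  assumes X: "vdc X" and t: "vdc t" and p: "vdf X (mat t) p" and A: "vdc A" and G: "vdf X (mat A) G"
    and v_in: "\<And>x i. \<lbrakk>x \<in> Ob X; i \<in> ix p x\<rbrakk> \<Longrightarrow> v x i \<in> ix G x"
    and v_nat: "\<And>u i. \<lbrakk>u \<in> Ver X; i \<in> ix p (vdom X u)\<rbrakk> \<Longrightarrow> vidx (fv G u) (v (vdom X u) i) = v (vcod X u) (vidx (fv p u) i)"
begin

interpretation X: virtual_double_category X by fact
interpretation A: virtual_double_category A by fact
interpretation p: virtual_double_functor X "mat t" p by fact
interpretation E: virtual_double_category "el X p" by (rule vdc_el[OF X t p])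
interpretation G: virtual_double_functor X "mat A" G by fact

lemma shift_tail: "\<lbrakk>set Js \<subseteq> Hor X; el_tail X p Js r\<rbrakk> \<Longrightarrow> el_tail X G Js (shift X v Js r)"
  by (induction Js arbitrary: r) (auto simp: v_in X.htrg_in)

lemma shift_tails: "\<lbrakk>set Js \<subseteq> Hor X; el_tail X p Js r\<rbrakk> \<Longrightarrow> tails (map (fh G) Js) (shift X v Js r)"
  by (simp add: tails_fh[OF G] shift_tail)

lemma shift_entry:
  assumes "hpath X x Js y" "i \<in> ix p x" "el_tail X p Js r"
  shows "mat_entry (map (fh G) Js) (v x i # shift X v Js r) = map (fh (untab X p G v)) (el_entry Js (i # r))"
  using assms unfolding hpath_def by (induction Js arbitrary: x i r) auto

lemma blk_shift:
  assumes "cpath X u qs u'" "el_tailss X p qs rs"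
  shows "blk (v (vdom X u) i) (map2 (\<lambda>q. shift X v (ctop X q)) qs rs)
    = map2 (\<lambda>q b. v (vdom X (clft X q)) (hd b) # shift X v (ctop X q) (tl b)) qs (blk i rs)"
  using assms
proof (induction qs arbitrary: u i rs)
  case (Cons q qs)
  then obtain r rs' where r: "rs = r # rs'" "el_tail X p (ctop X q) r" "el_tailss X p qs rs'" by (auto simp: list_all2_Cons2)
  have q: "q \<in> Cell X" "clft X q = u" "cpath X (crgt X q) qs u'" using Cons.prems(1) by (auto simp: cpath_def)
  note l = shift_last[OF X.ctop_path[OF q(1)] r(2), of v i, unfolded q(2)]
  show ?case using Cons.IH[OF q(3) r(3), of "last (i # r)"] l q(2) by (simp add: r(1) del: last.simps)
qed simp

text \<open>
  Moving indices by a natural family \<open>v\<close> commutes with their transport along the sides of multicells.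
  This is where \<open>v_nat\<close> enters the proof that \<open>untab\<close> preserves composition.
\<close>

lemma ends_shift:
  assumes c: "cpath X u qs u'" and i: "i \<in> ix p (vdom X u)" and r: "el_tailss X p qs rs"
  shows "ends (map (fc G) qs) (v (vdom X u) i) (map2 (\<lambda>q. shift X v (ctop X q)) qs rs) = shift X v (map (cbot X) qs) (el_ends X p qs i rs)"
proof -
  have th: "set qs \<subseteq> Cell X" using c chain_ends(3) unfolding cpath_def by fastforce
  have "ends (map (fc G) qs) (v (vdom X u) i) (map2 (\<lambda>q. shift X v (ctop X q)) qs rs)
      = map2 (\<lambda>q b. vidx (part 3 (fc G q)) (last (v (vdom X (clft X q)) (hd b) # shift X v (ctop X q) (tl b)))) qs (blk i rs)"
    unfolding ends_def map2_map1 blk_shift[OF c r] by (rule nth_equalityI) auto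
  also have "\<dots> = map2 (\<lambda>q b. v (htrg X (cbot X q)) (vidx (fv p (crgt X q)) (last b))) qs (blk i rs)"
  proof (rule map2_cong_all2[OF el_path(4)[OF X t p c i r]])
    fix q b assume "q \<in> set qs" and "\<exists>h r. b = h # r \<and> h \<in> ix p (vdom X (clft X q)) \<and> el_tail X p (ctop X q) r \<and> last b \<in> ix p (vdom X (crgt X q))"
    then obtain h r where b: "b = h # r" "h \<in> ix p (vdom X (clft X q))" "el_tail X p (ctop X q) r" "last b \<in> ix p (vdom X (crgt X q))"
      and t: "q \<in> Cell X" using th by blast
    show "vidx (part 3 (fc G q)) (last (v (vdom X (clft X q)) (hd b) # shift X v (ctop X q) (tl b))) = v (htrg X (cbot X q)) (vidx (fv p (crgt X q)) (last b))"
      using shift_last[OF X.ctop_path[OF t] b(3), of v h] v_nat[OF X.crgt_in[OF t] b(4)] b(1) X.cbot_trg[OF t]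
      by (simp add: fc_sel_into_mat[OF G t] del: last.simps)
  qed
  also have "\<dots> = shift X v (map (cbot X) qs) (el_ends X p qs i rs)" unfolding shift_def by (rule nth_equalityI) auto
  finally show ?thesis .
qed

lemma vdf_untab: "vdf (el X p) A (untab X p G v)"
proof -
  note vs = fv_sel_into_mat[OF G] and hs = fh_sel[OF G] and cs = fc_sel_into_mat[OF G]
  show ?thesis
  proof (unfold_locales, goal_cases)
    case (5 z)
    then obtain x i where z: "z = vlist [x, i]" "x \<in> Ob X" "i \<in> ix p x" by (auto elim: el_ObE)
    then show ?case using mat_ObD(2)[of "fo G x" A "v x i"] G.fo_in v_in by simp
  next
    case (6 z a b)
    then obtain u i where z: "z = vlist [u, i]" "u \<in> Ver X" "i \<in> ix p (vdom X u)" by (auto simp: ver_def elim: el_VerE)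
    note o = X.vdom_in[OF z(2)] X.vcod_in[OF z(2)]
    show ?case using mat_VerD(4)[OF vs(1)[OF z(2)], of "v (vdom X u) i"] 6 z v_in[OF o(1) z(3)] v_nat[OF z(2,3)] o act_in[OF X t p z(2,3)]
      by (auto simp: vs ver_def)
  next
    case (7 z)
    then obtain x i where z: "z = vlist [x, i]" "x \<in> Ob X" "i \<in> ix p x" by (auto elim: el_ObE)
    then show ?case using G.fv_vid[OF z(2)] G.fo_in[OF z(2)] v_in[OF z(2,3)] verD[OF X.vid_ver[OF z(2)]] by simp
  next
    case (8 f a b g c)
    obtain u i w j where f: "f = vlist [u, i]" "u \<in> Ver X" "i \<in> ix p (vdom X u)" and g: "g = vlist [w, j]" "w \<in> Ver X" "j \<in> ix p (vdom X w)"
      using 8 by (auto simp: ver_def elim!: el_VerE)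
    have e: "vcod X u = vdom X w" "vidx (fv p u) i = j" using 8 f g by (auto simp: ver_def)
    have vv: "ver X u (vdom X u) (vdom X w)" "ver X w (vdom X w) (vcod X w)" using f g e by (auto simp: ver_def)
    have c: "part (Suc 0) (fv G u) = part 0 (fv G w)" using vs[OF f(2)] vs[OF g(2)] e by simp
    show ?case using G.fv_vcomp[OF vv] verD[OF X.vcomp_ver[OF vv]] f g e v_in[OF X.vdom_in[OF f(2)] f(3)] v_nat[OF f(2,3)] c vs[OF f(2)] vs[OF g(2)]
      by (simp add: mat_vcomp_eq)
  next
    case (9 z)
    then obtain J i j where z: "z = vlist [J, i, j]" "J \<in> Hor X" "i \<in> ix p (hsrc X J)" "j \<in> ix p (htrg X J)" by (auto elim: el_HorE)
    then show ?case using mat_HorD(3)[OF hs(1)[OF z(2)]] hs[OF z(2)] v_in X.hsrc_in[OF z(2)] X.htrg_in[OF z(2)] by simp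
  next
    case (10 z)
    then obtain J i j where z: "z = vlist [J, i, j]" "J \<in> Hor X" "i \<in> ix p (hsrc X J)" "j \<in> ix p (htrg X J)" by (auto elim: el_HorE)
    then show ?case using mat_HorD(4)[OF hs(1)[OF z(2)]] hs[OF z(2)] v_in X.hsrc_in[OF z(2)] X.htrg_in[OF z(2)] by simp
  next
    case (11 z)
    then obtain J i j where z: "z = vlist [J, i, j]" "J \<in> Hor X" "i \<in> ix p (hsrc X J)" "j \<in> ix p (htrg X J)" by (auto elim: el_HorE)
    then show ?case using mat_HorD(5)[OF hs(1)[OF z(2)]] hs[OF z(2)] v_in X.hsrc_in[OF z(2)] X.htrg_in[OF z(2)] by simp
  next
    case (12 z Js \<Delta> l r)
    note c = cellD[OF 12]
    obtain q i s where z: "z = vlist [q, vlist (i # s)]" "q \<in> Cell X" "i \<in> ix p (vdom X (clft X q))" "el_tail X p (ctop X q) s"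
      using c(1) by (auto elim: el_CellE)
    have m: "z \<in> el_Cell X p" using c(1) by simp
    note hp = X.ctop_path[OF z(2)] and lr = X.clft_in[OF z(2)] X.crgt_in[OF z(2)]
    note ls = el_cell_right[OF X t p z(2-4)] and sl = shift_last[OF hp z(4), of v i]
    have i': "v (vdom X (clft X q)) i \<in> idx (part 0 (part 2 (fc G q)))" using v_in[OF X.vdom_in[OF lr(1)] z(3)] by (simp add: cs[OF z(2)] vs[OF lr(1)])
    have s': "tails (mat_ctop (fc G q)) (shift X v (ctop X q) s)" using shift_tails[OF X.ctop_in[OF z(2)] z(4)] by (simp add: cs[OF z(2)])
    note d = mat_CellD(7)[OF cs(1)[OF z(2)] i' s', unfolded sl cs[OF z(2)] v_nat[OF lr(1) z(3)] v_nat[OF lr(2) ls] shift_entry[OF hp z(3,4)]]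
    note a = act_in[OF X t p lr(1) z(3)] act_in[OF X t p lr(2) ls]
    have "Js = el_entry (ctop X q) (i # s)" "\<Delta> = vlist [cbot X q, vidx (fv p (clft X q)) i, vidx (fv p (crgt X q)) (last (i # s))]"
      "l = vlist [clft X q, i]" "r = vlist [crgt X q, last (i # s)]"
      using c m by (simp_all add: z(1) del: last.simps)
    then show ?case using d m a ls lr z X.cbot_in[OF z(2)] X.cbot_src[OF z(2)] X.cbot_trg[OF z(2)] by (simp del: last.simps)
  next
    case (13 z)
    then obtain J i j where z: "z = vlist [J, i, j]" "J \<in> Hor X" "i \<in> ix p (hsrc X J)" "j \<in> ix p (htrg X J)" by (auto elim: el_HorE)
    note c = cellD[OF X.cid_cell[OF z(2)]]
    show ?case using G.fc_cid[OF z(2)] c z hs[OF z(2)] v_in X.hsrc_in[OF z(2)] X.htrg_in[OF z(2)] verD[OF X.vid_ver[OF X.hsrc_in[OF z(2)]]]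
      by (simp add: cent_mat_cid)
  next
    case (14 \<kappa> u qs u')
    from el_composableD[OF X t p 14] obtain \<kappa>0 j s u0 i qs0 rs u0' where e: "\<kappa> = vlist [\<kappa>0, vlist (j # s)]" "u = vlist [u0, i]" "qs = el_cells qs0 (blk i rs)"
      and c: "composable X \<kappa>0 u0 qs0 u0'" and j: "j = vidx (fv p u0) i" and tl: "el_tailss X p qs0 rs"
      and m: "\<kappa> \<in> el_Cell X p" "u \<in> el_Ver X p"
      and en: "el_entry (ctop X \<kappa>0) (j # s) = map2 (\<lambda>q b. vlist [cbot X q, vidx (fv p (clft X q)) (hd b), vidx (fv p (crgt X q)) (last b)]) qs0 (blk i rs)"
      by blast
    have k0: "\<kappa>0 \<in> Cell X" "j \<in> ix p (vdom X (clft X \<kappa>0))" "el_tail X p (ctop X \<kappa>0) s" using m(1) by (auto simp: e)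
    have u0: "u0 \<in> Ver X" "i \<in> ix p (vdom X u0)" using m(2) by (auto simp: e)
    have "s = map (part 2) (el_entry (ctop X \<kappa>0) (j # s))" using map_part2_el_entry[OF el_tail_length[OF k0(3)]] by simp
    also have "\<dots> = el_ends X p qs0 i rs" unfolding en by (rule nth_equalityI) auto
    finally have s: "s = el_ends X p qs0 i rs" .
    have cp: "cpath X u0 qs0 u0'" using c by (simp add: composable_def)
    note I = el_composableI[OF X t p c u0(2) tl] and cc = cellD[OF X.ccomp_cell[OF c]] and cpt = composable_path[OF c]
    have vl: "ver X u0 (vdom X u0) (vdom X (clft X \<kappa>0))" "ver X (clft X \<kappa>0) (vdom X (clft X \<kappa>0)) (vcod X (clft X \<kappa>0))"
      using cpt X.clft_in[OF k0(1)] by (auto simp: ver_def)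
    have dom: "vdom X (clft X (ccomp X \<kappa>0 u0 qs0)) = vdom X u0" using verD[OF X.vcomp_ver[OF vl]] cc by simp
    let ?rs = "map2 (\<lambda>q. shift X v (ctop X q)) qs0 rs"
    have len: "list_all2 (\<lambda>r Js. length r = length Js) rs (map (ctop X) qs0)"
      using tl unfolding list_all2_map2 by (rule list_all2_mono) (simp add: el_tail_length)
    have sc: "shift X v (concat (map (ctop X) qs0)) (concat rs) = concat ?rs"
      unfolding shift_concat[OF len] by (simp only: map2_map1)
    have kG: "composable (mat A) (fc G \<kappa>0) (fv G u0) (map (fc G) qs0) (fv G u0')" by (rule G.composable_map[OF X c])
    have th: "set qs0 \<subseteq> Cell X" by (rule cpt(7))
    have tG: "tailss (map (fc G) qs0) ?rs"
      using tl th shift_tails[OF X.ctop_in] unfolding tailss_def by (auto simp: list_all2_conv_all_nth cs subset_iff)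
    have iG: "v (vdom X u0) i \<in> idx (part 0 (fv G u0))" using v_in[OF X.vdom_in[OF u0(1)] u0(2)] vs[OF u0(1)] by simp
    have mc: "map2 cent (map (fc G) qs0) (blk (v (vdom X u0) i) ?rs) = map (fc (untab X p G v)) (el_cells qs0 (blk i rs))"
    proof -
      have "map2 cent (map (fc G) qs0) (blk (v (vdom X u0) i) ?rs) = map2 (\<lambda>q b. cent (fc G q) (v (vdom X (clft X q)) (hd b) # shift X v (ctop X q) (tl b))) qs0 (blk i rs)"
        unfolding map2_map1 blk_shift[OF cp tl] by (rule nth_equalityI) auto
      also have "\<dots> = map2 (\<lambda>q b. fc (untab X p G v) (vlist [q, vlist b])) qs0 (blk i rs)"
        by (rule map2_cong_all2[OF el_path(4)[OF X t p cp u0(2) tl]]) (use th in auto)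
      finally show ?thesis by (simp add: comp_def split_def)
    qed
    have mem: "vlist [ccomp X \<kappa>0 u0 qs0, vlist (i # concat rs)] \<in> el_Cell X p"
      using cellD(1)[OF E.ccomp_cell[OF I(1)]] unfolding I(2) by simp
    have "fc (untab X p G v) (ccomp (el X p) \<kappa> u qs) = cent (fc G (ccomp X \<kappa>0 u0 qs0)) (v (vdom X u0) i # concat ?rs)"
      unfolding e j s I(2) using mem cc dom sc by simp
    also have "\<dots> = ccomp A (cent (fc G \<kappa>0) (vidx (fv G u0) (v (vdom X u0) i) # ends (map (fc G) qs0) (v (vdom X u0) i) ?rs)) (vent (fv G u0) (v (vdom X u0) i)) (map2 cent (map (fc G) qs0) (blk (v (vdom X u0) i) ?rs))"
      unfolding G.fc_ccomp[OF c] mat_ccomp_eq[OF kG] by (rule cent_mat_ccomp[OF kG iG tG])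
    also have "\<dots> = ccomp A (fc (untab X p G v) \<kappa>) (fv (untab X p G v) u) (map (fc (untab X p G v)) qs)"
      unfolding mc ends_shift[OF cp u0(2) tl] v_nat[OF u0] using k0 u0 cpt(3,4) s[symmetric] m by (simp add: e j)
    finally show ?case .
  qed (auto simp: untab_def)
qed

end

section \<open>Transformations between functors into matrices\<close>

text \<open>
  The cells \<open>c J i j\<close> along a path \<open>Js\<close>, where \<open>i\<close> and \<open>j\<close> are neighbouring indices of a tuple.
\<close>

definition along :: "('V \<Rightarrow> 'V \<Rightarrow> 'V \<Rightarrow> 'V) \<Rightarrow> 'V list \<Rightarrow> 'V list \<Rightarrow> 'V list" where
  "along c Js is = map (\<lambda>k. c (Js ! k) (is ! k) (is ! Suc k)) [0..<length Js]"

lemma along_simps [simp]: "along c [] is = []" "along c (J # Js) (i # j # r) = c J i j # along c Js (j # r)"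
  by (simp_all add: along_def map_upt_Suc del: upt_Suc)

lemma shift_eq_map: "el_tail X p Js r \<Longrightarrow> (\<And>J j. \<lbrakk>J \<in> set Js; j \<in> ix p (htrg X J)\<rbrakk> \<Longrightarrow> v (htrg X J) j = j) \<Longrightarrow> shift X v Js r = r"
  by (induction Js arbitrary: r) auto

lemma shift_shift:
  "el_tail X p Js r \<Longrightarrow> (\<And>J j. \<lbrakk>J \<in> set Js; j \<in> ix p (htrg X J)\<rbrakk> \<Longrightarrow> v (htrg X J) (w (htrg X J) j) = z (htrg X J) j)
    \<Longrightarrow> shift X v Js (shift X w Js r) = shift X z Js r"
  by (induction Js arbitrary: r) auto

lemma along_cong:
  assumes "hpath X x Js y" "i \<in> ix P x" "el_tail X P Js r"
    "\<And>J i j. \<lbrakk>J \<in> Hor X; i \<in> ix P (hsrc X J); j \<in> ix P (htrg X J)\<rbrakk> \<Longrightarrow> c J i j = c' J i j"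
  shows "along c Js (i # r) = along c' Js (i # r)"
  using assms unfolding hpath_def by (induction Js arbitrary: x i r) auto

lemma shift_cong:
  "el_tail X p Js r \<Longrightarrow> (\<And>J j. \<lbrakk>J \<in> set Js; j \<in> ix p (htrg X J)\<rbrakk> \<Longrightarrow> v (htrg X J) j = w (htrg X J) j) \<Longrightarrow> shift X v Js r = shift X w Js r"
  by (induction Js arbitrary: r) auto

lemma el_tail_shift:
  assumes "el_tail X p Js r" "\<And>J j. \<lbrakk>J \<in> set Js; j \<in> ix p (htrg X J)\<rbrakk> \<Longrightarrow> v (htrg X J) j \<in> ix d (htrg X J)"
  shows "el_tail X d Js (shift X v Js r)"
  using assms by (induction Js arbitrary: r) auto

definition trans_boundary :: "'V VDC \<Rightarrow> 'V VDC \<Rightarrow> 'V VDMap \<Rightarrow> 'V VDMap \<Rightarrow> ('V, 'V, 'V, 'V) vd_trans \<Rightarrow> bool" where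
  "trans_boundary X M P Q \<alpha> \<longleftrightarrow> (\<forall>x\<in>Ob X. ver M (tv \<alpha> x) (fo P x) (fo Q x))
     \<and> (\<forall>J\<in>Hor X. cell M (tc \<alpha> J) [fh P J] (fh Q J) (tv \<alpha> (hsrc X J)) (tv \<alpha> (htrg X J)))"

lemma vtr_boundary: "vtr X M P Q \<alpha> \<Longrightarrow> trans_boundary X M P Q \<alpha>"
  unfolding trans_boundary_def by (auto intro: vertical_transformation.tv_ver vertical_transformation.tc_cell)

context
  fixes X A :: "'V VDC" and P Q :: "'V VDMap" and \<alpha> :: "('V, 'V, 'V, 'V) vd_trans"
  assumes X: "vdc X" and A: "vdc A" and P: "vdf X (mat A) P" and Q: "vdf X (mat A) Q"
    and boundary: "trans_boundary X (mat A) P Q \<alpha>"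
begin

lemma tv: "x \<in> Ob X \<Longrightarrow> ver (mat A) (tv \<alpha> x) (fo P x) (fo Q x)"
  and tc: "J \<in> Hor X \<Longrightarrow> cell (mat A) (tc \<alpha> J) [fh P J] (fh Q J) (tv \<alpha> (hsrc X J)) (tv \<alpha> (htrg X J))"
  using boundary by (auto simp: trans_boundary_def)

interpretation X: virtual_double_category X by fact
interpretation A: virtual_double_category A by fact
interpretation M: virtual_double_category "mat A" by (rule vdc_mat[OF A])
interpretation P: virtual_double_functor X "mat A" P by fact
interpretation Q: virtual_double_functor X "mat A" Q by fact

lemma component_path:
  assumes "hpath X x Js y" "i \<in> ix P x" "el_tail X P Js r"
  shows "tailss (map (tc \<alpha>) Js) (map (\<lambda>j. [j]) r)" (is ?P3)
    "ends (map (tc \<alpha>) Js) i (map (\<lambda>j. [j]) r) = shift X (\<lambda>x. vidx (tv \<alpha> x)) Js r" (is ?P2)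
    "map2 cent (map (tc \<alpha>) Js) (blk i (map (\<lambda>j. [j]) r)) = along (\<lambda>J i j. cent (tc \<alpha> J) [i, j]) Js (i # r)" (is ?P1)
proof -
  have "?P3 \<and> ?P2 \<and> ?P1"
    using assms
  proof (induction Js arbitrary: x i r)
    case (Cons J Js)
    then obtain j s where r: "r = j # s" "j \<in> ix P (htrg X J)" "el_tail X P Js s" by auto
    have h: "J \<in> Hor X" "hpath X (htrg X J) Js y" using Cons.prems by (auto simp: hpath_def)
    show ?case using Cons.IH[OF h(2) r(2,3)] r(1,2) tc[OF h(1)] fh_sel(3)[OF P h(1)] by (simp add: cell_mat)
  qed simp
  then show "?P3" "?P2"
    "?P1" by blast+
qed

context
  fixes q assumes q: "q \<in> Cell X"
begin

lemma naturality_sides: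
  shows "cell (mat A) (ucomp (mat A) (tc \<alpha> (cbot X q)) (fc P q)) (map (fh P) (ctop X q)) (fh Q (cbot X q))
      (vcomp (mat A) (tv \<alpha> (vcod X (clft X q))) (fv P (clft X q))) (vcomp (mat A) (tv \<alpha> (vcod X (crgt X q))) (fv P (crgt X q)))" (is ?P2)
    "composable (mat A) (fc Q q) (tv \<alpha> (vdom X (clft X q))) (map (tc \<alpha>) (ctop X q)) (tv \<alpha> (vdom X (crgt X q)))" (is ?P3)
    "cell (mat A) (ccomp (mat A) (fc Q q) (tv \<alpha> (vdom X (clft X q))) (map (tc \<alpha>) (ctop X q))) (map (fh P) (ctop X q)) (fh Q (cbot X q))
      (vcomp (mat A) (fv Q (clft X q)) (tv \<alpha> (vdom X (clft X q)))) (vcomp (mat A) (fv Q (crgt X q)) (tv \<alpha> (vdom X (crgt X q))))" (is ?P1)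
proof -
  show "?P2"
    using M.ucomp_cell[OF tc[OF X.cbot_in[OF q]] P.fc_cell[OF X.cell_self[OF q]]] X.cbot_src[OF q] X.cbot_trg[OF q] by simp
  have "cpath (mat A) (tv \<alpha> (vdom X (clft X q))) (map (tc \<alpha>) (ctop X q)) (tv \<alpha> (vdom X (crgt X q)))"
    using X.ctop_path[OF q] unfolding hpath_def cpath_def
    by (rule chain_map) (use tv tc in \<open>simp_all add: ver_def cell_def del: mat_sel\<close>)
  moreover have "map (cbot (mat A)) (map (tc \<alpha>) (ctop X q)) = map (fh Q) (ctop X q)"
    using X.ctop_in[OF q] cellD(3)[OF tc] by auto
  ultimately show c: "?P3"
    using Q.fc_Cell[OF q] Q.fv_Ver[OF X.clft_in[OF q]] verD(3)[OF tv[OF X.vdom_in[OF X.clft_in[OF q]]]]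
    by (simp add: composable_def del: mat_sel map_map)
  have "map (ctop (mat A)) (map (tc \<alpha>) (ctop X q)) = map (\<lambda>J. [fh P J]) (ctop X q)"
    using X.ctop_in[OF q] cellD(2)[OF tc] by auto
  then have "concat (map (ctop (mat A)) (map (tc \<alpha>) (ctop X q))) = map (fh P) (ctop X q)" by (simp only: concat_map_singleton)
  then show "?P1"
    using M.ccomp_cell[OF c] Q.fc_Cell[OF q] by (simp only:)
qed

lemma naturality_entries:
  assumes i: "i \<in> ix P (vdom X (clft X q))" and r: "el_tail X P (ctop X q) r"
  shows "cent (ucomp (mat A) (tc \<alpha> (cbot X q)) (fc P q)) (i # r)
      = ucomp A (cent (tc \<alpha> (cbot X q)) [vidx (fv P (clft X q)) i, vidx (fv P (crgt X q)) (last (i # r))]) (cent (fc P q) (i # r))" (is ?P2)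
    "cent (ccomp (mat A) (fc Q q) (tv \<alpha> (vdom X (clft X q))) (map (tc \<alpha>) (ctop X q))) (i # r)
      = ccomp A (cent (fc Q q) (vidx (tv \<alpha> (vdom X (clft X q))) i # shift X (\<lambda>x. vidx (tv \<alpha> x)) (ctop X q) r))
          (vent (tv \<alpha> (vdom X (clft X q))) i) (along (\<lambda>J i j. cent (tc \<alpha> J) [i, j]) (ctop X q) (i # r))" (is ?P1)
proof -
  note l = X.clft_in[OF q]
  note c = naturality_sides(2)
  show "?P2"
    by (rule ucomp_mat[OF A tc[OF X.cbot_in[OF q]] P.fc_cell[OF X.cell_self[OF q]]])
      (use i r tails_fh[OF P X.ctop_in[OF q]] fv_sel_into_mat[OF P l] in auto)
  have i': "i \<in> idx (part 0 (tv \<alpha> (vdom X (clft X q))))" using tv[OF X.vdom_in[OF l]] i by (simp add: ver_mat)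
  note d = component_path[OF X.ctop_path[OF q] i r]
  have "i # r = i # concat (map (\<lambda>j. [j]) r)" by simp
  then show "?P1"
    using cent_mat_ccomp[OF c i' d(1)] unfolding mat_ccomp_eq[OF c] d(2,3) by simp
qed

end

lemma vertical_sides:
  assumes u: "u \<in> Ver X"
  shows "vcomp (mat A) (tv \<alpha> (vcod X u)) (fv P u) = mat_vcomp A (tv \<alpha> (vcod X u)) (fv P u)" (is ?P1)
    "vcomp (mat A) (fv Q u) (tv \<alpha> (vdom X u)) = mat_vcomp A (fv Q u) (tv \<alpha> (vdom X u))" (is ?P2)
    "mat_vcomp A (tv \<alpha> (vcod X u)) (fv P u) \<in> mat_Ver A" (is ?P3) "mat_vcomp A (fv Q u) (tv \<alpha> (vdom X u)) \<in> mat_Ver A" (is ?P4)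
proof -
  note a = tv[OF X.vdom_in[OF u], unfolded ver_mat] and b = tv[OF X.vcod_in[OF u], unfolded ver_mat]
  note p = fv_sel_into_mat[OF P u] and d = fv_sel_into_mat[OF Q u]
  show "?P1" "?P2"
    using a b p d by (simp_all add: mat_vcomp_eq)
  show "?P3" "?P4"
    using a b p d mat_vcomp_in[OF A] by simp_all
qed

text \<open>
  Being a transformation into \<open>mat A\<close> is a condition on entries: the index functions are natural, and
  at each tuple of indices the naturality equations hold in \<open>A\<close>. With \<open>vtr_into_matD\<close> this is an
  equivalence.
\<close>

lemma vtr_into_matI:
  assumes ext: "tv \<alpha> \<in> extensional (Ob X)" "tc \<alpha> \<in> extensional (Hor X)"
    and v: "\<And>u i. \<lbrakk>u \<in> Ver X; i \<in> ix P (vdom X u)\<rbrakk> \<Longrightarrow> vidx (tv \<alpha> (vcod X u)) (vidx (fv P u) i) = vidx (fv Q u) (vidx (tv \<alpha> (vdom X u)) i)"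
      "\<And>u i. \<lbrakk>u \<in> Ver X; i \<in> ix P (vdom X u)\<rbrakk> \<Longrightarrow>
        vcomp A (vent (tv \<alpha> (vcod X u)) (vidx (fv P u) i)) (vent (fv P u) i) = vcomp A (vent (fv Q u) (vidx (tv \<alpha> (vdom X u)) i)) (vent (tv \<alpha> (vdom X u)) i)"
    and c: "\<And>q i r. \<lbrakk>q \<in> Cell X; i \<in> ix P (vdom X (clft X q)); el_tail X P (ctop X q) r\<rbrakk> \<Longrightarrow>
        ucomp A (cent (tc \<alpha> (cbot X q)) [vidx (fv P (clft X q)) i, vidx (fv P (crgt X q)) (last (i # r))]) (cent (fc P q) (i # r))
        = ccomp A (cent (fc Q q) (vidx (tv \<alpha> (vdom X (clft X q))) i # shift X (\<lambda>x. vidx (tv \<alpha> x)) (ctop X q) r))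
          (vent (tv \<alpha> (vdom X (clft X q))) i) (along (\<lambda>J i j. cent (tc \<alpha> J) [i, j]) (ctop X q) (i # r))"
  shows "vtr X (mat A) P Q \<alpha>"
proof -
  have nat: "vcomp (mat A) (tv \<alpha> (vcod X u)) (fv P u) = vcomp (mat A) (fv Q u) (tv \<alpha> (vdom X u))" if u: "u \<in> Ver X" for u
  proof -
    note a = tv[OF X.vdom_in[OF u], unfolded ver_mat] and b = tv[OF X.vcod_in[OF u], unfolded ver_mat]
    note p = fv_sel_into_mat[OF P u] and d = fv_sel_into_mat[OF Q u] and s = vertical_sides[OF u]
    show ?thesis unfolding s(1,2)
      by (rule vent_ext[OF s(3,4)]) (use a b p d v[OF u] in auto)
  qed
  show ?thesis
  proof (unfold_locales, goal_cases)
    case 1 show ?case by (rule ext)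
  next
    case 2 show ?case by (rule ext)
  next
    case (3 x) then show ?case by (rule tv)
  next
    case (4 u x y) then show ?case using nat[of u] by (auto simp: ver_def)
  next
    case (5 J) then show ?case by (rule tc)
  next
    case (6 q)
    note l = X.clft_in[OF 6] and r = X.crgt_in[OF 6]
    note L = naturality_sides(1)[OF 6, unfolded cell_mat] and R = naturality_sides(3)[OF 6, unfolded cell_mat]
    have "ucomp (mat A) (tc \<alpha> (cbot X q)) (fc P q) = ccomp (mat A) (fc Q q) (tv \<alpha> (vdom X (clft X q))) (map (tc \<alpha>) (ctop X q))"
    proof (rule cent_ext[of _ A _ A])
      fix i s assume ii: "i \<in> idx (part 0 (part 2 (ucomp (mat A) (tc \<alpha> (cbot X q)) (fc P q))))"
        "tails (mat_ctop (ucomp (mat A) (tc \<alpha> (cbot X q)) (fc P q))) s"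
      have i: "i \<in> ix P (vdom X (clft X q))" using ii(1) L vertical_sides(1)[OF l] fv_sel_into_mat[OF P l] by simp
      have s: "el_tail X P (ctop X q) s" using ii(2) L tails_fh[OF P X.ctop_in[OF 6]] by simp
      show "cent (ucomp (mat A) (tc \<alpha> (cbot X q)) (fc P q)) (i # s) = cent (ccomp (mat A) (fc Q q) (tv \<alpha> (vdom X (clft X q))) (map (tc \<alpha>) (ctop X q))) (i # s)"
        unfolding naturality_entries[OF 6 i s] by (rule c[OF 6 i s])
    qed (use L R nat[OF l] nat[OF r] in simp_all)
    then show ?case using P.fc_Cell[OF 6] by (simp add: ucomp_def)
  qed
qed

lemma vtr_into_matD:
  assumes a: "vtr X (mat A) P Q \<alpha>"
  shows "\<And>u i. \<lbrakk>u \<in> Ver X; i \<in> ix P (vdom X u)\<rbrakk> \<Longrightarrow> vidx (tv \<alpha> (vcod X u)) (vidx (fv P u) i) = vidx (fv Q u) (vidx (tv \<alpha> (vdom X u)) i)"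
      "\<And>u i. \<lbrakk>u \<in> Ver X; i \<in> ix P (vdom X u)\<rbrakk> \<Longrightarrow>
        vcomp A (vent (tv \<alpha> (vcod X u)) (vidx (fv P u) i)) (vent (fv P u) i) = vcomp A (vent (fv Q u) (vidx (tv \<alpha> (vdom X u)) i)) (vent (tv \<alpha> (vdom X u)) i)"
      "\<And>q i r. \<lbrakk>q \<in> Cell X; i \<in> ix P (vdom X (clft X q)); el_tail X P (ctop X q) r\<rbrakk> \<Longrightarrow>
        ucomp A (cent (tc \<alpha> (cbot X q)) [vidx (fv P (clft X q)) i, vidx (fv P (crgt X q)) (last (i # r))]) (cent (fc P q) (i # r))
        = ccomp A (cent (fc Q q) (vidx (tv \<alpha> (vdom X (clft X q))) i # shift X (\<lambda>x. vidx (tv \<alpha> x)) (ctop X q) r))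
          (vent (tv \<alpha> (vdom X (clft X q))) i) (along (\<lambda>J i j. cent (tc \<alpha> J) [i, j]) (ctop X q) (i # r))"
proof -
  interpret a: vertical_transformation X "mat A" P Q \<alpha> by fact
  fix u i assume u: "u \<in> Ver X" and i: "i \<in> ix P (vdom X u)"
  note s = vertical_sides[OF u]
  have e: "mat_vcomp A (tv \<alpha> (vcod X u)) (fv P u) = mat_vcomp A (fv Q u) (tv \<alpha> (vdom X u))"
    using a.tv_natural[OF X.ver_self[OF u]] unfolding s(1,2) .
  have i': "i \<in> idx (part 0 (fv P u))" "i \<in> idx (part 0 (tv \<alpha> (vdom X u)))"
    using i fv_sel_into_mat[OF P u] tv[OF X.vdom_in[OF u]] by (simp_all add: ver_mat)
  have "vidx (mat_vcomp A (tv \<alpha> (vcod X u)) (fv P u)) i = vidx (mat_vcomp A (fv Q u) (tv \<alpha> (vdom X u))) i"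
    "vent (mat_vcomp A (tv \<alpha> (vcod X u)) (fv P u)) i = vent (mat_vcomp A (fv Q u) (tv \<alpha> (vdom X u))) i" using e by simp_all
  then show "vidx (tv \<alpha> (vcod X u)) (vidx (fv P u) i) = vidx (fv Q u) (vidx (tv \<alpha> (vdom X u)) i)"
    "vcomp A (vent (tv \<alpha> (vcod X u)) (vidx (fv P u) i)) (vent (fv P u) i) = vcomp A (vent (fv Q u) (vidx (tv \<alpha> (vdom X u)) i)) (vent (tv \<alpha> (vdom X u)) i)"
    using i' by simp_all
next
  interpret a: vertical_transformation X "mat A" P Q \<alpha> by fact
  fix q i r assume q: "q \<in> Cell X" and i: "i \<in> ix P (vdom X (clft X q))" and r: "el_tail X P (ctop X q) r"
  show "ucomp A (cent (tc \<alpha> (cbot X q)) [vidx (fv P (clft X q)) i, vidx (fv P (crgt X q)) (last (i # r))]) (cent (fc P q) (i # r))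
        = ccomp A (cent (fc Q q) (vidx (tv \<alpha> (vdom X (clft X q))) i # shift X (\<lambda>x. vidx (tv \<alpha> x)) (ctop X q) r))
          (vent (tv \<alpha> (vdom X (clft X q))) i) (along (\<lambda>J i j. cent (tc \<alpha> J) [i, j]) (ctop X q) (i # r))"
    using a.tc_natural_ucomp[OF q P] naturality_entries[OF q i r] by simp
qed

end

text \<open>
  Transformations into \<open>mat A\<close> may be given by their index functions \<open>v\<close> and entries \<open>f\<close>, \<open>c\<close>. Stated as an
  elimination rule, it keeps the codes of the components out of its applications.
\<close>

lemma vtr_tabulate:
  assumes X: "vdc X" and A: "vdc A" and P: "vdf X (mat A) P" and Q: "vdf X (mat A) Q"
    and v: "\<And>x i. \<lbrakk>x \<in> Ob X; i \<in> ix P x\<rbrakk> \<Longrightarrow> v x i \<in> ix Q x"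
    and f: "\<And>x i. \<lbrakk>x \<in> Ob X; i \<in> ix P x\<rbrakk> \<Longrightarrow> ver A (f x i) (oent (fo P x) i) (oent (fo Q x) (v x i))"
    and c: "\<And>J i j. \<lbrakk>J \<in> Hor X; i \<in> ix P (hsrc X J); j \<in> ix P (htrg X J)\<rbrakk> \<Longrightarrow>
      cell A (c J i j) [hent (fh P J) i j] (hent (fh Q J) (v (hsrc X J) i) (v (htrg X J) j)) (f (hsrc X J) i) (f (htrg X J) j)"
    and n: "\<And>u i. \<lbrakk>u \<in> Ver X; i \<in> ix P (vdom X u)\<rbrakk> \<Longrightarrow> v (vcod X u) (vidx (fv P u) i) = vidx (fv Q u) (v (vdom X u) i)
        \<and> vcomp A (f (vcod X u) (vidx (fv P u) i)) (vent (fv P u) i) = vcomp A (vent (fv Q u) (v (vdom X u) i)) (f (vdom X u) i)"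
      "\<And>q i r. \<lbrakk>q \<in> Cell X; i \<in> ix P (vdom X (clft X q)); el_tail X P (ctop X q) r\<rbrakk> \<Longrightarrow>
        ucomp A (c (cbot X q) (vidx (fv P (clft X q)) i) (vidx (fv P (crgt X q)) (last (i # r)))) (cent (fc P q) (i # r))
        = ccomp A (cent (fc Q q) (v (vdom X (clft X q)) i # shift X v (ctop X q) r)) (f (vdom X (clft X q)) i) (along c (ctop X q) (i # r))"
  obtains \<alpha> where "vtr X (mat A) P Q \<alpha>" "\<And>x i. \<lbrakk>x \<in> Ob X; i \<in> ix P x\<rbrakk> \<Longrightarrow> vidx (tv \<alpha> x) i = v x i \<and> vent (tv \<alpha> x) i = f x i"
    "\<And>J i j. \<lbrakk>J \<in> Hor X; i \<in> ix P (hsrc X J); j \<in> ix P (htrg X J)\<rbrakk> \<Longrightarrow> cent (tc \<alpha> J) [i, j] = c J i j"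
proof -
  interpret X: virtual_double_category X by fact
  interpret P: virtual_double_functor X "mat A" P by fact
  interpret Q: virtual_double_functor X "mat A" Q by fact
  define V where "V x = mkV (fo P x) (fo Q x) (v x) (f x)" for x
  define C where "C J = mkC [fh P J] (fh Q J) (V (hsrc X J)) (V (htrg X J)) (\<lambda>is. c J (is ! 0) (is ! 1))" for J
  define \<alpha> :: "('V, 'V, 'V, 'V) vd_trans" where "\<alpha> = \<lparr>tv = restrict V (Ob X), tc = restrict C (Hor X)\<rparr>"
  have sel: "tv \<alpha> x = V x" "J \<in> Hor X \<Longrightarrow> tc \<alpha> J = C J" if "x \<in> Ob X" for x J using that by (simp_all add: \<alpha>_def)
  have ve: "vidx (tv \<alpha> x) i = v x i" "vent (tv \<alpha> x) i = f x i" if "x \<in> Ob X" "i \<in> ix P x" for x i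
    using that by (simp_all add: sel V_def)
  have ce: "cent (tc \<alpha> J) [i, j] = c J i j" if "J \<in> Hor X" "i \<in> ix P (hsrc X J)" "j \<in> ix P (htrg X J)" for J i j
    using that fh_sel[OF P that(1)] X.hsrc_in[OF that(1)] by (simp add: sel(2) C_def V_def)
  have Vin: "V x \<in> mat_Ver A" if "x \<in> Ob X" for x
    unfolding V_def mkV_in using that P.fo_in Q.fo_in v f by auto
  have b: "trans_boundary X (mat A) P Q \<alpha>" unfolding trans_boundary_def
  proof (intro conjI ballI)
    fix x assume "x \<in> Ob X" then show "ver (mat A) (tv \<alpha> x) (fo P x) (fo Q x)" using Vin by (simp add: ver_mat sel(1)) (simp add: V_def)
  next
    fix J assume g: "J \<in> Hor X"
    note o = X.hsrc_in[OF g] X.htrg_in[OF g] and k = fh_sel[OF P g] and d = fh_sel[OF Q g]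
    have "C J \<in> mat_Cell A" unfolding C_def mkC_in
      using k d Vin[OF o(1)] Vin[OF o(2)] P.fo_in[OF o(1)] P.fo_in[OF o(2)] c[OF g] by (auto simp: V_def)
    then show "cell (mat A) (tc \<alpha> J) [fh P J] (fh Q J) (tv \<alpha> (hsrc X J)) (tv \<alpha> (htrg X J))"
      by (simp add: cell_mat sel[OF o(1)] sel[OF o(2)] g) (simp add: C_def)
  qed
  have "vtr X (mat A) P Q \<alpha>"
  proof (rule vtr_into_matI[OF X A P Q b])
    show "tv \<alpha> \<in> extensional (Ob X)" "tc \<alpha> \<in> extensional (Hor X)" by (simp_all add: \<alpha>_def)
  next
    fix u i assume u: "u \<in> Ver X" and i: "i \<in> ix P (vdom X u)"
    note o = X.vdom_in[OF u] X.vcod_in[OF u]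
    show "vidx (tv \<alpha> (vcod X u)) (vidx (fv P u) i) = vidx (fv Q u) (vidx (tv \<alpha> (vdom X u)) i)"
      "vcomp A (vent (tv \<alpha> (vcod X u)) (vidx (fv P u) i)) (vent (fv P u) i) = vcomp A (vent (fv Q u) (vidx (tv \<alpha> (vdom X u)) i)) (vent (tv \<alpha> (vdom X u)) i)"
      using n(1)[OF u i] i o act_in[OF X A P u i] by (simp_all add: ve)
  next
    fix q i r assume q: "q \<in> Cell X" and i: "i \<in> ix P (vdom X (clft X q))" and r: "el_tail X P (ctop X q) r"
    note l = X.clft_in[OF q] X.crgt_in[OF q]
    have k: "vidx (fv P (clft X q)) i \<in> ix P (hsrc X (cbot X q))" "vidx (fv P (crgt X q)) (last (i # r)) \<in> ix P (htrg X (cbot X q))"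
      using act_in[OF X A P l(1) i] act_in[OF X A P l(2) el_cell_right[OF X A P q i r]] X.cbot_src[OF q] X.cbot_trg[OF q] by simp_all
    have "shift X (\<lambda>x. vidx (tv \<alpha> x)) (ctop X q) r = shift X v (ctop X q) r"
      by (rule shift_cong[OF r]) (use ve(1) X.ctop_in[OF q] X.htrg_in in auto)
    moreover have "along (\<lambda>J i j. cent (tc \<alpha> J) [i, j]) (ctop X q) (i # r) = along c (ctop X q) (i # r)"
      by (rule along_cong[OF X.ctop_path[OF q] i r]) (rule ce)
    ultimately show "ucomp A (cent (tc \<alpha> (cbot X q)) [vidx (fv P (clft X q)) i, vidx (fv P (crgt X q)) (last (i # r))]) (cent (fc P q) (i # r)) =
       ccomp A (cent (fc Q q) (vidx (tv \<alpha> (vdom X (clft X q))) i # shift X (\<lambda>x. vidx (tv \<alpha> x)) (ctop X q) r))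
        (vent (tv \<alpha> (vdom X (clft X q))) i) (along (\<lambda>J i j. cent (tc \<alpha> J) [i, j]) (ctop X q) (i # r))"
      using n(2)[OF q i r] by (simp only: ve[OF X.vdom_in[OF l(1)] i] ce[OF X.cbot_in[OF q] k])
  qed
  then show ?thesis using that ve ce by blast
qed

section \<open>The 2-functor of matrices\<close>

lemma tuples_cong: "map idx xs = map idx ys \<Longrightarrow> tuples xs = tuples ys"
  by (simp add: tuples_def)

lemma mat_fo_mk: "mat_fo F x = mkO (part 0 x) (\<lambda>i. fo F (oent x i))"
  by (simp add: mat_fo_def mkO_def idx_def)

lemma mat_fo_sel [simp]: "part 0 (mat_fo F x) = part 0 x" "idx (mat_fo F x) = idx x"
  "i \<in> idx x \<Longrightarrow> oent (mat_fo F x) i = fo F (oent x i)"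
  by (simp_all add: mat_fo_mk idx_def)

lemma mat_fv_mk: assumes "g \<in> mat_Ver A"
  shows "mat_fv F g = mkV (mat_fo F (part 0 g)) (mat_fo F (part (Suc 0) g)) (vidx g) (\<lambda>i. fv F (vent g i))"
proof -
  have "part 2 g = part 2 (mkV (part 0 g) (part (Suc 0) g) (vidx g) (vent g))" by (simp only: mat_Ver_eta[OF assms])
  also have "\<dots> = vfam (idx (part 0 g)) (vidx g)" by (simp add: mkV_def)
  finally show ?thesis by (simp add: mat_fv_def mkV_def)
qed

lemma mat_fv_sel: assumes "g \<in> mat_Ver A"
  shows "part 0 (mat_fv F g) = mat_fo F (part 0 g)" "part (Suc 0) (mat_fv F g) = mat_fo F (part (Suc 0) g)"
    "i \<in> idx (part 0 g) \<Longrightarrow> vidx (mat_fv F g) i = vidx g i" "i \<in> idx (part 0 g) \<Longrightarrow> vent (mat_fv F g) i = fv F (vent g i)"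
  by (simp_all add: mat_fv_mk[OF assms])

lemma mat_fh_mk: "mat_fh F J = mkH (mat_fo F (part 0 J)) (mat_fo F (part (Suc 0) J)) (\<lambda>i j. fh F (hent J i j))"
  unfolding mat_fh_def mkH_def using tuples_cong[of "[part 0 J, part (Suc 0) J]" "[mat_fo F (part 0 J), mat_fo F (part (Suc 0) J)]"] by simp

lemma mat_fh_sel [simp]: "part 0 (mat_fh F J) = mat_fo F (part 0 J)" "part (Suc 0) (mat_fh F J) = mat_fo F (part (Suc 0) J)"
  "\<lbrakk>i \<in> idx (part 0 J); j \<in> idx (part (Suc 0) J)\<rbrakk> \<Longrightarrow> hent (mat_fh F J) i j = fh F (hent J i j)"
  by (simp_all add: mat_fh_mk)

lemma tails_map [simp]: "tails (map (mat_fh F) Js) r \<longleftrightarrow> tails Js r"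
  by (simp add: tails_def list_all2_map2)

lemma mat_fc_mk: assumes "q \<in> mat_Cell A"
  shows "mat_fc F q = mkC (map (mat_fh F) (mat_ctop q)) (mat_fh F (part (Suc 0) q)) (mat_fv F (part 2 q)) (mat_fv F (part 3 q)) (\<lambda>is. fc F (cent q is))"
proof -
  have "tuples (vertices (part 0 (part 2 q)) (mat_ctop q)) = tuples (vertices (part 0 (mat_fv F (part 2 q))) (map (mat_fh F) (mat_ctop q)))"
    by (rule tuples_cong) (simp add: vertices_def mat_fv_sel[OF mat_CellD(2)[OF assms]])
  then show ?thesis by (simp add: mat_fc_def mkC_def)
qed

lemma mat_fc_sel: assumes "q \<in> mat_Cell A"
  shows "mat_ctop (mat_fc F q) = map (mat_fh F) (mat_ctop q)" "part (Suc 0) (mat_fc F q) = mat_fh F (part (Suc 0) q)"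
    "part 2 (mat_fc F q) = mat_fv F (part 2 q)" "part 3 (mat_fc F q) = mat_fv F (part 3 q)"
    "\<lbrakk>i \<in> idx (part 0 (part 2 q)); tails (mat_ctop q) r\<rbrakk> \<Longrightarrow> cent (mat_fc F q) (i # r) = fc F (cent q (i # r))"
  by (simp_all add: mat_fc_mk[OF assms] mat_fv_sel[OF mat_CellD(2)[OF assms]])

lemma id_map_sel: "a \<in> Ob A \<Longrightarrow> fo (id_map A) a = a" "u \<in> Ver A \<Longrightarrow> fv (id_map A) u = u"
  "J \<in> Hor A \<Longrightarrow> fh (id_map A) J = J" "q \<in> Cell A \<Longrightarrow> fc (id_map A) q = q"
  by (auto simp: id_map_def)

lemma mkO_cong: "(\<And>i. i \<in> elts I \<Longrightarrow> a i = b i) \<Longrightarrow> mkO I a = mkO I b"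
  by (simp add: mkO_def cong: vfam_cong)

lemma mkV_cong: "(\<And>i. i \<in> idx x \<Longrightarrow> v i = w i \<and> f i = g i) \<Longrightarrow> mkV x y v f = mkV x y w g"
  by (simp add: mkV_def cong: vfam_cong)

lemma mkH_cong: "(\<And>i j. \<lbrakk>i \<in> idx x; j \<in> idx y\<rbrakk> \<Longrightarrow> g i j = h i j) \<Longrightarrow> mkH x y g = mkH x y h"
  by (simp add: mkH_def vfam_eq_iff ball_tuples2)

lemma mkC_cong: "(\<And>i s. \<lbrakk>i \<in> idx (part 0 l); tails Js s\<rbrakk> \<Longrightarrow> c (i # s) = d (i # s)) \<Longrightarrow> mkC Js \<Delta> l r c = mkC Js \<Delta> l r d"
  by (simp add: mkC_def vfam_eq_iff ball_tuples_vertices)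

lemma mat_map_sel:
  "x \<in> mat_Ob A \<Longrightarrow> fo (mat_map A F) x = mat_fo F x" "g \<in> mat_Ver A \<Longrightarrow> fv (mat_map A F) g = mat_fv F g"
  "J \<in> mat_Hor A \<Longrightarrow> fh (mat_map A F) J = mat_fh F J" "q \<in> mat_Cell A \<Longrightarrow> fc (mat_map A F) q = mat_fc F q"
  by (simp_all add: mat_map_def)

text \<open>
  The generic entry: for an object of \<open>mat A\<close> and an index, the entry there. This is the counit of the
  2-adjunction at \<open>A\<close>.
\<close>

definition entries :: "'V VDC \<Rightarrow> 'V VDMap" where
  "entries A = untab (mat A) (id_map (mat A)) (id_map (mat A)) (\<lambda>x i. i)"

lemma vdf_entries: assumes "vdc A" shows "vdf (el (mat A) (id_map (mat A))) A (entries A)"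
  unfolding entries_def using vdf_untab[OF vdc_mat[OF assms] assms vdf_id[OF vdc_mat[OF assms]] assms vdf_id[OF vdc_mat[OF assms]]] by simp

text \<open>
  Applying \<open>F\<close> to all entries of a matrix is tabulating \<open>F\<close> after the generic entry. That \<open>mat_map\<close> is a
  functor and depends functorially on \<open>F\<close> are thereby special cases of properties of \<open>tab\<close>. Since \<open>tab\<close> only uses
  the index data of the functor into matrices, the identity of \<open>mat A\<close> may take the place of the
  projection to \<open>mat t\<close>.
\<close>

lemma mat_map_eq_tab:
  assumes A: "vdc A"
  shows "mat_map A F = tab (mat A) (id_map (mat A)) (comp_map (el (mat A) (id_map (mat A))) F (entries A))"
proof -
  note MA = vdc_mat[OF A]
  define p where "p = id_map (mat A)"
  define H where "H = comp_map (el (mat A) p) F (entries A)"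
  have p: "vdf (mat A) (mat A) p" unfolding p_def by (rule vdf_id[OF MA])
  have p_sel: "x \<in> mat_Ob A \<Longrightarrow> fo p x = x" "u \<in> mat_Ver A \<Longrightarrow> fv p u = u" "J \<in> mat_Hor A \<Longrightarrow> fh p J = J" "q \<in> mat_Cell A \<Longrightarrow> fc p q = q"
    for x u J q by (simp_all add: p_def id_map_sel)
  note s = H_def entries_def p_def[symmetric] comp_map_sel p_sel
  have tl: "el_tail (mat A) p Js r \<longleftrightarrow> tails Js r" if "set Js \<subseteq> mat_Hor A" for Js r
  proof -
    have "map (fh p) Js = Js" using that p_sel(3) by (auto intro: map_idI)
    then show ?thesis using tails_fh[OF p, of Js r] that by simp
  qed
  have Ho: "fo H (vlist [x, i]) = fo F (oent x i)" if "x \<in> mat_Ob A" "i \<in> idx x" for x i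
    using that by (simp add: s)
  have Hv: "fv H (vlist [u, i]) = fv F (vent u i)" if "u \<in> mat_Ver A" "i \<in> idx (part 0 u)" for u i
    using that mat_VerD(1)[OF that(1)] by (simp add: s)
  have Hh: "fh H (vlist [J, i, j]) = fh F (hent J i j)" if "J \<in> mat_Hor A" "i \<in> idx (part 0 J)" "j \<in> idx (part (Suc 0) J)" for J i j
    using that mat_HorD(1,2)[OF that(1)] by (simp add: s)
  have Hc: "fc H (vlist [q, vlist (i # r)]) = fc F (cent q (i # r))" if "q \<in> mat_Cell A" "i \<in> idx (part 0 (part 2 q))" "tails (mat_ctop q) r" for q i r
  proof -
    note d = mat_CellD[OF that(1)]
    have t: "el_tail (mat A) p (mat_ctop q) r" using tl[OF chain_ends(3)[OF d(4)]] that(3) by simp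
    have "shift (mat A) (\<lambda>x i. i) (mat_ctop q) r = r" by (rule shift_eq_map[OF t]) simp
    then show ?thesis using that t d(2) mat_VerD(1)[OF d(2)] by (simp add: s)
  qed
  have o: "tab_fo p H x = mat_fo F x" if "x \<in> mat_Ob A" for x
    unfolding tab_fo_def mat_fo_mk p_sel(1)[OF that] by (rule mkO_cong) (simp add: Ho[OF that] idx_def)
  have v: "tab_fv (mat A) p H u = mat_fv F u" if "u \<in> mat_Ver A" for u
    using mat_VerD(1,2)[OF that] unfolding tab_fv_def mat_fv_mk[OF that] by (simp add: that o p_sel) (rule mkV_cong, simp add: Hv[OF that])
  have h: "tab_fh (mat A) p H J = mat_fh F J" if "J \<in> mat_Hor A" for J
    using mat_HorD(1,2)[OF that] unfolding tab_fh_def mat_fh_mk by (simp add: that o) (rule mkH_cong, simp add: Hh[OF that])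
  have c: "tab_fc (mat A) p H q = mat_fc F q" if "q \<in> mat_Cell A" for q
  proof -
    note d = mat_CellD[OF that]
    have "map (tab_fh (mat A) p H) (mat_ctop q) = map (mat_fh F) (mat_ctop q)" using chain_ends(3)[OF d(4)] h by auto
    then show ?thesis using d(1-3) unfolding tab_fc_def mat_fc_mk[OF that]
      by (simp add: that h v del: map_eq_conv) (rule mkC_cong, simp add: Hc[OF that] mat_fv_sel[OF d(2)])
  qed
  show ?thesis unfolding p_def[symmetric] H_def[symmetric] mat_map_def tab_def by (simp add: o v h c cong: restrict_cong)
qed

context
  fixes A B :: "'V VDC" and F :: "'V VDMap"
  assumes A: "vdc A" and B: "vdc B" and F: "vdf A B F"
begin

lemma vdf_mat: "vdf (mat A) (mat B) (mat_map A F)"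
proof -
  note MA = vdc_mat[OF A]
  show ?thesis unfolding mat_map_eq_tab[OF A]
    by (rule vdf_tab[OF MA A vdf_id[OF MA] B vdf_comp[OF vdc_el[OF MA A vdf_id[OF MA]] vdf_entries[OF A] F]])
qed

lemma mat_fo_in: "x \<in> mat_Ob A \<Longrightarrow> mat_fo F x \<in> mat_Ob B"
  using virtual_double_functor.fo_in[OF vdf_mat, of x] by (simp add: mat_map_sel)

lemma mat_fv_in: "g \<in> mat_Ver A \<Longrightarrow> mat_fv F g \<in> mat_Ver B"
  using virtual_double_functor.fv_Ver[OF vdf_mat, of g] by (simp add: mat_map_sel)

lemma mat_fh_in: "J \<in> mat_Hor A \<Longrightarrow> mat_fh F J \<in> mat_Hor B"
  using virtual_double_functor.fh_in[OF vdf_mat, of J] by (simp add: mat_map_sel)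

end

context
  fixes X t :: "'V VDC" and p :: "'V VDMap"
  assumes X: "vdc X" and t: "vdc t" and p: "vdf X (mat t) p"
begin

interpretation X: virtual_double_category X by fact

text \<open>
  Naturality of the correspondence between functors \<open>el X p \<rightarrow> A\<close> and \<open>X \<rightarrow> mat A\<close> in \<open>A\<close>.
\<close>

lemma mat_map_tab:
  assumes A: "vdc A" and F: "vdf (el X p) A F" and B: "vdc B" and H: "vdf A B H"
  shows "comp_map X (mat_map A H) (tab X p F) = tab X p (comp_map (el X p) H F)"
proof -
  note T = vdf_tab[OF X t p A F] and HF = vdf_comp[OF vdc_el[OF X t p] F H]
  note i = tab_fo_in[OF X t p A F] tab_fv_in[OF X t p A F] tab_fh_in[OF X t p A F] tab_fc_in[OF X t p A F]
  note s = comp_map_sel mat_map_sel tab_sel mat_fv_sel[where A = A] mat_fc_sel[where A = A]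
  show ?thesis
  proof (rule mat_functor_eqI[OF vdf_comp[OF X T vdf_mat[OF A B H]] vdf_tab[OF X t p B HF] X])
    fix q j r assume h: "q \<in> Cell X" "j \<in> ix (comp_map X (mat_map A H) (tab X p F)) (vdom X (clft X q))"
      "tails (map (fh (comp_map X (mat_map A H) (tab X p F))) (ctop X q)) r"
    have r: "el_tail X p (ctop X q) r"
    proof -
      have "map (fh (comp_map X (mat_map A H) (tab X p F))) (ctop X q) = map (mat_fh H) (map (tab_fh X p F) (ctop X q))"
        using X.ctop_in[OF h(1)] i by (auto simp: s)
      then show ?thesis using h(3) by (simp del: map_map)
    qed
    show "cent (fc (comp_map X (mat_map A H) (tab X p F)) q) (j # r) = cent (fc (tab X p (comp_map (el X p) H F)) q) (j # r)"
      using h r i X.vdom_in[OF X.clft_in[OF h(1)]] by (simp add: s)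
  qed (use i X.vdom_in X.hsrc_in X.htrg_in in \<open>simp_all add: s\<close>)
qed

text \<open>
  The hypotheses express that \<open>G\<close> lies over \<open>p\<close>: both have the same index data.
\<close>

lemma tab_untab:
  assumes A: "vdc A" and G: "vdf X (mat A) G"
    and o: "\<And>x. x \<in> Ob X \<Longrightarrow> part 0 (fo p x) = part 0 (fo G x)"
    and v: "\<And>u i. \<lbrakk>u \<in> Ver X; i \<in> ix p (vdom X u)\<rbrakk> \<Longrightarrow> vidx (fv p u) i = vidx (fv G u) i"
  shows "vdf (el X p) A (untab X p G (\<lambda>x i. i))" (is ?P1) "tab X p (untab X p G (\<lambda>x i. i)) = G"
proof -
  have idx: "ix p x = ix G x" if "x \<in> Ob X" for x using o[OF that] by (simp add: idx_def)
  show U: "?P1"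
    by (rule vdf_untab[OF X t p A G]) (use idx v in auto)
  show "tab X p (untab X p G (\<lambda>x i. i)) = G"
  proof (rule mat_functor_eqI[OF vdf_tab[OF X t p A U] G X])
    fix q j r assume h: "q \<in> Cell X" "j \<in> ix (tab X p (untab X p G (\<lambda>x i. i))) (vdom X (clft X q))"
      "tails (map (fh (tab X p (untab X p G (\<lambda>x i. i)))) (ctop X q)) r"
    have "map (fh (tab X p (untab X p G (\<lambda>x i. i)))) (ctop X q) = map (tab_fh X p (untab X p G (\<lambda>x i. i))) (ctop X q)"
      using X.ctop_in[OF h(1)] by (auto simp: tab_sel)
    then have r: "el_tail X p (ctop X q) r" using h(3) by (simp del: map_eq_conv)
    have "shift X (\<lambda>x i. i) (ctop X q) r = r" by (rule shift_eq_map[OF r]) simp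
    then show "cent (fc (tab X p (untab X p G (\<lambda>x i. i))) q) (j # r) = cent (fc G q) (j # r)"
      using h r X.vdom_in[OF X.clft_in[OF h(1)]] by (simp add: tab_sel)
  qed (use o v X.vdom_in X.hsrc_in X.htrg_in in \<open>simp_all add: tab_sel\<close>)
qed

end

lemma mat_map_id: assumes A: "vdc A" shows "mat_map A (id_map A) = id_map (mat A)"
proof -
  note MA = vdc_mat[OF A]
  show ?thesis unfolding mat_map_eq_tab[OF A] comp_map_id_left[OF vdc_el[OF MA A vdf_id[OF MA]] A vdf_entries[OF A]]
    unfolding entries_def by (rule tab_untab(2)[OF MA A vdf_id[OF MA] A vdf_id[OF MA]]) simp_all
qed

lemma mat_map_comp:
  assumes A: "vdc A" and B: "vdc B" and C: "vdc C" and F: "vdf A B F" and G: "vdf B C G"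
  shows "mat_map A (comp_map A G F) = comp_map (mat A) (mat_map B G) (mat_map A F)"
proof -
  note MA = vdc_mat[OF A] and e = vdf_entries[OF A] and E = vdc_el[OF vdc_mat[OF A] A vdf_id[OF vdc_mat[OF A]]]
  show ?thesis unfolding mat_map_eq_tab[OF A] comp_map_assoc[OF E A e F G]
    by (rule mat_map_tab[OF MA A vdf_id[OF MA] B vdf_comp[OF E e F] C G, symmetric])
qed

lemma mat_tv_mk: "mat_tv F \<alpha> G x = mkV (mat_fo F x) (mat_fo G x) id (\<lambda>i. tv \<alpha> (oent x i))"
  by (simp add: mat_tv_def mkV_def)

lemma mat_tv_sel [simp]: "part 0 (mat_tv F \<alpha> G x) = mat_fo F x" "part (Suc 0) (mat_tv F \<alpha> G x) = mat_fo G x"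
  "i \<in> idx x \<Longrightarrow> vidx (mat_tv F \<alpha> G x) i = i" "i \<in> idx x \<Longrightarrow> vent (mat_tv F \<alpha> G x) i = tv \<alpha> (oent x i)"
  by (simp_all add: mat_tv_mk)

lemma mat_tc_mk: "mat_tc F \<alpha> G J = mkC [mat_fh F J] (mat_fh G J) (mat_tv F \<alpha> G (part 0 J)) (mat_tv F \<alpha> G (part (Suc 0) J))
   (\<lambda>is. tc \<alpha> (hent J (is ! 0) (is ! 1)))"
proof -
  have "tuples [part 0 J, part (Suc 0) J] = tuples [mat_fo F (part 0 J), mat_fo F (part (Suc 0) J)]"
    by (rule tuples_cong) simp
  then show ?thesis by (simp add: mat_tc_def mkC_def vertices_def flip: part_def)
qed

lemma mat_tc_sel [simp]: "mat_ctop (mat_tc F \<alpha> G J) = [mat_fh F J]" "part (Suc 0) (mat_tc F \<alpha> G J) = mat_fh G J"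
  "part 2 (mat_tc F \<alpha> G J) = mat_tv F \<alpha> G (part 0 J)" "part 3 (mat_tc F \<alpha> G J) = mat_tv F \<alpha> G (part (Suc 0) J)"
  "\<lbrakk>i \<in> idx (part 0 J); j \<in> idx (part (Suc 0) J)\<rbrakk> \<Longrightarrow> cent (mat_tc F \<alpha> G J) [i, j] = tc \<alpha> (hent J i j)"
  by (simp_all add: mat_tc_mk)

lemma vtr_mat:
  assumes A: "vdc A" and B: "vdc B" and F: "vdf A B F" and G: "vdf A B G" and a: "vtr A B F G \<alpha>"
  shows "vtr (mat A) (mat B) (mat_map A F) (mat_map A G) (mat_trans A F \<alpha> G)"
proof -
  interpret a: vertical_transformation A B F G \<alpha> by fact
  note ms = mat_map_sel
  have tvs: "tv (mat_trans A F \<alpha> G) x = mat_tv F \<alpha> G x" if "x \<in> mat_Ob A" for x using that by (simp add: mat_trans_def)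
  have tcs: "tc (mat_trans A F \<alpha> G) J = mat_tc F \<alpha> G J" if "J \<in> mat_Hor A" for J using that by (simp add: mat_trans_def)
  have tvin: "mat_tv F \<alpha> G x \<in> mat_Ver B" if "x \<in> mat_Ob A" for x
    unfolding mat_tv_mk mkV_in using that mat_fo_in[OF A B] F G a.tv_ver[OF mat_ObD(2)[OF that]] by auto
  have tcin: "mat_tc F \<alpha> G J \<in> mat_Cell B" if "J \<in> mat_Hor A" for J
  proof -
    note d = mat_HorD[OF that]
    show ?thesis unfolding mat_tc_mk mkC_in
      using d tvin mat_fh_in[OF A B F that] mat_fh_in[OF A B G that] mat_fo_in[OF A B F] a.tc_cell[OF d(3)] by auto
  qed
  show ?thesis
  proof (rule vtr_into_matI[OF vdc_mat[OF A] B vdf_mat[OF A B F] vdf_mat[OF A B G]])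
    show "trans_boundary (mat A) (mat B) (mat_map A F) (mat_map A G) (mat_trans A F \<alpha> G)"
      unfolding trans_boundary_def using mat_HorD[where A = A] by (auto simp: ver_mat cell_mat tvs tcs tvin tcin ms)
    show "tv (mat_trans A F \<alpha> G) \<in> extensional (Ob (mat A))" "tc (mat_trans A F \<alpha> G) \<in> extensional (Hor (mat A))" by (simp_all add: mat_trans_def)
  next
    fix u i assume "u \<in> Ver (mat A)" "i \<in> ix (mat_map A F) (vdom (mat A) u)"
    then have u: "u \<in> mat_Ver A" and i: "i \<in> idx (part 0 u)" using mat_VerD(1)[of u A] by (simp_all add: ms)
    note d = mat_VerD[OF u]
    show "vidx (tv (mat_trans A F \<alpha> G) (vcod (mat A) u)) (vidx (fv (mat_map A F) u) i) = vidx (fv (mat_map A G) u) (vidx (tv (mat_trans A F \<alpha> G) (vdom (mat A) u)) i)"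
      "vcomp B (vent (tv (mat_trans A F \<alpha> G) (vcod (mat A) u)) (vidx (fv (mat_map A F) u) i)) (vent (fv (mat_map A F) u) i)
       = vcomp B (vent (fv (mat_map A G) u) (vidx (tv (mat_trans A F \<alpha> G) (vdom (mat A) u)) i)) (vent (tv (mat_trans A F \<alpha> G) (vdom (mat A) u)) i)"
      using u i d(1-3) a.tv_natural[OF d(4)[OF i]] by (simp_all add: ms tvs mat_fv_sel[OF u])
  next
    fix q i r assume h: "q \<in> Cell (mat A)" "i \<in> ix (mat_map A F) (vdom (mat A) (clft (mat A) q))" "el_tail (mat A) (mat_map A F) (ctop (mat A) q) r"
    have t: "q \<in> mat_Cell A" using h(1) by simp
    note d = mat_CellD[OF t]
    note dl = mat_VerD[OF d(2)] and dr = mat_VerD[OF d(3)] and H = chain_ends(3)[OF d(4)]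
    have i: "i \<in> idx (part 0 (part 2 q))" using h(2) t d(2) dl(1) by (simp add: ms)
    have "map (fh (mat_map A F)) (mat_ctop q) = map (mat_fh F) (mat_ctop q)" using H ms by auto
    then have r: "tails (mat_ctop q) r" using h(3) tails_fh[OF vdf_mat[OF A B F], of "mat_ctop q" r] H t by (simp del: map_eq_conv)
    have j: "last (i # r) \<in> idx (part 0 (part 3 q))" by (rule tails_last[OF d(4) i r])
    have jj: "vidx (part 2 q) i \<in> idx (part 0 (part (Suc 0) q))" "vidx (part 3 q) (last (i # r)) \<in> idx (part (Suc 0) (part (Suc 0) q))"
      using dl(3)[OF i] dr(3)[OF j] d(5,6) by simp_all
    have e: "shift (mat A) (\<lambda>x. vidx (tv (mat_trans A F \<alpha> G) x)) Js r = r
        \<and> along (\<lambda>J i j. cent (tc (mat_trans A F \<alpha> G) J) [i, j]) Js (i # r) = map (tc \<alpha>) (mat_entry Js (i # r))"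
      if "mpath A x Js y" "i \<in> idx x" "tails Js r" for Js x y i r
      using that
    proof (induction Js arbitrary: x i r)
      case (Cons J Js)
      then show ?case using mat_HorD(2)[of J A] by (auto simp: tvs tcs)
    qed simp
    note c = d(7)[OF i r]
    show "ucomp B (cent (tc (mat_trans A F \<alpha> G) (cbot (mat A) q)) [vidx (fv (mat_map A F) (clft (mat A) q)) i, vidx (fv (mat_map A F) (crgt (mat A) q)) (last (i # r))])
         (cent (fc (mat_map A F) q) (i # r))
       = ccomp B (cent (fc (mat_map A G) q) (vidx (tv (mat_trans A F \<alpha> G) (vdom (mat A) (clft (mat A) q))) i
             # shift (mat A) (\<lambda>x. vidx (tv (mat_trans A F \<alpha> G) x)) (ctop (mat A) q) r))
           (vent (tv (mat_trans A F \<alpha> G) (vdom (mat A) (clft (mat A) q))) i)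
           (along (\<lambda>J i j. cent (tc (mat_trans A F \<alpha> G) J) [i, j]) (ctop (mat A) q) (i # r))"
      using a.tc_natural_ucomp[OF cellD(1)[OF c] F] cellD[OF c] dl(4)[OF i] e[OF d(4) i r] t d(1-3) dl(1) i r j jj
      by (simp add: ver_def ms tvs tcs mat_fv_sel[OF d(2)] mat_fv_sel[OF d(3)] mat_fc_sel[OF t] del: last.simps)
  qed
qed

lemma mat_trans_sel:
  "x \<in> mat_Ob A \<Longrightarrow> tv (mat_trans A F \<alpha> G) x = mat_tv F \<alpha> G x" "J \<in> mat_Hor A \<Longrightarrow> tc (mat_trans A F \<alpha> G) J = mat_tc F \<alpha> G J"
  by (auto simp: mat_trans_def)

lemma mat_trans_id:
  assumes A: "vdc A" and B: "vdc B" and F: "vdf A B F"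
  shows "mat_trans A F (id_trans A B F) F = id_trans (mat A) (mat B) (mat_map A F)"
proof (rule mat_trans_eqI[OF vtr_mat[OF A B F F vtr_id[OF A B F]] vtr_id[OF vdc_mat[OF A] vdc_mat[OF B] vdf_mat[OF A B F]] vdc_mat[OF A] vdf_mat[OF A B F]])
  note ms = mat_map_sel mat_trans_sel
  show "vidx (tv (mat_trans A F (id_trans A B F) F) x) i = vidx (tv (id_trans (mat A) (mat B) (mat_map A F)) x) i"
    "vent (tv (mat_trans A F (id_trans A B F) F) x) i = vent (tv (id_trans (mat A) (mat B) (mat_map A F)) x) i"
    if "x \<in> Ob (mat A)" "i \<in> ix (mat_map A F) x" for x i
    using that mat_ObD(2)[of x A] mat_fo_in[OF A B F] by (auto simp: ms whisker_sel)
  show "cent (tc (mat_trans A F (id_trans A B F) F) J) [i, j] = cent (tc (id_trans (mat A) (mat B) (mat_map A F)) J) [i, j]"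
    if "J \<in> Hor (mat A)" "i \<in> ix (mat_map A F) (hsrc (mat A) J)" "j \<in> ix (mat_map A F) (htrg (mat A) J)" for J i j
    using that mat_HorD[of J A] mat_fh_in[OF A B F] by (auto simp: ms whisker_sel cent_mat_cid)
qed

lemma mat_trans_vcomp:
  assumes A: "vdc A" and B: "vdc B" and F: "vdf A B F" "vdf A B G" "vdf A B H" and t: "vtr A B F G \<alpha>" "vtr A B G H \<beta>"
  shows "mat_trans A F (vcomp_trans A B \<beta> \<alpha>) H = vcomp_trans (mat A) (mat B) (mat_trans A G \<beta> H) (mat_trans A F \<alpha> G)"
proof (rule mat_trans_eqI[OF vtr_mat[OF A B F(1,3) vtr_vcomp[OF A B F t]] vtr_vcomp[OF vdc_mat[OF A] vdc_mat[OF B] vdf_mat[OF A B F(1)] vdf_mat[OF A B F(2)] vdf_mat[OF A B F(3)] vtr_mat[OF A B F(1,2) t(1)] vtr_mat[OF A B F(2,3) t(2)]] vdc_mat[OF A] vdf_mat[OF A B F(1)]])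
  note a = vtr_mat[OF A B F(1,2) t(1)] and b = vtr_mat[OF A B F(2,3) t(2)]
  interpret MA: vertical_transformation "mat A" "mat B" "mat_map A F" "mat_map A G" "mat_trans A F \<alpha> G" by fact
  interpret MB: vertical_transformation "mat A" "mat B" "mat_map A G" "mat_map A H" "mat_trans A G \<beta> H" by fact
  note ms = mat_map_sel mat_trans_sel vcomp_trans_sel[OF t(1)] vcomp_trans_sel[OF a]
  show "vidx (tv (mat_trans A F (vcomp_trans A B \<beta> \<alpha>) H) x) i = vidx (tv (vcomp_trans (mat A) (mat B) (mat_trans A G \<beta> H) (mat_trans A F \<alpha> G)) x) i"
    "vent (tv (mat_trans A F (vcomp_trans A B \<beta> \<alpha>) H) x) i = vent (tv (vcomp_trans (mat A) (mat B) (mat_trans A G \<beta> H) (mat_trans A F \<alpha> G)) x) i"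
    if "x \<in> Ob (mat A)" "i \<in> ix (mat_map A F) x" for x i
    using that mat_ObD(2)[of x A] MA.tv_ver[of x] MB.tv_ver[of x]
    by (auto simp: ms ver_mat mat_vcomp_eq)
  show "cent (tc (mat_trans A F (vcomp_trans A B \<beta> \<alpha>) H) J) [i, j] = cent (tc (vcomp_trans (mat A) (mat B) (mat_trans A G \<beta> H) (mat_trans A F \<alpha> G)) J) [i, j]"
    if g: "J \<in> Hor (mat A)" and i: "i \<in> ix (mat_map A F) (hsrc (mat A) J)" and j: "j \<in> ix (mat_map A F) (htrg (mat A) J)" for J i j
  proof -
    have g': "J \<in> mat_Hor A" using g by simp
    note d = mat_HorD[OF g']
    have i: "i \<in> idx (part 0 J)" and j: "j \<in> idx (part (Suc 0) J)" using i j g' d by (simp_all add: ms)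
    show ?thesis using ucomp_mat[OF B MB.tc_cell[OF g] MA.tc_cell[OF g], of i "[j]"] g' i j d by (simp add: ms)
  qed
qed

lemma mat_trans_hcomp:
  assumes A: "vdc A" and B: "vdc B" and C: "vdc C" and F: "vdf A B F" "vdf A B G" "vdf B C H" "vdf B C K"
    and t: "vtr A B F G \<alpha>" "vtr B C H K \<beta>"
  shows "mat_trans A (comp_map A H F) (hcomp_trans A C H \<beta> G \<alpha>) (comp_map A K G)
    = hcomp_trans (mat A) (mat C) (mat_map B H) (mat_trans B H \<beta> K) (mat_map A G) (mat_trans A F \<alpha> G)" (is "?L = ?R")
proof (rule mat_trans_eqI)
  note MA = vdc_mat[OF A] and MB = vdc_mat[OF B] and MC = vdc_mat[OF C]
  note MF = vdf_mat[OF A B F(1)] and MG = vdf_mat[OF A B F(2)] and MH = vdf_mat[OF B C F(3)] and MK = vdf_mat[OF B C F(4)]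
  note a = vtr_mat[OF A B F(1,2) t(1)] and b = vtr_mat[OF B C F(3,4) t(2)]
  note HF = vdf_comp[OF A F(1,3)] and KG = vdf_comp[OF A F(2,4)]
  interpret MA: vertical_transformation "mat A" "mat B" "mat_map A F" "mat_map A G" "mat_trans A F \<alpha> G" by fact
  interpret MB: vertical_transformation "mat B" "mat C" "mat_map B H" "mat_map B K" "mat_trans B H \<beta> K" by fact
  interpret MH: virtual_double_functor "mat B" "mat C" "mat_map B H" by fact
  interpret MG: virtual_double_functor "mat A" "mat B" "mat_map A G" by fact
  show "vtr (mat A) (mat C) (mat_map A (comp_map A H F)) (mat_map A (comp_map A K G)) ?L"
    by (rule vtr_mat[OF A C HF KG vtr_hcomp[OF A B C F t]])
  show "vtr (mat A) (mat C) (mat_map A (comp_map A H F)) (mat_map A (comp_map A K G)) ?R"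
    unfolding mat_map_comp[OF A B C F(1,3)] mat_map_comp[OF A B C F(2,4)]
    by (rule vtr_hcomp[OF MA MB MC MF MG MH MK a b])
  show "vdc (mat A)" by (rule MA)
  show "vdf (mat A) (mat C) (mat_map A (comp_map A H F))" by (rule vdf_mat[OF A C HF])
  note ms = mat_map_sel mat_trans_sel
     hcomp_trans_sel[OF A F(3) t(1)] hcomp_trans_sel[OF MA MH a]
  show "vidx (tv ?L x) i = vidx (tv ?R x) i"
    "vent (tv ?L x) i = vent (tv ?R x) i"
    if x: "x \<in> Ob (mat A)" and i: "i \<in> ix (mat_map A (comp_map A H F)) x" for x i
  proof -
    have x': "x \<in> mat_Ob A" using x by simp
    have i': "i \<in> idx x" using i x' by (simp add: ms)
    have gx: "mat_fo G x \<in> mat_Ob B" by (rule mat_fo_in[OF A B F(2) x'])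
    have v: "mat_tv F \<alpha> G x \<in> mat_Ver B" using MA.tv_ver[OF x] x' by (simp add: ver_mat ms)
    note v1 = mat_fv_in[OF B C F(3) v]
    have v2: "mat_tv H \<beta> K (mat_fo G x) \<in> mat_Ver C" using MB.tv_ver[of "mat_fo G x"] gx by (simp add: ver_mat ms)
    have e: "tv ?R x
      = mat_vcomp C (mat_tv H \<beta> K (mat_fo G x)) (mat_fv H (mat_tv F \<alpha> G x))"
      using x' gx v v1 v2 by (simp add: ms mat_vcomp_eq mat_fv_sel[OF v])
    show "vidx (tv ?L x) i = vidx (tv ?R x) i"
      "vent (tv ?L x) i = vent (tv ?R x) i"
      unfolding e using x' i' mat_ObD(2)[OF x' i'] by (simp_all add: ms mat_fv_sel[OF v])
  qed
  show "cent (tc ?L J) [i, j] = cent (tc ?R J) [i, j]"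
    if g: "J \<in> Hor (mat A)" and i: "i \<in> ix (mat_map A (comp_map A H F)) (hsrc (mat A) J)"
      and j: "j \<in> ix (mat_map A (comp_map A H F)) (htrg (mat A) J)" for J i j
  proof -
    have g': "J \<in> mat_Hor A" using g by simp
    note d = mat_HorD[OF g']
    have i: "i \<in> idx (part 0 J)" and j: "j \<in> idx (part (Suc 0) J)" using i j g' d by (simp_all add: ms)
    note c = MA.tc_cell[OF g]
    note c1 = MH.fc_cell[OF c, simplified]
    note c2 = MB.tc_cell[OF MG.fh_in[OF g]]
    have m: "mat_tc F \<alpha> G J \<in> mat_Cell B" using cellD(1)[OF c] g' by (simp add: ms)
    note dm = mat_CellD[OF m]
    have gh: "mat_fh G J \<in> mat_Hor B" by (rule mat_fh_in[OF A B F(2) g'])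
    have "cent (tc ?R J) [i, j]
       = cent (ucomp (mat C) (tc (mat_trans B H \<beta> K) (fh (mat_map A G) J)) (fc (mat_map B H) (tc (mat_trans A F \<alpha> G) J))) [i, j]"
      using g by (simp only: ms)
    also have "\<dots> = ucomp C (tc \<beta> (fh G (hent J i j))) (fc H (tc \<alpha> (hent J i j)))"
      using ucomp_mat[OF C c2 c1, of i "[j]"] g' i j d gh m dm(2,3)
      by (simp add: ms mat_fc_sel[OF m] mat_fv_sel[OF dm(2), simplified] mat_fv_sel[OF dm(3), simplified] mat_fh_in[OF A B F(1) g'] mat_fh_in[OF B C F(3)])
    also have "\<dots> = cent (tc ?L J) [i, j]"
      using g' i j d(3)[OF i j] by (simp add: ms)
    finally show ?thesis ..
  qed
qed

theorem two_functor_Mat: "two_functor VDBL VDBL Mat"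
proof (unfold_locales, goal_cases)
  case (1 a) then show ?case by (simp add: Mat_def large_vdc_mat)
next
  case (2 f a b) then show ?case using vdf_mat[OF large_vdcD large_vdcD] by (auto simp: Mat_def VDBL_arr1 large_vdc_mat)
next
  case (3 x f g) then show ?case using vdf_mat[OF large_vdcD large_vdcD] vtr_mat[OF large_vdcD large_vdcD]
    by (auto simp: Mat_def VDBL_arr2 large_vdc_mat)
next
  case (4 a) then show ?case using mat_map_id[OF large_vdcD] by (simp add: Mat_def)
next
  case (5 f a b g c) then show ?case using mat_map_comp[OF large_vdcD large_vdcD large_vdcD] by (auto simp: Mat_def VDBL_arr1)
next
  case (6 f) then show ?case using mat_trans_id[OF large_vdcD large_vdcD] by (auto simp: Mat_def VDBL_C1)
next
  case (7 x f g y h) then show ?case using mat_trans_vcomp[OF large_vdcD large_vdcD] by (auto simp: Mat_def VDBL_arr2)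
next
  case (8 x f f' y g g')
  then show ?case using mat_trans_hcomp[OF large_vdcD large_vdcD large_vdcD] mat_map_comp[OF large_vdcD large_vdcD large_vdcD]
    by (auto simp: Mat_def VDBL_arr2)
qed

section \<open>Terminal virtual double categories\<close>

definition pt :: 'V where "pt = vset {}"

text \<open>
  A terminal object has one multicell of each arity, coded by a list of copies of a point.
\<close>

definition unit_cells :: "'V set" where "unit_cells = vlist ` lists {pt}"

definition unit_vdc :: "'V VDC" where
  "unit_vdc = \<lparr>Ob = {pt}, Ver = {pt}, vdom = restrict (\<lambda>_. pt) {pt}, vcod = restrict (\<lambda>_. pt) {pt},
     vid = restrict (\<lambda>_. pt) {pt}, vcomp = (\<lambda>g f. if f = pt \<and> g = pt then pt else undefined),
     Hor = {pt}, hsrc = restrict (\<lambda>_. pt) {pt}, htrg = restrict (\<lambda>_. pt) {pt},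
     Cell = unit_cells, ctop = restrict unlist unit_cells, cbot = restrict (\<lambda>_. pt) unit_cells,
     clft = restrict (\<lambda>_. pt) unit_cells, crgt = restrict (\<lambda>_. pt) unit_cells,
     cid = restrict (\<lambda>_. vlist [pt]) {pt},
     ccomp = (\<lambda>\<kappa> u qs. if \<kappa> \<in> unit_cells \<and> u = pt \<and> set qs \<subseteq> unit_cells \<and> length qs = length (unlist \<kappa>)
       then vlist (concat (map unlist qs)) else undefined)\<rparr>"

lemma unit_sel [simp]: "Ob unit_vdc = {pt}" "Ver unit_vdc = {pt}" "Hor unit_vdc = {pt}" "Cell unit_vdc = unit_cells"
  "vdom unit_vdc pt = pt" "vcod unit_vdc pt = pt" "vid unit_vdc pt = pt" "vcomp unit_vdc pt pt = pt"
  "hsrc unit_vdc pt = pt" "htrg unit_vdc pt = pt" "cid unit_vdc pt = vlist [pt]"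
  "q \<in> unit_cells \<Longrightarrow> ctop unit_vdc q = unlist q" "q \<in> unit_cells \<Longrightarrow> cbot unit_vdc q = pt"
  "q \<in> unit_cells \<Longrightarrow> clft unit_vdc q = pt" "q \<in> unit_cells \<Longrightarrow> crgt unit_vdc q = pt"
  by (auto simp: unit_vdc_def)

lemma vlist_unit_cells [simp]: "vlist xs \<in> unit_cells \<longleftrightarrow> set xs \<subseteq> {pt}"
  by (auto simp: unit_cells_def lists_eq_set)

lemma unit_cellsE: assumes "q \<in> unit_cells" obtains xs where "q = vlist xs" "set xs \<subseteq> {pt}"
  using assms by (auto simp: unit_cells_def lists_eq_set)

lemma replicate_pt: "set xs \<subseteq> {pt} \<Longrightarrow> xs = replicate (length xs) pt"
  by (induction xs) auto

lemma unit_chain: "chain {pt} unit_cells (clft unit_vdc) (crgt unit_vdc) u qs u' \<longleftrightarrow> u = pt \<and> u' = pt \<and> set qs \<subseteq> unit_cells"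
  by (induction qs arbitrary: u) auto

lemma unit_composable: "composable unit_vdc \<kappa> u qs u' \<longleftrightarrow> \<kappa> \<in> unit_cells \<and> u = pt \<and> u' = pt \<and> set qs \<subseteq> unit_cells \<and> length qs = length (unlist \<kappa>)"
proof -
  have "map (cbot unit_vdc) qs = unlist \<kappa> \<longleftrightarrow> length qs = length (unlist \<kappa>)"
    if "\<kappa> \<in> unit_cells" "set qs \<subseteq> unit_cells"
  proof -
    have "map (cbot unit_vdc) qs = map (\<lambda>_. pt) qs" using that(2) by (intro map_cong) (auto simp: subset_iff)
    then have "map (cbot unit_vdc) qs = replicate (length qs) pt" by (simp add: map_replicate_const)
    moreover have "unlist \<kappa> = replicate (length (unlist \<kappa>)) pt" using that(1) replicate_pt by (auto elim!: unit_cellsE)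
    ultimately show ?thesis by (metis length_replicate)
  qed
  then show ?thesis unfolding composable_def cpath_def by (auto simp: unit_chain)
qed

lemma large_vdc_unit: "large_vdc unit_vdc"
proof -
  have path: "hpath unit_vdc pt Js pt" if "set Js \<subseteq> {pt}" for Js
    using that by (induction Js) (auto simp: hpath_def)
  have cc: "ccomp unit_vdc \<kappa> u qs = vlist (concat (map unlist qs))" if "composable unit_vdc \<kappa> u qs u'" for \<kappa> u qs u'
    using that unfolding unit_composable by (simp add: unit_vdc_def)
  have cin: "vlist (concat (map unlist qs)) \<in> unit_cells" if "set qs \<subseteq> unit_cells" for qs
    using that by (fastforce elim!: unit_cellsE)
  have ct: "map (ctop unit_vdc) qs = map unlist qs" if "set qs \<subseteq> unit_cells" for qs
    using that by (auto simp: subset_iff)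
  have "vdc unit_vdc"
  proof (unfold_locales, goal_cases)
    case (13 q) then show ?case using path by (auto elim!: unit_cellsE)
  next
    case (17 \<kappa> u qs u')
    then show ?case unfolding cc[OF 17] using 17 cin ct[of qs] by (auto simp: unit_composable cell_def simp del: map_eq_conv)
  next
    case (18 q)
    then have k: "composable unit_vdc (vlist [pt]) pt [q] pt" by (simp add: unit_composable)
    from cc[OF k] 18 show ?case by (auto elim!: unit_cellsE)
  next
    case (19 q)
    then obtain Js where t: "q = vlist Js" "set Js \<subseteq> {pt}" by (auto elim: unit_cellsE)
    have m: "map (cid unit_vdc) Js = map (\<lambda>_. vlist [pt]) Js" using t(2) by (intro map_cong) (auto simp: subset_iff)
    have k: "composable unit_vdc q pt (map (\<lambda>_. vlist [pt]) Js) pt" using t by (auto simp: unit_composable)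
    have "concat (map unlist (map (\<lambda>_. vlist [pt]) Js)) = Js" using t(2) by (induction Js) auto
    then show ?case using cc[OF k] t m 19 by (simp del: map_map map_eq_conv)
  next
    case (20 \<kappa> u qs u' \<xi>ss ws)
    let ?\<phi> = "\<lambda>i. ccomp unit_vdc (qs ! i) (ws ! i) (\<xi>ss ! i)"
    have ws: "ws ! 0 = pt" using 20(4) by simp
    have \<phi>: "?\<phi> i = vlist (concat (map unlist (\<xi>ss ! i)))" if "i < length qs" for i by (rule cc[OF 20(6)[OF that]])
    have sub: "set (\<xi>ss ! i) \<subseteq> unit_cells" "length (\<xi>ss ! i) = length (unlist (qs ! i))" if "i < length qs" for i
      using 20(6)[OF that] by (auto simp: unit_composable)
    have k: "\<kappa> \<in> unit_cells" "u = pt" "set qs \<subseteq> unit_cells" "length qs = length (unlist \<kappa>)"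
      using 20(1) by (auto simp: unit_composable)
    have "map length \<xi>ss = map (length \<circ> unlist) qs" by (rule nth_equalityI) (use sub(2) 20(2) in auto)
    then have len: "length (concat \<xi>ss) = length (concat (map unlist qs))" by (simp add: length_concat)
    have "\<forall>\<xi>s\<in>set \<xi>ss. set \<xi>s \<subseteq> unit_cells" using sub(1) 20(2) by (simp add: all_set_conv_all_nth)
    then have "set (concat \<xi>ss) \<subseteq> unit_cells" by auto
    then have k1: "composable unit_vdc (vlist (concat (map unlist qs))) pt (concat \<xi>ss) pt"
      unfolding unit_composable using cin[OF k(3)] len by simp
    have "set (map ?\<phi> [0..<length qs]) \<subseteq> unit_cells" using \<phi> cin[OF sub(1)] by auto
    then have k2: "composable unit_vdc \<kappa> pt (map ?\<phi> [0..<length qs]) pt"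
      unfolding unit_composable using k by simp
    have "map unlist (map ?\<phi> [0..<length qs]) = map (\<lambda>\<xi>s. concat (map unlist \<xi>s)) \<xi>ss"
      by (rule nth_equalityI) (use \<phi> 20(2) in auto)
    moreover have "ccomp unit_vdc \<kappa> pt qs = vlist (concat (map unlist qs))" using cc[OF 20(1)] unfolding k(2) .
    ultimately show ?case unfolding ws k(2) by (simp only: unit_sel cc[OF k1] cc[OF k2] concat_map_concat_map)
  qed (auto simp: ver_def cell_def)
  moreover have "vdc_extensional unit_vdc"
  proof -
    have "ccomp unit_vdc \<kappa> u qs = undefined" if "\<nexists>u'. composable unit_vdc \<kappa> u qs u'" for \<kappa> u qs
      using that by (simp add: unit_composable) (auto simp: unit_vdc_def)
    then show ?thesis unfolding vdc_extensional_def by (auto simp: unit_vdc_def)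
  qed
  ultimately show ?thesis using large_lists[OF large_singleton] by (simp add: large_vdc_def unit_cells_def)
qed

lemma unit_cell_eq:
  assumes "q \<in> Cell unit_vdc" "q' \<in> Cell unit_vdc" "length (ctop unit_vdc q) = length (ctop unit_vdc q')"
  shows "q = q'"
proof -
  obtain xs ys where "q = vlist xs" "set xs \<subseteq> {pt}" "q' = vlist ys" "set ys \<subseteq> {pt}"
    using assms(1,2) by (auto elim!: unit_cellsE)
  then show ?thesis using assms(3) replicate_pt[of xs] replicate_pt[of ys] by simp
qed

definition to_unit :: "'V VDC \<Rightarrow> 'V VDMap" where
  "to_unit A = \<lparr>fo = \<lambda>a\<in>Ob A. pt, fv = \<lambda>u\<in>Ver A. pt, fh = \<lambda>J\<in>Hor A. pt, fc = \<lambda>q\<in>Cell A. vlist (map (\<lambda>_. pt) (ctop A q))\<rparr>"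

lemma vdf_to_unit: assumes "vdc A" shows "vdf A unit_vdc (to_unit A)"
proof -
  interpret A: virtual_double_category A by fact
  interpret U: virtual_double_category unit_vdc using large_vdc_unit large_vdcD by blast
  have fv_to_unit: "fv (to_unit A) u = pt" if "u \<in> Ver A" for u using that by (simp add: to_unit_def)
  have fc: "fc (to_unit A) q = vlist (map (\<lambda>_. pt) (ctop A q))" "fc (to_unit A) q \<in> unit_cells" if "q \<in> Cell A" for q
    using that by (auto simp: to_unit_def)
  show ?thesis
  proof (unfold_locales, goal_cases)
    case (8 f a b g c) then show ?case using A.vcomp_ver[OF 8] by (auto simp: to_unit_def ver_def)
  next
    case (12 q Js \<Delta> u u')
    have "map (fh (to_unit A)) Js = map (\<lambda>_. pt) Js" using A.ctop_in 12 by (intro map_cong) (auto simp: cell_def to_unit_def)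
    then show ?case using 12 fc[OF cellD(1)[OF 12]] A.cell_ver[OF 12] cellD[OF 12] by (simp add: cell_def) (simp add: to_unit_def)
  next
    case (13 J)
    then show ?case using fc[OF cellD(1)[OF A.cid_cell[OF 13]]] cellD[OF A.cid_cell[OF 13]] by (simp) (simp add: to_unit_def)
  next
    case (14 \<kappa> u qs u')
    note p = composable_path[OF 14] and c = A.ccomp_cell[OF 14]
    have m: "map (fc (to_unit A)) qs = map (\<lambda>q. vlist (map (\<lambda>_. pt) (ctop A q))) qs" using p(7) fc by auto
    have "composable unit_vdc (fc (to_unit A) \<kappa>) (fv (to_unit A) u) (map (fc (to_unit A)) qs) pt"
      unfolding unit_composable using p fc[OF p(2)] fc(2) map_eq_imp_length_eq[of "cbot A" qs "\<lambda>x. x" "ctop A \<kappa>"]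
      by (auto simp: fv_to_unit subset_iff)
    then have "ccomp unit_vdc (fc (to_unit A) \<kappa>) (fv (to_unit A) u) (map (fc (to_unit A)) qs) = vlist (concat (map unlist (map (fc (to_unit A)) qs)))"
      unfolding unit_composable by (simp add: unit_vdc_def)
    also have "\<dots> = vlist (map (\<lambda>_. pt) (concat (map (ctop A) qs)))" unfolding m by (simp add: map_concat comp_def)
    also have "\<dots> = fc (to_unit A) (ccomp A \<kappa> u qs)" using fc(1)[OF cellD(1)[OF c]] cellD(2)[OF c] by simp
    finally show ?case ..
  qed (use A.vid_ver A.hsrc_in A.htrg_in in \<open>auto simp: to_unit_def ver_def verD(1)[OF A.vid_ver] A.vdom_in A.vcod_in\<close>)
qed

lemma terminal_unit: "terminal VDBL unit_vdc"
  unfolding terminal_def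
proof (intro conjI ballI allI impI)
  show "unit_vdc \<in> C0 VDBL" by (simp add: large_vdc_unit)
  fix A assume A: "A \<in> C0 VDBL"
  then have v: "vdc A" by (simp add: large_vdcD)
  have uniq: "F = G" if "vdf A unit_vdc F" "vdf A unit_vdc G" for F G
  proof -
    interpret F: virtual_double_functor A unit_vdc F by fact
    interpret G: virtual_double_functor A unit_vdc G by fact
    show ?thesis
    proof (rule vd_map_eqI[OF that])
      fix q assume t: "q \<in> Cell A"
      show "fc F q = fc G q" by (rule unit_cell_eq) (use F.fc_Cell[OF t] G.fc_Cell[OF t] in auto)
    qed (use F.fo_in G.fo_in F.fh_in G.fh_in F.fv_Ver G.fv_Ver in auto)
  qed
  show "\<exists>!f. arr1 VDBL f A unit_vdc"
    using vdf_to_unit[OF v] uniq A by (intro ex1I[of _ "(A, to_unit A, unit_vdc)"]) (auto simp: VDBL_arr1 large_vdc_unit)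
  fix f assume "arr1 VDBL f A unit_vdc"
  then obtain F where f: "f = (A, F, unit_vdc)" and F: "vdf A unit_vdc F" by (auto simp: VDBL_arr1)
  have uv: "vdc unit_vdc" using large_vdc_unit large_vdcD by blast
  have tu: "\<alpha> = \<beta>" if "vtr A unit_vdc F F \<alpha>" "vtr A unit_vdc F F \<beta>" for \<alpha> \<beta>
  proof -
    interpret a: vertical_transformation A unit_vdc F F \<alpha> by fact
    interpret b: vertical_transformation A unit_vdc F F \<beta> by fact
    show ?thesis
    proof (rule vd_trans_eqI[OF a.tv_ext a.tc_ext b.tv_ext b.tc_ext])
      show "tv \<alpha> a = tv \<beta> a" if "a \<in> Ob A" for a using a.tv_ver[OF that] b.tv_ver[OF that] by (simp add: ver_def)
      show "tc \<alpha> J = tc \<beta> J" if "J \<in> Hor A" for J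
        using cellD(1,2)[OF a.tc_cell[OF that]] cellD(1,2)[OF b.tc_cell[OF that]] by (intro unit_cell_eq) auto
    qed
  qed
  show "\<exists>!\<alpha>. arr2 VDBL \<alpha> f f"
    using vtr_id[OF v uv F] tu A F by (intro ex1I[of _ "((A, F, unit_vdc), id_trans A unit_vdc F, (A, F, unit_vdc))"])
      (auto simp: VDBL_arr2 f large_vdc_unit)
qed

section \<open>Matrices over a terminal object\<close>

text \<open>
  An isomorphism-invariant description of terminal objects: at most one of each kind of datum, and at
  most one multicell of each arity. A terminal object has it as it is a retract of \<open>unit_vdc\<close>.
\<close>

definition thin :: "'V VDC \<Rightarrow> bool" where
  "thin t \<longleftrightarrow> large_vdc t \<and> (\<forall>x\<in>Ob t. \<forall>y\<in>Ob t. x = y) \<and> (\<forall>x\<in>Ver t. \<forall>y\<in>Ver t. x = y)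
    \<and> (\<forall>x\<in>Hor t. \<forall>y\<in>Hor t. x = y) \<and> (\<forall>q\<in>Cell t. \<forall>q'\<in>Cell t. length (ctop t q) = length (ctop t q') \<longrightarrow> q = q')"

lemma thinD:
  assumes "thin t"
  shows "large_vdc t" "\<lbrakk>x \<in> Ob t; y \<in> Ob t\<rbrakk> \<Longrightarrow> x = y" "\<lbrakk>x \<in> Ver t; y \<in> Ver t\<rbrakk> \<Longrightarrow> x = y" "\<lbrakk>x \<in> Hor t; y \<in> Hor t\<rbrakk> \<Longrightarrow> x = y"
    "\<lbrakk>x \<in> Cell t; y \<in> Cell t; length (ctop t x) = length (ctop t y)\<rbrakk> \<Longrightarrow> x = y"
  using assms unfolding thin_def by blast+

lemma terminal_thin: assumes "terminal VDBL t" shows "thin t"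
proof -
  have t: "large_vdc t" using assms by (simp add: terminal_def)
  note v = large_vdcD[OF t]
  have uv: "vdc unit_vdc" using large_vdc_unit large_vdcD by blast
  have "\<exists>g. arr1 VDBL g unit_vdc t" using assms large_vdc_unit unfolding terminal_def by force
  then obtain G where G: "vdf unit_vdc t G" by (auto simp: VDBL_arr1)
  note F = vdf_to_unit[OF v]
  have "arr1 VDBL (t, comp_map t G (to_unit t), t) t t" "arr1 VDBL (t, id_map t, t) t t"
    using t vdf_comp[OF v F G] vdf_id[OF v] by (auto simp: VDBL_arr1)
  then have e: "comp_map t G (to_unit t) = id_map t" using assms t unfolding terminal_def by force
  have o: "fo G pt = x" if "x \<in> Ob t" for x
    using comp_map_sel(1)[OF that, of G "to_unit t"] that by (simp add: e id_map_sel) (simp add: to_unit_def)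
  have vv: "fv G pt = x" if "x \<in> Ver t" for x
    using comp_map_sel(2)[OF that, of G "to_unit t"] that by (simp add: e id_map_sel) (simp add: to_unit_def)
  have h: "fh G pt = x" if "x \<in> Hor t" for x
    using comp_map_sel(3)[OF that, of G "to_unit t"] that by (simp add: e id_map_sel) (simp add: to_unit_def)
  have c: "fc G (vlist (map (\<lambda>_. pt) (ctop t q))) = q" if "q \<in> Cell t" for q
    using comp_map_sel(4)[OF that, of G "to_unit t"] that by (simp add: e id_map_sel) (simp add: to_unit_def)
  have cc: "q = q'" if "q \<in> Cell t" "q' \<in> Cell t" "length (ctop t q) = length (ctop t q')" for q q'
  proof -
    have "map (\<lambda>_. pt) (ctop t q) = map (\<lambda>_. pt) (ctop t q')" using that(3) by (simp add: map_replicate_const)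
    then have "fc G (vlist (map (\<lambda>_. pt) (ctop t q))) = fc G (vlist (map (\<lambda>_. pt) (ctop t q')))" by (simp only:)
    then show ?thesis by (rule box_equals[OF _ c[OF that(1)] c[OF that(2)]])
  qed
  have "x = y" if "x \<in> Ob t" "y \<in> Ob t" for x y using o[OF that(1)] o[OF that(2)] by (rule trans[OF sym])
  moreover have "x = y" if "x \<in> Ver t" "y \<in> Ver t" for x y using vv[OF that(1)] vv[OF that(2)] by (rule trans[OF sym])
  moreover have "x = y" if "x \<in> Hor t" "y \<in> Hor t" for x y using h[OF that(1)] h[OF that(2)] by (rule trans[OF sym])
  ultimately show ?thesis unfolding thin_def using t cc by blast
qed

text \<open>
  Entries in a thin \<open>t\<close> carry no information, so functors into \<open>mat t\<close> are compared on index data. The same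
  holds for transformations.
\<close>

lemma thin_functor_eqI:
  assumes t: "thin t" and X: "vdc X" and F: "vdf X (mat t) F" and G: "vdf X (mat t) G"
    and o: "\<And>x. x \<in> Ob X \<Longrightarrow> part 0 (fo F x) = part 0 (fo G x)"
    and v: "\<And>u i. \<lbrakk>u \<in> Ver X; i \<in> ix F (vdom X u)\<rbrakk> \<Longrightarrow> vidx (fv F u) i = vidx (fv G u) i"
  shows "F = G"
proof (rule mat_functor_eqI[OF F G X o _ v])
  interpret X: virtual_double_category X by fact
  interpret F: virtual_double_functor X "mat t" F by fact
  interpret G: virtual_double_functor X "mat t" G by fact
  have idx: "ix F x = ix G x" if "x \<in> Ob X" for x using o[OF that] by (simp add: idx_def)
  show "oent (fo F x) i = oent (fo G x) i" if "x \<in> Ob X" "i \<in> ix F x" for x i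
    by (rule thinD(2)[OF t]; rule mat_ObD(2)) (use F.fo_in[OF that(1)] G.fo_in[OF that(1)] idx[OF that(1)] that(2) in auto)
  show "vent (fv F u) i = vent (fv G u) i" if "u \<in> Ver X" "i \<in> ix F (vdom X u)" for u i
    using mat_VerD(4)[of "fv F u" t i] mat_VerD(4)[of "fv G u" t i] F.fv_ver[OF X.ver_self[OF that(1)], unfolded ver_mat] G.fv_ver[OF X.ver_self[OF that(1)], unfolded ver_mat]
      idx[OF X.vdom_in[OF that(1)]] that(2) by (intro thinD(3)[OF t]) (auto simp: ver_def)
  have h: "part 0 (fh F J) = fo F (hsrc X J) \<and> part (Suc 0) (fh F J) = fo F (htrg X J) \<and> fh F J \<in> mat_Hor t"
     "part 0 (fh G J) = fo G (hsrc X J) \<and> part (Suc 0) (fh G J) = fo G (htrg X J) \<and> fh G J \<in> mat_Hor t" if "J \<in> Hor X" for J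
    using F.fh_in[OF that] F.fh_src[OF that] F.fh_trg[OF that] G.fh_in[OF that] G.fh_src[OF that] G.fh_trg[OF that] by auto
  show "hent (fh F J) i j = hent (fh G J) i j" if "J \<in> Hor X" "i \<in> ix F (hsrc X J)" "j \<in> ix F (htrg X J)" for J i j
    using h[OF that(1)] mat_HorD(3)[of "fh F J" t i j] mat_HorD(3)[of "fh G J" t i j] idx[OF X.hsrc_in[OF that(1)]] idx[OF X.htrg_in[OF that(1)]] that(2,3) by (intro thinD(4)[OF t]) auto
  show "cent (fc F q) (i # r) = cent (fc G q) (i # r)" if "q \<in> Cell X" "i \<in> ix F (vdom X (clft X q))" "tails (map (fh F) (ctop X q)) r" for q i r
  proof -
    note cF = F.fc_cell[OF X.cell_self[OF that(1)], unfolded cell_mat] and cG = G.fc_cell[OF X.cell_self[OF that(1)], unfolded cell_mat]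
    note l = X.clft_in[OF that(1)]
    have "part 0 (fv F (clft X q)) = fo F (vdom X (clft X q))" "part 0 (fv G (clft X q)) = fo G (vdom X (clft X q))"
      using F.fv_ver[OF X.ver_self[OF l]] G.fv_ver[OF X.ver_self[OF l]] by (auto simp: ver_mat)
    then have i: "i \<in> idx (part 0 (part 2 (fc F q)))" "i \<in> idx (part 0 (part 2 (fc G q)))"
      using cF cG that(2) idx[OF X.vdom_in[OF l]] by auto
    have "tails (map (fh G) (ctop X q)) r"
      using that(3) X.ctop_in[OF that(1)] h idx X.htrg_in by (auto simp: tails_def list_all2_map2 list_all2_conv_all_nth subset_iff)
    then have r: "tails (mat_ctop (fc F q)) r" "tails (mat_ctop (fc G q)) r" using that(3) cF cG by auto
    show ?thesis
      using cellD(1,2)[OF mat_CellD(7)[of "fc F q" t, OF _ i(1) r(1)]] cellD(1,2)[OF mat_CellD(7)[of "fc G q" t, OF _ i(2) r(2)]] cF cG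
      by (intro thinD(5)[OF t]) auto
  qed
qed

lemma thin_trans_eqI:
  assumes t: "thin t" and X: "vdc X" and P: "vdf X (mat t) P" and a: "vtr X (mat t) P Q \<alpha>" and b: "vtr X (mat t) P Q \<beta>"
    and v: "\<And>x i. \<lbrakk>x \<in> Ob X; i \<in> ix P x\<rbrakk> \<Longrightarrow> vidx (tv \<alpha> x) i = vidx (tv \<beta> x) i"
  shows "\<alpha> = \<beta>"
proof (rule mat_trans_eqI[OF a b X P v])
  interpret X: virtual_double_category X by fact
  interpret P: virtual_double_functor X "mat t" P by fact
  interpret a: vertical_transformation X "mat t" P Q \<alpha> by fact
  interpret b: vertical_transformation X "mat t" P Q \<beta> by fact
  show "vent (tv \<alpha> x) i = vent (tv \<beta> x) i" if "x \<in> Ob X" "i \<in> ix P x" for x i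
    using mat_VerD(4)[of "tv \<alpha> x" t i] mat_VerD(4)[of "tv \<beta> x" t i] a.tv_ver[OF that(1), unfolded ver_mat] b.tv_ver[OF that(1), unfolded ver_mat] that(2) by (intro thinD(3)[OF t]) (auto simp: ver_def)
  show "cent (tc \<alpha> J) [i, j] = cent (tc \<beta> J) [i, j]" if g: "J \<in> Hor X" "i \<in> ix P (hsrc X J)" "j \<in> ix P (htrg X J)" for J i j
  proof -
    note ac = a.tc_cell[OF g(1), unfolded cell_mat] and bc = b.tc_cell[OF g(1), unfolded cell_mat]
    have h: "part (Suc 0) (fh P J) = fo P (htrg X J)" using P.fh_trg[OF g(1)] P.fh_in[OF g(1)] by simp
    have i: "i \<in> idx (part 0 (part 2 (tc \<alpha> J)))" "i \<in> idx (part 0 (part 2 (tc \<beta> J)))"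
      using ac bc a.tv_ver[OF X.hsrc_in[OF g(1)]] b.tv_ver[OF X.hsrc_in[OF g(1)]] g(2) by (auto simp: ver_mat)
    have r: "tails (mat_ctop (tc \<alpha> J)) [j]" "tails (mat_ctop (tc \<beta> J)) [j]" using ac bc h g(3) by auto
    show ?thesis
      using cellD(1,2)[OF mat_CellD(7)[of "tc \<alpha> J" t, OF _ i(1) r(1)]] cellD(1,2)[OF mat_CellD(7)[of "tc \<beta> J" t, OF _ i(2) r(2)]] ac bc
      by (intro thinD(5)[OF t]) auto
  qed
qed

section \<open>The left 2-adjoint\<close>

lemma over_sel:
  assumes A: "vdc A" and t: "vdc t" and B: "vdf A t B" and G: "vdf X (mat A) G"
  shows "x \<in> Ob X \<Longrightarrow> part 0 (fo (comp_map X (mat_map A B) G) x) = part 0 (fo G x)"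
    "x \<in> Ob X \<Longrightarrow> ix (comp_map X (mat_map A B) G) x = ix G x"
    "\<lbrakk>u \<in> Ver X; i \<in> ix G (vdom X u)\<rbrakk> \<Longrightarrow> vidx (fv (comp_map X (mat_map A B) G) u) i = vidx (fv G u) i"
proof -
  interpret G: virtual_double_functor X "mat A" G by fact
  note ms = mat_map_sel
  show "x \<in> Ob X \<Longrightarrow> part 0 (fo (comp_map X (mat_map A B) G) x) = part 0 (fo G x)"
    "x \<in> Ob X \<Longrightarrow> ix (comp_map X (mat_map A B) G) x = ix G x"
    using G.fo_in by (simp_all add: comp_map_sel ms)
  show "vidx (fv (comp_map X (mat_map A B) G) u) i = vidx (fv G u) i" if "u \<in> Ver X" "i \<in> ix G (vdom X u)"
    using fv_sel_into_mat[OF G that(1)] that by (simp add: comp_map_sel ms mat_fv_sel[where A = A])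
qed

context
  fixes X t :: "'V VDC" and p :: "'V VDMap"
  assumes X: "vdc X" and t: "thin t" and p: "vdf X (mat t) p"
begin

interpretation X: virtual_double_category X by fact
interpretation p: virtual_double_functor X "mat t" p by fact

lemma vdc_t: "vdc t" using t by (simp add: thin_def large_vdcD)

interpretation E: virtual_double_category "el X p" by (rule vdc_el[OF X vdc_t p])

lemma over_tab:
  assumes A: "vdc A" and F: "vdf (el X p) A F" and B: "vdf A t B"
  shows "comp_map X (mat_map A B) (tab X p F) = p"
  unfolding mat_map_tab[OF X vdc_t p A F vdc_t B]
  by (rule thin_functor_eqI[OF t X vdf_tab[OF X vdc_t p vdc_t vdf_comp[OF vdc_el[OF X vdc_t p] F B]] p])
    (simp_all add: tab_sel X.vdom_in)

lemma tab_inj: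
  assumes A: "vdc A" and F: "vdf (el X p) A F" and F': "vdf (el X p) A F'" and e: "tab X p F = tab X p F'"
  shows "F = F'"
proof -
  have fo: "tab_fo p F x = tab_fo p F' x" if "x \<in> Ob X" for x using tab_sel(1)[OF that] e by metis
  have fv: "tab_fv X p F x = tab_fv X p F' x" if "x \<in> Ver X" for x using tab_sel(2)[OF that] e by metis
  have fh: "tab_fh X p F x = tab_fh X p F' x" if "x \<in> Hor X" for x using tab_sel(3)[OF that] e by metis
  have fc: "tab_fc X p F x = tab_fc X p F' x" if "x \<in> Cell X" for x using tab_sel(4)[OF that] e by metis
  show ?thesis
  proof (rule vd_map_eqI[OF F F'])
    fix z assume "z \<in> Ob (el X p)"
    then obtain x i where z: "z = vlist [x, i]" "x \<in> Ob X" "i \<in> ix p x" by (auto elim: el_ObE)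
    show "fo F z = fo F' z" using tab_fo_sel(3)[OF z(3), of F] tab_fo_sel(3)[OF z(3), of F'] fo[OF z(2)] z(1) by simp
  next
    fix z assume "z \<in> Ver (el X p)"
    then obtain u i where z: "z = vlist [u, i]" "u \<in> Ver X" "i \<in> ix p (vdom X u)" by (auto elim: el_VerE)
    show "fv F z = fv F' z" using tab_fv_sel(4)[OF z(3), of F] tab_fv_sel(4)[OF z(3), of F'] fv[OF z(2)] z(1) by simp
  next
    fix z assume "z \<in> Hor (el X p)"
    then obtain J i j where z: "z = vlist [J, i, j]" "J \<in> Hor X" "i \<in> ix p (hsrc X J)" "j \<in> ix p (htrg X J)" by (auto elim: el_HorE)
    show "fh F z = fh F' z" using tab_fh_sel(3)[OF z(3,4), of F] tab_fh_sel(3)[OF z(3,4), of F'] fh[OF z(2)] z(1) by simp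
  next
    fix z assume "z \<in> Cell (el X p)"
    then obtain q i r where z: "z = vlist [q, vlist (i # r)]" "q \<in> Cell X" "i \<in> ix p (vdom X (clft X q))" "el_tail X p (ctop X q) r" by (auto elim: el_CellE)
    show "fc F z = fc F' z" using tab_fc_sel(5)[OF z(3,4), of F] tab_fc_sel(5)[OF z(3,4), of F'] fc[OF z(2)] z(1) by simp
  qed
qed

end

end

section \<open>Split fibrations from a class of cartesian 2-cells\<close>

text \<open>
  A splitting may be described by the class \<open>C\<close> of its chosen 2-cells instead of the function that
  selects them.
\<close>

definition chosen_lift :: "('o, 'm, 'c) two_cat \<Rightarrow> 'c set \<Rightarrow> 'm \<Rightarrow> 'm \<Rightarrow> 'c \<Rightarrow> 'c" where
  "chosen_lift K C p e \<beta> = (if liftable K p e \<beta> then THE \<phi>. \<phi> \<in> C \<and> trg2 K \<phi> = e \<and> whisk_left K p \<phi> = \<beta> else undefined)"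

lemma chosen_lift_eqI:
  assumes "\<exists>!\<phi>. \<phi> \<in> C \<and> trg2 K \<phi> = e \<and> whisk_left K p \<phi> = \<beta>" "liftable K p e \<beta>"
    and "\<phi> \<in> C" "trg2 K \<phi> = e" "whisk_left K p \<phi> = \<beta>"
  shows "chosen_lift K C p e \<beta> = \<phi>"
  using the1_equality[OF assms(1), of \<phi>] assms(2-) by (simp add: chosen_lift_def)

lemma chosen_lift:
  assumes "\<exists>!\<phi>. \<phi> \<in> C \<and> trg2 K \<phi> = e \<and> whisk_left K p \<phi> = \<beta>" "liftable K p e \<beta>"
  shows "chosen_lift K C p e \<beta> \<in> C" "trg2 K (chosen_lift K C p e \<beta>) = e" "whisk_left K p (chosen_lift K C p e \<beta>) = \<beta>"
  using theI'[OF assms(1)] assms(2) by (auto simp: chosen_lift_def)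

text \<open>
  A lift in \<open>C\<close> is unique. Thus each equation required of a splitting holds because its other side
  is again a member of \<open>C\<close> with the right codomain and image.
\<close>

lemma (in two_category) split_fibration_chosen_lift:
  assumes p: "arr1 K p E B"
    and C: "\<And>\<phi>. \<phi> \<in> C \<Longrightarrow> \<phi> \<in> C2 K \<and> trg1 K (src2 K \<phi>) = E"
    and cart: "\<And>\<phi>. \<phi> \<in> C \<Longrightarrow> cartesian K p \<phi>"
    and ids: "\<And>e. \<lbrakk>e \<in> C1 K; trg1 K e = E\<rbrakk> \<Longrightarrow> id2 K e \<in> C"
    and comp: "\<And>\<phi> \<psi>. \<lbrakk>\<phi> \<in> C; \<psi> \<in> C; trg2 K \<psi> = src2 K \<phi>\<rbrakk> \<Longrightarrow> vcmp K \<phi> \<psi> \<in> C"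
    and whisk: "\<And>\<phi> f. \<lbrakk>\<phi> \<in> C; f \<in> C1 K; trg1 K f = src1 K (src2 K \<phi>)\<rbrakk> \<Longrightarrow> whisk_right K \<phi> f \<in> C"
    and lift: "\<And>e \<beta>. liftable K p e \<beta> \<Longrightarrow> \<exists>!\<phi>. \<phi> \<in> C \<and> trg2 K \<phi> = e \<and> whisk_left K p \<phi> = \<beta>"
  shows "split_fibration K p (chosen_lift K C p)"
proof -
  have p1: "p \<in> C1 K" "src1 K p = E" using p by (auto simp: arr1_def)
  have sides: "arr2 K \<phi> (src2 K \<phi>) (trg2 K \<phi>)" "arr1 K (src2 K \<phi>) (src1 K (src2 K \<phi>)) E" "arr1 K (trg2 K \<phi>) (src1 K (src2 K \<phi>)) E"
    if "\<phi> \<in> C" for \<phi>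
    using C[OF that] arr2_arr1[of \<phi> "src2 K \<phi>" "trg2 K \<phi>"] by (auto simp: arr2_def)
  have over: "arr2 K \<beta> (cmp1 K p (src2 K \<phi>)) (cmp1 K p e)"
    if "\<phi> \<in> C" "trg2 K \<phi> = e" "whisk_left K p \<phi> = \<beta>" for \<phi> e \<beta>
    using whisk_left_arr[OF sides(1,2)[OF that(1)] p] that by simp
  show ?thesis
  proof (unfold_locales, goal_cases)
    case 1 show ?case by (rule p1)
  next
    case (2 e \<beta>) then show ?case by (simp add: chosen_lift_def)
  next
    case (3 e \<beta>) show ?case by (rule chosen_lift(2)[OF lift[OF 3] 3])
  next
    case (4 e \<beta>) show ?case by (rule chosen_lift(3)[OF lift[OF 4] 4])
  next
    case (5 e \<beta>) then show ?case using cart chosen_lift(1)[OF lift[OF 5] 5] by blast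
  next
    case (6 e)
    then have e: "arr1 K e (src1 K e) E" by (simp add: arr1_def p1)
    note pe = cmp1_arr[OF e p]
    have l: "liftable K p e (id2 K (cmp1 K p e))" using id2_arr[of "cmp1 K p e"] pe 6 by (simp add: liftable_def arr1_def arr2_def)
    show ?case
      by (rule chosen_lift_eqI[OF lift[OF l] l ids]) (use 6 p1 id2_arr[OF 6(1)] whisk_left_id2[OF e p] in \<open>auto simp: arr2_def\<close>)
  next
    case (7 e \<beta> \<gamma>)
    let ?\<phi> = "chosen_lift K C p e \<beta>"
    note \<phi> = chosen_lift[OF lift[OF 7(1)] 7(1)]
    note o = over[OF \<phi>] and s = sides[OF \<phi>(1)]
    have g: "arr2 K \<gamma> (src2 K \<gamma>) (cmp1 K p (src2 K ?\<phi>))" using 7 o by (auto simp: arr2_def)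
    have l: "liftable K p (src2 K ?\<phi>) \<gamma>" using g s(2) by (simp add: liftable_def arr1_def arr2_def p1)
    note \<psi> = chosen_lift[OF lift[OF l] l]
    note t = sides[OF \<psi>(1)]
    have v: "arr2 K (vcmp K ?\<phi> (chosen_lift K C p (src2 K ?\<phi>) \<gamma>)) (src2 K (chosen_lift K C p (src2 K ?\<phi>) \<gamma>)) e"
      by (rule vcmp_arr) (use t(1) s(1) \<phi>(2) \<psi>(2) in simp_all)
    have w: "whisk_left K p (vcmp K ?\<phi> (chosen_lift K C p (src2 K ?\<phi>) \<gamma>)) = vcmp K \<beta> \<gamma>"
      using whisk_left_vcmp[OF _ s(1) t(2) p, of "chosen_lift K C p (src2 K ?\<phi>) \<gamma>"] t(1) \<phi>(3) \<psi>(2,3) by simp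
    have l': "liftable K p e (vcmp K \<beta> \<gamma>)"
      using vcmp_arr[OF g o] 7(1) by (simp add: liftable_def arr2_def)
    show ?case by (rule chosen_lift_eqI[OF lift[OF l'] l' comp[OF \<phi>(1) \<psi>(1,2)] _ w]) (use v in \<open>simp add: arr2_def\<close>)
  next
    case (8 e \<beta> f)
    let ?\<phi> = "chosen_lift K C p e \<beta>"
    note \<phi> = chosen_lift[OF lift[OF 8(1)] 8(1)]
    note o = over[OF \<phi>] and s = sides[OF \<phi>(1)]
    have e: "arr1 K e (src1 K (src2 K ?\<phi>)) E" using s(3) \<phi>(2) by simp
    have f: "arr1 K f (src1 K f) (src1 K (src2 K ?\<phi>))" using 8 e by (simp add: arr1_def)
    note r = whisk_right_arr[OF s(1) f s(2)]
    have w: "whisk_left K p (whisk_right K ?\<phi> f) = whisk_right K \<beta> f"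
      using whisk_left_hcmp[OF id2_arr s(1), of f p B] f s(2) p \<phi>(3) by (auto simp: arr1_def whisk_right_def)
    have l: "liftable K p (cmp1 K e f) (whisk_right K \<beta> f)"
      using whisk_right_arr[OF o f cmp1_arr[OF s(2) p]] cmp1_arr[OF f e] cmp1_assoc[OF f e p]
      by (simp add: liftable_def arr1_def arr2_def p1)
    show ?case
      by (rule chosen_lift_eqI[OF lift[OF l] l whisk[OF \<phi>(1)]]) (use 8 f r w \<phi>(2) in \<open>auto simp: arr1_def arr2_def\<close>)
  qed
qed

lemma (in two_category) chosen_lift_preserved:
  assumes p: "arr1 K p E B" and p': "arr1 K p' E' B" and f: "arr1 K f E E'" and pf: "cmp1 K p' f = p"
    and C: "\<And>\<phi>. \<phi> \<in> C \<Longrightarrow> \<phi> \<in> C2 K \<and> trg1 K (src2 K \<phi>) = E \<and> whisk_left K f \<phi> \<in> C'"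
    and lift: "\<And>e \<beta>. liftable K p e \<beta> \<Longrightarrow> \<exists>!\<phi>. \<phi> \<in> C \<and> trg2 K \<phi> = e \<and> whisk_left K p \<phi> = \<beta>"
    and lift': "\<And>e \<beta>. liftable K p' e \<beta> \<Longrightarrow> \<exists>!\<phi>. \<phi> \<in> C' \<and> trg2 K \<phi> = e \<and> whisk_left K p' \<phi> = \<beta>"
    and l: "liftable K p e \<beta>"
  shows "whisk_left K f (chosen_lift K C p e \<beta>) = chosen_lift K C' p' (cmp1 K f e) \<beta>"
proof -
  let ?\<phi> = "chosen_lift K C p e \<beta>"
  note \<phi> = chosen_lift[OF lift[OF l] l]
  have s: "arr2 K ?\<phi> (src2 K ?\<phi>) e" "arr1 K (src2 K ?\<phi>) (src1 K (src2 K ?\<phi>)) E"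
    using C[OF \<phi>(1)] \<phi>(2) arr2_arr1[of ?\<phi> "src2 K ?\<phi>" e] by (auto simp: arr2_def arr1_def)
  note e = arr2_arr1'[OF s]
  have l': "liftable K p' (cmp1 K f e) \<beta>"
    using l cmp1_arr[OF e f] cmp1_assoc[OF e f p'] p' by (simp add: liftable_def arr1_def pf)
  have "whisk_left K (cmp1 K p' f) ?\<phi> = whisk_left K p' (whisk_left K f ?\<phi>)"
    using hcmp_assoc[OF s(1) id2_arr id2_arr, of f p'] hcmp_id2[OF f p'] s(2) f p'
    by (auto simp: whisk_left_def arr1_def)
  then show ?thesis
    by (intro chosen_lift_eqI[OF lift'[OF l'] l', symmetric])
      (use pf C[OF \<phi>(1)] \<phi>(3) whisk_left_arr[OF s f] in \<open>auto simp: arr2_def\<close>)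
qed

context grothendieck_universes
begin

section \<open>The universal property on 2-cells\<close>

definition untab_trans :: "'V VDC \<Rightarrow> 'V VDMap \<Rightarrow> ('V, 'V, 'V, 'V) vd_trans \<Rightarrow> ('V, 'V, 'V, 'V) vd_trans" where
  "untab_trans X p \<gamma> = \<lparr>tv = \<lambda>z\<in>el_Ob X p. vent (tv \<gamma> (part 0 z)) (part 1 z),
     tc = \<lambda>z\<in>el_Hor X p. cent (tc \<gamma> (part 0 z)) [part 1 z, part 2 z]\<rparr>"

lemma untab_trans_sel [simp]:
  "vlist [x, i] \<in> el_Ob X p \<Longrightarrow> tv (untab_trans X p \<gamma>) (vlist [x, i]) = vent (tv \<gamma> x) i"
  "vlist [J, i, j] \<in> el_Hor X p \<Longrightarrow> tc (untab_trans X p \<gamma>) (vlist [J, i, j]) = cent (tc \<gamma> J) [i, j]"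
  by (simp_all add: untab_trans_def)

context
  fixes X t A :: "'V VDC" and p F F' :: "'V VDMap"
  assumes X: "vdc X" and t: "thin t" and p: "vdf X (mat t) p" and A: "vdc A" and F: "vdf (el X p) A F" and F': "vdf (el X p) A F'"
begin

interpretation X: virtual_double_category X by fact
interpretation A: virtual_double_category A by fact
interpretation p: virtual_double_functor X "mat t" p by fact
interpretation E: virtual_double_category "el X p" by (rule vdc_el[OF X vdc_t[OF X t p] p])
interpretation F: virtual_double_functor "el X p" A F by fact
interpretation F': virtual_double_functor "el X p" A F' by fact

lemmas vt = vdc_t[OF X t p]
lemmas Tab = vdf_tab[OF X vt p A F] vdf_tab[OF X vt p A F']

text \<open>
  If the index functions of \<open>\<gamma>\<close> are identities, its entries are indexed by the objects and horizontal
  morphisms of \<open>el X p\<close>, and naturality of \<open>\<gamma>\<close> read entrywise is naturality of this family.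
\<close>

lemma vtr_untab_trans:
  assumes g: "vtr X (mat A) (tab X p F) (tab X p F') \<gamma>"
    and id: "\<And>x i. \<lbrakk>x \<in> Ob X; i \<in> ix p x\<rbrakk> \<Longrightarrow> vidx (tv \<gamma> x) i = i"
  shows "vtr (el X p) A F F' (untab_trans X p \<gamma>)"
proof -
  interpret g: vertical_transformation X "mat A" "tab X p F" "tab X p F'" \<gamma> by fact
  note D = vtr_into_matD[OF X A Tab vtr_boundary[OF g] g]
  have al: "along (\<lambda>J i j. cent (tc \<gamma> J) [i, j]) Js (i # r) = map (tc (untab_trans X p \<gamma>)) (el_entry Js (i # r))"
    if "hpath X x Js y" "i \<in> ix p x" "el_tail X p Js r" for x Js y i r
    using that unfolding hpath_def by (induction Js arbitrary: x i r) auto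
  show ?thesis
  proof (unfold_locales, goal_cases)
    case (3 z)
    then obtain x i where z: "z = vlist [x, i]" "x \<in> Ob X" "i \<in> ix p x" by (auto elim: el_ObE)
    show ?case using mat_VerD(4)[of "tv \<gamma> x" A i] g.tv_ver[OF z(2)] z id by (simp add: ver_mat tab_sel)
  next
    case (4 w a b)
    then obtain u i where w: "w = vlist [u, i]" "u \<in> Ver X" "i \<in> ix p (vdom X u)" by (auto simp: ver_def elim: el_VerE)
    have ab: "a = vlist [vdom X u, i]" "b = vlist [vcod X u, vidx (fv p u) i]" using 4 w by (auto simp: ver_def)
    show ?case using D(2)[OF w(2), of i] w id X.vdom_in[OF w(2)] X.vcod_in[OF w(2)] act_in[OF X vt p w(2,3)]
      by (simp add: ab tab_sel)
  next
    case (5 z)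
    then obtain J i j where z: "z = vlist [J, i, j]" "J \<in> Hor X" "i \<in> ix p (hsrc X J)" "j \<in> ix p (htrg X J)" by (auto elim: el_HorE)
    note c = g.tc_cell[OF z(2), unfolded cell_mat]
    note o = X.hsrc_in[OF z(2)] X.htrg_in[OF z(2)]
    have "cell A (cent (tc \<gamma> J) [i, j]) (mat_entry (mat_ctop (tc \<gamma> J)) [i, j])
         (hent (part (Suc 0) (tc \<gamma> J)) (vidx (part 2 (tc \<gamma> J)) i) (vidx (part 3 (tc \<gamma> J)) (last [i, j]))) (vent (part 2 (tc \<gamma> J)) i) (vent (part 3 (tc \<gamma> J)) (last [i, j]))"
      by (rule mat_CellD(7)) (use c z o g.tv_ver[OF o(1)] in \<open>auto simp: ver_mat tab_sel\<close>)
    then show ?case using c z o id by (simp add: tab_sel)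
  next
    case (6 z)
    then obtain q i r where z: "z = vlist [q, vlist (i # r)]" "q \<in> Cell X" "i \<in> ix p (vdom X (clft X q))" "el_tail X p (ctop X q) r" by (auto elim: el_CellE)
    note o = X.clft_in[OF z(2)] X.crgt_in[OF z(2)]
    have "el_tail X (tab X p F) (ctop X q) r"
      using z(4) X.ctop_in[OF z(2)] X.htrg_in by (auto simp: el_tail_def list_all2_conv_all_nth tab_sel subset_iff)
    note d = D(3)[OF z(2) _ this, of i]
    have sh: "shift X (\<lambda>x. vidx (tv \<gamma> x)) (ctop X q) r = r"
      by (rule shift_eq_map[OF z(4)]) (use id X.ctop_in[OF z(2)] X.htrg_in in auto)
    note l = el_cell_right[OF X vt p z(2-4)]
    have "clft A (fc F z) = fv F (clft (el X p) z)" using F.fc_Cell[of z] 6 by simp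
    then show ?case
      using d z o X.vdom_in[OF o(1)] sh id X.cbot_in[OF z(2)] X.cbot_src[OF z(2)] X.cbot_trg[OF z(2)] act_in[OF X vt p o(1) z(3)] act_in[OF X vt p o(2) l]
        al[OF X.ctop_path[OF z(2)] z(3,4)] l
      by (simp add: tab_sel ucomp_def del: last.simps)
  qed (auto simp: untab_trans_def)
qed

lemma unit_in: "vdf X (mat (el X p)) (el_unit X p)"
  by (rule vdf_tab[OF X vt p vdc_el[OF X vt p] vdf_id[OF vdc_el[OF X vt p]]])

lemma unit_comp: "comp_map X (mat_map (el X p) F) (el_unit X p) = tab X p F"
  unfolding mat_map_tab[OF X vt p vdc_el[OF X vt p] vdf_id[OF vdc_el[OF X vt p]] A F]
    comp_map_id_right[OF vdc_el[OF X vt p] F] ..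

end

lemma unit_whisker:
  assumes X: "vdc X" and t: "thin t" and p: "vdf X (mat t) p" and A: "vdc A" and F: "vdf (el X p) A F" and F': "vdf (el X p) A F'"
    and a: "vtr (el X p) A F F' \<alpha>"
  defines "\<gamma> \<equiv> pre_trans X (mat_trans (el X p) F \<alpha> F') (el_unit X p)"
  shows "vtr X (mat A) (tab X p F) (tab X p F') \<gamma>" (is ?P1)
    "\<lbrakk>x \<in> Ob X; i \<in> ix p x\<rbrakk> \<Longrightarrow> vidx (tv \<gamma> x) i = i"
    "\<lbrakk>x \<in> Ob X; i \<in> ix p x\<rbrakk> \<Longrightarrow> vent (tv \<gamma> x) i = tv \<alpha> (vlist [x, i])"
    "\<lbrakk>J \<in> Hor X; i \<in> ix p (hsrc X J); j \<in> ix p (htrg X J)\<rbrakk> \<Longrightarrow> cent (tc \<gamma> J) [i, j] = tc \<alpha> (vlist [J, i, j])"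
proof -
  note vt = vdc_t[OF X t p]
  note E = vdc_el[OF X vt p] and i = vdf_id[OF vdc_el[OF X vt p]]
  show "?P1"
    using vtr_pre[OF X unit_in[OF X t p A F F'] vtr_mat[OF E A F F' a]]
    unfolding unit_comp[OF X t p A F F'] unit_comp[OF X t p A F' F] \<gamma>_def .
  note ui = tab_fo_in[OF X vt p E i] tab_fh_in[OF X vt p E i]
  show "\<lbrakk>x \<in> Ob X; i \<in> ix p x\<rbrakk> \<Longrightarrow> vidx (tv \<gamma> x) i = i"
    "\<lbrakk>x \<in> Ob X; i \<in> ix p x\<rbrakk> \<Longrightarrow> vent (tv \<gamma> x) i = tv \<alpha> (vlist [x, i])"
    using ui by (simp_all add: \<gamma>_def whisker_sel tab_sel mat_trans_sel id_map_sel)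
  show "\<lbrakk>J \<in> Hor X; i \<in> ix p (hsrc X J); j \<in> ix p (htrg X J)\<rbrakk> \<Longrightarrow> cent (tc \<gamma> J) [i, j] = tc \<alpha> (vlist [J, i, j])"
    using ui by (simp add: \<gamma>_def whisker_sel tab_sel mat_trans_sel id_map_sel)
qed

lemma unit_universal2:
  assumes X: "vdc X" and t: "thin t" and p: "vdf X (mat t) p" and A: "vdc A" and F: "vdf (el X p) A F" and F': "vdf (el X p) A F'"
    and g: "vtr X (mat A) (tab X p F) (tab X p F') \<gamma>"
    and id: "\<And>x i. \<lbrakk>x \<in> Ob X; i \<in> ix p x\<rbrakk> \<Longrightarrow> vidx (tv \<gamma> x) i = i"
  shows "\<exists>!\<alpha>. vtr (el X p) A F F' \<alpha> \<and> pre_trans X (mat_trans (el X p) F \<alpha> F') (el_unit X p) = \<gamma>"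
proof (rule ex1I[of _ "untab_trans X p \<gamma>"])
  note vt = vdc_t[OF X t p]
  interpret X: virtual_double_category X by fact
  note U = vtr_untab_trans[OF X t p A F F' g id]
  note W = unit_whisker[OF X t p A F F']
  show "vtr (el X p) A F F' (untab_trans X p \<gamma>) \<and> pre_trans X (mat_trans (el X p) F (untab_trans X p \<gamma>) F') (el_unit X p) = \<gamma>"
  proof
    show "vtr (el X p) A F F' (untab_trans X p \<gamma>)" by (rule U)
    show "pre_trans X (mat_trans (el X p) F (untab_trans X p \<gamma>) F') (el_unit X p) = \<gamma>"
      by (rule mat_trans_eqI[OF W(1)[OF U] g X vdf_tab[OF X vt p A F]])
        (simp_all add: tab_sel W[OF U] id X.hsrc_in X.htrg_in)
  qed
  fix \<alpha> assume a: "vtr (el X p) A F F' \<alpha> \<and> pre_trans X (mat_trans (el X p) F \<alpha> F') (el_unit X p) = \<gamma>"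
  then have a1: "vtr (el X p) A F F' \<alpha>" and e: "pre_trans X (mat_trans (el X p) F \<alpha> F') (el_unit X p) = \<gamma>" by blast+
  interpret a: vertical_transformation "el X p" A F F' \<alpha> by fact
  interpret u: vertical_transformation "el X p" A F F' "untab_trans X p \<gamma>" by (rule U)
  note w = W[OF a1, unfolded e]
  show "\<alpha> = untab_trans X p \<gamma>"
  proof (rule vd_trans_eqI[OF a.tv_ext a.tc_ext u.tv_ext u.tc_ext])
    fix z assume "z \<in> Ob (el X p)"
    then show "tv \<alpha> z = tv (untab_trans X p \<gamma>) z" using w(3) by (auto elim!: el_ObE)
  next
    fix z assume "z \<in> Hor (el X p)"
    then show "tc \<alpha> z = tc (untab_trans X p \<gamma>) z" using w(4) by (auto elim!: el_HorE)
  qed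
qed

section \<open>Reindexing\<close>

text \<open>
  The chosen cartesian 2-cells: only the indices change, and all entries are identities.
\<close>

definition reindexing :: "'V VDC \<Rightarrow> 'V VDC \<Rightarrow> 'V VDMap \<Rightarrow> ('V, 'V, 'V, 'V) vd_trans \<Rightarrow> bool" where
  "reindexing X A P \<tau> \<longleftrightarrow> (\<forall>x\<in>Ob X. \<forall>i\<in>ix P x. vent (tv \<tau> x) i = vid A (oent (fo P x) i))
    \<and> (\<forall>J\<in>Hor X. \<forall>i\<in>ix P (hsrc X J). \<forall>j\<in>ix P (htrg X J). cent (tc \<tau> J) [i, j] = cid A (hent (fh P J) i j))"

lemma along_eq_map:
  assumes "hpath X x Js y" "i \<in> ix P x" "el_tail X P Js r"
    "\<And>J i j. \<lbrakk>J \<in> Hor X; i \<in> ix P (hsrc X J); j \<in> ix P (htrg X J)\<rbrakk> \<Longrightarrow> c J i j = f (hent (fh P J) i j)"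
  shows "along c Js (i # r) = map f (mat_entry (map (fh P) Js) (i # r))"
  using assms unfolding hpath_def by (induction Js arbitrary: x i r) auto

lemma mat_entry_shift:
  assumes "hpath X x Js y" "i \<in> ix P x" "el_tail X P Js r"
    "\<And>J i j. \<lbrakk>J \<in> Hor X; i \<in> ix P (hsrc X J); j \<in> ix P (htrg X J)\<rbrakk> \<Longrightarrow> hent (fh P J) i j = hent (fh E J) (v (hsrc X J) i) (v (htrg X J) j)"
  shows "mat_entry (map (fh P) Js) (i # r) = mat_entry (map (fh E) Js) (v x i # shift X v Js r)"
  using assms unfolding hpath_def by (induction Js arbitrary: x i r) auto

lemma fc_entry:
  assumes X: "vdc X" and G: "vdf X (mat A) G" and "q \<in> Cell X" "i \<in> ix G (vdom X (clft X q))" "el_tail X G (ctop X q) r"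
  shows "cell A (cent (fc G q) (i # r)) (mat_entry (map (fh G) (ctop X q)) (i # r))
    (hent (fh G (cbot X q)) (vidx (fv G (clft X q)) i) (vidx (fv G (crgt X q)) (last (i # r)))) (vent (fv G (clft X q)) i) (vent (fv G (crgt X q)) (last (i # r)))"
proof -
  interpret X: virtual_double_category X by fact
  show ?thesis
    using mat_CellD(7)[of "fc G q" A i r] fc_sel_into_mat[OF G assms(3)] assms(4,5) fv_sel_into_mat[OF G X.clft_in[OF assms(3)]]
      tails_fh[OF G X.ctop_in[OF assms(3)]] by (simp del: last.simps)
qed

context
  fixes X A :: "'V VDC" and P E :: "'V VDMap" and \<tau> :: "('V, 'V, 'V, 'V) vd_trans"
  assumes X: "vdc X" and A: "vdc A" and P: "vdf X (mat A) P" and E: "vdf X (mat A) E" and \<tau>: "vtr X (mat A) P E \<tau>"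
begin

interpretation X: virtual_double_category X by fact
interpretation A: virtual_double_category A by fact
interpretation P: virtual_double_functor X "mat A" P by fact
interpretation E: virtual_double_functor X "mat A" E by fact
interpretation \<tau>: vertical_transformation X "mat A" P E \<tau> by fact

lemma tv_entry:
  assumes "x \<in> Ob X" "i \<in> ix P x"
  shows "vidx (tv \<tau> x) i \<in> ix E x" "ver A (vent (tv \<tau> x) i) (oent (fo P x) i) (oent (fo E x) (vidx (tv \<tau> x) i))"
  using mat_VerD(3,4)[of "tv \<tau> x" A i] \<tau>.tv_ver[OF assms(1)] assms(2) by (auto simp: ver_mat)

lemma tc_entry:
  assumes "J \<in> Hor X" "i \<in> ix P (hsrc X J)" "j \<in> ix P (htrg X J)"
  shows "cell A (cent (tc \<tau> J) [i, j]) [hent (fh P J) i j] (hent (fh E J) (vidx (tv \<tau> (hsrc X J)) i) (vidx (tv \<tau> (htrg X J)) j))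
    (vent (tv \<tau> (hsrc X J)) i) (vent (tv \<tau> (htrg X J)) j)"
proof -
  note c = \<tau>.tc_cell[OF assms(1), unfolded cell_mat]
  have "cell A (cent (tc \<tau> J) [i, j]) (mat_entry (mat_ctop (tc \<tau> J)) [i, j])
       (hent (part (Suc 0) (tc \<tau> J)) (vidx (part 2 (tc \<tau> J)) i) (vidx (part 3 (tc \<tau> J)) (last [i, j]))) (vent (part 2 (tc \<tau> J)) i) (vent (part 3 (tc \<tau> J)) (last [i, j]))"
    by (rule mat_CellD(7)) (use c assms \<tau>.tv_ver[OF X.hsrc_in[OF assms(1)]] fh_sel[OF P assms(1)] in \<open>auto simp: ver_mat\<close>)
  then show ?thesis using c by simp
qed

context
  assumes R: "reindexing X A P \<tau>"
begin

text \<open>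
  Since identities have equal domain and codomain, the source \<open>P\<close> of a reindexing is \<open>E\<close> with moved
  indices. For vertical morphisms and multicells this is the naturality equation with the identities
  cancelled. This determines \<open>P\<close> from \<open>E\<close> and the index functions.
\<close>

lemma reindexing_entries:
  shows "\<lbrakk>x \<in> Ob X; i \<in> ix P x\<rbrakk> \<Longrightarrow> oent (fo P x) i = oent (fo E x) (vidx (tv \<tau> x) i)"
    "\<lbrakk>J \<in> Hor X; i \<in> ix P (hsrc X J); j \<in> ix P (htrg X J)\<rbrakk> \<Longrightarrow>
       hent (fh P J) i j = hent (fh E J) (vidx (tv \<tau> (hsrc X J)) i) (vidx (tv \<tau> (htrg X J)) j)"
    "\<lbrakk>u \<in> Ver X; i \<in> ix P (vdom X u)\<rbrakk> \<Longrightarrow> vent (fv P u) i = vent (fv E u) (vidx (tv \<tau> (vdom X u)) i)"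
    "\<lbrakk>q \<in> Cell X; i \<in> ix P (vdom X (clft X q)); el_tail X P (ctop X q) r\<rbrakk> \<Longrightarrow>
       cent (fc P q) (i # r) = cent (fc E q) (vidx (tv \<tau> (vdom X (clft X q))) i # shift X (\<lambda>x. vidx (tv \<tau> x)) (ctop X q) r)"
proof -
  note D = vtr_into_matD[OF X A P E vtr_boundary[OF \<tau>] \<tau>]
  have Rv: "vent (tv \<tau> x) i = vid A (oent (fo P x) i)" if "x \<in> Ob X" "i \<in> ix P x" for x i using R that by (simp add: reindexing_def)
  have Rc: "cent (tc \<tau> J) [i, j] = cid A (hent (fh P J) i j)" if "J \<in> Hor X" "i \<in> ix P (hsrc X J)" "j \<in> ix P (htrg X J)" for J i j
    using R that by (simp add: reindexing_def)
  have Po: "oent (fo P x) i \<in> Ob A" if "x \<in> Ob X" "i \<in> ix P x" for x i using mat_ObD(2)[of "fo P x" A i] P.fo_in[OF that(1)] that(2) by simp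
  show o: "oent (fo P x) i = oent (fo E x) (vidx (tv \<tau> x) i)" if "x \<in> Ob X" "i \<in> ix P x" for x i
    using tv_entry(2)[OF that] A.vid_ver[OF Po[OF that]] Rv[OF that] by (simp add: ver_def)
  have Ph: "hent (fh P J) i j \<in> Hor A" if "J \<in> Hor X" "i \<in> ix P (hsrc X J)" "j \<in> ix P (htrg X J)" for J i j
    using mat_HorD(3)[of "fh P J" A i j] fh_sel[OF P that(1)] that(2,3) by simp
  show h: "hent (fh P J) i j = hent (fh E J) (vidx (tv \<tau> (hsrc X J)) i) (vidx (tv \<tau> (htrg X J)) j)"
    if "J \<in> Hor X" "i \<in> ix P (hsrc X J)" "j \<in> ix P (htrg X J)" for J i j
    using cellD(3)[OF tc_entry[OF that]] cellD(3)[OF A.cid_cell[OF Ph[OF that]]] Rc[OF that] by simp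
  show "vent (fv P u) i = vent (fv E u) (vidx (tv \<tau> (vdom X u)) i)" if u: "u \<in> Ver X" and i: "i \<in> ix P (vdom X u)" for u i
  proof -
    note p = fv_sel_into_mat[OF P u] and e = fv_sel_into_mat[OF E u] and x = X.vdom_in[OF u]
    have k: "vidx (fv P u) i \<in> ix P (vcod X u)" using mat_VerD(3)[OF p(1), of i] p i by simp
    have vp: "ver A (vent (fv P u) i) (oent (fo P (vdom X u)) i) (oent (fo P (vcod X u)) (vidx (fv P u) i))" using mat_VerD(4)[OF p(1), of i] p i by simp
    let ?k = "vidx (tv \<tau> (vdom X u)) i"
    have ve: "ver A (vent (fv E u) ?k) (oent (fo E (vdom X u)) ?k) (oent (fo E (vcod X u)) (vidx (fv E u) ?k))"
      using mat_VerD(4)[OF e(1), of ?k] e tv_entry(1)[OF x i] by simp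
    show ?thesis using D(2)[OF u i] A.vcomp_id_left[OF vp] A.vcomp_id_right[OF ve] o[OF x i] by (simp add: Rv[OF x i] Rv[OF X.vcod_in[OF u] k])
  qed
  show "cent (fc P q) (i # r) = cent (fc E q) (vidx (tv \<tau> (vdom X (clft X q))) i # shift X (\<lambda>x. vidx (tv \<tau> x)) (ctop X q) r)"
    if t: "q \<in> Cell X" and i: "i \<in> ix P (vdom X (clft X q))" and r: "el_tail X P (ctop X q) r" for q i r
  proof -
    note lr = X.clft_in[OF t] X.crgt_in[OF t] and hp = X.ctop_path[OF t]
    note pl = fv_sel_into_mat[OF P lr(1)] and pr = fv_sel_into_mat[OF P lr(2)]
    note cP = fc_entry[OF X P t i r]
    let ?i = "vidx (tv \<tau> (vdom X (clft X q))) i" and ?r = "shift X (\<lambda>x. vidx (tv \<tau> x)) (ctop X q) r"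
    have r': "el_tail X E (ctop X q) ?r"
      using r X.ctop_in[OF t] tv_entry(1) X.htrg_in by (auto simp: el_tail_def shift_def list_all2_conv_all_nth subset_iff)
    note cE = fc_entry[OF X E t tv_entry(1)[OF X.vdom_in[OF lr(1)] i] r']
    have l: "last (i # r) \<in> ix P (vdom X (crgt X q))" using el_tail_last[OF X A P hp i r] .
    have k: "vidx (fv P (clft X q)) i \<in> ix P (hsrc X (cbot X q))" "vidx (fv P (crgt X q)) (last (i # r)) \<in> ix P (htrg X (cbot X q))"
      using mat_VerD(3)[OF pl(1), of i] mat_VerD(3)[OF pr(1), of "last (i # r)"] pl pr i l X.cbot_src[OF t] X.cbot_trg[OF t] by simp_all
    have a: "along (\<lambda>J i j. cent (tc \<tau> J) [i, j]) (ctop X q) (i # r) = map (cid A) (ctop A (cent (fc E q) (?i # ?r)))"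
    proof -
      have "along (\<lambda>J i j. cent (tc \<tau> J) [i, j]) (ctop X q) (i # r) = map (cid A) (mat_entry (map (fh P) (ctop X q)) (i # r))"
        by (rule along_eq_map[OF hp i r]) (rule Rc)
      moreover have "mat_entry (map (fh P) (ctop X q)) (i # r) = mat_entry (map (fh E) (ctop X q)) (?i # ?r)"
        by (rule mat_entry_shift[where v = "\<lambda>x. vidx (tv \<tau> x)", OF hp i r]) (rule h)
      ultimately show ?thesis by (simp only: cellD(2)[OF cE])
    qed
    have d: "vdom A (clft A (cent (fc E q) (?i # ?r))) = oent (fo P (vdom X (clft X q))) i"
      using A.cell_ver(1)[OF cE] mat_VerD(4)[of "fv E (clft X q)" A ?i] fv_sel_into_mat[OF E lr(1)] tv_entry(1)[OF X.vdom_in[OF lr(1)] i] cellD(4)[OF cE] o[OF X.vdom_in[OF lr(1)] i]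
      by (simp add: ver_def)
    have "cent (fc P q) (i # r) = ucomp A (cent (tc \<tau> (cbot X q)) [vidx (fv P (clft X q)) i, vidx (fv P (crgt X q)) (last (i # r))]) (cent (fc P q) (i # r))"
      unfolding Rc[OF X.cbot_in[OF t] k] by (rule A.ucomp_id_left[OF cP, symmetric])
    also have "\<dots> = ccomp A (cent (fc E q) (?i # ?r)) (vid A (vdom A (clft A (cent (fc E q) (?i # ?r))))) (map (cid A) (ctop A (cent (fc E q) (?i # ?r))))"
      unfolding D(3)[OF t i r] a d Rv[OF X.vdom_in[OF lr(1)] i] ..
    also have "\<dots> = cent (fc E q) (?i # ?r)" by (rule A.ccomp_id_right[OF cellD(1)[OF cE]])
    finally show ?thesis .
  qed
qed

end

end

lemma reindexing_id:
  assumes X: "vdc X" and E: "vdf X (mat A) E" shows "reindexing X A E (id_trans X (mat A) E)"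
proof -
  interpret E: virtual_double_functor X "mat A" E by fact
  show ?thesis using E.fo_in fh_sel[OF E] by (simp add: reindexing_def whisker_sel cent_mat_cid)
qed

lemma reindexing_pre:
  assumes Y: "vdc Y" and G: "vdf Y X G" and "reindexing X A P \<tau>"
  shows "reindexing Y A (comp_map Y P G) (pre_trans Y \<tau> G)"
proof -
  interpret Y: virtual_double_category Y by fact
  interpret G: virtual_double_functor Y X G by fact
  show ?thesis using assms(3) G.fo_in G.fh_in G.fh_src G.fh_trg Y.hsrc_in Y.htrg_in
    unfolding reindexing_def by (auto simp: whisker_sel comp_map_sel)
qed

lemma reindexing_post:
  assumes X: "vdc X" and A: "vdc A" and P: "vdf X (mat A) P" and E: "vdf X (mat A) E" and \<tau>: "vtr X (mat A) P E \<tau>"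
    and C: "vdc C" and F: "vdf A C F" and R: "reindexing X A P \<tau>"
  shows "reindexing X C (comp_map X (mat_map A F) P) (post_trans X (mat_map A F) \<tau>)"
proof -
  interpret X: virtual_double_category X by fact
  interpret P: virtual_double_functor X "mat A" P by fact
  interpret F: virtual_double_functor A C F by fact
  interpret \<tau>: vertical_transformation X "mat A" P E \<tau> by fact
  note s = whisker_sel comp_map_sel mat_map_sel mat_fv_sel[where A = A] mat_fc_sel[where A = A]
  have v: "vent (fv (mat_map A F) (tv \<tau> x)) i = vid C (oent (fo (mat_map A F) (fo P x)) i)" if "x \<in> Ob X" "i \<in> ix P x" for x i
    using R that \<tau>.tv_ver[OF that(1)] P.fo_in[OF that(1)] mat_ObD(2)[of "fo P x" A i] F.fv_vid by (simp add: s ver_mat reindexing_def)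
  have c: "cent (fc (mat_map A F) (tc \<tau> J)) [i, j] = cid C (hent (fh (mat_map A F) (fh P J)) i j)"
    if "J \<in> Hor X" "i \<in> ix P (hsrc X J)" "j \<in> ix P (htrg X J)" for J i j
    using R that \<tau>.tc_cell[OF that(1)] \<tau>.tv_ver[OF X.hsrc_in[OF that(1)]] fh_sel[OF P that(1)] mat_HorD(3)[of "fh P J" A i j] F.fc_cid
    by (simp add: s cell_mat ver_mat reindexing_def)
  show ?thesis using v c P.fo_in X.hsrc_in X.htrg_in by (simp add: reindexing_def s)
qed

lemma vcomp_reindexing_entries:
  assumes X: "vdc X" and A: "vdc A" and Q: "vdf X (mat A) Q" and P: "vdf X (mat A) P" and E: "vdf X (mat A) E"
    and \<sigma>: "vtr X (mat A) Q P \<sigma>" and \<tau>: "vtr X (mat A) P E \<tau>" and R: "reindexing X A P \<tau>"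
  shows "\<lbrakk>x \<in> Ob X; i \<in> ix Q x\<rbrakk> \<Longrightarrow> vidx (tv (vcomp_trans X (mat A) \<tau> \<sigma>) x) i = vidx (tv \<tau> x) (vidx (tv \<sigma> x) i)"
    "\<lbrakk>x \<in> Ob X; i \<in> ix Q x\<rbrakk> \<Longrightarrow> vent (tv (vcomp_trans X (mat A) \<tau> \<sigma>) x) i = vent (tv \<sigma> x) i"
    "\<lbrakk>J \<in> Hor X; i \<in> ix Q (hsrc X J); j \<in> ix Q (htrg X J)\<rbrakk> \<Longrightarrow> cent (tc (vcomp_trans X (mat A) \<tau> \<sigma>) J) [i, j] = cent (tc \<sigma> J) [i, j]"
proof -
  interpret X: virtual_double_category X by fact
  interpret A: virtual_double_category A by fact
  interpret \<tau>: vertical_transformation X "mat A" P E \<tau> by fact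
  interpret \<sigma>: vertical_transformation X "mat A" Q P \<sigma> by fact
  note s = vcomp_trans_sel[OF \<sigma>]
  show "vidx (tv (vcomp_trans X (mat A) \<tau> \<sigma>) x) i = vidx (tv \<tau> x) (vidx (tv \<sigma> x) i)"
    if "x \<in> Ob X" "i \<in> ix Q x" for x i
    using that \<tau>.tv_ver[OF that(1)] \<sigma>.tv_ver[OF that(1)] by (simp add: s mat_vcomp_eq ver_mat)
  show "vent (tv (vcomp_trans X (mat A) \<tau> \<sigma>) x) i = vent (tv \<sigma> x) i" if x: "x \<in> Ob X" and i: "i \<in> ix Q x" for x i
    using R x i tv_entry[OF X A Q P \<sigma> x i] \<tau>.tv_ver[OF x] \<sigma>.tv_ver[OF x] A.vcomp_id_left[OF tv_entry(2)[OF X A Q P \<sigma> x i]]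
    by (simp add: s mat_vcomp_eq ver_mat reindexing_def)
  show "cent (tc (vcomp_trans X (mat A) \<tau> \<sigma>) J) [i, j] = cent (tc \<sigma> J) [i, j]"
    if g: "J \<in> Hor X" and i: "i \<in> ix Q (hsrc X J)" and j: "j \<in> ix Q (htrg X J)" for J i j
  proof -
    note o = X.hsrc_in[OF g] X.htrg_in[OF g]
    note k = tv_entry(1)[OF X A Q P \<sigma> o(1) i] tv_entry(1)[OF X A Q P \<sigma> o(2) j]
    have "cent (ucomp (mat A) (tc \<tau> J) (tc \<sigma> J)) [i, j] = ucomp A (cent (tc \<tau> J) [vidx (tv \<sigma> (hsrc X J)) i, vidx (tv \<sigma> (htrg X J)) (last [i, j])]) (cent (tc \<sigma> J) [i, j])"
      by (rule ucomp_mat[OF A \<tau>.tc_cell[OF g] \<sigma>.tc_cell[OF g]]) (use i j \<sigma>.tv_ver[OF o(1)] fh_sel[OF Q g] in \<open>auto simp: ver_mat\<close>)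
    then show ?thesis
      using R g k A.ucomp_id_left[OF tc_entry[OF X A Q P \<sigma> g i j]] by (simp add: s reindexing_def)
  qed
qed

lemma reindexing_vcomp:
  assumes X: "vdc X" and A: "vdc A" and Q: "vdf X (mat A) Q" and P: "vdf X (mat A) P" and E: "vdf X (mat A) E"
    and \<sigma>: "vtr X (mat A) Q P \<sigma>" and \<tau>: "vtr X (mat A) P E \<tau>" and R: "reindexing X A Q \<sigma>" "reindexing X A P \<tau>"
  shows "reindexing X A Q (vcomp_trans X (mat A) \<tau> \<sigma>)"
  using R(1) vcomp_reindexing_entries[OF X A Q P E \<sigma> \<tau> R(2)] unfolding reindexing_def by simp

context
  fixes X A t :: "'V VDC" and P B :: "'V VDMap"
  assumes X: "vdc X" and A: "vdc A" and t: "vdc t" and B: "vdf A t B" and P: "vdf X (mat A) P"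
begin

interpretation X: virtual_double_category X by fact
interpretation P: virtual_double_functor X "mat A" P by fact

lemma vdf_over: "vdf X (mat t) (comp_map X (mat_map A B) P)"
  by (rule vdf_comp[OF X P vdf_mat[OF A t B]])

lemma vtr_over: assumes "vdf X (mat A) E" "vtr X (mat A) P E \<tau>"
  shows "vtr X (mat t) (comp_map X (mat_map A B) P) (comp_map X (mat_map A B) E) (post_trans X (mat_map A B) \<tau>)"
  by (rule vtr_post[OF X vdc_mat[OF A] P assms(1) vdf_mat[OF A t B] assms(2)])

lemma post_vidx: assumes "vtr X (mat A) P E \<tau>" "x \<in> Ob X" "i \<in> ix P x"
  shows "vidx (tv (post_trans X (mat_map A B) \<tau>) x) i = vidx (tv \<tau> x) i"
  using vertical_transformation.tv_ver[OF assms(1,2)] assms(2,3)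
  by (simp add: whisker_sel mat_map_sel ver_mat mat_fv_sel[where A = A])

end

text \<open>
  The factorization \<open>\<chi>\<close> of \<open>\<psi>\<close> through a reindexing is forced: its index functions are those of \<open>\<gamma>\<close>, and by
  \<open>vcomp_reindexing_entries\<close> its entries are those of \<open>\<psi>\<close>. These have the right boundary, because the
  entries of \<open>P\<close> are entries of \<open>E\<close>, and they satisfy the same equations in \<open>A\<close>.
\<close>

lemma reindexing_cartesian:
  assumes X: "vdc X" and A: "vdc A" and P: "vdf X (mat A) P" and E: "vdf X (mat A) E" and \<tau>: "vtr X (mat A) P E \<tau>"
    and R: "reindexing X A P \<tau>" and K: "vdf X (mat A) K" and \<psi>: "vtr X (mat A) K E \<psi>" and t: "thin t" and B: "vdf A t B"
    and \<gamma>: "vtr X (mat t) (comp_map X (mat_map A B) K) (comp_map X (mat_map A B) P) \<gamma>"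
    and eq: "vcomp_trans X (mat t) (post_trans X (mat_map A B) \<tau>) \<gamma> = post_trans X (mat_map A B) \<psi>"
  shows "\<exists>!\<chi>. vtr X (mat A) K P \<chi> \<and> vcomp_trans X (mat A) \<tau> \<chi> = \<psi> \<and> post_trans X (mat_map A B) \<chi> = \<gamma>"
proof -
  interpret X: virtual_double_category X by fact
  have vt: "vdc t" using t by (simp add: thin_def large_vdcD)
  interpret \<gamma>: vertical_transformation X "mat t" "comp_map X (mat_map A B) K" "comp_map X (mat_map A B) P" \<gamma> by fact
  note oK = vdf_over[OF X A vt B K] and oP = vdf_over[OF X A vt B P]
  note sK = over_sel[OF A vt B K] and sP = over_sel[OF A vt B P]
  have \<gamma>in: "vidx (tv \<gamma> x) i \<in> ix P x" if "x \<in> Ob X" "i \<in> ix K x" for x i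
    using tv_entry(1)[OF X vt oK oP \<gamma> that(1), of i] that sK(2) sP(2) by simp
  have cmp: "vidx (tv \<tau> x) (vidx (tv \<gamma> x) i) = vidx (tv \<psi> x) i" if x: "x \<in> Ob X" and i: "i \<in> ix K x" for x i
  proof -
    have "vidx (tv (vcomp_trans X (mat t) (post_trans X (mat_map A B) \<tau>) \<gamma>) x) i = vidx (tv (post_trans X (mat_map A B) \<tau>) x) (vidx (tv \<gamma> x) i)"
      using \<gamma>.tv_ver[OF x] vertical_transformation.tv_ver[OF vtr_over[OF X A vt B P E \<tau>] x] x i sK(2)
      by (simp add: vcomp_trans_sel[OF \<gamma>] mat_vcomp_eq ver_mat)
    then show ?thesis unfolding eq post_vidx[OF X A vt B K \<psi> x i] post_vidx[OF X A vt B P \<tau> x \<gamma>in[OF x i]] by simp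
  qed
  note e = reindexing_entries[OF X A P E \<tau> R]
  obtain \<chi> where \<chi>: "vtr X (mat A) K P \<chi>"
    and v\<chi>: "\<And>x i. \<lbrakk>x \<in> Ob X; i \<in> ix K x\<rbrakk> \<Longrightarrow> vidx (tv \<chi> x) i = vidx (tv \<gamma> x) i \<and> vent (tv \<chi> x) i = vent (tv \<psi> x) i"
    and c\<chi>: "\<And>J i j. \<lbrakk>J \<in> Hor X; i \<in> ix K (hsrc X J); j \<in> ix K (htrg X J)\<rbrakk> \<Longrightarrow> cent (tc \<chi> J) [i, j] = cent (tc \<psi> J) [i, j]"
  proof (rule vtr_tabulate[OF X A K P, of "\<lambda>x. vidx (tv \<gamma> x)" "\<lambda>x. vent (tv \<psi> x)" "\<lambda>J i j. cent (tc \<psi> J) [i, j]"])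
    show "vidx (tv \<gamma> x) i \<in> ix P x" "ver A (vent (tv \<psi> x) i) (oent (fo K x) i) (oent (fo P x) (vidx (tv \<gamma> x) i))" if "x \<in> Ob X" "i \<in> ix K x" for x i
      using tv_entry(2)[OF X A K E \<psi> that] e(1)[OF that(1) \<gamma>in[OF that]] cmp[OF that] \<gamma>in[OF that] by simp_all
  next
    fix J i j assume g: "J \<in> Hor X" and i: "i \<in> ix K (hsrc X J)" and j: "j \<in> ix K (htrg X J)"
    note o = X.hsrc_in[OF g] X.htrg_in[OF g]
    show "cell A (cent (tc \<psi> J) [i, j]) [hent (fh K J) i j] (hent (fh P J) (vidx (tv \<gamma> (hsrc X J)) i) (vidx (tv \<gamma> (htrg X J)) j))
        (vent (tv \<psi> (hsrc X J)) i) (vent (tv \<psi> (htrg X J)) j)"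
      using tc_entry[OF X A K E \<psi> g i j] e(2)[OF g \<gamma>in[OF o(1) i] \<gamma>in[OF o(2) j]] cmp[OF o(1) i] cmp[OF o(2) j] by simp
  next
    fix u i assume u: "u \<in> Ver X" and i: "i \<in> ix K (vdom X u)"
    note o = X.vdom_in[OF u] X.vcod_in[OF u]
    show "vidx (tv \<gamma> (vcod X u)) (vidx (fv K u) i) = vidx (fv P u) (vidx (tv \<gamma> (vdom X u)) i)
        \<and> vcomp A (vent (tv \<psi> (vcod X u)) (vidx (fv K u) i)) (vent (fv K u) i) = vcomp A (vent (fv P u) (vidx (tv \<gamma> (vdom X u)) i)) (vent (tv \<psi> (vdom X u)) i)"
      using vtr_into_matD(1)[OF X vt oK oP vtr_boundary[OF \<gamma>] \<gamma> u, of i] vtr_into_matD(2)[OF X A K E vtr_boundary[OF \<psi>] \<psi> u i]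
        e(3)[OF u \<gamma>in[OF o(1) i]] cmp[OF o(1) i] i o sK sP u \<gamma>in[OF o(1) i] by simp
  next
    fix q i r assume q: "q \<in> Cell X" and i: "i \<in> ix K (vdom X (clft X q))" and r: "el_tail X K (ctop X q) r"
    note o = X.vdom_in[OF X.clft_in[OF q]]
    have h: "htrg X J \<in> Ob X" if "J \<in> set (ctop X q)" for J using that X.ctop_in[OF q] X.htrg_in by auto
    have s: "el_tail X P (ctop X q) (shift X (\<lambda>x. vidx (tv \<gamma> x)) (ctop X q) r)"
      by (rule el_tail_shift[OF r]) (use h \<gamma>in in auto)
    have ss: "shift X (\<lambda>x. vidx (tv \<tau> x)) (ctop X q) (shift X (\<lambda>x. vidx (tv \<gamma> x)) (ctop X q) r) = shift X (\<lambda>x. vidx (tv \<psi> x)) (ctop X q) r"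
      by (rule shift_shift[OF r]) (use h cmp in auto)
    show "ucomp A (cent (tc \<psi> (cbot X q)) [vidx (fv K (clft X q)) i, vidx (fv K (crgt X q)) (last (i # r))]) (cent (fc K q) (i # r)) =
       ccomp A (cent (fc P q) (vidx (tv \<gamma> (vdom X (clft X q))) i # shift X (\<lambda>x. vidx (tv \<gamma> x)) (ctop X q) r))
        (vent (tv \<psi> (vdom X (clft X q))) i) (along (\<lambda>J i j. cent (tc \<psi> J) [i, j]) (ctop X q) (i # r))"
      using vtr_into_matD(3)[OF X A K E vtr_boundary[OF \<psi>] \<psi> q i r] e(4)[OF q \<gamma>in[OF o i] s] unfolding ss cmp[OF o i] by simp
  qed (rule that)
  show ?thesis
  proof (rule ex1I[of _ \<chi>], intro conjI)
    show "vtr X (mat A) K P \<chi>" by (rule \<chi>)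
    show "vcomp_trans X (mat A) \<tau> \<chi> = \<psi>"
      by (rule mat_trans_eqI[OF vtr_vcomp[OF X vdc_mat[OF A] K P E \<chi> \<tau>] \<psi> X K])
        (simp_all add: vcomp_reindexing_entries[OF X A K P E \<chi> \<tau> R] v\<chi> c\<chi> cmp)
    show "post_trans X (mat_map A B) \<chi> = \<gamma>"
      by (rule thin_trans_eqI[OF t X oK vtr_over[OF X A vt B K P \<chi>] \<gamma>]) (simp add: sK post_vidx[OF X A vt B K \<chi>] v\<chi>)
    fix \<chi>' assume "vtr X (mat A) K P \<chi>' \<and> vcomp_trans X (mat A) \<tau> \<chi>' = \<psi> \<and> post_trans X (mat_map A B) \<chi>' = \<gamma>"
    then have \<chi>': "vtr X (mat A) K P \<chi>'" and v: "vcomp_trans X (mat A) \<tau> \<chi>' = \<psi>" and d: "post_trans X (mat_map A B) \<chi>' = \<gamma>" by blast+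
    show "\<chi>' = \<chi>"
      by (rule mat_trans_eqI[OF \<chi>' \<chi> X K])
        (use post_vidx[OF X A vt B K \<chi>', unfolded d] vcomp_reindexing_entries[OF X A K P E \<chi>' \<tau> R, unfolded v] in \<open>simp_all add: v\<chi> c\<chi>\<close>)
  qed
qed

lemma reindexing_unique:
  assumes X: "vdc X" and A: "vdc A" and E: "vdf X (mat A) E" and t: "vdc t" and B: "vdf A t B"
    and P: "vdf X (mat A) P" and \<tau>: "vtr X (mat A) P E \<tau>" and R: "reindexing X A P \<tau>"
    and P': "vdf X (mat A) P'" and \<tau>': "vtr X (mat A) P' E \<tau>'" and R': "reindexing X A P' \<tau>'"
    and b: "comp_map X (mat_map A B) P = comp_map X (mat_map A B) P'" and \<beta>: "post_trans X (mat_map A B) \<tau> = post_trans X (mat_map A B) \<tau>'"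
  shows "P = P' \<and> \<tau> = \<tau>'"
proof -
  interpret X: virtual_double_category X by fact
  note s = over_sel[OF A t B P] and s' = over_sel[OF A t B P']
  have part: "part 0 (fo P x) = part 0 (fo P' x)" if "x \<in> Ob X" for x using s(1)[OF that] s'(1)[OF that] b by simp
  have idx: "ix P x = ix P' x" if "x \<in> Ob X" for x using part[OF that] by (simp add: idx_def)
  have v: "vidx (tv \<tau> x) i = vidx (tv \<tau>' x) i" if "x \<in> Ob X" "i \<in> ix P x" for x i
    using post_vidx[OF X A t B P \<tau> that] post_vidx[OF X A t B P' \<tau>' that(1)] that idx \<beta> by simp
  note e = reindexing_entries[OF X A P E \<tau> R] and e' = reindexing_entries[OF X A P' E \<tau>' R']
  have PP: "P = P'"
  proof (rule mat_functor_eqI[OF P P' X part])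
    show "oent (fo P x) i = oent (fo P' x) i" if "x \<in> Ob X" "i \<in> ix P x" for x i
      using e(1)[OF that] e'(1)[OF that(1)] that idx v by simp
    show "vidx (fv P u) i = vidx (fv P' u) i" if "u \<in> Ver X" "i \<in> ix P (vdom X u)" for u i
      using s(3)[OF that] s'(3)[OF that(1), of i] that idx[OF X.vdom_in[OF that(1)]] b by simp
    show "vent (fv P u) i = vent (fv P' u) i" if "u \<in> Ver X" "i \<in> ix P (vdom X u)" for u i
      using e(3)[OF that] e'(3)[OF that(1), of i] that idx[OF X.vdom_in[OF that(1)]] v[OF X.vdom_in[OF that(1)]] by simp
    show "hent (fh P J) i j = hent (fh P' J) i j" if "J \<in> Hor X" "i \<in> ix P (hsrc X J)" "j \<in> ix P (htrg X J)" for J i j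
      using e(2)[OF that] e'(2)[OF that(1), of i j] that idx X.hsrc_in[OF that(1)] X.htrg_in[OF that(1)] v by simp
    show "cent (fc P q) (i # r) = cent (fc P' q) (i # r)" if th: "q \<in> Cell X" and i: "i \<in> ix P (vdom X (clft X q))" and "tails (map (fh P) (ctop X q)) r" for q i r
    proof -
      have r: "el_tail X P (ctop X q) r" using that(3) tails_fh[OF P X.ctop_in[OF th]] by simp
      have h: "htrg X J \<in> Ob X" if "J \<in> set (ctop X q)" for J using that X.ctop_in[OF th] X.htrg_in by auto
      have r': "el_tail X P' (ctop X q) r"
        using r h idx by (auto simp: el_tail_def list_all2_conv_all_nth)
      have "shift X (\<lambda>x. vidx (tv \<tau> x)) (ctop X q) r = shift X (\<lambda>x. vidx (tv \<tau>' x)) (ctop X q) r"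
        by (rule shift_cong[OF r]) (use h v in auto)
      then show ?thesis using e(4)[OF th i r] e'(4)[OF th _ r', of i] i idx v X.vdom_in[OF X.clft_in[OF th]] by simp
    qed
  qed
  have "\<tau> = \<tau>'"
    by (rule mat_trans_eqI[OF \<tau> \<tau>'[folded PP] X P v])
      (use R R'[folded PP] in \<open>simp_all add: reindexing_def\<close>)
  then show ?thesis using PP by blast
qed

text \<open>
  The lift of \<open>\<beta>\<close> with codomain \<open>E\<close> has as its source the family \<open>E\<close> reindexed along the index functions
  of \<open>\<beta>\<close>, which \<open>untab\<close> and \<open>tab\<close> construct.
\<close>

lemma reindexing_exists:
  assumes X: "vdc X" and A: "vdc A" and E: "vdf X (mat A) E" and t: "thin t" and B: "vdf A t B"
    and b: "vdf X (mat t) b" and \<beta>: "vtr X (mat t) b (comp_map X (mat_map A B) E) \<beta>"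
  shows "\<exists>P \<tau>. vdf X (mat A) P \<and> vtr X (mat A) P E \<tau> \<and> reindexing X A P \<tau>
    \<and> comp_map X (mat_map A B) P = b \<and> post_trans X (mat_map A B) \<tau> = \<beta>"
proof -
  interpret X: virtual_double_category X by fact
  interpret A: virtual_double_category A by fact
  have vt: "vdc t" using t by (simp add: thin_def large_vdcD)
  note oE = vdf_over[OF X A vt B E] and sE = over_sel[OF A vt B E]
  define v where "v = (\<lambda>x i. vidx (tv \<beta> x) i)"
  have v_in: "v x i \<in> ix E x" if "x \<in> Ob X" "i \<in> ix b x" for x i
    using tv_entry(1)[OF X vt b oE \<beta> that] sE(2)[OF that(1)] by (simp add: v_def)
  have v_nat: "vidx (fv E u) (v (vdom X u) i) = v (vcod X u) (vidx (fv b u) i)" if "u \<in> Ver X" "i \<in> ix b (vdom X u)" for u i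
    using vtr_into_matD(1)[OF X vt b oE vtr_boundary[OF \<beta>] \<beta> that] sE(3)[OF that(1) v_in[OF X.vdom_in[OF that(1)] that(2)]] by (simp add: v_def)
  define U where "U = untab X b E v"
  define P where "P = tab X b U"
  have U: "vdf (el X b) A U" unfolding U_def by (rule vdf_untab[OF X vt b A E v_in v_nat])
  have P: "vdf X (mat A) P" unfolding P_def by (rule vdf_tab[OF X vt b A U])
  have ov: "comp_map X (mat_map A B) P = b" unfolding P_def by (rule over_tab[OF X t b A U B])
  interpret P: virtual_double_functor X "mat A" P by fact
  have Pi: "ix P x = ix b x" if "x \<in> Ob X" for x using that by (simp add: P_def tab_sel)
  have Pt: "el_tail X P Js r \<longleftrightarrow> el_tail X b Js r" if "set Js \<subseteq> Hor X" for Js r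
    using that Pi X.htrg_in by (auto simp: el_tail_def list_all2_conv_all_nth subset_iff)
  have Po: "oent (fo P x) i = oent (fo E x) (v x i)" if "x \<in> Ob X" "i \<in> ix P x" for x i
    using that by (simp add: P_def U_def tab_sel)
  have Pv: "vidx (fv P u) i = vidx (fv b u) i" "vent (fv P u) i = vent (fv E u) (v (vdom X u) i)" if "u \<in> Ver X" "i \<in> ix P (vdom X u)" for u i
    using that X.vdom_in[OF that(1)] by (simp_all add: P_def U_def tab_sel)
  have Ph: "hent (fh P J) i j = hent (fh E J) (v (hsrc X J) i) (v (htrg X J) j)"
    if "J \<in> Hor X" "i \<in> ix P (hsrc X J)" "j \<in> ix P (htrg X J)" for J i j
    using that X.hsrc_in[OF that(1)] X.htrg_in[OF that(1)] by (simp add: P_def U_def tab_sel)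
  have Pc: "cent (fc P q) (i # r) = cent (fc E q) (v (vdom X (clft X q)) i # shift X v (ctop X q) r)"
    if "q \<in> Cell X" "i \<in> ix P (vdom X (clft X q))" "el_tail X P (ctop X q) r" for q i r
    using that X.vdom_in[OF X.clft_in[OF that(1)]] Pt[OF X.ctop_in[OF that(1)]] by (simp add: Pi) (simp add: P_def U_def tab_sel)
  have PO: "oent (fo P x) i \<in> Ob A" if "x \<in> Ob X" "i \<in> ix P x" for x i using mat_ObD(2)[of "fo P x" A i] P.fo_in[OF that(1)] that(2) by simp
  have PH: "hent (fh P J) i j \<in> Hor A" "hsrc A (hent (fh P J) i j) = oent (fo P (hsrc X J)) i" "htrg A (hent (fh P J) i j) = oent (fo P (htrg X J)) j"
    if "J \<in> Hor X" "i \<in> ix P (hsrc X J)" "j \<in> ix P (htrg X J)" for J i j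
    using mat_HorD(3-5)[of "fh P J" A i j] fh_sel[OF P that(1)] that(2,3) by simp_all
  obtain \<tau> where \<tau>: "vtr X (mat A) P E \<tau>"
    and v\<tau>: "\<And>x i. \<lbrakk>x \<in> Ob X; i \<in> ix P x\<rbrakk> \<Longrightarrow> vidx (tv \<tau> x) i = v x i \<and> vent (tv \<tau> x) i = vid A (oent (fo P x) i)"
    and c\<tau>: "\<And>J i j. \<lbrakk>J \<in> Hor X; i \<in> ix P (hsrc X J); j \<in> ix P (htrg X J)\<rbrakk> \<Longrightarrow> cent (tc \<tau> J) [i, j] = cid A (hent (fh P J) i j)"
  proof (rule vtr_tabulate[OF X A P E, of v "\<lambda>x i. vid A (oent (fo P x) i)" "\<lambda>J i j. cid A (hent (fh P J) i j)"])
    show "v x i \<in> ix E x" "ver A (vid A (oent (fo P x) i)) (oent (fo P x) i) (oent (fo E x) (v x i))" if "x \<in> Ob X" "i \<in> ix P x" for x i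
      using that v_in[OF that(1)] Pi[OF that(1)] A.vid_ver[OF PO[OF that]] Po[OF that] by simp_all
    show "cell A (cid A (hent (fh P J) i j)) [hent (fh P J) i j] (hent (fh E J) (v (hsrc X J) i) (v (htrg X J) j)) (vid A (oent (fo P (hsrc X J)) i)) (vid A (oent (fo P (htrg X J)) j))"
      if "J \<in> Hor X" "i \<in> ix P (hsrc X J)" "j \<in> ix P (htrg X J)" for J i j
      using A.cid_cell[OF PH(1)[OF that]] PH(2,3)[OF that] Ph[OF that] by simp
  next
    fix u i assume u: "u \<in> Ver X" and i: "i \<in> ix P (vdom X u)"
    have "ver A (vent (fv P u) i) (oent (fo P (vdom X u)) i) (oent (fo P (vcod X u)) (vidx (fv P u) i))"
      using mat_VerD(4)[of "fv P u" A i] fv_sel_into_mat[OF P u] i by simp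
    then show "v (vcod X u) (vidx (fv P u) i) = vidx (fv E u) (v (vdom X u) i)
        \<and> vcomp A (vid A (oent (fo P (vcod X u)) (vidx (fv P u) i))) (vent (fv P u) i) = vcomp A (vent (fv E u) (v (vdom X u) i)) (vid A (oent (fo P (vdom X u)) i))"
      using A.vcomp_id_left A.vcomp_id_right Pv[OF u i] v_nat[OF u, of i] i X.vdom_in[OF u] by (simp add: Pi)
  next
    fix q i r assume q: "q \<in> Cell X" and i: "i \<in> ix P (vdom X (clft X q))" and r: "el_tail X P (ctop X q) r"
    note c = fc_entry[OF X P q i r]
    have al: "along (\<lambda>J i j. cid A (hent (fh P J) i j)) (ctop X q) (i # r) = map (cid A) (ctop A (cent (fc P q) (i # r)))"
      unfolding cellD(2)[OF c] by (rule along_eq_map[OF X.ctop_path[OF q] i r]) simp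
    have "vdom A (clft A (cent (fc P q) (i # r))) = oent (fo P (vdom X (clft X q))) i"
      using cellD(4)[OF c] mat_VerD(4)[of "fv P (clft X q)" A i] fv_sel_into_mat[OF P X.clft_in[OF q]] i by (simp add: ver_def)
    then show "ucomp A (cid A (hent (fh P (cbot X q)) (vidx (fv P (clft X q)) i) (vidx (fv P (crgt X q)) (last (i # r))))) (cent (fc P q) (i # r)) =
       ccomp A (cent (fc E q) (v (vdom X (clft X q)) i # shift X v (ctop X q) r)) (vid A (oent (fo P (vdom X (clft X q))) i))
        (along (\<lambda>J i j. cid A (hent (fh P J) i j)) (ctop X q) (i # r))"
      using A.ccomp_id_right[OF cellD(1)[OF c]] unfolding al A.ucomp_id_left[OF c] Pc[OF q i r, symmetric] by simp
  qed (rule that)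
  have "post_trans X (mat_map A B) \<tau> = \<beta>"
    by (rule thin_trans_eqI[OF t X b vtr_over[OF X A vt B P E \<tau>, unfolded ov] \<beta>])
      (simp add: post_vidx[OF X A vt B P \<tau>] Pi v\<tau> v_def)
  moreover have "reindexing X A P \<tau>" by (simp add: reindexing_def v\<tau> c\<tau>)
  ultimately show ?thesis using P \<tau> ov by blast
qed

section \<open>Familiality of the 2-functor of matrices\<close>

definition reindexings :: "'V VDC \<Rightarrow> 'V VDTrans set" where
  "reindexings A = {((X, P, mat A), \<tau>, (X, E, mat A)) | X P \<tau> E. large_vdc X \<and> vdf X (mat A) P \<and> vdf X (mat A) E
     \<and> vtr X (mat A) P E \<tau> \<and> reindexing X A P \<tau>}"

definition el_of :: "'V VDFun \<Rightarrow> 'V VDC" where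
  "el_of p = (case p of (X, P, _) \<Rightarrow> el X P)"

definition unit_of :: "'V VDFun \<Rightarrow> 'V VDFun" where
  "unit_of p = (case p of (X, P, _) \<Rightarrow> (X, el_unit X P, mat (el X P)))"

lemma el_of_simp [simp]: "el_of (X, P, M) = el X P" by (simp add: el_of_def)
lemma unit_of_simp [simp]: "unit_of (X, P, M) = (X, el_unit X P, mat (el X P))" by (simp add: unit_of_def)

lemma Mat_sel [simp]: "F0 Mat A = mat A" "F1 Mat (A, F, B) = (mat A, mat_map A F, mat B)"
  "F2 Mat ((A, F, B), \<alpha>, (A', G, B')) = ((mat A, mat_map A F, mat B), mat_trans A F \<alpha> G, (mat A, mat_map A G, mat B))"
  by (simp_all add: Mat_def)

context
  fixes t :: "'V VDC"
  assumes tt: "terminal VDBL t"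
begin

interpretation V: two_category VDBL by (rule two_category_VDBL)
interpretation functor_with_terminal VDBL VDBL Mat t
  by (rule functor_with_terminal.intro[OF two_category_VDBL two_category_VDBL two_functor_Mat functor_with_terminal_axioms.intro[OF tt]])

lemma thin_t: "thin t" by (rule terminal_thin[OF tt])
lemma large_t: "large_vdc t" by (rule thinD(1)[OF thin_t])
lemma vdc_terminal: "vdc t" by (rule large_vdcD[OF large_t])

lemma to_terminal_VDBL:
  assumes "large_vdc A" obtains B where "to_terminal VDBL t A = (A, B, t)" "vdf A t B" "proj A = (mat A, mat_map A B, mat t)"
proof -
  have "arr1 VDBL (to_terminal VDBL t A) A t" by (rule to_terminal[OF tt]) (use assms in simp)
  then obtain B where "to_terminal VDBL t A = (A, B, t)" "vdf A t B" by (auto simp: VDBL_arr1)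
  then show ?thesis using that by simp
qed

lemma reindexings_liftable:
  assumes A: "large_vdc A" and l: "liftable VDBL (proj A) e \<beta>"
  shows "\<exists>!\<phi>. \<phi> \<in> reindexings A \<and> trg2 VDBL \<phi> = e \<and> whisk_left VDBL (proj A) \<phi> = \<beta>"
proof -
  note vA = large_vdcD[OF A]
  obtain B where B: "vdf A t B" "proj A = (mat A, mat_map A B, mat t)" by (rule to_terminal_VDBL[OF A])
  note vt = vdc_terminal
  obtain X E where e: "e = (X, E, mat A)" "large_vdc X" "vdf X (mat A) E"
    using l by (auto simp: liftable_def B(2) VDBL_C1)
  have X: "vdc X" using e large_vdcD by simp
  obtain b \<beta>0 where b: "\<beta> = ((X, b, mat t), \<beta>0, (X, comp_map X (mat_map A B) E, mat t))" "vdf X (mat t) b"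
    "vtr X (mat t) b (comp_map X (mat_map A B) E) \<beta>0"
    using l by (auto simp: liftable_def B(2) e VDBL_C2)
  have w: "whisk_left VDBL (proj A) ((X, P, mat A), \<tau>, (X, E, mat A)) = ((X, comp_map X (mat_map A B) P, mat t), post_trans X (mat_map A B) \<tau>, (X, comp_map X (mat_map A B) E, mat t))"
    if "vtr X (mat A) P E \<tau>" for P \<tau>
    unfolding B(2) by (rule VDBL_whisk_left[OF X vdc_mat[OF vt] e(3) vdf_mat[OF vA vt B(1)] that])
  from reindexing_exists[OF X vA e(3) thin_t B(1) b(2,3)] obtain P \<tau> where P: "vdf X (mat A) P" "vtr X (mat A) P E \<tau>" "reindexing X A P \<tau>"
    "comp_map X (mat_map A B) P = b" "post_trans X (mat_map A B) \<tau> = \<beta>0" by blast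
  show ?thesis
  proof (rule ex1I[of _ "((X, P, mat A), \<tau>, (X, E, mat A))"])
    show "((X, P, mat A), \<tau>, (X, E, mat A)) \<in> reindexings A \<and> trg2 VDBL ((X, P, mat A), \<tau>, (X, E, mat A)) = e
        \<and> whisk_left VDBL (proj A) ((X, P, mat A), \<tau>, (X, E, mat A)) = \<beta>"
      using P e by (auto simp: reindexings_def w b(1))
    fix \<phi> assume p: "\<phi> \<in> reindexings A \<and> trg2 VDBL \<phi> = e \<and> whisk_left VDBL (proj A) \<phi> = \<beta>"
    then obtain P' \<tau>' where P': "\<phi> = ((X, P', mat A), \<tau>', (X, E, mat A))" "vdf X (mat A) P'" "vtr X (mat A) P' E \<tau>'" "reindexing X A P' \<tau>'"
      by (auto simp: reindexings_def e(1))
    then have "comp_map X (mat_map A B) P' = b" "post_trans X (mat_map A B) \<tau>' = \<beta>0" using p w[OF P'(3)] by (auto simp: b(1))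
    then show "\<phi> = ((X, P, mat A), \<tau>, (X, E, mat A))"
      using reindexing_unique[OF X vA e(3) vt B(1) P'(2-4) P(1-3)] P(4,5) P'(1) by simp
  qed
qed

lemma reindexings_cartesian:
  assumes A: "large_vdc A" and p: "\<phi> \<in> reindexings A" shows "cartesian VDBL (proj A) \<phi>"
proof -
  note vA = large_vdcD[OF A]
  obtain B where B: "vdf A t B" "proj A = (mat A, mat_map A B, mat t)" by (rule to_terminal_VDBL[OF A])
  note vt = vdc_terminal
  obtain X P \<tau> E where f: "\<phi> = ((X, P, mat A), \<tau>, (X, E, mat A))" "large_vdc X" "vdf X (mat A) P" "vdf X (mat A) E" "vtr X (mat A) P E \<tau>" "reindexing X A P \<tau>"
    using p by (auto simp: reindexings_def)
  have X: "vdc X" using f large_vdcD by simp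
  have w: "whisk_left VDBL (proj A) ((X, Q, mat A), \<sigma>, (X, Q', mat A)) = ((X, comp_map X (mat_map A B) Q, mat t), post_trans X (mat_map A B) \<sigma>, (X, comp_map X (mat_map A B) Q', mat t))"
    if "vdf X (mat A) Q'" "vtr X (mat A) Q Q' \<sigma>" for Q Q' \<sigma>
    unfolding B(2) by (rule VDBL_whisk_left[OF X vdc_mat[OF vt] that(1) vdf_mat[OF vA vt B(1)] that(2)])
  show ?thesis unfolding cartesian_def
  proof (intro conjI allI impI)
    show "\<phi> \<in> C2 VDBL" "trg1 VDBL (src2 VDBL \<phi>) = src1 VDBL (proj A)" using f A by (simp_all add: B(2) large_vdc_mat)
    fix \<psi> \<gamma> assume h: "\<psi> \<in> C2 VDBL \<and> trg2 VDBL \<psi> = trg2 VDBL \<phi>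
       \<and> arr2 VDBL \<gamma> (cmp1 VDBL (proj A) (src2 VDBL \<psi>)) (cmp1 VDBL (proj A) (src2 VDBL \<phi>))
       \<and> vcmp VDBL (whisk_left VDBL (proj A) \<phi>) \<gamma> = whisk_left VDBL (proj A) \<psi>"
    then obtain K \<psi>0 where k: "\<psi> = ((X, K, mat A), \<psi>0, (X, E, mat A))" "vdf X (mat A) K" "vtr X (mat A) K E \<psi>0"
      by (auto simp: f(1) VDBL_C2)
    obtain \<gamma>0 where g: "\<gamma> = ((X, comp_map X (mat_map A B) K, mat t), \<gamma>0, (X, comp_map X (mat_map A B) P, mat t))"
      "vtr X (mat t) (comp_map X (mat_map A B) K) (comp_map X (mat_map A B) P) \<gamma>0"
      using h by (auto simp: f(1) k(1) B(2) VDBL_arr2)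
    have e: "vcomp_trans X (mat t) (post_trans X (mat_map A B) \<tau>) \<gamma>0 = post_trans X (mat_map A B) \<psi>0"
      using h w[OF f(4,5)] w[OF f(4) k(3)] by (simp add: f(1) k(1) g(1))
    have "\<exists>!\<chi>. vtr X (mat A) K P \<chi> \<and> vcomp_trans X (mat A) \<tau> \<chi> = \<psi>0 \<and> post_trans X (mat_map A B) \<chi> = \<gamma>0"
      by (rule reindexing_cartesian[OF X vA f(3-6) k(2,3) thin_t B(1) g(2) e])
    then obtain \<chi>0 where c: "vtr X (mat A) K P \<chi>0" "vcomp_trans X (mat A) \<tau> \<chi>0 = \<psi>0" "post_trans X (mat_map A B) \<chi>0 = \<gamma>0"
      and u: "\<And>\<chi>. vtr X (mat A) K P \<chi> \<Longrightarrow> vcomp_trans X (mat A) \<tau> \<chi> = \<psi>0 \<Longrightarrow> post_trans X (mat_map A B) \<chi> = \<gamma>0 \<Longrightarrow> \<chi> = \<chi>0" by blast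
    show "\<exists>!\<chi>. arr2 VDBL \<chi> (src2 VDBL \<psi>) (src2 VDBL \<phi>) \<and> vcmp VDBL \<phi> \<chi> = \<psi> \<and> whisk_left VDBL (proj A) \<chi> = \<gamma>"
    proof (rule ex1I[of _ "((X, K, mat A), \<chi>0, (X, P, mat A))"])
      show "arr2 VDBL ((X, K, mat A), \<chi>0, (X, P, mat A)) (src2 VDBL \<psi>) (src2 VDBL \<phi>) \<and> vcmp VDBL \<phi> ((X, K, mat A), \<chi>0, (X, P, mat A)) = \<psi>
          \<and> whisk_left VDBL (proj A) ((X, K, mat A), \<chi>0, (X, P, mat A)) = \<gamma>"
        using c f k(1,2) A by (simp add: VDBL_arr2 w g(1) large_vdc_mat)
      fix \<chi> assume x: "arr2 VDBL \<chi> (src2 VDBL \<psi>) (src2 VDBL \<phi>) \<and> vcmp VDBL \<phi> \<chi> = \<psi> \<and> whisk_left VDBL (proj A) \<chi> = \<gamma>"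
      then obtain \<chi>1 where "\<chi> = ((X, K, mat A), \<chi>1, (X, P, mat A))" "vtr X (mat A) K P \<chi>1" by (auto simp: f(1) k(1) VDBL_arr2)
      then show "\<chi> = ((X, K, mat A), \<chi>0, (X, P, mat A))" using x u[of \<chi>1] w[OF f(3), of K \<chi>1] by (simp add: f(1) k(1) g(1))
    qed
  qed
qed

lemma split_fibration_proj:
  assumes A: "large_vdc A" shows "split_fibration VDBL (proj A) (chosen_lift VDBL (reindexings A) (proj A))"
proof (rule V.split_fibration_chosen_lift)
  note vA = large_vdcD[OF A]
  show "arr1 VDBL (proj A) (mat A) (mat t)" using proj_arr[of A] A by simp
  show "\<phi> \<in> C2 VDBL \<and> trg1 VDBL (src2 VDBL \<phi>) = mat A" if "\<phi> \<in> reindexings A" for \<phi>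
    using that A by (auto simp: reindexings_def large_vdc_mat)
  show "cartesian VDBL (proj A) \<phi>" if "\<phi> \<in> reindexings A" for \<phi> by (rule reindexings_cartesian[OF A that])
  show "id2 VDBL e \<in> reindexings A" if "e \<in> C1 VDBL" "trg1 VDBL e = mat A" for e
    using that vtr_id[OF large_vdcD vdc_mat[OF vA]] reindexing_id[OF large_vdcD] by (auto simp: VDBL_C1 reindexings_def)
  show "vcmp VDBL \<phi> \<psi> \<in> reindexings A" if h: "\<phi> \<in> reindexings A" "\<psi> \<in> reindexings A" "trg2 VDBL \<psi> = src2 VDBL \<phi>" for \<phi> \<psi>
  proof -
    obtain X P \<tau> E where f: "\<phi> = ((X, P, mat A), \<tau>, (X, E, mat A))" "large_vdc X" "vdf X (mat A) P" "vdf X (mat A) E" "vtr X (mat A) P E \<tau>" "reindexing X A P \<tau>"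
      using h(1) by (auto simp: reindexings_def)
    obtain Q \<sigma> where g: "\<psi> = ((X, Q, mat A), \<sigma>, (X, P, mat A))" "vdf X (mat A) Q" "vtr X (mat A) Q P \<sigma>" "reindexing X A Q \<sigma>"
      using h(2,3) by (auto simp: reindexings_def f(1))
    note X = large_vdcD[OF f(2)]
    show ?thesis
      using f g vtr_vcomp[OF X vdc_mat[OF vA] g(2) f(3,4) g(3) f(5)] reindexing_vcomp[OF X vA g(2) f(3,4) g(3) f(5) g(4) f(6)]
      by (auto simp: reindexings_def)
  qed
  show "whisk_right VDBL \<phi> f \<in> reindexings A" if h: "\<phi> \<in> reindexings A" "f \<in> C1 VDBL" "trg1 VDBL f = src1 VDBL (src2 VDBL \<phi>)" for \<phi> f
  proof -
    obtain X P \<tau> E where g: "\<phi> = ((X, P, mat A), \<tau>, (X, E, mat A))" "large_vdc X" "vdf X (mat A) P" "vdf X (mat A) E" "vtr X (mat A) P E \<tau>" "reindexing X A P \<tau>"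
      using h(1) by (auto simp: reindexings_def)
    obtain Y G where f: "f = (Y, G, X)" "large_vdc Y" "vdf Y X G" using h(2,3) by (auto simp: VDBL_C1 g(1))
    note X = large_vdcD[OF g(2)] and Y = large_vdcD[OF f(2)]
    show ?thesis
      unfolding f(1) g(1) VDBL_whisk_right[OF Y vdc_mat[OF vA] X f(3) g(3,5)]
      using f(2) vdf_comp[OF Y f(3) g(3)] vdf_comp[OF Y f(3) g(4)] vtr_pre[OF Y f(3) g(5)] reindexing_pre[OF Y f(3) g(6)]
      by (auto simp: reindexings_def)
  qed
  show "\<exists>!\<phi>. \<phi> \<in> reindexings A \<and> trg2 VDBL \<phi> = e \<and> whisk_left VDBL (proj A) \<phi> = \<beta>" if "liftable VDBL (proj A) e \<beta>" for e \<beta>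
    by (rule reindexings_liftable[OF A that])
qed

lemma chosen_lift_natural:
  assumes f: "arr1 VDBL f A C" and l: "liftable VDBL (proj A) e \<beta>"
  shows "whisk_left VDBL (F1 Mat f) (chosen_lift VDBL (reindexings A) (proj A) e \<beta>) = chosen_lift VDBL (reindexings C) (proj C) (cmp1 VDBL (F1 Mat f) e) \<beta>"
proof -
  obtain F where F: "f = (A, F, C)" "large_vdc A" "large_vdc C" "vdf A C F" using f by (auto simp: VDBL_arr1)
  note vA = large_vdcD[OF F(2)] and vC = large_vdcD[OF F(3)]
  show ?thesis
  proof (rule V.chosen_lift_preserved[OF _ _ _ cmp_proj[OF f]])
    show "arr1 VDBL (proj A) (mat A) (mat t)" "arr1 VDBL (proj C) (mat C) (mat t)" using proj_arr F by simp_all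
    show "arr1 VDBL (F1 Mat f) (mat A) (mat C)" using vdf_mat[OF vA vC F(4)] F by (simp add: VDBL_arr1 large_vdc_mat)
    show "\<phi> \<in> C2 VDBL \<and> trg1 VDBL (src2 VDBL \<phi>) = mat A \<and> whisk_left VDBL (F1 Mat f) \<phi> \<in> reindexings C" if p: "\<phi> \<in> reindexings A" for \<phi>
    proof -
      obtain X P \<tau> E where g: "\<phi> = ((X, P, mat A), \<tau>, (X, E, mat A))" "large_vdc X" "vdf X (mat A) P" "vdf X (mat A) E" "vtr X (mat A) P E \<tau>" "reindexing X A P \<tau>"
        using p by (auto simp: reindexings_def)
      note X = large_vdcD[OF g(2)] and m = vdf_mat[OF vA vC F(4)]
      have "whisk_left VDBL (F1 Mat f) \<phi> = ((X, comp_map X (mat_map A F) P, mat C), post_trans X (mat_map A F) \<tau>, (X, comp_map X (mat_map A F) E, mat C))"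
        unfolding F(1) g(1) Mat_sel by (rule VDBL_whisk_left[OF X vdc_mat[OF vC] g(4) m g(5)])
      then show ?thesis
        using g F vdf_comp[OF X g(3) m] vdf_comp[OF X g(4) m] vtr_post[OF X vdc_mat[OF vA] g(3,4) m g(5)] reindexing_post[OF X vA g(3-5) vC F(4) g(6)]
        by (auto simp: reindexings_def large_vdc_mat)
    qed
  qed (use reindexings_liftable F(2,3) l in blast)+
qed

text \<open>
  The universal arrow at \<open>(X, P)\<close> is the tabulation of the identity of \<open>el X P\<close>. Composition with it takes
  \<open>F\<close> to \<open>tab X P F\<close>, so its universal property on 1-cells is that \<open>tab\<close> is bijective onto the functors over \<open>P\<close>.
\<close>

lemma familial_at_Mat: "familial_at VDBL VDBL Mat t"
proof (rule familial_atI[where Fo = el_of and \<eta> = unit_of and c = "\<lambda>A. chosen_lift VDBL (reindexings A) (proj A)"])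
  note vt = vdc_terminal
  have over: "\<exists>X P. p = (X, P, mat t) \<and> large_vdc X \<and> vdc X \<and> vdf X (mat t) P \<and> large_vdc (el X P) \<and> vdc (el X P)"
    if "p \<in> C1 VDBL" "trg1 VDBL p = F0 Mat t" for p
    using that large_vdc_el[OF large_vdcD vt] vdc_el[OF large_vdcD vt] by (auto simp: VDBL_C1 large_vdcD)
  show "el_of p \<in> C0 VDBL" if "p \<in> C1 VDBL" "trg1 VDBL p = F0 Mat t" for p using over[OF that] by auto
  show "arr1 VDBL (unit_of p) (src1 VDBL p) (F0 Mat (el_of p)) \<and> cmp1 VDBL (proj (el_of p)) (unit_of p) = p"
    if h: "p \<in> C1 VDBL" "trg1 VDBL p = F0 Mat t" for p
  proof -
    obtain X P where p: "p = (X, P, mat t)" "large_vdc X" "vdc X" "vdf X (mat t) P" "large_vdc (el X P)" "vdc (el X P)" using over[OF h] by blast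
    obtain B where B: "vdf (el X P) t B" "proj (el X P) = (mat (el X P), mat_map (el X P) B, mat t)" by (rule to_terminal_VDBL[OF p(5)])
    note i = vdf_id[OF p(6)]
    show ?thesis
      using vdf_tab[OF p(3) vt p(4,6) i] over_tab[OF p(3) thin_t p(4,6) i B(1)] p B(2) by (simp add: VDBL_arr1 large_vdc_mat)
  qed
  show "\<exists>!f. arr1 VDBL f (el_of p) a \<and> cmp1 VDBL (F1 Mat f) (unit_of p) = g"
    if h: "p \<in> C1 VDBL" "trg1 VDBL p = F0 Mat t" and a: "a \<in> C0 VDBL" and g: "arr1 VDBL g (src1 VDBL p) (F0 Mat a)" "cmp1 VDBL (proj a) g = p" for p a g
  proof -
    obtain X P where p: "p = (X, P, mat t)" "large_vdc X" "vdc X" "vdf X (mat t) P" "large_vdc (el X P)" "vdc (el X P)" using over[OF h] by blast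
    have la: "large_vdc a" and va: "vdc a" using a large_vdcD by simp_all
    obtain B where B: "vdf a t B" "proj a = (mat a, mat_map a B, mat t)" by (rule to_terminal_VDBL[OF la])
    obtain G where G: "g = (X, G, mat a)" "vdf X (mat a) G" using g(1) by (auto simp: p(1) VDBL_arr1)
    have P: "P = comp_map X (mat_map a B) G" using g(2) by (simp add: p(1) G(1) B(2))
    note s = over_sel[OF va vt B(1) G(2)]
    have "vidx (fv P u) i = vidx (fv G u) i" if "u \<in> Ver X" "i \<in> ix P (vdom X u)" for u i
      using that s(2) s(3)[OF that(1)] virtual_double_category.vdom_in[OF p(3) that(1)] unfolding P by simp
    moreover have "part 0 (fo P x) = part 0 (fo G x)" if "x \<in> Ob X" for x using s(1)[OF that] unfolding P .
    ultimately obtain U where U: "vdf (el X P) a U" "tab X P U = G"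
      using tab_untab[OF p(3) vt p(4) va G(2)] by blast
    have c: "cmp1 VDBL (F1 Mat (el X P, F, a)) (unit_of p) = (X, tab X P F, mat a)" if "vdf (el X P) a F" for F
      using unit_comp[OF p(3) thin_t p(4) va that that] by (simp add: p(1))
    show ?thesis
    proof (rule ex1I[of _ "(el X P, U, a)"])
      show "arr1 VDBL (el X P, U, a) (el_of p) a \<and> cmp1 VDBL (F1 Mat (el X P, U, a)) (unit_of p) = g"
        using c[OF U(1)] U p la G(1) by (simp add: VDBL_arr1)
      fix f assume f: "arr1 VDBL f (el_of p) a \<and> cmp1 VDBL (F1 Mat f) (unit_of p) = g"
      then obtain F where F: "f = (el X P, F, a)" "vdf (el X P) a F" by (auto simp: p(1) VDBL_arr1)
      then have "tab X P F = tab X P U" using f c[OF F(2)] U(2) G(1) by simp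
      then show "f = (el X P, U, a)" using tab_inj[OF p(3) thin_t p(4) va F(2) U(1)] F(1) by simp
    qed
  qed
  show "\<exists>!\<alpha>. arr2 VDBL \<alpha> f f' \<and> whisk_right VDBL (F2 Mat \<alpha>) (unit_of p) = \<gamma>"
    if h: "p \<in> C1 VDBL" "trg1 VDBL p = F0 Mat t" and ff: "arr1 VDBL f (el_of p) a" "arr1 VDBL f' (el_of p) a"
      and g: "arr2 VDBL \<gamma> (cmp1 VDBL (F1 Mat f) (unit_of p)) (cmp1 VDBL (F1 Mat f') (unit_of p))" "whisk_left VDBL (proj a) \<gamma> = id2 VDBL p" for p a f f' \<gamma>
  proof -
    obtain X P where p: "p = (X, P, mat t)" "large_vdc X" "vdc X" "vdf X (mat t) P" "large_vdc (el X P)" "vdc (el X P)" using over[OF h] by blast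
    obtain F F' where F: "f = (el X P, F, a)" "f' = (el X P, F', a)" "large_vdc a" "vdf (el X P) a F" "vdf (el X P) a F'"
      using ff by (auto simp: p(1) VDBL_arr1)
    note va = large_vdcD[OF F(3)]
    obtain B where B: "vdf a t B" "proj a = (mat a, mat_map a B, mat t)" by (rule to_terminal_VDBL[OF F(3)])
    note T = vdf_tab[OF p(3) vt p(4) va F(4)] and T' = vdf_tab[OF p(3) vt p(4) va F(5)]
    obtain \<gamma>0 where g0: "\<gamma> = ((X, tab X P F, mat a), \<gamma>0, (X, tab X P F', mat a))" "vtr X (mat a) (tab X P F) (tab X P F') \<gamma>0"
      using g(1) unit_comp[OF p(3) thin_t p(4) va F(4,4)] unit_comp[OF p(3) thin_t p(4) va F(5,5)] by (auto simp: p(1) F(1,2) VDBL_arr2)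
    have "post_trans X (mat_map a B) \<gamma>0 = id_trans X (mat t) P"
      using g(2) unfolding g0(1) B(2) VDBL_whisk_left[OF p(3) vdc_mat[OF vt] T' vdf_mat[OF va vt B(1)] g0(2)] by (simp add: p(1))
    then have id: "vidx (tv \<gamma>0 x) i = i" if "x \<in> Ob X" "i \<in> ix P x" for x i
      using post_vidx[OF p(3) va vt B(1) T g0(2) that(1), of i] that virtual_double_functor.fo_in[OF p(4) that(1)]
      by (simp add: whisker_sel tab_sel)
    have w: "whisk_right VDBL (F2 Mat ((el X P, F, a), \<alpha>, (el X P, F', a))) (unit_of p)
        = ((X, tab X P F, mat a), pre_trans X (mat_trans (el X P) F \<alpha> F') (el_unit X P), (X, tab X P F', mat a))" if "vtr (el X P) a F F' \<alpha>" for \<alpha>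
    proof -
      have u: "vdf X (mat (el X P)) (el_unit X P)" by (rule unit_in[OF p(3) thin_t p(4) va F(4,5)])
      show ?thesis unfolding p(1) unit_of_simp Mat_sel
          VDBL_whisk_right[OF p(3) vdc_mat[OF va] vdc_mat[OF p(6)] u vdf_mat[OF p(6) va F(4)] vtr_mat[OF p(6) va F(4,5) that]]
          unit_comp[OF p(3) thin_t p(4) va F(4,4)] unit_comp[OF p(3) thin_t p(4) va F(5,5)] ..
    qed
    from unit_universal2[OF p(3) thin_t p(4) va F(4,5) g0(2) id] obtain \<alpha>0 where a: "vtr (el X P) a F F' \<alpha>0"
      "pre_trans X (mat_trans (el X P) F \<alpha>0 F') (el_unit X P) = \<gamma>0"
      and uniq: "\<And>\<alpha>. \<lbrakk>vtr (el X P) a F F' \<alpha>; pre_trans X (mat_trans (el X P) F \<alpha> F') (el_unit X P) = \<gamma>0\<rbrakk> \<Longrightarrow> \<alpha> = \<alpha>0" by blast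
    show ?thesis
    proof (rule ex1I[of _ "((el X P, F, a), \<alpha>0, (el X P, F', a))"])
      show "arr2 VDBL ((el X P, F, a), \<alpha>0, (el X P, F', a)) f f' \<and> whisk_right VDBL (F2 Mat ((el X P, F, a), \<alpha>0, (el X P, F', a))) (unit_of p) = \<gamma>"
        unfolding w[OF a(1)] using a p F g0(1) by (simp add: VDBL_arr2)
      fix \<alpha> assume x: "arr2 VDBL \<alpha> f f' \<and> whisk_right VDBL (F2 Mat \<alpha>) (unit_of p) = \<gamma>"
      then obtain \<alpha>1 where a1: "\<alpha> = ((el X P, F, a), \<alpha>1, (el X P, F', a))" "vtr (el X P) a F F' \<alpha>1" by (auto simp: F(1,2) VDBL_arr2)
      then show "\<alpha> = ((el X P, F, a), \<alpha>0, (el X P, F', a))" using uniq[OF a1(2)] x w[OF a1(2)] g0(1) by (simp del: unit_of_simp Mat_sel)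
    qed
  qed
  show "split_fibration VDBL (proj a) (chosen_lift VDBL (reindexings a) (proj a))" if "a \<in> C0 VDBL" for a
    by (rule split_fibration_proj) (use that in simp)
  show "whisk_left VDBL (F1 Mat f) (chosen_lift VDBL (reindexings a) (proj a) e \<beta>) = chosen_lift VDBL (reindexings b) (proj b) (cmp1 VDBL (F1 Mat f) e) \<beta>"
    if "arr1 VDBL f a b" "liftable VDBL (proj a) e \<beta>" for f a b e \<beta> by (rule chosen_lift_natural[OF that])
qed

end

theorem familial_Mat: "familial VDBL VDBL Mat"
  unfolding familial_def using two_category_VDBL two_functor_Mat terminal_unit familial_at_Mat by blast

end

theorem theorem6p2:
  fixes elts :: "'V \<Rightarrow> 'V set" and U1 :: 'V
  assumes "grothendieck_universes elts U1"
  shows "familial (grothendieck_universes.VDBL elts) (grothendieck_universes.VDBL elts)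
           (grothendieck_universes.Mat elts U1)"
  by (rule grothendieck_universes.familial_Mat[OF assms])

end
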